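(* Let $U:\mathcal P_1\to\mathbb R$ be continuous with respect to $\mathcal W_1$ and, for $n\ge 3$, let $U_n$ be the mollification of $U$ constructed in the context. Then: (i) $U_n\in C^\infty(\mathcal P_2)\cap C^0(\mathcal P_1)$, and $\lim_{n\to\infty}\sup_{\mu\in\mathcal M}|U_n(\mu)-U(\mu)|=0$ for every compact $\mathcal M\subset\mathcal P_1$ (compact under $\mathcal W_1$). (ii) If $U$ is Lipschitz continuous under $\mathcal W_1$ with Lipschitz constant $L$, then each $U_n$ is Lipschitz continuous under $\mathcal W_1$ with Lipschitz constant $CL$, where $C$ may depend on $d$ but not on $n$. (iii) Assume $U\in C^1(\mathcal P_2)$ and that $\partial_\mu U$ is uniformly continuous on $(\mathcal M\cap\mathcal P_2)\times K$, under $\mathcal W_1$ for the component $\mu$, where $\mathcal M\subset\mathcal P_1$ and $K\subset\mathbb R^d$ are compact. Then $$\lim_{n\to\infty}\ \sup_{\mu\in\mathcal M\cap\mathcal P_2}\int_K|\partial_\mu U_n(\mu,x)-\partial_\mu U(\mu,x)|\,dx=0 .$$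
   Context: $\mathcal P$ is the set of probability measures on $\mathbb R^d$; $\|\mu\|_p^p:=\int|x|^p\mu(dx)$; $\mathcal P_p:=\{\mu\in\mathcal P:\|\mu\|_p<\infty\}$ with the $p$-Wasserstein distance $\mathcal W_p$; $C^0(\mathcal P_p)$ is the set of real functions on $\mathcal P_p$ continuous under $\mathcal W_p$. Wasserstein derivative: for $U:\mathcal P_2\to\mathbb R$, $\partial_\mu U:\mathcal P_2\times\mathbb R^d\to\mathbb R^d$ satisfies $U(\mathcal L_{\xi+\eta})-U(\mathcal L_\xi)=\mathbb E[\partial_\mu U(\mathcal L_\xi,\xi)\cdot\eta]+o(\|\eta\|_{L^2})$ for all square integrable $\mathbb R^d$-valued $\xi,\eta$, where $\mathcal L_\xi$ is the law of $\xi$. $C^1(\mathcal P_2)$ is the set of continuous $U:\mathcal P_2\to\mathbb R$ such that $\partial_\mu U$ exists and is continuous on $\mathcal P_2\times\mathbb R^d$; higher order derivatives ($\partial_x\partial_\mu U$, $\partial_{\mu\mu}U$, etc.) are defined in the same manner, and $C^\infty(\mathcal P_2)$ means that derivatives of all orders exist and are continuous. Construction of $U_n$, $n\ge3$. Let $I=I_n\in C^\infty([0,1])$ satisfy $I(x)=1$ for $x\le n^{-3}$, $I(x)=1-x$ for $\frac1n\le x\le 1-\frac1n$, $I(x)=0$ for $x\ge 1-n^{-3}$, $0\le I\le1$, $-(1+\frac1n)\le I'\le0$, $I(x)+I(1-x)=1$. For $i\in\mathbb Z$, $x\in\mathbb R$ put $\phi_i(x):=I(|nx-i|)\mathbf 1_{[\frac{i-1}n,\frac{i+1}n]}(x)$,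 and for $\vec i=(i_1,\dots,i_d)\in\mathbb Z^d$, $x\in\mathbb R^d$ put $\phi_{\vec i}(x):=\prod_{l=1}^d\phi_{i_l}(x_l)$. Let $Q_M:=\{x\in\mathbb R^d:|x_l|\le M,\ l=1,\dots,d\}$, and let $h=h_n\in C_c^\infty(\mathbb R^d)$ satisfy $0\le h\le1$, $h\equiv1$ on $Q_n$, $h\equiv0$ on $Q_{3n/2}^c$, $|\partial_xh|\le\frac3n$. Put $$\psi_{\vec i}(\mu):=\int_{\mathbb R^d}\phi_{\vec i}(x)h(x)\mu(dx)+\mathbf 1_{\{\vec i=\vec0\}}\int_{\mathbb R^d}(1-h(x))\mu(dx).$$ Let $\mathbb Z^d_n:=\mathbb Z^d\cap Q_{2n^2}$, $N_n:=|\mathbb Z^d_n|=(4n^2+1)^d$, $\Delta_n:=\{y=(y_{\vec i})_{\vec i\in\mathbb Z^d_n\setminus\{\vec0\}}:|y_{\vec i}|\le N_n^{-3}\}\subset\mathbb R^{N_n-1}$, $y_{\vec0}:=-\sum_{\vec i\in\mathbb Z^d_n\setminus\{\vec0\}}y_{\vec i}$, and $$\mu_n(y):=\sum_{\vec i\in\mathbb Z^d_n}\frac{N_n}{N_n+1}\Big[\psi_{\vec i}(\mu)+\frac1{N_n^2}+y_{\vec i}\Big]\delta_{\vec i/n},$$ which is a probability measure for every $y\in\Delta_n$. Let $\zeta_n$ be a smooth probability density on $\mathbb R^{N_n-1}$ with support $\Delta_n$. Finally $$U_n(\mu):=\int_{\Delta_n}\zeta_n(y)\,U(\mu_n(y))\,dy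 .$$
   Formalization: In (iii) the uniform continuity of ∂_μU on (M∩P_2)×K is assumed for all compact M and K, not just one fixed pair, and the limit is concluded for all such pairs; for a single fixed pair, e.g. d=1 and M={δ_0}, the claim fails. *)

theory Defs
  imports "HOL-Probability.Probability"
begin

definition Pp :: "nat \<Rightarrow> (real^'d) measure set" where
  "Pp p = {\<mu>. prob_space \<mu> \<and> sets \<mu> = sets borel \<and> integrable \<mu> (\<lambda>x. norm x ^ p)}"

definition couplings ::
  "(real^'d) measure \<Rightarrow> (real^'d) measure \<Rightarrow> ((real^'d) \<times> (real^'d)) measure set" where
  "couplings \<mu> \<nu> = {\<pi>. prob_space \<pi> \<and> sets \<pi> = sets (borel \<Otimes>\<^sub>M borel)
                       \<and> distr \<pi> borel fst = \<mu> \<and> distr \<pi> borel snd = \<nu>}"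

definition wasserstein :: "nat \<Rightarrow> (real^'d) measure \<Rightarrow> (real^'d) measure \<Rightarrow> real" where
  "wasserstein p \<mu> \<nu> =
     root p (enn2real (INF \<pi>\<in>couplings \<mu> \<nu>. \<integral>\<^sup>+z. ennreal (dist (fst z) (snd z) ^ p) \<partial>\<pi>))"

definition wtop :: "nat \<Rightarrow> (real^'d) measure topology" where
  "wtop p = Metric_space.mtopology (Pp p) (wasserstein p)"

definition C0_P :: "nat \<Rightarrow> ((real^'d) measure \<Rightarrow> real) \<Rightarrow> bool" where
  "C0_P p U \<longleftrightarrow> continuous_map (wtop p) euclideanreal U"

definition lipschitz_W1 :: "real \<Rightarrow> ((real^'d) measure \<Rightarrow> real) \<Rightarrow> bool" where
  "lipschitz_W1 L U \<longleftrightarrow> (\<forall>\<mu>\<in>Pp 1. \<forall>\<nu>\<in>Pp 1. \<bar>U \<mu> - U \<nu>\<bar> \<le> L * wasserstein 1 \<mu> \<nu>)"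

definition L2 :: "'w measure \<Rightarrow> ('w \<Rightarrow> real^'d) set" where
  "L2 M = {\<xi> \<in> borel_measurable M. integrable M (\<lambda>\<omega>. (norm (\<xi> \<omega>))\<^sup>2)}"

definition L2norm :: "'w measure \<Rightarrow> ('w \<Rightarrow> real^'d) \<Rightarrow> real" where
  "L2norm M \<eta> = sqrt (\<integral>\<omega>. (norm (\<eta> \<omega>))\<^sup>2 \<partial>M)"

text \<open>
  The random vectors \<open>\<xi>\<close>, \<open>\<eta>\<close> range over all probability spaces whose sample space is
  \<open>\<real>\<^sup>d \<times> \<real>\<^sup>d\<close>.  Nothing is lost, since the expansion only involves the joint law of
  \<open>(\<xi>, \<eta>)\<close>, which lives there.  Integrability of \<open>D(law \<xi>, \<xi>) \<bullet> \<eta>\<close> is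
  explicit because the Bochner integral of a non-integrable function is 0.
\<close>

definition has_wderiv ::
  "((real^'d) measure \<Rightarrow> real) \<Rightarrow> ((real^'d) measure \<Rightarrow> real^'d \<Rightarrow> real^'d) \<Rightarrow> bool" where
  "has_wderiv U D \<longleftrightarrow>
     (\<forall>M::((real^'d) \<times> (real^'d)) measure. prob_space M \<longrightarrow> (\<forall>\<xi>\<in>L2 M.
        (\<forall>\<eta>\<in>L2 M. integrable M (\<lambda>\<omega>. D (distr M borel \<xi>) (\<xi> \<omega>) \<bullet> \<eta> \<omega>)) \<and>
        (\<forall>\<epsilon>>0. \<exists>\<delta>>0. \<forall>\<eta>\<in>L2 M. L2norm M \<eta> \<le> \<delta> \<longrightarrow>
           \<bar>U (distr M borel (\<lambda>\<omega>. \<xi> \<omega> + \<eta> \<omega>)) - U (distr M borel \<xi>)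
             - (\<integral>\<omega>. D (distr M borel \<xi>) (\<xi> \<omega>) \<bullet> \<eta> \<omega> \<partial>M)\<bar> \<le> \<epsilon> * L2norm M \<eta>)))"

definition has_cont_wderiv ::
  "((real^'d) measure \<Rightarrow> real) \<Rightarrow> ((real^'d) measure \<Rightarrow> real^'d \<Rightarrow> real^'d) \<Rightarrow> bool" where
  "has_cont_wderiv U D \<longleftrightarrow>
     has_wderiv U D \<and>
     continuous_map (prod_topology (wtop 2) euclidean) euclidean (\<lambda>(\<mu>, x). D \<mu> x)"

definition C1_P2 :: "((real^'d) measure \<Rightarrow> real) \<Rightarrow> bool" where
  "C1_P2 U \<longleftrightarrow> C0_P 2 U \<and> (\<exists>D. has_cont_wderiv U D)"

text \<open>
  The expansion determines \<open>\<partial>\<^sub>\<mu>U(\<mu>, \<cdot>)\<close> only \<open>\<mu>\<close>-almost everywhere.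
  The version that is continuous on \<open>P\<^sub>2 \<times> \<real>\<^sup>d\<close> is unique there, so for
  \<open>C\<^sup>1\<close> functions the choice operator below has no freedom on \<open>P\<^sub>2 \<times> \<real>\<^sup>d\<close>.
\<close>

definition wderiv ::
  "((real^'d) measure \<Rightarrow> real) \<Rightarrow> (real^'d) measure \<Rightarrow> real^'d \<Rightarrow> real^'d" where
  "wderiv U = (SOME D. has_cont_wderiv U D)"

text \<open>
  \<open>Ck_P2 k m F\<close>: the function \<open>F(\<mu>, x\<^sub>0, \<dots>, x\<^bsub>m-1\<^esub>)\<close> on \<open>P\<^sub>2 \<times> (\<real>\<^sup>d)\<^sup>m\<close> has
  jointly continuous derivatives up to order \<open>k\<close>, in all variables and in any order.
  A derivative in \<open>\<mu>\<close> adds one more space variable (number \<open>m\<close>); vector-valued derivatives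
  are treated componentwise.  So \<open>\<partial>\<^sub>\<mu>U\<close>, \<open>\<partial>\<^sub>x\<partial>\<^sub>\<mu>U\<close>, \<open>\<partial>\<^bsub>\<mu>\<mu>\<^esub>U\<close>
  etc. arise from \<open>m = 0\<close>.
\<close>

primrec Ck_P2 ::
  "nat \<Rightarrow> nat \<Rightarrow> ((real^'d) measure \<times> (nat \<Rightarrow> real^'d) \<Rightarrow> real) \<Rightarrow> bool" where
  "Ck_P2 0 m F \<longleftrightarrow>
     continuous_map (prod_topology (wtop 2) (product_topology (\<lambda>_. euclidean) {..<m}))
       euclideanreal F"
| "Ck_P2 (Suc k) m F \<longleftrightarrow>
     continuous_map (prod_topology (wtop 2) (product_topology (\<lambda>_. euclidean) {..<m}))
       euclideanreal F \<and>
     (\<exists>D. (\<forall>X \<in> {..<m} \<rightarrow>\<^sub>E UNIV.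
             has_wderiv (\<lambda>\<mu>. F (\<mu>, X)) (\<lambda>\<mu> x. \<chi> l. D l (\<mu>, X(m := x)))) \<and>
          (\<forall>l. Ck_P2 k (Suc m) (D l))) \<and>
     (\<forall>j<m. \<forall>l. \<exists>G.
          (\<forall>\<mu>\<in>Pp 2. \<forall>X \<in> {..<m} \<rightarrow>\<^sub>E UNIV.
             ((\<lambda>t. F (\<mu>, X(j := X j + t *\<^sub>R axis l 1))) has_real_derivative G (\<mu>, X)) (at 0)) \<and>
          Ck_P2 k m G)"

definition Cinf_P2 :: "((real^'d) measure \<Rightarrow> real) \<Rightarrow> bool" where
  "Cinf_P2 U \<longleftrightarrow> (\<forall>k. Ck_P2 k 0 (\<lambda>(\<mu>, X). U \<mu>))"

definition smooth01 :: "(real \<Rightarrow> real) \<Rightarrow> bool" where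
  "smooth01 f \<longleftrightarrow>
     (\<exists>D. D 0 = f \<and>
        (\<forall>k::nat. \<forall>x\<in>{0..1}. (D k has_real_derivative D (Suc k) x) (at x within {0..1})))"

primrec Ck_vec :: "nat \<Rightarrow> (real^'d \<Rightarrow> real) \<Rightarrow> bool" where
  "Ck_vec 0 f \<longleftrightarrow> continuous_on UNIV f"
| "Ck_vec (Suc k) f \<longleftrightarrow>
     continuous_on UNIV f \<and>
     (\<forall>l. \<exists>g. (\<forall>x. ((\<lambda>t. f (x + t *\<^sub>R axis l 1)) has_real_derivative g x) (at 0)) \<and> Ck_vec k g)"

definition smooth_vec :: "(real^'d \<Rightarrow> real) \<Rightarrow> bool" where
  "smooth_vec f \<longleftrightarrow> (\<forall>k. Ck_vec k f)"

primrec Ck_fun :: "nat \<Rightarrow> 'i set \<Rightarrow> (('i \<Rightarrow> real) \<Rightarrow> real) \<Rightarrow> bool" where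
  "Ck_fun 0 J f \<longleftrightarrow> continuous_map (product_topology (\<lambda>_. euclideanreal) J) euclideanreal f"
| "Ck_fun (Suc k) J f \<longleftrightarrow>
     continuous_map (product_topology (\<lambda>_. euclideanreal) J) euclideanreal f \<and>
     (\<forall>j\<in>J. \<exists>g. (\<forall>y \<in> J \<rightarrow>\<^sub>E UNIV. ((\<lambda>t. f (y(j := t))) has_real_derivative g y) (at (y j))) \<and>
                 Ck_fun k J g)"

definition smooth_fun :: "'i set \<Rightarrow> (('i \<Rightarrow> real) \<Rightarrow> real) \<Rightarrow> bool" where
  "smooth_fun J f \<longleftrightarrow> (\<forall>k. Ck_fun k J f)"

definition profile :: "nat \<Rightarrow> (real \<Rightarrow> real) \<Rightarrow> bool" where
  "profile n I \<longleftrightarrow>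
     smooth01 I \<and>
     (\<forall>x\<in>{0..1}.
        (x \<le> 1 / real n ^ 3 \<longrightarrow> I x = 1) \<and>
        (1 / real n \<le> x \<and> x \<le> 1 - 1 / real n \<longrightarrow> I x = 1 - x) \<and>
        (1 - 1 / real n ^ 3 \<le> x \<longrightarrow> I x = 0) \<and>
        0 \<le> I x \<and> I x \<le> 1 \<and>
        I x + I (1 - x) = 1) \<and>
     (\<exists>I'. \<forall>x\<in>{0..1}. (I has_real_derivative I' x) (at x within {0..1}) \<and>
        - (1 + 1 / real n) \<le> I' x \<and> I' x \<le> 0)"

definition cubeQ :: "real \<Rightarrow> (real^'d) set" where
  "cubeQ M = {x. \<forall>l. \<bar>x $ l\<bar> \<le> M}"

definition cutoff :: "nat \<Rightarrow> (real^'d \<Rightarrow> real) \<Rightarrow> bool" where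
  "cutoff n h \<longleftrightarrow>
     smooth_vec h \<and> compact (closure {x. h x \<noteq> 0}) \<and>
     (\<forall>x. 0 \<le> h x \<and> h x \<le> 1) \<and>
     (\<forall>x \<in> cubeQ (real n). h x = 1) \<and>
     (\<forall>x. x \<notin> cubeQ (3 * real n / 2) \<longrightarrow> h x = 0) \<and>
     (\<exists>g. \<forall>x. (GDERIV h x :> g x) \<and> norm (g x) \<le> 3 / real n)"

definition phi1 :: "nat \<Rightarrow> (real \<Rightarrow> real) \<Rightarrow> int \<Rightarrow> real \<Rightarrow> real" where
  "phi1 n I i x =
     I \<bar>real n * x - real_of_int i\<bar>
       * indicator {(real_of_int i - 1) / real n .. (real_of_int i + 1) / real n} x"

definition phi :: "nat \<Rightarrow> (real \<Rightarrow> real) \<Rightarrow> int^'d \<Rightarrow> real^'d \<Rightarrow> real" where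
  "phi n I i x = (\<Prod>l\<in>UNIV. phi1 n I (i $ l) (x $ l))"

definition psi ::
  "nat \<Rightarrow> (real \<Rightarrow> real) \<Rightarrow> (real^'d \<Rightarrow> real) \<Rightarrow> int^'d \<Rightarrow> (real^'d) measure \<Rightarrow> real" where
  "psi n I h i \<mu> =
     (\<integral>x. phi n I i x * h x \<partial>\<mu>) + (if i = 0 then \<integral>x. 1 - h x \<partial>\<mu> else 0)"

definition grid :: "nat \<Rightarrow> (int^'d) set" where
  "grid n = {i. \<forall>l. \<bar>i $ l\<bar> \<le> 2 * (int n)\<^sup>2}"

abbreviation grid0 :: "nat \<Rightarrow> (int^'d) set" where
  "grid0 n \<equiv> grid n - {0}"

definition Ngrid :: "'d::finite itself \<Rightarrow> nat \<Rightarrow> real" where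
  "Ngrid _ n = real (card (grid n :: (int^'d) set))"

text \<open>\<open>\<real>\<close> to the power \<open>N\<^sub>n - 1\<close> is the space \<open>grid0 n \<rightarrow>\<^sub>E UNIV\<close> of extensional functions.\<close>

definition Delta :: "nat \<Rightarrow> (int^'d \<Rightarrow> real) set" where
  "Delta n = {y \<in> grid0 n \<rightarrow>\<^sub>E UNIV. \<forall>i\<in>grid0 n. \<bar>y i\<bar> \<le> 1 / Ngrid TYPE('d) n ^ 3}"

definition kernel :: "nat \<Rightarrow> ((int^'d \<Rightarrow> real) \<Rightarrow> real) \<Rightarrow> bool" where
  "kernel n \<zeta> \<longleftrightarrow>
     smooth_fun (grid0 n) \<zeta> \<and>
     (\<forall>y \<in> grid0 n \<rightarrow>\<^sub>E UNIV. 0 \<le> \<zeta> y) \<and>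
     has_bochner_integral (Pi\<^sub>M (grid0 n) (\<lambda>_. lborel)) \<zeta> 1 \<and>
     product_topology (\<lambda>_. euclideanreal) (grid0 n)
       closure_of {y \<in> grid0 n \<rightarrow>\<^sub>E UNIV. \<zeta> y \<noteq> 0} = Delta n"

definition ycoord :: "nat \<Rightarrow> (int^'d \<Rightarrow> real) \<Rightarrow> int^'d \<Rightarrow> real" where
  "ycoord n y i = (if i = 0 then - (\<Sum>j\<in>grid0 n. y j) else y i)"

text \<open>The sum of Dirac measures as the image of a weighted counting measure on the grid.\<close>

definition mu_n ::
  "nat \<Rightarrow> (real \<Rightarrow> real) \<Rightarrow> (real^'d \<Rightarrow> real) \<Rightarrow> (real^'d) measure \<Rightarrow> (int^'d \<Rightarrow> real)
    \<Rightarrow> (real^'d) measure" where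
  "mu_n n I h \<mu> y =
     distr
       (point_measure (grid n)
          (\<lambda>i. ennreal (Ngrid TYPE('d) n / (Ngrid TYPE('d) n + 1)
                  * (psi n I h i \<mu> + 1 / (Ngrid TYPE('d) n)\<^sup>2 + ycoord n y i))))
       borel (\<lambda>i. \<chi> l. real_of_int (i $ l) / real n)"

definition mollify ::
  "nat \<Rightarrow> (real \<Rightarrow> real) \<Rightarrow> (real^'d \<Rightarrow> real) \<Rightarrow> ((int^'d \<Rightarrow> real) \<Rightarrow> real)
    \<Rightarrow> ((real^'d) measure \<Rightarrow> real) \<Rightarrow> (real^'d) measure \<Rightarrow> real" where
  "mollify n I h \<zeta> U \<mu> =
     (LINT y:Delta n|Pi\<^sub>M (grid0 n) (\<lambda>_. lborel). \<zeta> y * U (mu_n n I h \<mu> y))"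

definition mollifier_data ::
  "(nat \<Rightarrow> real \<Rightarrow> real) \<Rightarrow> (nat \<Rightarrow> real^'d \<Rightarrow> real) \<Rightarrow> (nat \<Rightarrow> (int^'d \<Rightarrow> real) \<Rightarrow> real)
    \<Rightarrow> bool" where
  "mollifier_data I h \<zeta> \<longleftrightarrow> (\<forall>n\<ge>3. profile n (I n) \<and> cutoff n (h n) \<and> kernel n (\<zeta> n))"

definition unif_cont_W1 ::
  "(real^'d) measure set \<Rightarrow> (real^'d) set \<Rightarrow> ((real^'d) measure \<Rightarrow> real^'d \<Rightarrow> real^'d) \<Rightarrow> bool"
  where
  "unif_cont_W1 A K D \<longleftrightarrow>
     (\<forall>\<epsilon>>0. \<exists>\<delta>>0. \<forall>\<mu>\<in>A. \<forall>\<nu>\<in>A. \<forall>x\<in>K. \<forall>y\<in>K.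
        wasserstein 1 \<mu> \<nu> < \<delta> \<and> dist x y < \<delta> \<longrightarrow> dist (D \<mu> x) (D \<nu> y) < \<epsilon>)"

end

theory Submission imports Defs begin

text \<open>The atoms of \<open>\<mu>\<^sub>n(y)\<close> do not move, and their masses are affine in
  \<open>\<psi>\<^sub>i(\<mu>) + y\<^sub>i\<close>.  Translating the integration variable therefore moves the dependence on
  \<open>\<mu>\<close> into the kernel \<open>\<zeta>\<^sub>n\<close>, and \<open>U\<^sub>n\<close> is a smooth function of finitely many moments of smooth
  compactly supported functions.

  Sending the mass at \<open>x\<close> to the node \<open>i/n\<close> with probability equal to the weight at \<open>i\<close> couples
  \<open>\<mu>\<close> with its quantization; the additional uniform and \<open>y\<close> parts have total mass of order
  \<open>1/N\<^sub>n\<close> and lie at distance of order \<open>n\<close> from 0.  This gives the convergence.  The Lipschitz bound follows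
  from the coupling of the weights at \<open>x\<close> and at \<open>x'\<close> that keeps their common part in place, since
  at most \<open>4\<^sup>d\<close> nodes carry weight and the weights have Lipschitz constants of order \<open>n\<close>.

  For the derivative, \<open>\<partial>\<^sub>l\<close> of the partition functions pairs nodes that are neighbours in direction \<open>l\<close> with opposite
  signs, so \<open>\<partial>\<^sub>\<mu>U\<^sub>n(\<mu>, x)\<^sub>l\<close> is a weighted sum of differences of partial derivatives of
  the convolution.  Such a difference is the effect of transferring mass from a node near \<open>x\<close> to its
  neighbour, which is an average of \<open>\<partial>\<^sub>\<mu>U \<cdot> e\<^sub>l / n\<close> near \<open>(\<mu>, x)\<close>.  The slope of the
  partition functions is exactly \<open>n\<close> outside strips of total measure of order \<open>1/n\<close>, and bounded by \<open>n + 1\<close> inside.\<close>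

section \<open>Couplings and the Wasserstein distance\<close>

text \<open>The kernel lives on one coordinate fewer than there are nodes, because the weight at the
  node 0 is fixed by the total mass. Only the moments of \<open>phi * h\<close> at the other nodes
  enter, and these integrands are compactly supported, unlike \<open>1 - h\<close> at the node 0.

  The powers of \<open>N\<close> are matched to each other. The \<open>N - 1\<close> free
  perturbations are at most \<open>1 / N ^ 3\<close> each, so the dependent one is at most
  \<open>(N - 1) / N ^ 3\<close>, and with the uniform share 1/N^2 every weight keeps a reserve of
  \<open>1 / N ^ 3\<close>. This reserve is the mass that can be transferred between nodes when the
  derivative is computed.

  Two obstacles shape the treatment of the derivative. The expansion determines it only almost
  everywhere, so the function selected by \<open>wderiv\<close> has to be identified: two continuous
  versions are compared at measures with an atom at the given point, and such measures are dense.
  Moreover, the quantized measures leave the compact set on which uniform continuity is given, so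
  that hypothesis is applied to enlarged compact sets.\<close>

lemma power_convex_comb:
  fixes a b u v :: real
  assumes "0 \<le> a" "0 \<le> b" "0 \<le> u" "0 \<le> v" "u + v = 1"
  shows "(u * a + v * b) ^ p \<le> u * a ^ p + v * b ^ p"
proof (induction p)
  case 0
  show ?case using assms by simp
next
  case (Suc p)
  \<comment> \<open>Both factors have the same sign. Their product times \<open>u * v\<close> is
    exactly the convexity defect that appears in the induction step.\<close>
  have "0 \<le> (a - b) * (a ^ p - b ^ p)"
    using assms power_mono[of a b p] power_mono[of b a p]
    by (cases "a \<le> b") (auto simp: mult_nonpos_nonpos mult_nonneg_nonneg)
  then have d: "0 \<le> u * v * ((a - b) * (a ^ p - b ^ p))"
    using assms by simp
  have v: "v = 1 - u" using assms by simp
  have "(u * a + v * b) ^ Suc p \<le> (u * a + v * b) * (u * a ^ p + v * b ^ p)"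
    using Suc assms by (simp add: mult_left_mono)
  also have "\<dots> = u * a ^ Suc p + v * b ^ Suc p - u * v * ((a - b) * (a ^ p - b ^ p))"
    unfolding v by (simp add: algebra_simps)
  also have "\<dots> \<le> u * a ^ Suc p + v * b ^ Suc p" using d by simp
  finally show ?case .
qed

text \<open>The quotient of \<open>f + g\<close> by \<open>A + B\<close> is the convex combination
  of \<open>f / A\<close> and \<open>g / B\<close> with weights \<open>A / (A + B)\<close> and
  \<open>B / (A + B)\<close>. Convexity of the power therefore gives the estimate pointwise, before
  integration. Positive upper bounds take the place of the norms, which might vanish.\<close>

lemma nn_integral_Minkowski:
  fixes f g :: "'a \<Rightarrow> real"
  assumes [measurable]: "f \<in> borel_measurable M" "g \<in> borel_measurable M"
    and nn: "\<And>x. 0 \<le> f x" "\<And>x. 0 \<le> g x"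
    and A: "0 < A" "(\<integral>\<^sup>+x. ennreal (f x ^ p) \<partial>M) \<le> ennreal (A ^ p)"
    and B: "0 < B" "(\<integral>\<^sup>+x. ennreal (g x ^ p) \<partial>M) \<le> ennreal (B ^ p)"
  shows "(\<integral>\<^sup>+x. ennreal ((f x + g x) ^ p) \<partial>M) \<le> ennreal ((A + B) ^ p)"
proof -
  define a where "a = (A + B) ^ p * (A / (A + B)) / A ^ p"
  define b where "b = (A + B) ^ p * (B / (A + B)) / B ^ p"
  have ab: "0 \<le> a" "0 \<le> b" using A B by (auto simp: a_def b_def)
  have lin: "ennreal (a * F + b * G) = ennreal a * ennreal F + ennreal b * ennreal G"
    if "0 \<le> F" "0 \<le> G" for F G
    using ab that by (simp add: ennreal_mult)
  have pt: "(f x + g x) ^ p \<le> a * f x ^ p + b * g x ^ p" for x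
  proof -
    have "A / (A + B) * (f x / A) = f x / (A + B)" "B / (A + B) * (g x / B) = g x / (A + B)"
      using A(1) B(1) by simp_all
    then have "A / (A + B) * (f x / A) + B / (A + B) * (g x / B) = (f x + g x) / (A + B)"
      by (simp only: add_divide_distrib)
    moreover have AB: "(A + B) ^ p \<noteq> 0" using A(1) B(1) by simp
    ultimately have "(f x + g x) ^ p = (A + B) ^ p * (A / (A + B) * (f x / A) + B / (A + B) * (g x / B)) ^ p"
      using AB by (simp only: power_divide times_divide_eq_right nonzero_mult_div_cancel_left)
    also have "\<dots> \<le> (A + B) ^ p * (A / (A + B) * (f x / A) ^ p + B / (A + B) * (g x / B) ^ p)"
      using A(1) B(1) nn by (intro mult_left_mono power_convex_comb) (simp_all flip: add_divide_distrib)
    also have "\<dots> = a * f x ^ p + b * g x ^ p"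
      by (simp add: a_def b_def power_divide algebra_simps)
    finally show ?thesis .
  qed
  have "(\<integral>\<^sup>+x. ennreal ((f x + g x) ^ p) \<partial>M)
      \<le> (\<integral>\<^sup>+x. ennreal a * ennreal (f x ^ p) + ennreal b * ennreal (g x ^ p) \<partial>M)"
    using pt by (intro nn_integral_mono) (simp only: nn zero_le_power lin[symmetric] ennreal_leI)
  also have "\<dots> = ennreal a * (\<integral>\<^sup>+x. ennreal (f x ^ p) \<partial>M) + ennreal b * (\<integral>\<^sup>+x. ennreal (g x ^ p) \<partial>M)"
    by (subst nn_integral_add) (auto simp: nn_integral_cmult)
  also have "\<dots> \<le> ennreal a * ennreal (A ^ p) + ennreal b * ennreal (B ^ p)"
    using A B by (intro add_mono mult_left_mono) auto
  also have "\<dots> = ennreal (a * A ^ p + b * B ^ p)"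
    using A B by (intro lin[symmetric]) auto
  also have "a * A ^ p + b * B ^ p = (A + B) ^ p * (A / (A + B) + B / (A + B))"
    using A B by (simp add: a_def b_def distrib_left)
  also have "\<dots> = (A + B) ^ p" using A(1) B(1) by (simp flip: add_divide_distrib)
  finally show ?thesis .
qed

section \<open>Laws with finite moments and their couplings\<close>

lemma Pp_D:
  assumes "\<mu> \<in> Pp p"
  shows "prob_space \<mu>" "sets \<mu> = sets borel" "space \<mu> = UNIV" "integrable \<mu> (\<lambda>x. norm x ^ p)"
  using assms sets_eq_imp_space_eq[of \<mu> borel] by (auto simp: Pp_def)

lemma couplings_D:
  assumes "\<pi> \<in> couplings \<mu> \<nu>"
  shows "prob_space \<pi>" "sets \<pi> = sets (borel \<Otimes>\<^sub>M borel)" "space \<pi> = UNIV"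
    "distr \<pi> borel fst = \<mu>" "distr \<pi> borel snd = \<nu>"
  using assms sets_eq_imp_space_eq[of \<pi> "borel \<Otimes>\<^sub>M borel"]
  by (auto simp: couplings_def space_pair_measure)

lemma couplings_measurable:
  assumes "\<pi> \<in> couplings \<mu> \<nu>"
  shows "f \<in> measurable \<pi> N \<longleftrightarrow> f \<in> measurable (borel \<Otimes>\<^sub>M borel) N"
  using measurable_cong_sets[OF couplings_D(2)[OF assms] refl] by auto

lemma couplings_nonempty:
  assumes "\<mu> \<in> Pp p" "\<nu> \<in> Pp q"
  shows "\<mu> \<Otimes>\<^sub>M \<nu> \<in> couplings \<mu> \<nu>"
proof -
  interpret m: prob_space \<mu> using assms Pp_D by blast
  interpret n: prob_space \<nu> using assms Pp_D by blast
  interpret P: pair_prob_space \<mu> \<nu> ..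
  have s: "sets (\<mu> \<Otimes>\<^sub>M \<nu>) = sets (borel \<Otimes>\<^sub>M borel)"
    using Pp_D(2)[OF assms(1)] Pp_D(2)[OF assms(2)] by (rule sets_pair_measure_cong)
  have 1: "distr (\<mu> \<Otimes>\<^sub>M \<nu>) \<mu> fst = \<mu>" by (rule n.distr_pair_fst)
  have "distr (\<mu> \<Otimes>\<^sub>M \<nu>) \<nu> snd = \<nu>"
  proof (rule measure_eqI)
    fix A assume "A \<in> sets (distr (\<mu> \<Otimes>\<^sub>M \<nu>) \<nu> snd)"
    then have A: "A \<in> sets \<nu>" by simp
    have "snd -` A \<inter> space (\<mu> \<Otimes>\<^sub>M \<nu>) = space \<mu> \<times> A"
      using sets.sets_into_space[OF A] by (auto simp: space_pair_measure)
    then show "emeasure (distr (\<mu> \<Otimes>\<^sub>M \<nu>) \<nu> snd) A = emeasure \<nu> A"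
      using A by (simp add: emeasure_distr n.emeasure_pair_measure_Times m.emeasure_space_1)
  qed simp
  moreover have "distr (\<mu> \<Otimes>\<^sub>M \<nu>) borel fst = distr (\<mu> \<Otimes>\<^sub>M \<nu>) \<mu> fst"
    "distr (\<mu> \<Otimes>\<^sub>M \<nu>) borel snd = distr (\<mu> \<Otimes>\<^sub>M \<nu>) \<nu> snd"
    using Pp_D(2)[OF assms(1)] Pp_D(2)[OF assms(2)] by (auto intro!: distr_cong)
  ultimately show ?thesis
    using s 1 by (simp add: couplings_def P.prob_space_axioms)
qed

lemma power_sum_le:
  fixes a b :: real
  assumes "0 \<le> a" "0 \<le> b"
  shows "(a + b) ^ p \<le> 2 ^ p * (a ^ p + b ^ p)"
proof -
  have "(a + b) ^ p \<le> (2 * max a b) ^ p" using assms by (intro power_mono) auto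
  also have "\<dots> = 2 ^ p * max a b ^ p" by (simp add: power_mult_distrib)
  also have "\<dots> \<le> 2 ^ p * (a ^ p + b ^ p)"
    using assms by (intro mult_left_mono) (auto simp: max_def)
  finally show ?thesis .
qed

lemma coupling_integrable:
  fixes f :: "real^'d \<Rightarrow> 'b::{banach,second_countable_topology}"
  assumes \<pi>: "\<pi> \<in> couplings \<mu> \<nu>"
  shows "integrable \<mu> f \<Longrightarrow> integrable \<pi> (\<lambda>z. f (fst z))"
    "integrable \<nu> f \<Longrightarrow> integrable \<pi> (\<lambda>z. f (snd z))"
    "f \<in> borel_measurable borel \<Longrightarrow> (\<integral>z. f (fst z) \<partial>\<pi>) = (\<integral>x. f x \<partial>\<mu>)"
    "f \<in> borel_measurable borel \<Longrightarrow> (\<integral>z. f (snd z) \<partial>\<pi>) = (\<integral>x. f x \<partial>\<nu>)"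
proof -
  note D = couplings_D[OF \<pi>]
  have m [measurable]: "fst \<in> borel_measurable \<pi>" "snd \<in> borel_measurable \<pi>"
    using \<pi> by (auto simp: couplings_measurable)
  show "integrable \<pi> (\<lambda>z. f (fst z))" if i: "integrable \<mu> f"
    by (rule integrable_distr[where M'=borel and T=fst]) (use D i in auto)
  show "integrable \<pi> (\<lambda>z. f (snd z))" if i: "integrable \<nu> f"
    by (rule integrable_distr[where M'=borel and T=snd]) (use D i in auto)
  show "(\<integral>z. f (fst z) \<partial>\<pi>) = (\<integral>x. f x \<partial>\<mu>)" if "f \<in> borel_measurable borel"
    using integral_distr[of fst \<pi> borel f] that D by simp
  show "(\<integral>z. f (snd z) \<partial>\<pi>) = (\<integral>x. f x \<partial>\<nu>)" if "f \<in> borel_measurable borel"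
    using integral_distr[of snd \<pi> borel f] that D by simp
qed

lemma coupling_cost_integrable:
  assumes "\<mu> \<in> Pp p" "\<nu> \<in> Pp p" and \<pi>: "\<pi> \<in> couplings \<mu> \<nu>"
  shows "integrable \<pi> (\<lambda>z. dist (fst z) (snd z) ^ p)"
proof (rule Bochner_Integration.integrable_bound)
  note m = couplings_measurable[OF \<pi>]
  show "integrable \<pi> (\<lambda>z. 2 ^ p * (norm (fst z) ^ p + norm (snd z) ^ p))"
    using coupling_integrable(1,2)[OF \<pi>, of "\<lambda>x. norm x ^ p"] Pp_D(4)[OF assms(1)] Pp_D(4)[OF assms(2)]
    by (intro integrable_mult_right Bochner_Integration.integrable_add)
  show "(\<lambda>z. dist (fst z) (snd z) ^ p) \<in> borel_measurable \<pi>"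
    unfolding m by measurable
  show "AE z in \<pi>. norm (dist (fst z) (snd z) ^ p) \<le> norm (2 ^ p * (norm (fst z) ^ p + norm (snd z) ^ p))"
  proof (rule AE_I2)
    fix z :: "(real^'d) \<times> (real^'d)"
    have "dist (fst z) (snd z) ^ p \<le> (norm (fst z) + norm (snd z)) ^ p"
      by (intro power_mono) (auto simp: dist_norm norm_triangle_ineq4)
    also have "\<dots> \<le> 2 ^ p * (norm (fst z) ^ p + norm (snd z) ^ p)"
      by (rule power_sum_le) auto
    finally show "norm (dist (fst z) (snd z) ^ p) \<le> norm (2 ^ p * (norm (fst z) ^ p + norm (snd z) ^ p))"
      by simp
  qed
qed

lemma enn2real_less_imp: "enn2real x < r \<Longrightarrow> x < \<top> \<Longrightarrow> x < ennreal r"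
  by (cases x) (auto simp: ennreal_less_iff)

lemma wasserstein_nonneg: "p > 0 \<Longrightarrow> 0 \<le> wasserstein p \<mu> \<nu>"
  by (simp add: wasserstein_def)

lemma wasserstein_le:
  assumes "\<pi> \<in> couplings \<mu> \<nu>" "p > 0" "0 \<le> e"
    and "(\<integral>\<^sup>+z. ennreal (dist (fst z) (snd z) ^ p) \<partial>\<pi>) \<le> ennreal (e ^ p)"
  shows "wasserstein p \<mu> \<nu> \<le> e"
proof -
  have "(INF \<pi>\<in>couplings \<mu> \<nu>. \<integral>\<^sup>+z. ennreal (dist (fst z) (snd z) ^ p) \<partial>\<pi>) \<le> ennreal (e ^ p)"
    using assms by (meson INF_lower order_trans)
  then have "enn2real (INF \<pi>\<in>couplings \<mu> \<nu>. \<integral>\<^sup>+z. ennreal (dist (fst z) (snd z) ^ p) \<partial>\<pi>) \<le> e ^ p"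
    using assms by (simp add: enn2real_leI)
  then have "wasserstein p \<mu> \<nu> \<le> root p (e ^ p)"
    unfolding wasserstein_def using assms by simp
  then show ?thesis using assms by (simp add: real_root_power_cancel)
qed

text \<open>Stands in for an optimal coupling: every number strictly above the distance exceeds the
  cost of some coupling. The applications let that number decrease to the distance at the
  end.\<close>

lemma wasserstein_lt:
  assumes "\<mu> \<in> Pp p" "\<nu> \<in> Pp p" "p > 0" "wasserstein p \<mu> \<nu> < e"
  obtains \<pi> where "\<pi> \<in> couplings \<mu> \<nu>"
    "(\<integral>\<^sup>+z. ennreal (dist (fst z) (snd z) ^ p) \<partial>\<pi>) < ennreal (e ^ p)"
    "(\<integral>z. dist (fst z) (snd z) ^ p \<partial>\<pi>) < e ^ p"
proof -
  let ?I = "INF \<pi>\<in>couplings \<mu> \<nu>. \<integral>\<^sup>+z. ennreal (dist (fst z) (snd z) ^ p) \<partial>\<pi>"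
  have e: "0 < e" using assms wasserstein_nonneg[of p \<mu> \<nu>] by linarith
  have nn: "(\<integral>\<^sup>+z. ennreal (dist (fst z) (snd z) ^ p) \<partial>\<pi>) = ennreal (\<integral>z. dist (fst z) (snd z) ^ p \<partial>\<pi>)"
    if "\<pi> \<in> couplings \<mu> \<nu>" for \<pi>
    using coupling_cost_integrable[OF assms(1,2) that] by (intro nn_integral_eq_integral) auto
  \<comment> \<open>Finiteness has to be shown first, since \<open>enn2real\<close> sends an
    infinite infimum to 0.\<close>
  have "?I \<le> (\<integral>\<^sup>+z. ennreal (dist (fst z) (snd z) ^ p) \<partial>(\<mu> \<Otimes>\<^sub>M \<nu>))"
    using couplings_nonempty[OF assms(1,2)] by (rule INF_lower)
  also have "\<dots> < \<top>" using nn[OF couplings_nonempty[OF assms(1,2)]] by simp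
  finally have fin: "?I < \<top>" .
  have "root p (enn2real ?I) < root p (e ^ p)"
    using assms e unfolding wasserstein_def by (simp add: real_root_power_cancel)
  then have "enn2real ?I < e ^ p" using assms by simp
  then have "?I < ennreal (e ^ p)"
    using fin by (intro enn2real_less_imp)
  then obtain \<pi> where \<pi>: "\<pi> \<in> couplings \<mu> \<nu>"
    "(\<integral>\<^sup>+z. ennreal (dist (fst z) (snd z) ^ p) \<partial>\<pi>) < ennreal (e ^ p)"
    by (auto simp: INF_less_iff)
  moreover have "(\<integral>z. dist (fst z) (snd z) ^ p \<partial>\<pi>) < e ^ p"
    using \<pi> by (simp add: nn ennreal_less_iff)
  ultimately show ?thesis using that by blast
qed

section \<open>Approximate gluing and the triangle inequality\<close>

text \<open>Cubes of side \<epsilon>/d have diameter at most \<epsilon>, already in the l1 norm.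
  Because there are countably many cells, measurability can be checked cell by cell and all null
  cells can be discarded at once.\<close>

lemma grid_cell:
  fixes \<epsilon> :: real
  assumes "0 < \<epsilon>"
  obtains c :: "real^'d \<Rightarrow> int^'d" where "c \<in> measurable borel (count_space UNIV)"
    "\<And>x y. c x = c y \<Longrightarrow> dist x y \<le> \<epsilon>"
proof
  define \<delta> where "\<delta> = \<epsilon> / real CARD('d)"
  have \<delta>: "0 < \<delta>" using assms by (simp add: \<delta>_def)
  define c :: "real^'d \<Rightarrow> int^'d" where "c x = (\<chi> l. \<lfloor>x $ l / \<delta>\<rfloor>)" for x
  have [measurable]: "Measurable.pred borel (\<lambda>x::real^'d. \<lfloor>x $ l / \<delta>\<rfloor> = k)" for l k
    by measurable
  have "c -` {k} \<inter> space borel \<in> sets borel" for k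
  proof -
    have "c -` {k} \<inter> space borel = {x\<in>space borel. \<forall>l. \<lfloor>x $ l / \<delta>\<rfloor> = k $ l}"
      by (auto simp: c_def vec_eq_iff)
    also have "\<dots> \<in> sets borel" by measurable
    finally show ?thesis .
  qed
  then show "c \<in> measurable borel (count_space UNIV)"
    by (subst measurable_count_space_eq_countable) auto
  fix x y assume c: "c x = c y"
  have "\<bar>(x - y) $ l\<bar> \<le> \<delta>" for l
  proof -
    have "\<lfloor>x $ l / \<delta>\<rfloor> = \<lfloor>y $ l / \<delta>\<rfloor>" using c by (simp add: c_def vec_eq_iff)
    then have "\<bar>x $ l / \<delta> - y $ l / \<delta>\<bar> \<le> 1" by linarith
    then have "\<bar>(x $ l - y $ l) / \<delta>\<bar> \<le> 1" by (simp add: diff_divide_distrib)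
    then show ?thesis using \<delta> by (simp add: abs_divide field_simps)
  qed
  then have "(\<Sum>l\<in>UNIV. \<bar>(x - y) $ l\<bar>) \<le> (\<Sum>l\<in>(UNIV::'d set). \<delta>)" by (intro sum_mono)
  also have "\<dots> = \<epsilon>" by (simp add: \<delta>_def)
  finally show "dist x y \<le> \<epsilon>"
    using norm_le_l1_cart[of "x - y"] by (simp add: dist_norm)
qed

text \<open>Gluing without disintegration: the two couplings are made independent conditionally on a
  countable partition of the middle space into small cells.\<close>

lemma approximate_gluing:
  fixes \<mu> \<nu> \<rho> :: "(real^'d) measure"
  assumes p1: "\<pi>\<^sub>1 \<in> couplings \<mu> \<nu>" and p2: "\<pi>\<^sub>2 \<in> couplings \<nu> \<rho>" and "0 < \<epsilon>"
  obtains M where "prob_space M"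
    "sets M = sets ((borel \<Otimes>\<^sub>M borel) \<Otimes>\<^sub>M (borel \<Otimes>\<^sub>M borel))"
    "distr M (borel \<Otimes>\<^sub>M borel) fst = \<pi>\<^sub>1" "distr M (borel \<Otimes>\<^sub>M borel) snd = \<pi>\<^sub>2"
    "AE w in M. dist (snd (fst w)) (fst (snd w)) \<le> \<epsilon>"
proof -
  let ?B = "borel \<Otimes>\<^sub>M borel :: ((real^'d) \<times> (real^'d)) measure"
  note D1 = couplings_D[OF p1] and D2 = couplings_D[OF p2]
  obtain c :: "real^'d \<Rightarrow> int^'d" where c [measurable]: "c \<in> measurable borel (count_space UNIV)"
    and cd: "\<And>x y. c x = c y \<Longrightarrow> dist x y \<le> \<epsilon>"
    using grid_cell[OF \<open>0 < \<epsilon>\<close>] by blast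
  interpret \<pi>1: prob_space \<pi>\<^sub>1 by fact
  interpret \<pi>2: prob_space \<pi>\<^sub>2 by fact
  interpret P: pair_prob_space \<pi>\<^sub>1 \<pi>\<^sub>2 ..
  have s1 [measurable_cong]: "sets \<pi>\<^sub>1 = sets ?B" and s2 [measurable_cong]: "sets \<pi>\<^sub>2 = sets ?B"
    by fact+
  have [measurable]: "fst \<in> borel_measurable \<pi>\<^sub>1" "snd \<in> borel_measurable \<pi>\<^sub>1"
    "fst \<in> borel_measurable \<pi>\<^sub>2" "snd \<in> borel_measurable \<pi>\<^sub>2" by measurable
  have cs [measurable]: "{x. c x = k} \<in> sets borel" for k
    using measurable_sets[OF c, of "{k}"] by (simp add: vimage_def)
  have m1: "{a. c (snd a) = k} \<in> sets ?B" and m2: "{a. c (fst a) = k} \<in> sets ?B" for k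
    using measurable_sets[OF measurable_comp[OF measurable_snd c], of "{k}" borel]
      measurable_sets[OF measurable_comp[OF measurable_fst c], of "{k}" borel]
    by (auto simp: vimage_def space_pair_measure)
  define q where "q k = measure \<nu> {x. c x = k}" for k
  have emq: "emeasure \<nu> {x. c x = k} = ennreal (q k)" for k
  proof -
    have "finite_measure \<nu>"
      using \<pi>1.prob_space_distr[of snd borel] D1(5) by (simp add: prob_space_def)
    then show ?thesis by (simp add: q_def finite_measure.emeasure_eq_measure)
  qed
  have e1: "emeasure \<pi>\<^sub>1 {a. c (snd a) = k} = ennreal (q k)" for k
  proof -
    have "emeasure \<nu> {x. c x = k} = emeasure \<pi>\<^sub>1 (snd -` {x. c x = k} \<inter> space \<pi>\<^sub>1)"
      using D1(5) by (subst D1(5)[symmetric], subst emeasure_distr) auto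
    then show ?thesis using emq[of k] D1(3) by (simp add: vimage_def)
  qed
  have e2: "emeasure \<pi>\<^sub>2 {b. c (fst b) = k} = ennreal (q k)" for k
  proof -
    have "emeasure \<nu> {x. c x = k} = emeasure \<pi>\<^sub>2 (fst -` {x. c x = k} \<inter> space \<pi>\<^sub>2)"
      using D2(4) by (subst D2(4)[symmetric], subst emeasure_distr) auto
    then show ?thesis using emq[of k] D2(3) by (simp add: vimage_def)
  qed
  \<comment> \<open>A cell that is null for the middle marginal is null for both couplings. This
    matters because the density below divides by the mass of the cell.\<close>
  have ae1: "AE a in \<pi>\<^sub>1. q (c (snd a)) \<noteq> 0"
  proof -
    have "AE a in \<pi>\<^sub>1. \<forall>k. q k = 0 \<longrightarrow> c (snd a) \<noteq> k"
      unfolding AE_all_countable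
    proof
      fix k
      show "AE a in \<pi>\<^sub>1. q k = 0 \<longrightarrow> c (snd a) \<noteq> k"
        using e1[of k] m1[of k] by (auto simp: s1 intro!: AE_I[where N="{a. c (snd a) = k}"])
    qed
    then show ?thesis by eventually_elim auto
  qed
  have ae2: "AE a in \<pi>\<^sub>2. q (c (fst a)) \<noteq> 0"
  proof -
    have "AE a in \<pi>\<^sub>2. \<forall>k. q k = 0 \<longrightarrow> c (fst a) \<noteq> k"
      unfolding AE_all_countable
    proof
      fix k
      show "AE a in \<pi>\<^sub>2. q k = 0 \<longrightarrow> c (fst a) \<noteq> k"
        using e2[of k] m2[of k] by (auto simp: s2 intro!: AE_I[where N="{a. c (fst a) = k}"])
    qed
    then show ?thesis by eventually_elim auto
  qed
  \<comment> \<open>Density with respect to the product of the two couplings: both middle points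
    must lie in the same cell, and the mass of that cell is divided out. On a null cell the value is
    0, by division by 0.\<close>
  define f :: "((real^'d) \<times> (real^'d)) \<times> ((real^'d) \<times> (real^'d)) \<Rightarrow> ennreal"
    where "f w = (if c (snd (fst w)) = c (fst (snd w)) then ennreal (1 / q (c (snd (fst w)))) else 0)" for w
  have [measurable]: "Measurable.pred (?B \<Otimes>\<^sub>M ?B) (\<lambda>w. c (snd (fst w)) = c (fst (snd w)))"
  proof -
    have "(\<lambda>w. c (snd (fst w)) = c (fst (snd w))) = (\<lambda>w. \<exists>k. c (snd (fst w)) = k \<and> c (fst (snd w)) = k)"
      by auto
    also have "Measurable.pred (?B \<Otimes>\<^sub>M ?B) \<dots>" by measurable
    finally show ?thesis .
  qed
  have f [measurable]: "f \<in> borel_measurable (\<pi>\<^sub>1 \<Otimes>\<^sub>M \<pi>\<^sub>2)"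
    unfolding f_def by measurable
  \<comment> \<open>Integrating out the second coupling gives the mass of the cell divided by
    itself. Hence the first marginal of the glued measure is unchanged; \<open>i1\<close> is the
    mirror image.\<close>
  have i2: "AE a in \<pi>\<^sub>1. (\<integral>\<^sup>+b. f (a, b) \<partial>\<pi>\<^sub>2) = 1"
    using ae1
  proof eventually_elim
    case (elim a)
    have q: "0 < q (c (snd a))" using elim by (simp add: q_def zero_less_measure_iff)
    have "(\<integral>\<^sup>+b. f (a, b) \<partial>\<pi>\<^sub>2)
        = (\<integral>\<^sup>+b. ennreal (1 / q (c (snd a))) * indicator {b. c (fst b) = c (snd a)} b \<partial>\<pi>\<^sub>2)"
      by (intro nn_integral_cong) (auto simp: f_def indicator_def)
    also have "\<dots> = ennreal (1 / q (c (snd a))) * ennreal (q (c (snd a)))"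
      using D2(2,3) by (subst nn_integral_cmult_indicator) (auto simp: e2 m2)
    also have "\<dots> = 1" using q by (simp flip: ennreal_mult)
    finally show ?case .
  qed
  have i1: "AE b in \<pi>\<^sub>2. (\<integral>\<^sup>+a. f (a, b) \<partial>\<pi>\<^sub>1) = 1"
    using ae2
  proof eventually_elim
    case (elim b)
    have q: "0 < q (c (fst b))" using elim by (simp add: q_def zero_less_measure_iff)
    have "(\<integral>\<^sup>+a. f (a, b) \<partial>\<pi>\<^sub>1)
        = (\<integral>\<^sup>+a. ennreal (1 / q (c (fst b))) * indicator {a. c (snd a) = c (fst b)} a \<partial>\<pi>\<^sub>1)"
      by (intro nn_integral_cong) (auto simp: f_def indicator_def)
    also have "\<dots> = ennreal (1 / q (c (fst b))) * ennreal (q (c (fst b)))"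
      using D1(2,3) by (subst nn_integral_cmult_indicator) (auto simp: e1 m1)
    also have "\<dots> = 1" using q by (simp flip: ennreal_mult)
    finally show ?case .
  qed
  define M where "M = density (\<pi>\<^sub>1 \<Otimes>\<^sub>M \<pi>\<^sub>2) f"
  have sM: "sets M = sets (?B \<Otimes>\<^sub>M ?B)"
    unfolding M_def using sets_pair_measure_cong[OF s1 s2] by simp
  have d1: "distr M ?B fst = \<pi>\<^sub>1"
  proof (rule measure_eqI)
    fix A assume "A \<in> sets (distr M ?B fst)"
    then have A [measurable]: "A \<in> sets ?B" by simp
    have "emeasure (distr M ?B fst) A = emeasure M (fst -` A \<inter> space M)"
      by (intro emeasure_distr) (auto simp: M_def)
    also have "\<dots> = (\<integral>\<^sup>+w. f w * indicator (fst -` A \<inter> space M) w \<partial>(\<pi>\<^sub>1 \<Otimes>\<^sub>M \<pi>\<^sub>2))"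
      unfolding M_def by (intro emeasure_density) auto
    also have "\<dots> = (\<integral>\<^sup>+w. f w * indicator A (fst w) \<partial>(\<pi>\<^sub>1 \<Otimes>\<^sub>M \<pi>\<^sub>2))"
      by (intro nn_integral_cong) (auto simp: M_def indicator_def)
    also have "\<dots> = (\<integral>\<^sup>+a. \<integral>\<^sup>+b. f (a, b) * indicator A a \<partial>\<pi>\<^sub>2 \<partial>\<pi>\<^sub>1)"
      by (subst \<pi>2.nn_integral_fst[symmetric]) auto
    also have "\<dots> = (\<integral>\<^sup>+a. (\<integral>\<^sup>+b. f (a, b) \<partial>\<pi>\<^sub>2) * indicator A a \<partial>\<pi>\<^sub>1)"
      by (intro nn_integral_cong nn_integral_multc) auto
    also have "\<dots> = (\<integral>\<^sup>+a. indicator A a \<partial>\<pi>\<^sub>1)"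
      using i2 by (intro nn_integral_cong_AE) auto
    also have "\<dots> = emeasure \<pi>\<^sub>1 A" using A s1 by simp
    finally show "emeasure (distr M ?B fst) A = emeasure \<pi>\<^sub>1 A" .
  qed (simp add: s1)
  have d2: "distr M ?B snd = \<pi>\<^sub>2"
  proof (rule measure_eqI)
    fix A assume "A \<in> sets (distr M ?B snd)"
    then have A [measurable]: "A \<in> sets ?B" by simp
    have "emeasure (distr M ?B snd) A = emeasure M (snd -` A \<inter> space M)"
      by (intro emeasure_distr) (auto simp: M_def)
    also have "\<dots> = (\<integral>\<^sup>+w. f w * indicator (snd -` A \<inter> space M) w \<partial>(\<pi>\<^sub>1 \<Otimes>\<^sub>M \<pi>\<^sub>2))"
      unfolding M_def by (intro emeasure_density) auto
    also have "\<dots> = (\<integral>\<^sup>+w. f w * indicator A (snd w) \<partial>(\<pi>\<^sub>1 \<Otimes>\<^sub>M \<pi>\<^sub>2))"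
      by (intro nn_integral_cong) (auto simp: M_def indicator_def)
    also have "\<dots> = (\<integral>\<^sup>+b. \<integral>\<^sup>+a. f (a, b) * indicator A b \<partial>\<pi>\<^sub>1 \<partial>\<pi>\<^sub>2)"
      by (subst P.nn_integral_snd[symmetric]) auto
    also have "\<dots> = (\<integral>\<^sup>+b. (\<integral>\<^sup>+a. f (a, b) \<partial>\<pi>\<^sub>1) * indicator A b \<partial>\<pi>\<^sub>2)"
      by (intro nn_integral_cong nn_integral_multc) auto
    also have "\<dots> = (\<integral>\<^sup>+b. indicator A b \<partial>\<pi>\<^sub>2)"
      using i1 by (intro nn_integral_cong_AE) auto
    also have "\<dots> = emeasure \<pi>\<^sub>2 A" using A s2 by simp
    finally show "emeasure (distr M ?B snd) A = emeasure \<pi>\<^sub>2 A" .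
  qed (simp add: s2)
  have "prob_space M"
    by (rule prob_space_distrD[of fst M ?B]) (simp_all add: d1 D1(1), simp add: M_def)
  moreover have "AE w in M. dist (snd (fst w)) (fst (snd w)) \<le> \<epsilon>"
    unfolding M_def
    by (subst AE_density) (auto simp: f_def intro!: cd)
  ultimately show ?thesis using that sM d1 d2 by blast
qed

text \<open>The two middle points of the glued measure agree only up to \<epsilon>. The path from
  the first to the last point thus has three legs, and Minkowski's inequality is applied
  twice.\<close>

lemma wasserstein_triangle:
  assumes "0 < p" and m: "\<mu> \<in> Pp p" "\<nu> \<in> Pp p" "\<rho> \<in> Pp p"
  shows "wasserstein p \<mu> \<rho> \<le> wasserstein p \<mu> \<nu> + wasserstein p \<nu> \<rho>"
proof (rule field_le_epsilon)
  fix e :: real assume e: "0 < e"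
  \<comment> \<open>One third each for the two nearly optimal couplings and for the mismatch of the
    middle points.\<close>
  define \<epsilon> where "\<epsilon> = e / 3"
  have \<epsilon>: "0 < \<epsilon>" using e by (simp add: \<epsilon>_def)
  define a where "a = wasserstein p \<mu> \<nu> + \<epsilon>"
  define b where "b = wasserstein p \<nu> \<rho> + \<epsilon>"
  have ab: "0 < a" "0 < b"
    using \<epsilon> wasserstein_nonneg[OF \<open>0 < p\<close>] unfolding a_def b_def by (auto intro: add_nonneg_pos)
  obtain \<pi>\<^sub>1 where \<pi>1: "\<pi>\<^sub>1 \<in> couplings \<mu> \<nu>"
      "(\<integral>\<^sup>+z. ennreal (dist (fst z) (snd z) ^ p) \<partial>\<pi>\<^sub>1) < ennreal (a ^ p)"
    using wasserstein_lt[OF m(1,2) \<open>0 < p\<close>, of a] \<epsilon> by (auto simp: a_def)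
  obtain \<pi>\<^sub>2 where \<pi>2: "\<pi>\<^sub>2 \<in> couplings \<nu> \<rho>"
      "(\<integral>\<^sup>+z. ennreal (dist (fst z) (snd z) ^ p) \<partial>\<pi>\<^sub>2) < ennreal (b ^ p)"
    using wasserstein_lt[OF m(2,3) \<open>0 < p\<close>, of b] \<epsilon> by (auto simp: b_def)
  let ?B = "borel \<Otimes>\<^sub>M borel :: ((real^'a) \<times> (real^'a)) measure"
  obtain M where M: "prob_space M" "sets M = sets (?B \<Otimes>\<^sub>M ?B)"
    "distr M ?B fst = \<pi>\<^sub>1" "distr M ?B snd = \<pi>\<^sub>2"
    "AE w in M. dist (snd (fst w)) (fst (snd w)) \<le> \<epsilon>"
    by (rule approximate_gluing[OF \<pi>1(1) \<pi>2(1) \<epsilon>])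
  interpret M: prob_space M by fact
  note [measurable_cong] = M(2)
  have [measurable]: "fst \<in> measurable M ?B" "snd \<in> measurable M ?B" by measurable
  define T where "T w = (fst (fst w), snd (snd w))" for w :: "((real^'a) \<times> (real^'a)) \<times> ((real^'a) \<times> (real^'a))"
  have [measurable]: "T \<in> measurable M ?B" unfolding T_def by measurable
  have "distr (distr M ?B T) borel fst = distr (distr M ?B fst) borel fst"
    by (subst (1 2) distr_distr) (auto simp: comp_def T_def)
  moreover have "distr (distr M ?B T) borel snd = distr (distr M ?B snd) borel snd"
    by (subst (1 2) distr_distr) (auto simp: comp_def T_def)
  ultimately have cp: "distr M ?B T \<in> couplings \<mu> \<rho>"
    using couplings_D(4,5)[OF \<pi>1(1)] couplings_D(4,5)[OF \<pi>2(1)] M(3,4)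
    by (auto simp: couplings_def intro!: M.prob_space_distr)
  have c1: "(\<integral>\<^sup>+w. ennreal (dist (fst (fst w)) (snd (fst w)) ^ p) \<partial>M) \<le> ennreal (a ^ p)"
    using \<pi>1(2) nn_integral_distr[of fst M ?B "\<lambda>z. ennreal (dist (fst z) (snd z) ^ p)"] by (simp add: M(3) couplings_measurable[OF \<pi>1(1)])
  have c2: "(\<integral>\<^sup>+w. ennreal (dist (fst (snd w)) (snd (snd w)) ^ p) \<partial>M) \<le> ennreal (b ^ p)"
    using \<pi>2(2) nn_integral_distr[of snd M ?B "\<lambda>z. ennreal (dist (fst z) (snd z) ^ p)"] by (simp add: M(4) couplings_measurable[OF \<pi>2(1)])
  have "(\<integral>\<^sup>+w. ennreal (dist (snd (fst w)) (fst (snd w)) ^ p) \<partial>M) \<le> (\<integral>\<^sup>+w. ennreal (\<epsilon> ^ p) \<partial>M)"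
    using M(5) by (intro nn_integral_mono_AE) (auto elim!: eventually_mono intro!: ennreal_leI power_mono)
  then have c3: "(\<integral>\<^sup>+w. ennreal (dist (snd (fst w)) (fst (snd w)) ^ p) \<partial>M) \<le> ennreal (\<epsilon> ^ p)"
    by (simp add: M.emeasure_space_1)
  have c12: "(\<integral>\<^sup>+w. ennreal ((dist (fst (fst w)) (snd (fst w)) + dist (snd (fst w)) (fst (snd w))) ^ p) \<partial>M)
      \<le> ennreal ((a + \<epsilon>) ^ p)"
    by (rule nn_integral_Minkowski) (use c1 c3 ab \<epsilon> in auto)
  have c: "(\<integral>\<^sup>+w. ennreal (((dist (fst (fst w)) (snd (fst w)) + dist (snd (fst w)) (fst (snd w)))
      + dist (fst (snd w)) (snd (snd w))) ^ p) \<partial>M) \<le> ennreal ((a + \<epsilon> + b) ^ p)"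
    by (rule nn_integral_Minkowski) (use c12 c2 ab \<epsilon> in auto)
  have "(\<integral>\<^sup>+z. ennreal (dist (fst z) (snd z) ^ p) \<partial>distr M ?B T)
      = (\<integral>\<^sup>+w. ennreal (dist (fst (fst w)) (snd (snd w)) ^ p) \<partial>M)"
    by (subst nn_integral_distr) (auto simp: T_def)
  also have "\<dots> \<le> (\<integral>\<^sup>+w. ennreal (((dist (fst (fst w)) (snd (fst w)) + dist (snd (fst w)) (fst (snd w)))
      + dist (fst (snd w)) (snd (snd w))) ^ p) \<partial>M)"
  proof (intro nn_integral_mono ennreal_leI power_mono)
    fix w :: "((real^'a) \<times> (real^'a)) \<times> ((real^'a) \<times> (real^'a))"
    show "dist (fst (fst w)) (snd (snd w)) \<le> dist (fst (fst w)) (snd (fst w))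
        + dist (snd (fst w)) (fst (snd w)) + dist (fst (snd w)) (snd (snd w))"
      using dist_triangle[of "fst (fst w)" "snd (snd w)" "snd (fst w)"]
        dist_triangle[of "snd (fst w)" "snd (snd w)" "fst (snd w)"] by linarith
  qed auto
  also note c
  finally have "wasserstein p \<mu> \<rho> \<le> a + \<epsilon> + b"
    using ab \<epsilon> by (intro wasserstein_le[OF cp \<open>0 < p\<close>]) auto
  then show "wasserstein p \<mu> \<rho> \<le> wasserstein p \<mu> \<nu> + wasserstein p \<nu> \<rho> + e"
    by (simp add: a_def b_def \<epsilon>_def)
qed


lemma couplings_swap:
  assumes "\<pi> \<in> couplings \<mu> \<nu>"
  shows "distr \<pi> (borel \<Otimes>\<^sub>M borel) (\<lambda>z. (snd z, fst z)) \<in> couplings \<nu> \<mu>"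
proof -
  note D = couplings_D[OF assms]
  interpret prob_space \<pi> by fact
  note [measurable_cong] = D(2)
  have [measurable]: "(\<lambda>z. (snd z, fst z)) \<in> measurable \<pi> (borel \<Otimes>\<^sub>M borel)" by measurable
  show ?thesis
    using D by (auto simp: couplings_def distr_distr comp_def intro!: prob_space_distr)
qed

lemma wasserstein_commute: "wasserstein p \<mu> \<nu> = wasserstein p \<nu> \<mu>"
proof -
  have *: "(INF \<pi>\<in>couplings \<mu> \<nu>. \<integral>\<^sup>+z. ennreal (dist (fst z) (snd z) ^ p) \<partial>\<pi>)
      \<le> (INF \<pi>\<in>couplings \<nu> \<mu>. \<integral>\<^sup>+z. ennreal (dist (fst z) (snd z) ^ p) \<partial>\<pi>)" for \<mu> \<nu> :: "(real^'a) measure"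
  proof (rule INF_mono)
    fix \<pi> assume \<pi>: "\<pi> \<in> couplings \<nu> \<mu>"
    note [measurable_cong] = couplings_D(2)[OF \<pi>]
    have [measurable]: "(\<lambda>z. (snd z, fst z)) \<in> measurable \<pi> (borel \<Otimes>\<^sub>M borel)" by measurable
    have "(\<integral>\<^sup>+z. ennreal (dist (fst z) (snd z) ^ p) \<partial>distr \<pi> (borel \<Otimes>\<^sub>M borel) (\<lambda>z. (snd z, fst z)))
        = (\<integral>\<^sup>+z. ennreal (dist (fst z) (snd z) ^ p) \<partial>\<pi>)"
      by (subst nn_integral_distr) (auto simp: dist_commute)
    then show "\<exists>\<pi>'\<in>couplings \<mu> \<nu>. (\<integral>\<^sup>+z. ennreal (dist (fst z) (snd z) ^ p) \<partial>\<pi>')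
        \<le> (\<integral>\<^sup>+z. ennreal (dist (fst z) (snd z) ^ p) \<partial>\<pi>)"
      using couplings_swap[OF \<pi>] by (intro bexI) auto
  qed
  show ?thesis unfolding wasserstein_def using *[of \<mu> \<nu>] *[of \<nu> \<mu>] by (simp add: antisym)
qed

section \<open>Integrals of Lipschitz functions and the metric axioms\<close>

text \<open>Bernoulli's inequality for \<open>f / B\<close> is the tangent line of the power at
  \<open>B\<close>; integrating it bounds the mean of \<open>f\<close> by \<open>B\<close>. Any
  \<open>B\<close> above \<open>A\<close> is positive even when \<open>A = 0\<close>, and letting
  \<open>B\<close> decrease to \<open>A\<close> gives the claim.\<close>

lemma (in prob_space) Jensen_power_le:
  fixes f :: "'a \<Rightarrow> real"
  assumes [measurable]: "f \<in> borel_measurable M" and nn: "\<And>x. 0 \<le> f x"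
    and i: "integrable M (\<lambda>x. f x ^ p)" and "0 < p" "0 \<le> A" "(\<integral>x. f x ^ p \<partial>M) \<le> A ^ p"
  shows "integrable M f" "(\<integral>x. f x \<partial>M) \<le> A"
proof -
  have b: "f x \<le> B * (1 + ((f x / B) ^ p - 1) / p)" if "B > 0" for x B
  proof -
    have "1 + real p * (f x / B - 1) \<le> (1 + (f x / B - 1)) ^ p"
      using nn that by (intro Bernoulli_inequality) (simp add: field_simps)
    then have "real p * (f x / B - 1) \<le> (f x / B) ^ p - 1" by simp
    then have "f x / B - 1 \<le> ((f x / B) ^ p - 1) / p" using \<open>0 < p\<close> by (simp add: pos_le_divide_eq mult.commute)
    then have "f x / B \<le> 1 + ((f x / B) ^ p - 1) / p" by simp
    then show ?thesis using that by (simp add: pos_divide_le_eq mult.commute)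
  qed
  have iB: "integrable M (\<lambda>x. B * (1 + ((f x / B) ^ p - 1) / p))" for B
    using i by (auto simp: power_divide)
  show int: "integrable M f"
    by (rule Bochner_Integration.integrable_bound[OF iB[of 1]]) (use b[of 1] nn in \<open>auto intro!: AE_I2 order_trans[OF _ abs_ge_self]\<close>)
  have "(\<integral>x. f x \<partial>M) \<le> B" if "A < B" for B
  proof -
    have B: "0 < B" using that assms by simp
    have "(\<integral>x. f x \<partial>M) \<le> (\<integral>x. B * (1 + ((f x / B) ^ p - 1) / p) \<partial>M)"
      using b[OF B] int iB by (intro integral_mono) auto
    also have "\<dots> = B * (1 + ((\<integral>x. f x ^ p \<partial>M) / B ^ p - 1) / p)"
      using i by (simp add: power_divide prob_space)
    also have "\<dots> \<le> B * (1 + 0)"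
    proof -
      have "(\<integral>x. f x ^ p \<partial>M) \<le> B ^ p"
        using assms(6) power_mono[of A B p] that \<open>0 \<le> A\<close> by linarith
      then have "(\<integral>x. f x ^ p \<partial>M) / B ^ p - 1 \<le> 0" using B by simp
      then show ?thesis
        using B by (intro mult_left_mono add_left_mono) (auto simp: divide_nonpos_nonneg)
    qed
    finally show ?thesis by simp
  qed
  then show "(\<integral>x. f x \<partial>M) \<le> A" by (rule dense_ge)
qed

lemma Pp_antimono:
  assumes "\<mu> \<in> Pp p" "0 < p"
  shows "\<mu> \<in> Pp 1"
proof -
  interpret prob_space \<mu> using assms Pp_D by blast
  note [measurable_cong] = Pp_D(2)[OF assms(1)]
  have [measurable]: "norm \<in> borel_measurable \<mu>" by measurable
  \<comment> \<open>At least 1, so that \<open>A\<close> is bounded by its own power.\<close>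
  define A where "A = max 1 (\<integral>x. norm x ^ p \<partial>\<mu>)"
  have "(\<integral>x. norm x ^ p \<partial>\<mu>) \<le> A ^ p"
  proof -
    have "A ^ 1 \<le> A ^ p" using assms(2) by (intro power_increasing) (auto simp: A_def)
    then show ?thesis by (simp add: A_def)
  qed
  then have "integrable \<mu> norm"
    using assms Pp_D(4)[OF assms(1)] by (intro Jensen_power_le(1)[of norm p A]) (auto simp: A_def)
  then show ?thesis using Pp_D[OF assms(1)] by (simp add: Pp_def)
qed

text \<open>The easy half of Kantorovich-Rubinstein duality: integrate the Lipschitz estimate
  against a nearly optimal coupling. For exponents above 1, Jensen's inequality turns the cost into
  a bound on the mean distance.\<close>

lemma wasserstein_Lipschitz_integral:
  fixes f :: "real^'d \<Rightarrow> real"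
  assumes m: "\<mu> \<in> Pp p" "\<nu> \<in> Pp p" and "0 < p" and "0 \<le> B"
    and f: "\<And>x y. \<bar>f x - f y\<bar> \<le> B * dist x y"
    and i: "integrable \<mu> f" "integrable \<nu> f"
  shows "\<bar>(\<integral>x. f x \<partial>\<mu>) - (\<integral>x. f x \<partial>\<nu>)\<bar> \<le> B * wasserstein p \<mu> \<nu>"
proof -
  have fm: "f \<in> borel_measurable borel"
    using borel_measurable_integrable[OF i(1)] Pp_D(2)[OF m(1)] measurable_cong_sets by blast
  have "\<bar>(\<integral>x. f x \<partial>\<mu>) - (\<integral>x. f x \<partial>\<nu>)\<bar> \<le> B * e" if e: "wasserstein p \<mu> \<nu> < e" for e
  proof -
    obtain \<pi> where \<pi>: "\<pi> \<in> couplings \<mu> \<nu>" "(\<integral>z. dist (fst z) (snd z) ^ p \<partial>\<pi>) < e ^ p"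
      using wasserstein_lt[OF m \<open>0 < p\<close> e] by blast
    interpret prob_space \<pi> using couplings_D[OF \<pi>(1)] by blast
    have e0: "0 \<le> e" using e wasserstein_nonneg[OF \<open>0 < p\<close>, of \<mu> \<nu>] by linarith
    have dm: "(\<lambda>z. dist (fst z) (snd z)) \<in> borel_measurable \<pi>"
      by (simp add: couplings_measurable[OF \<pi>(1)])
    note J = Jensen_power_le[OF dm _ coupling_cost_integrable[OF m \<pi>(1)] \<open>0 < p\<close> e0]
    have d: "integrable \<pi> (\<lambda>z. dist (fst z) (snd z))" "(\<integral>z. dist (fst z) (snd z) \<partial>\<pi>) \<le> e"
      using J \<pi>(2) by auto
    note c = coupling_integrable[OF \<pi>(1)]
    have if1: "integrable \<pi> (\<lambda>z. f (fst z))" and if2: "integrable \<pi> (\<lambda>z. f (snd z))"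
      using c(1)[OF i(1)] c(2)[OF i(2)] .
    have "(\<integral>x. f x \<partial>\<mu>) - (\<integral>x. f x \<partial>\<nu>) = (\<integral>z. f (fst z) - f (snd z) \<partial>\<pi>)"
      using c(3)[OF fm] c(4)[OF fm] if1 if2 by simp
    also have "\<bar>\<dots>\<bar> \<le> (\<integral>z. \<bar>f (fst z) - f (snd z)\<bar> \<partial>\<pi>)" by (rule integral_abs_bound)
    also have "\<dots> \<le> (\<integral>z. B * dist (fst z) (snd z) \<partial>\<pi>)"
      using if1 if2 d(1) f by (intro integral_mono) auto
    also have "\<dots> \<le> B * e" using d(2) \<open>0 \<le> B\<close> by (simp add: mult_left_mono)
    finally show ?thesis .
  qed
  then have *: "\<bar>(\<integral>x. f x \<partial>\<mu>) - (\<integral>x. f x \<partial>\<nu>)\<bar> \<le> B * (wasserstein p \<mu> \<nu> + e)" if "0 < e" for e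
    using that by simp
  have "((\<lambda>e. B * (wasserstein p \<mu> \<nu> + e)) \<longlongrightarrow> B * (wasserstein p \<mu> \<nu> + 0)) (at_right 0)"
    by (intro tendsto_intros)
  then show ?thesis
    using * by (intro tendsto_lowerbound[where F="at_right (0::real)"]) (auto simp: eventually_at_right_less intro!: eventually_mono[OF eventually_at_right_less])
qed

lemma wasserstein_self: "\<mu> \<in> Pp p \<Longrightarrow> 0 < p \<Longrightarrow> wasserstein p \<mu> \<mu> = 0"
proof -
  assume \<mu>: "\<mu> \<in> Pp p" and p: "0 < p"
  note D = Pp_D[OF \<mu>]
  interpret prob_space \<mu> by fact
  note [measurable_cong] = D(2)
  have [measurable]: "(\<lambda>x. (x, x)) \<in> measurable \<mu> (borel \<Otimes>\<^sub>M borel)" by measurable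
  have "distr \<mu> borel (\<lambda>x. x) = \<mu>" using D(2) by (metis distr_id2)
  then have c: "distr \<mu> (borel \<Otimes>\<^sub>M borel) (\<lambda>x. (x, x)) \<in> couplings \<mu> \<mu>"
    by (auto simp: couplings_def distr_distr comp_def intro!: prob_space_distr)
  have "wasserstein p \<mu> \<mu> \<le> 0"
    by (rule wasserstein_le[OF c p]) (use p in \<open>auto simp: nn_integral_distr zero_power\<close>)
  then show ?thesis using wasserstein_nonneg[OF p, of \<mu> \<mu>] by simp
qed

text \<open>Distance 0 makes the integrals of all bounded Lipschitz functions agree. The indicator
  of a closed set is the pointwise limit of such functions, and the closed sets form an
  intersection-stable generator of the Borel sets.\<close>

lemma wasserstein_eq_0_imp_eq:
  fixes \<mu> \<nu> :: "(real^'d) measure"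
  assumes m: "\<mu> \<in> Pp p" "\<nu> \<in> Pp p" and "0 < p" and W: "wasserstein p \<mu> \<nu> = 0"
  shows "\<mu> = \<nu>"
proof (rule measure_eqI_generator_eq[where \<Omega>=UNIV and E="Collect closed" and A="\<lambda>_. UNIV"])
  note D1 = Pp_D[OF m(1)] and D2 = Pp_D[OF m(2)]
  interpret m1: prob_space \<mu> by fact
  interpret m2: prob_space \<nu> by fact
  note [measurable_cong] = D1(2) D2(2)
  show "Int_stable (Collect closed)" by (auto simp: Int_stable_def)
  show "sets \<mu> = sigma_sets UNIV (Collect closed)" "sets \<nu> = sigma_sets UNIV (Collect closed)"
    by (simp_all add: D1 D2 borel_eq_closed)
  fix C :: "(real^'d) set" assume "C \<in> Collect closed"
  then have C: "closed C" and [measurable]: "C \<in> sets borel" by auto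
  show "emeasure \<mu> C = emeasure \<nu> C"
  \<comment> \<open>The value of \<open>infdist\<close> at the empty set is 0, so the approximating
    functions would be constantly 1 there.\<close>
  proof (cases "C = {}")
    case False
    define f where "f k x = max 0 (1 - real k * infdist x C)" for k and x :: "real^'d"
    have fb: "norm (f k x) \<le> 1" for k x using infdist_nonneg[of x C] by (auto simp: f_def)
    have fc: "continuous_on UNIV (f k)" for k unfolding f_def by (intro continuous_intros)
    then have [measurable]: "f k \<in> borel_measurable borel" for k
      by (rule borel_measurable_continuous_onI)
    have fl: "\<bar>f k x - f k y\<bar> \<le> real k * dist x y" for k x y
    proof -
      have "\<bar>f k x - f k y\<bar> \<le> \<bar>real k * infdist x C - real k * infdist y C\<bar>"
        by (auto simp: f_def)
      also have "\<dots> = real k * \<bar>infdist x C - infdist y C\<bar>"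
        by (simp flip: right_diff_distrib add: abs_mult)
      also have "\<dots> \<le> real k * dist x y"
        using infdist_triangle_abs[of x C y] by (intro mult_left_mono) auto
      finally show ?thesis .
    qed
    have fi: "integrable \<mu> (f k)" "integrable \<nu> (f k)" for k
      using fb by (auto intro!: m1.integrable_const_bound[where B=1] m2.integrable_const_bound[where B=1])
    have eq: "(\<integral>x. f k x \<partial>\<mu>) = (\<integral>x. f k x \<partial>\<nu>)" for k
      using wasserstein_Lipschitz_integral[OF m \<open>0 < p\<close> _ fl fi] W by simp
    have lim: "(\<lambda>k. f k x) \<longlonglongrightarrow> indicator C x" for x
    proof (cases "x \<in> C")
      case True
      then show ?thesis by (simp add: f_def)
    next
      case x: False
      then have pos: "0 < infdist x C"
        using C False by (simp add: infdist_pos_not_in_closed)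
      obtain k0 where k0: "1 / infdist x C < real k0" using reals_Archimedean2 by blast
      have "f k x = 0" if "k0 \<le> k" for k
      proof -
        have "1 < real k0 * infdist x C" using k0 pos by (simp add: field_simps)
        also have "\<dots> \<le> real k * infdist x C" using that pos by (intro mult_right_mono) auto
        finally show ?thesis by (simp add: f_def)
      qed
      then have "\<forall>\<^sub>F k in sequentially. f k x = 0" by (auto simp: eventually_sequentially)
      then show ?thesis using x by (simp add: tendsto_eventually)
    qed
    have "(\<lambda>k. \<integral>x. f k x \<partial>\<mu>) \<longlonglongrightarrow> (\<integral>x. indicator C x \<partial>\<mu>)"
      by (rule integral_dominated_convergence[where w="\<lambda>_. 1"]) (use lim fb in auto)
    moreover have "(\<lambda>k. \<integral>x. f k x \<partial>\<nu>) \<longlonglongrightarrow> (\<integral>x. indicator C x \<partial>\<nu>)"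
      by (rule integral_dominated_convergence[where w="\<lambda>_. 1"]) (use lim fb in auto)
    ultimately have "measure \<mu> C = measure \<nu> C"
      using LIMSEQ_unique by (simp add: eq D1(3) D2(3)) blast
    then show ?thesis by (simp add: m1.emeasure_eq_measure m2.emeasure_eq_measure)
  qed simp
qed (use finite_measure.emeasure_finite[OF prob_space.finite_measure[OF Pp_D(1)[OF m(1)]]] in auto)

lemma Metric_space_wasserstein: "0 < p \<Longrightarrow> Metric_space (Pp p) (wasserstein p)"
  by unfold_locales
    (auto simp: wasserstein_nonneg wasserstein_commute wasserstein_self
      intro: wasserstein_eq_0_imp_eq wasserstein_triangle)

lemma topspace_wtop [simp]: "0 < p \<Longrightarrow> topspace (wtop p) = Pp p"
  by (simp add: wtop_def Metric_space.topspace_mtopology Metric_space_wasserstein)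

lemma continuous_map_wtop_euclidean:
  fixes f :: "(real^'d) measure \<Rightarrow> 'b::metric_space"
  assumes "0 < p"
  shows "continuous_map (wtop p) euclidean f \<longleftrightarrow>
    (\<forall>\<mu>\<in>Pp p. \<forall>\<epsilon>>0. \<exists>\<delta>>0. \<forall>\<nu>\<in>Pp p. wasserstein p \<mu> \<nu> < \<delta> \<longrightarrow> dist (f \<mu>) (f \<nu>) < \<epsilon>)"
proof -
  interpret Metric_space "Pp p :: (real^'d) measure set" "wasserstein p" using assms by (rule Metric_space_wasserstein)
  show ?thesis
    unfolding wtop_def continuous_map_from_metric
  proof (intro iffI conjI ballI allI impI)
    assume *: "f \<in> Pp p \<rightarrow> topspace euclidean \<and> (\<forall>a\<in>Pp p. \<forall>U. openin euclidean U \<and> f a \<in> U \<longrightarrow>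
        (\<exists>r>0. \<forall>x. x \<in> Pp p \<and> wasserstein p a x < r \<longrightarrow> f x \<in> U))"
    fix \<mu> :: "(real^'d) measure" and \<epsilon> :: real assume "\<mu> \<in> Pp p" "0 < \<epsilon>"
    then have "\<exists>r>0. \<forall>x. x \<in> Pp p \<and> wasserstein p \<mu> x < r \<longrightarrow> f x \<in> ball (f \<mu>) \<epsilon>"
      using conjunct2[OF *, rule_format, of \<mu> "ball (f \<mu>) \<epsilon>"] by simp
    then show "\<exists>\<delta>>0. \<forall>\<nu>\<in>Pp p. wasserstein p \<mu> \<nu> < \<delta> \<longrightarrow> dist (f \<mu>) (f \<nu>) < \<epsilon>" by auto
  next
    assume *: "\<forall>\<mu>\<in>Pp p. \<forall>\<epsilon>>0. \<exists>\<delta>>0. \<forall>\<nu>\<in>Pp p. wasserstein p \<mu> \<nu> < \<delta> \<longrightarrow> dist (f \<mu>) (f \<nu>) < \<epsilon>"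
    fix \<mu> :: "(real^'d) measure" and U assume "\<mu> \<in> Pp p" and U: "openin euclidean U \<and> f \<mu> \<in> U"
    from U obtain \<epsilon> where "0 < \<epsilon>" "ball (f \<mu>) \<epsilon> \<subseteq> U" by (metis openE open_openin)
    then show "\<exists>r>0. \<forall>x. x \<in> Pp p \<and> wasserstein p \<mu> x < r \<longrightarrow> f x \<in> U"
      using *[rule_format, OF \<open>\<mu> \<in> Pp p\<close> \<open>0 < \<epsilon>\<close>] by (meson mem_ball subsetD)
  qed auto
qed

section \<open>Finitely supported measures\<close>

text \<open>The shape of \<open>mu_n\<close> with index set, masses and positions as parameters.
  Positions may coincide, so an atom can be split into several parcels without changing the
  measure.\<close>

definition atomic :: "'i set \<Rightarrow> ('i \<Rightarrow> real) \<Rightarrow> ('i \<Rightarrow> real^'d) \<Rightarrow> (real^'d) measure" where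
  "atomic A m f = distr (point_measure A (\<lambda>i. ennreal (m i))) borel f"

lemma sets_atomic [simp, measurable_cong]: "sets (atomic A m f) = sets borel"
  by (simp add: atomic_def)

lemma space_atomic [simp]: "space (atomic A m f) = UNIV"
  by (simp add: atomic_def)

lemma emeasure_atomic:
  assumes "finite A" "\<And>i. i \<in> A \<Longrightarrow> 0 \<le> m i" "B \<in> sets borel"
  shows "emeasure (atomic A m f) B = ennreal (\<Sum>i\<in>A. m i * indicator B (f i))"
proof -
  have "emeasure (atomic A m f) B = emeasure (point_measure A (\<lambda>i. ennreal (m i))) (f -` B \<inter> A)"
    using assms unfolding atomic_def by (subst emeasure_distr) (auto simp: space_point_measure)
  also have "\<dots> = (\<Sum>i\<in>f -` B \<inter> A. ennreal (m i))"
    using assms by (subst emeasure_point_measure_finite) auto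
  also have "\<dots> = (\<Sum>i\<in>A. ennreal (m i * indicator B (f i)))"
    using assms by (intro sum.mono_neutral_cong_left) (auto simp: indicator_def)
  also have "\<dots> = ennreal (\<Sum>i\<in>A. m i * indicator B (f i))"
    using assms by (intro sum_ennreal) auto
  finally show ?thesis .
qed

text \<open>Serves to change the representation of a measure: couplings reindex it by pairs, and
  moving a parcel of mass splits an atom in two.\<close>

lemma atomic_eqI:
  assumes "finite A" "\<And>i. i \<in> A \<Longrightarrow> 0 \<le> m i" "finite T" "\<And>t. t \<in> T \<Longrightarrow> 0 \<le> g t"
    and "\<And>B. (\<Sum>i\<in>A. m i * indicator B (f i)) = (\<Sum>t\<in>T. g t * indicator B (h t) :: real)"
  shows "atomic A m f = atomic T g h"
  by (rule measure_eqI) (use assms in \<open>auto simp: emeasure_atomic\<close>)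

lemma prob_space_atomic:
  assumes "finite A" "\<And>i. i \<in> A \<Longrightarrow> 0 \<le> m i" "(\<Sum>i\<in>A. m i) = 1"
  shows "prob_space (atomic A m f)"
  using emeasure_atomic[OF assms(1,2), where B=UNIV and f=f] assms(3) by (intro prob_spaceI) simp

lemma integral_atomic:
  fixes g :: "real^'d \<Rightarrow> 'b::{banach, second_countable_topology}"
  assumes "finite A" "\<And>i. i \<in> A \<Longrightarrow> 0 \<le> m i" "g \<in> borel_measurable borel"
  shows "integrable (atomic A m f) g" "(\<integral>x. g x \<partial>atomic A m f) = (\<Sum>i\<in>A. m i *\<^sub>R g (f i))"
proof -
  have g: "g \<in> borel_measurable borel" by fact
  have f: "f \<in> measurable (point_measure A (\<lambda>i. ennreal (m i))) borel" by simp
  show "integrable (atomic A m f) g"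
    unfolding atomic_def integrable_distr_eq[OF f g]
    by (rule integrable_point_measure_finite) fact
  show "(\<integral>x. g x \<partial>atomic A m f) = (\<Sum>i\<in>A. m i *\<^sub>R g (f i))"
    unfolding atomic_def integral_distr[OF f g]
    using assms by (intro lebesgue_integral_point_measure_finite) auto
qed

lemma atomic_Pp:
  assumes "finite A" "\<And>i. i \<in> A \<Longrightarrow> 0 \<le> m i" "(\<Sum>i\<in>A. m i) = 1"
  shows "atomic A m f \<in> Pp p"
  using assms by (simp add: Pp_def prob_space_atomic integral_atomic(1))

text \<open>A common index set with common masses is already a coupling: the parcel \<open>t\<close>
  travels from \<open>f t\<close> to \<open>h t\<close>.\<close>

lemma wasserstein_atomic_le:
  fixes f h :: "'i \<Rightarrow> real^'d"
  assumes T: "finite T" "\<And>t. t \<in> T \<Longrightarrow> 0 \<le> g t" "(\<Sum>t\<in>T. g t) = 1" and p: "0 < p" "0 \<le> e"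
    and c: "(\<Sum>t\<in>T. g t * dist (f t) (h t) ^ p) \<le> e ^ p"
  shows "wasserstein p (atomic T g f) (atomic T g h) \<le> e"
proof -
  let ?B = "borel \<Otimes>\<^sub>M borel :: ((real^'d) \<times> (real^'d)) measure"
  let ?P = "point_measure T (\<lambda>i. ennreal (g i))"
  interpret P: prob_space ?P
    using T by (intro prob_spaceI) (simp add: emeasure_point_measure_finite space_point_measure sum_ennreal)
  have fh [measurable]: "(\<lambda>t. (f t, h t)) \<in> measurable ?P ?B" by (auto simp: space_pair_measure)
  have "distr (distr ?P ?B (\<lambda>t. (f t, h t))) borel fst = atomic T g f"
    "distr (distr ?P ?B (\<lambda>t. (f t, h t))) borel snd = atomic T g h"
    unfolding atomic_def by (subst distr_distr[OF _ fh]; simp add: comp_def)+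
  then have cp: "distr ?P ?B (\<lambda>t. (f t, h t)) \<in> couplings (atomic T g f) (atomic T g h)"
    using P.prob_space_distr[OF fh] by (simp add: couplings_def)
  have "(\<integral>\<^sup>+z. ennreal (dist (fst z) (snd z) ^ p) \<partial>distr ?P ?B (\<lambda>t. (f t, h t)))
      = (\<integral>\<^sup>+t. ennreal (dist (f t) (h t) ^ p) \<partial>?P)"
    by (subst nn_integral_distr[OF fh]) simp_all
  also have "\<dots> = (\<Sum>t\<in>T. ennreal (g t) * ennreal (dist (f t) (h t) ^ p))"
    using T(1) by (rule nn_integral_point_measure_finite)
  also have "\<dots> = (\<Sum>t\<in>T. ennreal (g t * dist (f t) (h t) ^ p))"
    using T by (intro sum.cong) (auto simp: ennreal_mult)
  also have "\<dots> = ennreal (\<Sum>t\<in>T. g t * dist (f t) (h t) ^ p)"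
    using T by (intro sum_ennreal) auto
  also have "\<dots> \<le> ennreal (e ^ p)" using c by (rule ennreal_leI)
  finally show ?thesis by (intro wasserstein_le[OF cp p])
qed

text \<open>The coupling of two weight vectors that keeps the common mass in place and distributes the
  excess of \<open>a\<close> over the deficit independently.  If the weights agree, the excess is 0 and so
  is the second summand (division by 0).\<close>

definition tv_coupling :: "'i set \<Rightarrow> ('i \<Rightarrow> real) \<Rightarrow> ('i \<Rightarrow> real) \<Rightarrow> 'i \<Rightarrow> 'i \<Rightarrow> real" where
  "tv_coupling A a b i j = (if i = j then min (a i) (b i) else 0)
     + max 0 (a i - b i) * max 0 (b j - a j) / (\<Sum>k\<in>A. max 0 (a k - b k))"

context
  fixes A :: "'i set" and a b :: "'i \<Rightarrow> real"
  assumes A: "finite A" and ab: "(\<Sum>i\<in>A. a i) = (\<Sum>i\<in>A. b i)"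
    and nn: "\<And>i. i \<in> A \<Longrightarrow> 0 \<le> a i" "\<And>i. i \<in> A \<Longrightarrow> 0 \<le> b i"
begin

lemma tv_excess_eq: "(\<Sum>k\<in>A. max 0 (a k - b k)) = (\<Sum>k\<in>A. max 0 (b k - a k))"
proof -
  have "(\<Sum>k\<in>A. max 0 (a k - b k)) - (\<Sum>k\<in>A. max 0 (b k - a k)) = (\<Sum>k\<in>A. a k - b k)"
    unfolding sum_subtractf[symmetric] by (intro sum.cong) auto
  then show ?thesis using ab by (simp add: sum_subtractf)
qed

lemma tv_coupling_nonneg: "i \<in> A \<Longrightarrow> 0 \<le> tv_coupling A a b i j"
  using nn by (auto simp: tv_coupling_def intro!: add_nonneg_nonneg divide_nonneg_nonneg sum_nonneg)

lemma tv_excess_0: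
  assumes "(\<Sum>k\<in>A. max 0 (a k - b k)) = 0" "i \<in> A"
  shows "max 0 (a i - b i) = 0" "max 0 (b i - a i) = 0"
proof -
  show "max 0 (a i - b i) = 0"
    using assms A by (subst (asm) sum_nonneg_eq_0_iff) auto
  show "max 0 (b i - a i) = 0"
    using assms A unfolding tv_excess_eq by (subst (asm) sum_nonneg_eq_0_iff) auto
qed

lemma tv_coupling_marginal1:
  assumes "i \<in> A" shows "(\<Sum>j\<in>A. tv_coupling A a b i j) = a i"
proof -
  let ?R = "\<Sum>k\<in>A. max 0 (a k - b k)"
  have "(\<Sum>j\<in>A. tv_coupling A a b i j) = min (a i) (b i) + max 0 (a i - b i) * (\<Sum>j\<in>A. max 0 (b j - a j)) / ?R"
    unfolding tv_coupling_def sum.distrib using A assms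
    by (simp add: sum_distrib_left sum_divide_distrib)
  also have "\<dots> = min (a i) (b i) + max 0 (a i - b i)"
    using tv_excess_0[OF _ assms] by (cases "?R = 0") (auto simp: tv_excess_eq)
  also have "\<dots> = a i" by auto
  finally show ?thesis .
qed

lemma tv_coupling_marginal2:
  assumes "j \<in> A" shows "(\<Sum>i\<in>A. tv_coupling A a b i j) = b j"
proof -
  let ?R = "\<Sum>k\<in>A. max 0 (a k - b k)"
  have "(\<Sum>i\<in>A. tv_coupling A a b i j) = min (a j) (b j) + ?R * max 0 (b j - a j) / ?R"
    unfolding tv_coupling_def sum.distrib using A assms
    by (simp add: sum_distrib_right sum_divide_distrib)
  also have "\<dots> = min (a j) (b j) + max 0 (b j - a j)"
    using tv_excess_0[OF _ assms] by (cases "?R = 0") auto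
  also have "\<dots> = b j" by auto
  finally show ?thesis .
qed

text \<open>Mass on the diagonal costs nothing. For the rest, a detour through the fixed point
  \<open>q\<close> splits the distance into a term in \<open>i\<close> and a term in
  \<open>j\<close>, the double sum factorizes, and excess plus deficit at a node is the absolute
  difference of its weights.\<close>

lemma tv_coupling_cost:
  fixes x :: "'i \<Rightarrow> 'b::metric_space"
  shows "(\<Sum>i\<in>A. \<Sum>j\<in>A. tv_coupling A a b i j * dist (x i) (x j)) \<le> (\<Sum>i\<in>A. \<bar>a i - b i\<bar> * dist (x i) q)"
proof -
  let ?R = "\<Sum>k\<in>A. max 0 (a k - b k)"
  let ?u = "\<lambda>i. max 0 (a i - b i)" and ?v = "\<lambda>i. max 0 (b i - a i)"
  have R: "0 \<le> ?R" by (intro sum_nonneg) auto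
  have "(\<Sum>i\<in>A. \<Sum>j\<in>A. tv_coupling A a b i j * dist (x i) (x j))
      \<le> (\<Sum>i\<in>A. \<Sum>j\<in>A. ?u i * ?v j / ?R * (dist (x i) q + dist (x j) q))"
  proof (intro sum_mono)
    fix i j
    have "tv_coupling A a b i j * dist (x i) (x j) = ?u i * ?v j / ?R * dist (x i) (x j)"
      by (simp add: tv_coupling_def)
    also have "\<dots> \<le> ?u i * ?v j / ?R * (dist (x i) q + dist (x j) q)"
      using R by (intro mult_left_mono dist_triangle2) (auto intro!: divide_nonneg_nonneg)
    finally show "tv_coupling A a b i j * dist (x i) (x j) \<le> ?u i * ?v j / ?R * (dist (x i) q + dist (x j) q)" .
  qed
  also have "\<dots> = (\<Sum>i\<in>A. \<Sum>j\<in>A. ?u i * dist (x i) q * ?v j / ?R) + (\<Sum>i\<in>A. \<Sum>j\<in>A. ?v j * dist (x j) q * ?u i / ?R)"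
    by (simp add: sum.distrib[symmetric] distrib_left algebra_simps add_divide_distrib)
  also have "(\<Sum>i\<in>A. \<Sum>j\<in>A. ?v j * dist (x j) q * ?u i / ?R) = (\<Sum>j\<in>A. \<Sum>i\<in>A. ?v j * dist (x j) q * ?u i / ?R)"
    by (rule sum.swap)
  also have "(\<Sum>i\<in>A. \<Sum>j\<in>A. ?u i * dist (x i) q * ?v j / ?R) = (\<Sum>i\<in>A. ?u i * dist (x i) q * (?R / ?R))"
    by (simp add: sum_divide_distrib[symmetric] sum_distrib_left[symmetric] tv_excess_eq)
  also have "(\<Sum>j\<in>A. \<Sum>i\<in>A. ?v j * dist (x j) q * ?u i / ?R) = (\<Sum>i\<in>A. ?v i * dist (x i) q * (?R / ?R))"
    by (simp add: sum_divide_distrib[symmetric] sum_distrib_left[symmetric])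
  also have "(\<Sum>i\<in>A. ?u i * dist (x i) q * (?R / ?R)) + (\<Sum>i\<in>A. ?v i * dist (x i) q * (?R / ?R))
      \<le> (\<Sum>i\<in>A. \<bar>a i - b i\<bar> * dist (x i) q)"
    unfolding sum.distrib[symmetric]
  proof (intro sum_mono)
    fix i assume "i \<in> A"
    have "?u i * dist (x i) q * (?R / ?R) + ?v i * dist (x i) q * (?R / ?R) = (\<bar>a i - b i\<bar> * dist (x i) q) * (?R / ?R)"
      by (auto simp: algebra_simps max_def)
    \<comment> \<open>The factor \<open>?R / ?R\<close> is 1, or 0 if there is no excess at
      all.\<close>
    also have "\<dots> \<le> \<bar>a i - b i\<bar> * dist (x i) q"
      by (cases "?R = 0") auto
    finally show "?u i * dist (x i) q * (?R / ?R) + ?v i * dist (x i) q * (?R / ?R) \<le> \<bar>a i - b i\<bar> * dist (x i) q" .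
  qed
  finally show ?thesis .
qed

end

text \<open>Reindexing both measures by pairs \<open>(i, j)\<close> with mass \<open>g i j\<close>
  reduces a transport plan to parcels that start at \<open>x i\<close> and end at
  \<open>x j\<close>.\<close>

lemma wasserstein_atomic_coupling_le:
  fixes x :: "'i \<Rightarrow> real^'d"
  assumes A: "finite A" and g: "\<And>i j. i \<in> A \<Longrightarrow> j \<in> A \<Longrightarrow> 0 \<le> g i j"
    and ga: "\<And>i. i \<in> A \<Longrightarrow> (\<Sum>j\<in>A. g i j) = a i" and gb: "\<And>j. j \<in> A \<Longrightarrow> (\<Sum>i\<in>A. g i j) = b j"
    and a: "(\<Sum>i\<in>A. a i) = 1"
  shows "wasserstein 1 (atomic A a x) (atomic A b x) \<le> (\<Sum>i\<in>A. \<Sum>j\<in>A. g i j * dist (x i) (x j))"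
proof -
  let ?T = "A \<times> A" let ?g = "\<lambda>(i, j). g i j"
  have a0: "0 \<le> a i" if "i \<in> A" for i using ga[OF that] g that by (metis sum_nonneg)
  have b0: "0 \<le> b i" if "i \<in> A" for i using gb[OF that] g that by (metis sum_nonneg)
  have 1: "atomic A a x = atomic ?T ?g (\<lambda>t. x (fst t))"
  proof (rule atomic_eqI)
    fix B
    have "(\<Sum>i\<in>A. a i * indicator B (x i)) = (\<Sum>i\<in>A. \<Sum>j\<in>A. g i j * indicator B (x i))"
      by (intro sum.cong) (auto simp: sum_distrib_right[symmetric] ga)
    then show "(\<Sum>i\<in>A. a i * indicator B (x i)) = (\<Sum>t\<in>A \<times> A. ?g t * indicator B (x (fst t)) :: real)"
      by (simp add: sum.cartesian_product case_prod_beta)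
  qed (use A g a0 in auto)
  have 2: "atomic A b x = atomic ?T ?g (\<lambda>t. x (snd t))"
  proof (rule atomic_eqI)
    fix B
    have "(\<Sum>j\<in>A. b j * indicator B (x j)) = (\<Sum>j\<in>A. \<Sum>i\<in>A. g i j * indicator B (x j))"
      by (intro sum.cong) (auto simp: sum_distrib_right[symmetric] gb)
    also have "\<dots> = (\<Sum>i\<in>A. \<Sum>j\<in>A. g i j * indicator B (x j))" by (rule sum.swap)
    finally show "(\<Sum>i\<in>A. b i * indicator B (x i)) = (\<Sum>t\<in>A \<times> A. ?g t * indicator B (x (snd t)) :: real)"
      by (simp add: sum.cartesian_product case_prod_beta)
  qed (use A g b0 in auto)
  have s: "(\<Sum>t\<in>?T. ?g t) = 1"
    using a ga by (simp add: sum.cartesian_product[symmetric])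
  show ?thesis
    unfolding 1 2 using A g s
    by (intro wasserstein_atomic_le)
      (auto simp: sum.cartesian_product case_prod_beta intro!: sum_nonneg)
qed

lemma wasserstein_atomic_weights_le:
  fixes x :: "'i \<Rightarrow> real^'d"
  assumes "finite A" "\<And>i. i \<in> A \<Longrightarrow> 0 \<le> a i" "\<And>i. i \<in> A \<Longrightarrow> 0 \<le> b i"
    and s: "(\<Sum>i\<in>A. a i) = 1" "(\<Sum>i\<in>A. b i) = 1"
  shows "wasserstein 1 (atomic A a x) (atomic A b x) \<le> (\<Sum>i\<in>A. \<bar>a i - b i\<bar> * dist (x i) q)"
proof -
  have ab: "(\<Sum>i\<in>A. a i) = (\<Sum>i\<in>A. b i)" using s by simp
  note tv = assms(1) ab assms(2,3)
  have "wasserstein 1 (atomic A a x) (atomic A b x) \<le> (\<Sum>i\<in>A. \<Sum>j\<in>A. tv_coupling A a b i j * dist (x i) (x j))"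
    using tv_coupling_nonneg[OF tv] tv_coupling_marginal1[OF tv] tv_coupling_marginal2[OF tv] assms
    by (intro wasserstein_atomic_coupling_le) auto
  also have "\<dots> \<le> (\<Sum>i\<in>A. \<bar>a i - b i\<bar> * dist (x i) q)"
    by (rule tv_coupling_cost[OF tv])
  finally show ?thesis .
qed

section \<open>Smooth functions of several variables\<close>

text \<open>Mean value theorem for \<open>F\<close> minus a line of slope \<open>c\<close>. With
  \<open>c = 0\<close> it gives Lipschitz bounds, with the slope at \<open>a\<close> a first-order
  expansion. The segment covers both orders of \<open>a\<close> and \<open>b\<close>.\<close>

lemma mvt_affine_bound:
  fixes F :: "real \<Rightarrow> real"
  assumes "\<And>t. t \<in> closed_segment a b \<Longrightarrow> (F has_real_derivative F' t) (at t)"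
    and "\<And>t. t \<in> closed_segment a b \<Longrightarrow> \<bar>F' t - c\<bar> \<le> B"
  shows "\<bar>F b - F a - c * (b - a)\<bar> \<le> B * \<bar>b - a\<bar>"
proof -
  have "norm ((F b - c * b) - (F a - c * a)) \<le> B * norm (b - a)"
  proof (rule field_differentiable_bound[where S="closed_segment a b" and f'="\<lambda>t. F' t - c"])
    fix t assume t: "t \<in> closed_segment a b"
    show "((\<lambda>x. F x - c * x) has_field_derivative F' t - c) (at t within closed_segment a b)"
      using assms(1)[OF t] by (auto intro!: derivative_eq_intros intro: DERIV_subset)
  qed (use assms in auto)
  then show ?thesis by (simp add: algebra_simps)
qed

text \<open>First-order expansion from partial derivatives, changing one coordinate at a time.  The set
  \<open>Y\<close> allows for extensional functions as well as for all functions.\<close>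

lemma partial_derivatives_expansion:
  fixes f :: "('i \<Rightarrow> real) \<Rightarrow> real"
  assumes J: "finite J"
    and Y: "\<And>y j t. y \<in> Y \<Longrightarrow> j \<in> J \<Longrightarrow> y(j := t) \<in> Y"
    and D: "\<And>y j. y \<in> Y \<Longrightarrow> j \<in> J \<Longrightarrow> ((\<lambda>t. f (y(j := t))) has_real_derivative g j y) (at (y j))"
    and y: "y \<in> Y" "\<And>i. i \<notin> J \<Longrightarrow> y' i = y i"
    and B: "\<And>u j. u \<in> Y \<Longrightarrow> j \<in> J \<Longrightarrow> (\<And>i. i \<in> J \<Longrightarrow> \<bar>u i - y i\<bar> \<le> \<bar>y' i - y i\<bar>) \<Longrightarrow> \<bar>g j u - c j\<bar> \<le> B"
  shows "\<bar>f y' - f y - (\<Sum>j\<in>J. c j * (y' j - y j))\<bar> \<le> B * (\<Sum>j\<in>J. \<bar>y' j - y j\<bar>)"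
proof -
  define z where "z S i = (if i \<in> S then y' i else y i)" for S i
  have "z S \<in> Y \<and> \<bar>f (z S) - f y - (\<Sum>j\<in>S. c j * (y' j - y j))\<bar> \<le> B * (\<Sum>j\<in>S. \<bar>y' j - y j\<bar>)"
    if "S \<subseteq> J" for S
    using finite_subset[OF that J] that
  proof (induction S rule: finite_induct)
    case empty
    have "z {} = y" by (auto simp: z_def)
    then show ?case using y by simp
  next
    case (insert j S)
    then have IH: "z S \<in> Y" "\<bar>f (z S) - f y - (\<Sum>j\<in>S. c j * (y' j - y j))\<bar> \<le> B * (\<Sum>j\<in>S. \<bar>y' j - y j\<bar>)"
      and j: "j \<in> J" "j \<notin> S" by auto
    have z1: "z (insert j S) = (z S)(j := y' j)" and z0: "z S = (z S)(j := y j)"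
      using j by (auto simp: z_def)
    have "\<bar>f ((z S)(j := y' j)) - f ((z S)(j := y j)) - c j * (y' j - y j)\<bar> \<le> B * \<bar>y' j - y j\<bar>"
    proof (rule mvt_affine_bound)
      fix t assume t: "t \<in> closed_segment (y j) (y' j)"
      have u: "(z S)(j := t) \<in> Y" using Y IH j by blast
      show "((\<lambda>t. f ((z S)(j := t))) has_real_derivative g j ((z S)(j := t))) (at t)"
        using D[OF u j(1)] by simp
      \<comment> \<open>The intermediate point stays in the box spanned by \<open>y\<close> and
        \<open>y'\<close>, where the derivatives are controlled.\<close>
      show "\<bar>g j ((z S)(j := t)) - c j\<bar> \<le> B"
      proof (rule B[OF u j(1)])
        fix i assume "i \<in> J"
        show "\<bar>((z S)(j := t)) i - y i\<bar> \<le> \<bar>y' i - y i\<bar>"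
          using t by (auto simp: z_def closed_segment_eq_real_ivl split: if_splits)
      qed
    qed
    then have "\<bar>f (z (insert j S)) - f (z S) - c j * (y' j - y j)\<bar> \<le> B * \<bar>y' j - y j\<bar>"
      using z0 z1 by simp
    moreover have "z (insert j S) \<in> Y" using z1 Y IH j by simp
    ultimately show ?case using IH(2) insert.hyps
      by (simp add: distrib_left)
  qed
  from this[of J] have "\<bar>f (z J) - f y - (\<Sum>j\<in>J. c j * (y' j - y j))\<bar> \<le> B * (\<Sum>j\<in>J. \<bar>y' j - y j\<bar>)" by simp
  moreover have "z J = y'" using y by (auto simp: z_def)
  ultimately show ?thesis by simp
qed

section \<open>Calculus of smooth functions on Euclidean space\<close>

lemma Ck_vec_continuous: "Ck_vec k f \<Longrightarrow> continuous_on UNIV f"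
  by (cases k) auto

lemma Ck_vec_Suc_D: "Ck_vec (Suc k) f \<Longrightarrow> Ck_vec k f"
proof (induction k arbitrary: f)
  case (Suc k)
  have "\<exists>g. (\<forall>x. ((\<lambda>t. f (x + t *\<^sub>R axis l 1)) has_real_derivative g x) (at 0)) \<and> Ck_vec k g" for l
    using Suc.prems Suc.IH unfolding Ck_vec.simps(2)[of "Suc k"] by fast
  then show ?case using Suc.prems by simp
qed simp

lemma Ck_vec_const: "Ck_vec k (\<lambda>_. c)"
  by (induction k arbitrary: c) (auto intro!: exI[of _ "\<lambda>_. 0"])

lemma Ck_vec_add: "Ck_vec k f \<Longrightarrow> Ck_vec k g \<Longrightarrow> Ck_vec k (\<lambda>x. f x + g x)"
proof (induction k arbitrary: f g)
  case 0
  then show ?case by (auto intro!: continuous_intros)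
next
  case (Suc k)
  show ?case
    unfolding Ck_vec.simps
  proof (intro conjI allI)
    show "continuous_on UNIV (\<lambda>x. f x + g x)" using Suc.prems by (auto intro!: continuous_intros)
    fix l
    obtain f' g' where "\<forall>x. ((\<lambda>t. f (x + t *\<^sub>R axis l 1)) has_real_derivative f' x) (at 0)" "Ck_vec k f'"
      "\<forall>x. ((\<lambda>t. g (x + t *\<^sub>R axis l 1)) has_real_derivative g' x) (at 0)" "Ck_vec k g'"
      using Suc.prems by fastforce
    then show "\<exists>h. (\<forall>x. ((\<lambda>t. f (x + t *\<^sub>R axis l 1) + g (x + t *\<^sub>R axis l 1)) has_real_derivative h x) (at 0)) \<and> Ck_vec k h"
      using Suc.IH by (intro exI[of _ "\<lambda>x. f' x + g' x"]) (auto intro!: derivative_eq_intros)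
  qed
qed

lemma Ck_vec_mult: "Ck_vec k f \<Longrightarrow> Ck_vec k g \<Longrightarrow> Ck_vec k (\<lambda>x. f x * g x)"
proof (induction k arbitrary: f g)
  case 0
  then show ?case by (auto intro!: continuous_intros)
next
  case (Suc k)
  show ?case
    unfolding Ck_vec.simps
  proof (intro conjI allI)
    show "continuous_on UNIV (\<lambda>x. f x * g x)" using Suc.prems by (auto intro!: continuous_intros)
    fix l
    obtain f' g' where *: "\<forall>x. ((\<lambda>t. f (x + t *\<^sub>R axis l 1)) has_real_derivative f' x) (at 0)" "Ck_vec k f'"
      "\<forall>x. ((\<lambda>t. g (x + t *\<^sub>R axis l 1)) has_real_derivative g' x) (at 0)" "Ck_vec k g'"
      using Suc.prems by fastforce
    show "\<exists>h. (\<forall>x. ((\<lambda>t. f (x + t *\<^sub>R axis l 1) * g (x + t *\<^sub>R axis l 1)) has_real_derivative h x) (at 0)) \<and> Ck_vec k h"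
      using * Suc.IH[OF *(2) Ck_vec_Suc_D[OF Suc.prems(2)]] Suc.IH[OF *(4) Ck_vec_Suc_D[OF Suc.prems(1)]]
      by (intro exI[of _ "\<lambda>x. f' x * g x + g' x * f x"]) (auto intro!: derivative_eq_intros Ck_vec_add)
  qed
qed

lemma smooth_vec_const: "smooth_vec (\<lambda>_. c)"
  and smooth_vec_add: "smooth_vec f \<Longrightarrow> smooth_vec g \<Longrightarrow> smooth_vec (\<lambda>x. f x + g x)"
  and smooth_vec_mult: "smooth_vec f \<Longrightarrow> smooth_vec g \<Longrightarrow> smooth_vec (\<lambda>x. f x * g x)"
  by (simp_all add: smooth_vec_def Ck_vec_const Ck_vec_add Ck_vec_mult)

lemma smooth_vec_prod:
  "(\<And>i. i \<in> S \<Longrightarrow> smooth_vec (f i)) \<Longrightarrow> smooth_vec (\<lambda>x. \<Prod>i\<in>S. f i x)"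
  by (induction S rule: infinite_finite_induct) (auto intro: smooth_vec_const smooth_vec_mult)

text \<open>The whole sequence of iterated derivatives is given, and the induction varies its index:
  differentiating along axis \<open>l\<close> passes from \<open>m\<close> to \<open>m + 1\<close>,
  along any other axis the result is 0.\<close>

lemma smooth_vec_coordinate:
  fixes l :: "'d::finite"
  assumes D: "\<And>k x. (D k has_real_derivative D (Suc k) x) (at x)"
  shows "smooth_vec (\<lambda>x. D m (x $ l))"
  unfolding smooth_vec_def
proof
  fix k
  show "Ck_vec k (\<lambda>x. D m (x $ l))"
  proof (induction k arbitrary: m)
    case 0
    have "continuous_on UNIV (D m)" using D DERIV_continuous_on by blast
    then have "continuous_on UNIV (\<lambda>x::real^'d. D m (x $ l))"
      by (rule continuous_on_compose2) (auto intro!: continuous_intros)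
    then show ?case by simp
  next
    case (Suc k)
    have "\<exists>g. (\<forall>x. ((\<lambda>t. D m ((x + t *\<^sub>R axis i 1) $ l)) has_real_derivative g x) (at 0)) \<and> Ck_vec k g" for i
    proof (cases "i = l")
      case True
      have "((\<lambda>t. D m ((x + t *\<^sub>R axis i 1) $ l)) has_real_derivative D (Suc m) (x $ l)) (at 0)" for x :: "real^'d"
      proof -
        have "((\<lambda>t. D m (x $ l + t)) has_real_derivative D (Suc m) (x $ l)) (at 0)"
          using D[of m "x $ l"] DERIV_shift[of "D m" "D (Suc m) (x $ l)" 0 "x $ l"] by (simp add: add.commute)
        then show ?thesis by (simp add: True axis_def)
      qed
      then show ?thesis using Suc[of "Suc m"] by (intro exI[of _ "\<lambda>x. D (Suc m) (x $ l)"]) auto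
    next
      case False
      then show ?thesis by (intro exI[of _ "\<lambda>_. 0"]) (auto simp: axis_def Ck_vec_const)
    qed
    then show ?case using Ck_vec_continuous[OF Suc[of m]] by simp
  qed
qed

text \<open>Smoothness provides, for each order \<open>k\<close>, some partial derivative of class
  \<open>k\<close>. Uniqueness of derivatives identifies them all, so that a single function has
  every order.\<close>

lemma smooth_vec_partial:
  assumes "smooth_vec f"
  obtains g where "\<And>l. smooth_vec (g l)"
    "\<And>l x. ((\<lambda>t. f (x + t *\<^sub>R axis l 1)) has_real_derivative g l x) (at 0)"
proof -
  have "\<exists>g. smooth_vec g \<and> (\<forall>x. ((\<lambda>t. f (x + t *\<^sub>R axis l 1)) has_real_derivative g x) (at 0))" for l
  proof -
    have "Ck_vec (Suc k) f" for k using assms by (simp add: smooth_vec_def)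
    then have "\<forall>k. \<exists>g. (\<forall>x. ((\<lambda>t. f (x + t *\<^sub>R axis l 1)) has_real_derivative g x) (at 0)) \<and> Ck_vec k g"
      by simp
    then obtain g where g: "\<And>k x. ((\<lambda>t. f (x + t *\<^sub>R axis l 1)) has_real_derivative g k x) (at 0)" "\<And>k. Ck_vec k (g k)"
      by metis
    have "g k = g 0" for k using DERIV_unique[OF g(1) g(1)] by blast
    then show ?thesis using g unfolding smooth_vec_def by metis
  qed
  then show ?thesis using that by metis
qed

section \<open>Smooth functions supported in a cube\<close>

lemma cubeQ_eq_cbox: "cubeQ R = cbox (\<chi> l. - R) (\<chi> l. R)"
  by (auto simp: cubeQ_def mem_box_cart abs_le_iff) (metis minus_le_iff)+

lemma compact_cubeQ: "compact (cubeQ R)" and closed_cubeQ: "closed (cubeQ R)"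
  by (auto simp: cubeQ_eq_cbox compact_cbox closed_cbox)

text \<open>The radius is part of the notion so that partial derivatives stay in the same class.
  Compactness of the cube then bounds all derivatives.\<close>

definition test_fun :: "real \<Rightarrow> (real^'d \<Rightarrow> real) \<Rightarrow> bool" where
  "test_fun R f \<longleftrightarrow> smooth_vec f \<and> (\<forall>x. x \<notin> cubeQ R \<longrightarrow> f x = 0)"

lemma test_fun_bounded:
  assumes "test_fun R f"
  obtains B where "0 \<le> B" "\<And>x. \<bar>f x\<bar> \<le> B"
proof -
  have c: "continuous_on UNIV f" using assms Ck_vec_continuous unfolding test_fun_def smooth_vec_def by blast
  have "bounded (f ` cubeQ R)"
    by (intro compact_imp_bounded compact_continuous_image compact_cubeQ continuous_on_subset[OF c]) simp
  then obtain B where B: "\<And>x. x \<in> cubeQ R \<Longrightarrow> \<bar>f x\<bar> \<le> B" by (auto simp: bounded_iff)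
  have "\<bar>f x\<bar> \<le> max 0 B" for x
    using B[of x] assms by (cases "x \<in> cubeQ R") (auto simp: test_fun_def)
  then show ?thesis using that[of "max 0 B"] by simp
qed

lemma test_fun_measurable [measurable]: "test_fun R f \<Longrightarrow> f \<in> borel_measurable borel"
  unfolding test_fun_def smooth_vec_def
  using Ck_vec_continuous borel_measurable_continuous_onI by blast

text \<open>The complement of the closed cube is open, so at a point outside it the function
  vanishes along a whole interval in each axis direction, and the derivative is 0.\<close>

lemma test_fun_partial:
  assumes "test_fun R f"
  obtains g where "\<And>l. test_fun R (g l)"
    "\<And>l x. ((\<lambda>t. f (x + t *\<^sub>R axis l 1)) has_real_derivative g l x) (at 0)"
proof -
  obtain g where g: "\<And>l. smooth_vec (g l)"
    "\<And>l x. ((\<lambda>t. f (x + t *\<^sub>R axis l 1)) has_real_derivative g l x) (at 0)"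
    using assms smooth_vec_partial unfolding test_fun_def by metis
  have "g l x = 0" if x: "x \<notin> cubeQ R" for l x
  proof -
    have "((\<lambda>t. x + t *\<^sub>R axis l 1) \<longlongrightarrow> x + 0 *\<^sub>R axis l 1) (at 0)" by (intro tendsto_intros)
    then have "\<forall>\<^sub>F t in at 0. x + t *\<^sub>R axis l 1 \<in> - cubeQ R"
      using x by (intro topological_tendstoD) (auto simp: closed_cubeQ)
    then have "\<forall>\<^sub>F t in at 0. f (x + t *\<^sub>R axis l 1) = 0"
      by eventually_elim (use assms in \<open>auto simp: test_fun_def\<close>)
    then have "\<forall>\<^sub>F t in nhds 0. f (x + t *\<^sub>R axis l 1) = 0"
      using x assms unfolding eventually_at_filter eventually_nhds test_fun_def
      by (elim ex_forward) auto
    then have "((\<lambda>t. f (x + t *\<^sub>R axis l 1)) has_real_derivative 0) (at 0)"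
      by (subst DERIV_cong_ev[OF refl _ refl]) auto
    then show ?thesis using g(2) DERIV_unique by blast
  qed
  then show ?thesis using g by (intro that[of g]) (auto simp: test_fun_def)
qed

text \<open>Translates between two encodings of a partial derivative: moving along an axis, with
  derivative taken at 0, and overwriting a coordinate, with derivative taken at its current
  value.\<close>

lemma shift_partial_derivative:
  fixes f :: "real^'d \<Rightarrow> real" and y :: "'d \<Rightarrow> real"
  assumes "((\<lambda>t. f ((\<chi> i. y i) + t *\<^sub>R axis j 1)) has_real_derivative d) (at 0)"
  shows "((\<lambda>t. f (\<chi> i. (y(j := t)) i)) has_real_derivative d) (at (y j))"
proof -
  have "(\<lambda>t. f (\<chi> i. (y(j := t + y j)) i)) = (\<lambda>t. f ((\<chi> i. y i) + t *\<^sub>R axis j 1))"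
    by (intro ext arg_cong[where f=f]) (auto simp: vec_eq_iff axis_def)
  then show ?thesis
    using assms DERIV_shift[of "\<lambda>t. f (\<chi> i. (y(j := t)) i)" d 0 "y j"] by simp
qed

lemma sum_abs_le_card_norm:
  fixes v :: "real^'d" shows "(\<Sum>l\<in>UNIV. \<bar>v $ l\<bar>) \<le> real CARD('d) * norm v"
proof -
  have "(\<Sum>l\<in>UNIV. \<bar>v $ l\<bar>) \<le> (\<Sum>l\<in>(UNIV::'d set). norm v)"
    by (intro sum_mono component_le_norm_cart)
  then show ?thesis by simp
qed

lemma vec_partial_expansion:
  fixes f :: "real^'d \<Rightarrow> real"
  assumes D: "\<And>l x. ((\<lambda>t. f (x + t *\<^sub>R axis l 1)) has_real_derivative g l x) (at 0)"
    and B: "\<And>u l. (\<And>i. \<bar>u $ i - x $ i\<bar> \<le> \<bar>v $ i\<bar>) \<Longrightarrow> \<bar>g l u - c $ l\<bar> \<le> B" and "0 \<le> B"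
  shows "\<bar>f (x + v) - f x - c \<bullet> v\<bar> \<le> B * (real CARD('d) * norm v)"
proof -
  let ?f = "\<lambda>y. f (\<chi> i. y i)"
  have "\<bar>?f (\<lambda>i. (x + v) $ i) - ?f (\<lambda>i. x $ i) - (\<Sum>j\<in>UNIV. c $ j * ((x + v) $ j - x $ j))\<bar>
      \<le> B * (\<Sum>j\<in>UNIV. \<bar>(x + v) $ j - x $ j\<bar>)"
  proof (rule partial_derivatives_expansion[where Y=UNIV and g="\<lambda>l y. g l (\<chi> i. y i)"])
    show "((\<lambda>t. f (\<chi> i. (y(j := t)) i)) has_real_derivative g j (\<chi> i. y i)) (at (y j))" for y j
      by (rule shift_partial_derivative) (rule D)
  qed (use B in auto)
  then have "\<bar>f (x + v) - f x - c \<bullet> v\<bar> \<le> B * (\<Sum>j\<in>UNIV. \<bar>v $ j\<bar>)"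
    unfolding vec_lambda_eta by (simp add: inner_vec_def)
  also have "\<dots> \<le> B * (real CARD('d) * norm v)"
    using \<open>0 \<le> B\<close> sum_abs_le_card_norm by (intro mult_left_mono) auto
  finally show ?thesis .
qed

lemma test_fun_Lipschitz:
  fixes f :: "real^'d \<Rightarrow> real"
  assumes "test_fun R f"
  obtains B where "0 \<le> B" "\<And>x y. \<bar>f x - f y\<bar> \<le> B * dist x y"
proof -
  obtain g where g: "\<And>l. test_fun R (g l)"
    "\<And>l x. ((\<lambda>t. f (x + t *\<^sub>R axis l 1)) has_real_derivative g l x) (at 0)"
    using test_fun_partial[OF assms] by blast
  have "\<exists>B. 0 \<le> B \<and> (\<forall>x. \<bar>g l x\<bar> \<le> B)" for l using test_fun_bounded[OF g(1)] by metis
  then obtain B where B: "\<And>l. 0 \<le> B l" "\<And>l x. \<bar>g l x\<bar> \<le> B l" by metis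
  define C where "C = (\<Sum>l\<in>UNIV. B l)"
  have C: "0 \<le> C" "\<bar>g l x\<bar> \<le> C" for l x
  proof -
    show "0 \<le> C" using B by (simp add: C_def sum_nonneg)
    show "\<bar>g l x\<bar> \<le> C"
      using B member_le_sum[of l UNIV B] order_trans by (fastforce simp: C_def)
  qed
  have "\<bar>f x - f y\<bar> \<le> C * real CARD('d) * dist x y" for x y
    using vec_partial_expansion[OF g(2), of y "x - y" 0 C] C by (simp add: dist_norm mult.assoc)
  then show ?thesis using that[of "C * real CARD('d)"] C by simp
qed

text \<open>The partial derivatives are test functions themselves, hence Lipschitz. This makes the
  remainder quadratic uniformly in \<open>x\<close>, which is what an expansion in the L2 norm of
  the displacement requires.\<close>

lemma test_fun_expansion:
  fixes f :: "real^'d \<Rightarrow> real"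
  assumes g: "\<And>l. test_fun R (g l)"
    "\<And>l x. ((\<lambda>t. f (x + t *\<^sub>R axis l 1)) has_real_derivative g l x) (at 0)"
  obtains B where "0 \<le> B" "\<And>x v. \<bar>f (x + v) - f x - (\<chi> l. g l x) \<bullet> v\<bar> \<le> B * (norm v)\<^sup>2"
proof -
  have "\<exists>B. 0 \<le> B \<and> (\<forall>x y. \<bar>g l x - g l y\<bar> \<le> B * dist x y)" for l using test_fun_Lipschitz[OF g(1)] by metis
  then obtain B where B: "\<And>l. 0 \<le> B l" "\<And>l x y. \<bar>g l x - g l y\<bar> \<le> B l * dist x y" by metis
  define C where "C = (\<Sum>l\<in>UNIV. B l)"
  have C: "0 \<le> C" "B l \<le> C" for l
    using B member_le_sum[of l UNIV B] by (auto simp: C_def sum_nonneg)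
  let ?d = "real CARD('d)"
  have "\<bar>f (x + v) - f x - (\<chi> l. g l x) \<bullet> v\<bar> \<le> C * (?d * norm v) * (?d * norm v)" for x v
  proof (rule vec_partial_expansion[OF g(2)])
    fix u l assume u: "\<And>i. \<bar>u $ i - x $ i\<bar> \<le> \<bar>v $ i\<bar>"
    have "norm (u - x) \<le> (\<Sum>i\<in>UNIV. \<bar>(u - x) $ i\<bar>)" by (rule norm_le_l1_cart)
    also have "\<dots> \<le> (\<Sum>i\<in>UNIV. \<bar>v $ i\<bar>)" using u by (intro sum_mono) auto
    also have "\<dots> \<le> ?d * norm v" by (rule sum_abs_le_card_norm)
    finally have d: "dist u x \<le> ?d * norm v" by (simp add: dist_norm)
    have "\<bar>g l u - g l x\<bar> \<le> B l * dist u x" by (rule B)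
    also have "\<dots> \<le> C * (?d * norm v)" using C B(1) d by (intro mult_mono) auto
    finally show "\<bar>g l u - (\<chi> l. g l x) $ l\<bar> \<le> C * (?d * norm v)" by simp
  qed (use C in auto)
  then show ?thesis using that[of "C * ?d * ?d"] C by (simp add: power2_eq_square algebra_simps)
qed

section \<open>The partition of unity on the grid\<close>

lemma iterated_derivatives_locally_const:
  fixes D :: "nat \<Rightarrow> real \<Rightarrow> real"
  assumes "open S" and "\<And>t. t \<in> S \<Longrightarrow> D 0 t = c"
    and "\<And>k t. t \<in> S \<Longrightarrow> (D k has_real_derivative D (Suc k) t) (at t)"
    and "t \<in> S" "0 < k"
  shows "D k t = 0"
proof -
  have "\<forall>t\<in>S. D (Suc k) t = 0" for k
  proof (induction k)
    case 0
    show ?case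
    proof
      fix t assume "t \<in> S"
      then have "(D 0 has_real_derivative 0) (at t)"
        using assms(1,2) by (intro has_field_derivative_transform_within_open[of "\<lambda>_. c" 0 t S "D 0"]) simp_all
      then show "D (Suc 0) t = 0" using assms(3) \<open>t \<in> S\<close> DERIV_unique by blast
    qed
  next
    case (Suc k)
    show ?case
    proof
      fix t assume "t \<in> S"
      then have "(D (Suc k) has_real_derivative 0) (at t)"
        using assms(1) Suc by (intro has_field_derivative_transform_within_open[of "\<lambda>_. 0" 0 t S "D (Suc k)"]) simp_all
      then show "D (Suc (Suc k)) t = 0" using assms(3) \<open>t \<in> S\<close> DERIV_unique by blast
    qed
  qed
  then show ?thesis using assms(4,5) by (metis gr0_implies_Suc)
qed

lemma profile_D:
  assumes "profile n I" "0 \<le> t" "t \<le> 1"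
  shows "t \<le> 1 / real n ^ 3 \<Longrightarrow> I t = 1" "1 / real n \<le> t \<Longrightarrow> t \<le> 1 - 1 / real n \<Longrightarrow> I t = 1 - t"
    "1 - 1 / real n ^ 3 \<le> t \<Longrightarrow> I t = 0" "0 \<le> I t" "I t \<le> 1" "I t + I (1 - t) = 1"
  using assms unfolding profile_def by auto

text \<open>The profile is smooth on [0,1] with one-sided derivatives at the ends, and the absolute
  value has a kink at 0. Gluing is smooth because the profile is constant within 1/n^3 of either
  end. All derivatives are produced together, with the bounds on the first one that determine the
  slope of the partition functions.\<close>

lemma phi1_derivatives:
  assumes I: "profile n I" and n: "3 \<le> n"
  obtains E where "E 0 = phi1 n I i" "\<And>k x. (E k has_real_derivative E (Suc k) x) (at x)"
    "\<And>x. \<bar>E 1 x\<bar> \<le> real n + 1"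
    "\<And>x. 0 < real n * x - i \<Longrightarrow> real n * x - i < 1 \<Longrightarrow> E 1 x \<le> 0"
    "\<And>x. 1 / real n < real n * x - i \<Longrightarrow> real n * x - i < 1 - 1 / real n \<Longrightarrow> E 1 x = - real n"
proof -
  let ?n = "real n"
  define c where "c = 1 / ?n ^ 3"
  have c: "0 < c" "c < 1"
    using n one_less_power[of ?n 3] by (auto simp: c_def)
  obtain D where D0: "D 0 = I"
    and D: "\<And>k x. x \<in> {0..1} \<Longrightarrow> (D k has_real_derivative D (Suc k) x) (at x within {0..1})"
    using I by (auto simp: profile_def smooth01_def)
  have Di: "(D k has_real_derivative D (Suc k) t) (at t)" if "0 < t" "t < 1" for k t
    using D[of t k] that by (simp add: at_within_Icc_at)
  have lo0: "I t = 1" if "0 < t" "t < c" for t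
    using profile_D(1)[OF I, of t] that c by (simp add: c_def)
  have hi0: "I t = 0" if "1 - c < t" "t < 1" for t
    using profile_D(3)[OF I, of t] that c(2) unfolding c_def by linarith
  have lo: "D k t = (if k = 0 then 1 else 0)" if "0 < t" "t < c" for k t
  proof (cases "k = 0")
    case True then show ?thesis using lo0 that by (simp add: D0)
  next
    case False
    have "D k t = 0"
      by (rule iterated_derivatives_locally_const[of "{0<..<c}" D 1])
        (use that c False lo0 Di in \<open>auto simp: D0\<close>)
    then show ?thesis using False by simp
  qed
  have hi: "D k t = 0" if "1 - c < t" "t < 1" for k t
  proof (cases "k = 0")
    case True then show ?thesis using hi0 that by (simp add: D0)
  next
    case False
    show ?thesis
      by (rule iterated_derivatives_locally_const[of "{1 - c<..<1}" D 0])
        (use that c False hi0 Di in \<open>auto simp: D0\<close>)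
  qed
  \<comment> \<open>The chain rule on the two open halves, with \<open>- n\<close> in place of
    \<open>n\<close> on the left. At the centre the value is that of the constant 1 and its
    derivatives, and outside the support it is 0.\<close>
  define E where "E k x = (let s = ?n * x - of_int i in
    if 0 < s \<and> s < 1 then ?n ^ k * D k s
    else if - 1 < s \<and> s < 0 then (- ?n) ^ k * D k (- s)
    else if s = 0 \<and> k = 0 then 1 else 0)" for k x
  have E_pos: "E k x = ?n ^ k * D k (?n * x - of_int i)" if "0 < ?n * x - of_int i" "?n * x - of_int i < 1" for k x
    unfolding E_def Let_def using that by (simp only: if_True conj_absorb simp_thms)
  have E_neg: "E k x = (- ?n) ^ k * D k (of_int i - ?n * x)" if "- 1 < ?n * x - of_int i" "?n * x - of_int i < 0" for k x
    unfolding E_def Let_def using that by simp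
  have E_lo: "E k x = (if k = 0 then 1 else 0)" if "- c < ?n * x - of_int i" "?n * x - of_int i < c" for k x
  proof -
    consider "0 < ?n * x - of_int i" | "?n * x - of_int i < 0" | "?n * x - of_int i = 0" by linarith
    then show ?thesis
    proof cases
      case 1 then show ?thesis using E_pos[of x k] lo[of "?n * x - of_int i" k] that c by simp
    next
      case 2 then show ?thesis using E_neg[of x k] lo[of "of_int i - ?n * x" k] that c by simp
    next
      case 3 then show ?thesis by (simp add: E_def)
    qed
  qed
  have E_hi: "E k x = 0" if a: "1 - c < ?n * x - of_int i \<or> ?n * x - of_int i < - (1 - c)" for k x
  proof -
    consider "1 - c < ?n * x - of_int i" "?n * x - of_int i < 1" | "?n * x - of_int i < - (1 - c)" "- 1 < ?n * x - of_int i"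
      | "1 \<le> ?n * x - of_int i" | "?n * x - of_int i \<le> - 1" using a by linarith
    then show ?thesis
    proof cases
      case 1 then show ?thesis using E_pos[of x k] hi[of "?n * x - of_int i" k] c by simp
    next
      case 2 then show ?thesis using E_neg[of x k] hi[of "of_int i - ?n * x" k] c by simp
    next
      case 3 then show ?thesis by (simp add: E_def Let_def)
    next
      case 4 then show ?thesis by (simp add: E_def Let_def)
    qed
  qed
  have E0: "E 0 x = phi1 n I i x" for x
  proof -
    define s where "s = ?n * x - of_int i"
    have x: "x \<in> {(real_of_int i - 1) / real n .. (real_of_int i + 1) / real n} \<longleftrightarrow> - 1 \<le> s \<and> s \<le> 1"
      using n by (auto simp: s_def field_simps)
    have "phi1 n I i x = (if - 1 \<le> s \<and> s \<le> 1 then I \<bar>s\<bar> else 0)"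
      unfolding phi1_def using x by (auto simp: s_def indicator_def)
    moreover have "I 0 = 1" "I 1 = 0"
      using profile_D(1)[OF I, of 0] profile_D(3)[OF I, of 1] by auto
    ultimately show ?thesis
      unfolding E_def Let_def s_def[symmetric] by (auto simp: D0 abs_if)
  qed
  have E: "(E k has_real_derivative E (Suc k) x) (at x)" for k x
  proof -
    define s where "s = ?n * x - of_int i"
    have op: "open {x. a < ?n * x - of_int i \<and> ?n * x - of_int i < b}" for a b
      by (intro open_Collect_conj open_Collect_less continuous_intros)
    \<comment> \<open>Five open regions cover the line: \<open>c\<close> is positive, so the flat
      pieces around -1, 0 and 1 overlap the two halves and every derivative is two-sided.\<close>
    consider "0 < s" "s < 1" | "- 1 < s" "s < 0" | "- c < s" "s < c" | "1 - c < s" | "s < - (1 - c)"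
      using c by linarith
    then show ?thesis
    proof cases
      case 1
      have "((\<lambda>x. ?n ^ k * D k (?n * x - of_int i)) has_real_derivative ?n ^ k * (D (Suc k) s * ?n)) (at x)"
        unfolding s_def
        by (intro DERIV_cmult DERIV_chain2[OF Di]) (use 1 in \<open>auto simp: s_def intro!: derivative_eq_intros\<close>)
      moreover have "?n ^ k * (D (Suc k) s * ?n) = E (Suc k) x"
        using 1 by (simp add: E_def s_def[symmetric])
      ultimately have "((\<lambda>x. ?n ^ k * D k (?n * x - of_int i)) has_real_derivative E (Suc k) x) (at x)" by simp
      then show ?thesis
        by (rule has_field_derivative_transform_within_open[OF _ op[of 0 1]]) (use 1 in \<open>simp_all add: E_pos s_def\<close>)
    next
      case 2
      have "((\<lambda>x. (- ?n) ^ k * D k (of_int i - ?n * x)) has_real_derivative (- ?n) ^ k * (D (Suc k) (- s) * (- ?n))) (at x)"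
      proof (rule DERIV_cmult)
        have "(D k has_real_derivative D (Suc k) (- s)) (at (of_int i - ?n * x))"
          using Di[of "- s" k] 2 by (simp add: s_def)
        moreover have "((\<lambda>x. of_int i - ?n * x) has_real_derivative - ?n) (at x)"
          by (auto intro!: derivative_eq_intros)
        ultimately show "((\<lambda>x. D k (of_int i - ?n * x)) has_real_derivative D (Suc k) (- s) * (- ?n)) (at x)"
          by (rule DERIV_chain2)
      qed
      moreover have "(- ?n) ^ k * (D (Suc k) (- s) * (- ?n)) = E (Suc k) x"
        using 2 by (simp add: E_def s_def[symmetric])
      ultimately have "((\<lambda>x. (- ?n) ^ k * D k (of_int i - ?n * x)) has_real_derivative E (Suc k) x) (at x)" by simp
      then show ?thesis
        by (rule has_field_derivative_transform_within_open[OF _ op[of "- 1" 0]]) (use 2 in \<open>simp_all add: E_neg s_def\<close>)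
    next
      case 3
      have "E (Suc k) x = 0" using 3 E_lo[of x "Suc k"] by (simp add: s_def)
      then have "((\<lambda>_. if k = 0 then 1 else 0) has_real_derivative E (Suc k) x) (at x)" by simp
      then show ?thesis
        by (rule has_field_derivative_transform_within_open[OF _ op[of "- c" c]])
          (use 3 in \<open>simp_all add: s_def E_lo\<close>)
    next
      case 4
      have "E (Suc k) x = 0" using 4 by (intro E_hi) (simp add: s_def)
      then have d: "((\<lambda>_. 0) has_real_derivative E (Suc k) x) (at x)" by simp
      have o: "open {x. 1 - c < ?n * x - of_int i}" by (intro open_Collect_less continuous_intros)
      show ?thesis
      proof (rule has_field_derivative_transform_within_open[OF d o])
        show "0 = E k y" if "y \<in> {x. 1 - c < ?n * x - of_int i}" for y
          using that by (intro E_hi[symmetric]) blast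
        show "x \<in> {x. 1 - c < ?n * x - of_int i}" using 4 unfolding s_def by blast
      qed
    next
      case 5
      have "E (Suc k) x = 0" using 5 by (intro E_hi) (simp add: s_def)
      then have d: "((\<lambda>_. 0) has_real_derivative E (Suc k) x) (at x)" by simp
      have o: "open {x. ?n * x - of_int i < - (1 - c)}" by (intro open_Collect_less continuous_intros)
      show ?thesis
      proof (rule has_field_derivative_transform_within_open[OF d o])
        show "0 = E k y" if "y \<in> {x. ?n * x - of_int i < - (1 - c)}" for y
          using that by (intro E_hi[symmetric]) blast
        show "x \<in> {x. ?n * x - of_int i < - (1 - c)}" using 5 unfolding s_def by blast
      qed
    qed
  qed
  obtain I' where I': "\<And>x. x \<in> {0..1} \<Longrightarrow> (I has_real_derivative I' x) (at x within {0..1})"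
     "\<And>x. x \<in> {0..1} \<Longrightarrow> - (1 + 1 / real n) \<le> I' x \<and> I' x \<le> 0"
    using I unfolding profile_def by blast
  have D1: "- (1 + 1 / real n) \<le> D 1 t" "D 1 t \<le> 0" if "0 < t" "t < 1" for t
  proof -
    have "(I has_real_derivative I' t) (at t)" using I'(1)[of t] that by (simp add: at_within_Icc_at)
    moreover have "(I has_real_derivative D 1 t) (at t)" using Di[of t 0] that by (simp add: D0)
    ultimately have "D 1 t = I' t" by (rule DERIV_unique[symmetric])
    then show "- (1 + 1 / real n) \<le> D 1 t" "D 1 t \<le> 0" using I'(2)[of t] that by auto
  qed
  have D1b: "?n * \<bar>D 1 t\<bar> \<le> ?n + 1" if "0 < t" "t < 1" for t
  proof -
    have "?n * \<bar>D 1 t\<bar> \<le> ?n * (1 + 1 / ?n)" using D1[OF that] by (intro mult_left_mono) auto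
    also have "\<dots> = ?n + 1" using n by (simp add: distrib_left)
    finally show ?thesis .
  qed
  have E1: "\<bar>E 1 x\<bar> \<le> ?n + 1" for x
    unfolding E_def Let_def using D1b by (auto simp: abs_mult)
  have E2: "E 1 x \<le> 0" if "0 < real n * x - i" "real n * x - i < 1" for x
    using that D1(2)[OF that] by (simp add: E_def mult_nonneg_nonpos)
  have E3: "E 1 x = - real n" if s: "1 / real n < real n * x - i" "real n * x - i < 1 - 1 / real n" for x
  proof -
    let ?s = "real n * x - i"
    have i0: "0 < 1 / real n" using n by simp
    have s01: "0 < ?s" "?s < 1" using s i0 by linarith+
    have "(I has_real_derivative - 1) (at ?s)"
    proof (rule has_field_derivative_transform_within_open[where f="\<lambda>t. 1 - t" and S="{1 / real n<..<1 - 1 / real n}"])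
      show "1 - t = I t" if t: "t \<in> {1 / real n<..<1 - 1 / real n}" for t
      proof -
        have "1 / real n < t" "t < 1 - 1 / real n" using t by auto
        moreover from this have "0 \<le> t" "t \<le> 1" using i0 by linarith+
        ultimately show ?thesis using profile_D(2)[OF I, of t] by simp
      qed
    qed (use s in \<open>auto intro!: derivative_eq_intros\<close>)
    then have "D 1 ?s = - 1" using Di[OF s01, of 0] DERIV_unique by (fastforce simp: D0)
    then show ?thesis using s01 by (simp add: E_def)
  qed
  show ?thesis by (rule that[of E]) (use E0 E E1 E2 E3 in auto)
qed

lemma phi1_bounds:
  assumes "profile n I" "3 \<le> n"
  shows "0 \<le> phi1 n I i x" "phi1 n I i x \<le> 1" "phi1 n I i x \<noteq> 0 \<Longrightarrow> \<bar>real n * x - i\<bar> < 1"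
proof -
  let ?s = "\<bar>real n * x - i\<bar>"
  have x: "x \<in> {(real_of_int i - 1) / real n .. (real_of_int i + 1) / real n} \<longleftrightarrow> ?s \<le> 1"
    using assms(2) by (auto simp: field_simps abs_le_iff)
  have *: "phi1 n I i x = (if ?s \<le> 1 then I ?s else 0)"
    unfolding phi1_def using x by (auto simp: indicator_def)
  show "0 \<le> phi1 n I i x" "phi1 n I i x \<le> 1"
    unfolding * using profile_D[OF assms(1), of ?s] by auto
  have "I 1 = 0" using profile_D(3)[OF assms(1), of 1] by auto
  then show "phi1 n I i x \<noteq> 0 \<Longrightarrow> ?s < 1"
    unfolding * by (cases "?s = 1") (auto split: if_splits)
qed

text \<open>Only the two integers around \<open>n * x\<close> contribute. With \<open>t\<close> the
  fractional part, their values are \<open>I t\<close> and \<open>I (1 - t)\<close>, and the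
  symmetry of the profile applies.\<close>

lemma phi1_sum:
  assumes I: "profile n I" "3 \<le> n" and B: "finite B" "\<lfloor>real n * x\<rfloor> \<in> B" "\<lfloor>real n * x\<rfloor> + 1 \<in> B"
  shows "(\<Sum>i\<in>B. phi1 n I i x) = 1"
proof -
  define k where "k = \<lfloor>real n * x\<rfloor>"
  define t where "t = real n * x - k"
  have t: "0 \<le> t" "t < 1" unfolding t_def k_def by linarith+
  have in_iff: "x \<in> {(real_of_int i - 1) / real n .. (real_of_int i + 1) / real n} \<longleftrightarrow> \<bar>real n * x - i\<bar> \<le> 1" for i
    using I(2) by (auto simp: field_simps abs_le_iff)
  have "(\<Sum>i\<in>B. phi1 n I i x) = (\<Sum>i\<in>{k, k + 1}. phi1 n I i x)"
  proof (rule sum.mono_neutral_right)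
    show "\<forall>i\<in>B - {k, k + 1}. phi1 n I i x = 0"
    proof
      fix i assume "i \<in> B - {k, k + 1}"
      then have "i \<le> k - 1 \<or> k + 2 \<le> i" by auto
      then have "1 \<le> \<bar>real n * x - i\<bar>"
      proof
        assume "i \<le> k - 1"
        then have "real_of_int i \<le> real_of_int k - 1" by linarith
        then show ?thesis using t by (simp add: t_def)
      next
        assume "k + 2 \<le> i"
        then have "real_of_int k + 2 \<le> real_of_int i" by linarith
        then show ?thesis using t by (simp add: t_def)
      qed
      then show "phi1 n I i x = 0" using phi1_bounds(3)[OF I, of i x] by auto
    qed
  qed (use B in \<open>auto simp: k_def\<close>)
  also have "\<dots> = phi1 n I k x + phi1 n I (k + 1) x" by simp
  also have "phi1 n I k x = I t"
    unfolding phi1_def using in_iff[of k] t by (simp add: t_def[symmetric] indicator_def)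
  also have "phi1 n I (k + 1) x = I (1 - t)"
  proof -
    have e: "real n * x - (k + 1) = t - 1" by (simp add: t_def)
    then have a: "\<bar>real n * x - (k + 1)\<bar> = 1 - t" using t by simp
    have i: "x \<in> {(real_of_int (k + 1) - 1) / real n .. (real_of_int (k + 1) + 1) / real n}"
      unfolding in_iff a using t by simp
    show ?thesis unfolding phi1_def a using i by (simp only: indicator_simps mult_1_right)
  qed
  also have "I t + I (1 - t) = 1" using profile_D(6)[OF I(1)] t by simp
  finally show ?thesis .
qed

section \<open>The grid and the partition of unity in several variables\<close>

lemma vec_set_eq_image: "{i :: 'a^'d. \<forall>l. i $ l \<in> B l} = vec_lambda ` (\<Pi>\<^sub>E l\<in>UNIV. B l)"
proof -
  have "i = vec_lambda (vec_nth i)" for i :: "'a^'d" by simp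
  then show ?thesis by (auto simp: PiE_UNIV_domain intro!: image_eqI)
qed

lemma inj_vec_lambda: "inj_on vec_lambda A"
  by (auto simp: inj_on_def vec_lambda_inject)

lemma finite_vec_set: "(\<And>l. finite (B l)) \<Longrightarrow> finite {i :: 'a^'d. \<forall>l. i $ l \<in> B l}"
  unfolding vec_set_eq_image by (intro finite_imageI finite_PiE) auto

lemma card_vec_set: "(\<And>l. finite (B l)) \<Longrightarrow> card {i :: 'a^'d. \<forall>l. i $ l \<in> B l} = (\<Prod>l\<in>UNIV. card (B l))"
  unfolding vec_set_eq_image by (simp add: card_image[OF inj_vec_lambda] card_PiE)

lemma sum_prod_vec:
  fixes f :: "'d::finite \<Rightarrow> 'a \<Rightarrow> 'b::comm_semiring_1"
  assumes "\<And>l. finite (B l)"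
  shows "(\<Sum>i | \<forall>l. i $ l \<in> B l. \<Prod>l\<in>UNIV. f l (i $ l)) = (\<Prod>l\<in>UNIV. \<Sum>j\<in>B l. f l j)"
  unfolding vec_set_eq_image using assms
  by (simp add: sum.reindex[OF inj_vec_lambda] prod_sum_PiE)

lemma grid_eq: "grid n = {i :: int^'d. \<forall>l. i $ l \<in> {- 2 * (int n)\<^sup>2 .. 2 * (int n)\<^sup>2}}"
  by (auto simp: grid_def abs_le_iff minus_le_iff)

lemma finite_grid [simp]: "finite (grid n)"
  unfolding grid_eq by (rule finite_vec_set) simp

lemma zero_in_grid [simp]: "0 \<in> grid n"
  by (simp add: grid_def)

text \<open>The power d is dropped. Quadratic growth in \<open>n\<close> is enough to dominate the
  distance of the nodes from the origin, which is of order \<open>n\<close>.\<close>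

lemma Ngrid_ge: "4 * (real n)\<^sup>2 + 1 \<le> Ngrid TYPE('d::finite) n"
proof -
  let ?m = "card {- 2 * (int n)\<^sup>2 .. 2 * (int n)\<^sup>2}"
  have "card (grid n :: (int^'d) set) = ?m ^ CARD('d)"
    unfolding grid_eq by (subst card_vec_set) auto
  moreover have "?m = 4 * n\<^sup>2 + 1"
  proof -
    have "2 * (int n)\<^sup>2 + 1 - - 2 * (int n)\<^sup>2 = int (4 * n\<^sup>2 + 1)" by simp
    then show ?thesis unfolding card_atLeastAtMost_int by (simp only: nat_int)
  qed
  moreover have "(4 * n\<^sup>2 + 1) ^ 1 \<le> (4 * n\<^sup>2 + 1) ^ CARD('d)"
    by (rule power_increasing) auto
  ultimately have "4 * n\<^sup>2 + 1 \<le> card (grid n :: (int^'d) set)" by simp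
  then have "real (4 * n\<^sup>2 + 1) \<le> real (card (grid n :: (int^'d) set))" by (rule of_nat_mono)
  then show ?thesis by (simp add: Ngrid_def)
qed

lemma phi_bounds:
  fixes i :: "int^'d"
  assumes "profile n I" "3 \<le> n"
  shows "0 \<le> phi n I i x" "phi n I i x \<le> 1" "phi n I i x \<noteq> 0 \<Longrightarrow> \<bar>real n * x $ l - i $ l\<bar> < 1"
  using phi1_bounds[OF assms] unfolding phi_def by (auto intro!: prod_nonneg prod_le_1)

text \<open>Here the grid radius meets the support of the cutoff: 3n^2/2 is at most 2n^2 - 1 for
  \<open>n \<ge> 3\<close>, so both integer neighbours of \<open>n * x\<close> index nodes of the
  grid.\<close>

lemma floor_in_grid_range:
  assumes "3 \<le> n" "\<bar>x\<bar> \<le> 3 * real n / 2"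
  shows "- 2 * (int n)\<^sup>2 \<le> \<lfloor>real n * x\<rfloor>" "\<lfloor>real n * x\<rfloor> + 1 \<le> 2 * (int n)\<^sup>2"
proof -
  have "\<bar>real n * x\<bar> \<le> real n * (3 * real n / 2)"
    using assms by (simp add: abs_mult mult_left_mono)
  also have "\<dots> \<le> 2 * (real n)\<^sup>2 - 1"
  proof -
    have "3\<^sup>2 \<le> (real n)\<^sup>2" using assms by (intro power_mono) auto
    then show ?thesis by (simp add: power2_eq_square)
  qed
  finally have "- (2 * (real n)\<^sup>2 - 1) \<le> real n * x" "real n * x \<le> 2 * (real n)\<^sup>2 - 1" by linarith+
  moreover have "real_of_int (2 * (int n)\<^sup>2) = 2 * (real n)\<^sup>2" "real_of_int (- 2 * (int n)\<^sup>2) = - 2 * (real n)\<^sup>2"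
    by simp_all
  ultimately show "- 2 * (int n)\<^sup>2 \<le> \<lfloor>real n * x\<rfloor>" "\<lfloor>real n * x\<rfloor> + 1 \<le> 2 * (int n)\<^sup>2"
    unfolding le_floor_iff add1_zle_eq floor_less_iff by linarith+
qed

lemma phi_sum:
  fixes x :: "real^'d"
  assumes "profile n I" "3 \<le> n" "x \<in> cubeQ (3 * real n / 2)"
  shows "(\<Sum>i\<in>grid n. phi n I i x) = 1"
proof -
  have "(\<Sum>i\<in>grid n. phi n I i x) = (\<Prod>l\<in>UNIV. \<Sum>j\<in>{- 2 * (int n)\<^sup>2 .. 2 * (int n)\<^sup>2}. phi1 n I j (x $ l))"
    unfolding grid_eq phi_def by (rule sum_prod_vec) simp
  also have "\<dots> = (\<Prod>l\<in>(UNIV::'d set). 1)"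
  proof (intro prod.cong refl)
    fix l
    have "\<bar>x $ l\<bar> \<le> 3 * real n / 2" using assms by (auto simp: cubeQ_def)
    then show "(\<Sum>j\<in>{- 2 * (int n)\<^sup>2 .. 2 * (int n)\<^sup>2}. phi1 n I j (x $ l)) = 1"
      using floor_in_grid_range[OF assms(2), of "x $ l"] by (intro phi1_sum[OF assms(1,2)]) auto
  qed
  finally show ?thesis by simp
qed

lemma cutoff_D:
  fixes h :: "real^'d \<Rightarrow> real"
  assumes "cutoff n h"
  shows "smooth_vec h" "0 \<le> h x" "h x \<le> 1" "x \<in> cubeQ (real n) \<Longrightarrow> h x = 1"
    "x \<notin> cubeQ (3 * real n / 2) \<Longrightarrow> h x = 0"
  using assms by (auto simp: cutoff_def)

lemma cutoff_Lipschitz: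
  fixes h :: "real^'d \<Rightarrow> real"
  assumes "cutoff n h"
  shows "\<bar>h x - h y\<bar> \<le> 3 / real n * dist x y"
proof -
  obtain g where g: "\<And>x. GDERIV h x :> g x" "\<And>x. norm (g x) \<le> 3 / real n"
    using assms unfolding cutoff_def by blast
  have "norm (h x - h y) \<le> 3 / real n * norm (x - y)"
  proof (rule differentiable_bound[where S=UNIV and f'="\<lambda>x h. h \<bullet> g x"])
    show "(h has_derivative (\<lambda>h. h \<bullet> g x)) (at x within UNIV)" for x
      using g(1)[of x] by (simp add: gderiv_def)
    show "onorm (\<lambda>h. h \<bullet> g x) \<le> 3 / real n" for x
    proof (rule onorm_le)
      fix v
      have "norm (v \<bullet> g x) \<le> norm v * norm (g x)" by (rule Cauchy_Schwarz_ineq2[unfolded real_norm_def[symmetric]])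
      also have "\<dots> \<le> norm v * (3 / real n)" using g(2) by (intro mult_left_mono) auto
      finally show "norm (v \<bullet> g x) \<le> 3 / real n * norm v" by (simp add: mult.commute)
    qed
  qed auto
  then show ?thesis by (simp add: dist_norm)
qed

section \<open>Weights of the nodes and their variation\<close>

text \<open>The integrand behind \<open>psi\<close>: a Markov kernel from points to nodes. The mass
  removed by the cutoff is sent to the node 0.\<close>

definition wgt :: "nat \<Rightarrow> (real \<Rightarrow> real) \<Rightarrow> (real^'d \<Rightarrow> real) \<Rightarrow> int^'d \<Rightarrow> real^'d \<Rightarrow> real" where
  "wgt n I h i x = phi n I i x * h x + (if i = 0 then 1 - h x else 0)"

lemma smooth_vec_phi:
  assumes "profile n I" "3 \<le> n"
  shows "smooth_vec (phi n I i)"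
  unfolding phi_def
proof (rule smooth_vec_prod)
  fix l
  obtain E where "E 0 = phi1 n I (i $ l)" "\<And>k x. (E k has_real_derivative E (Suc k) x) (at x)"
    using phi1_derivatives[OF assms, of "i $ l"] by metis
  then show "smooth_vec (\<lambda>x. phi1 n I (i $ l) (x $ l))"
    using smooth_vec_coordinate[of E 0 l] by simp
qed

context
  fixes n I and h :: "real^'d \<Rightarrow> real"
  assumes I: "profile n I" and n: "3 \<le> n" and h: "cutoff n h"
begin

lemma test_fun_phi_cutoff: "test_fun (3 * real n / 2) (\<lambda>x. phi n I i x * h x)"
  using cutoff_D[OF h] smooth_vec_phi[OF I n] by (auto simp: test_fun_def intro!: smooth_vec_mult)

lemma wgt_nonneg: "0 \<le> wgt n I h i x"
  using cutoff_D(2-5)[OF h, of x] phi_bounds[OF I n, of i x] by (simp add: wgt_def)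

lemma phi_cutoff_sum: "(\<Sum>i\<in>grid n. phi n I i x * h x) = h x"
  using phi_sum[OF I n, of x] cutoff_D(5)[OF h, of x]
  by (cases "x \<in> cubeQ (3 * real n / 2)") (auto simp flip: sum_distrib_right)

lemma wgt_sum: "(\<Sum>i\<in>grid n. wgt n I h i x) = 1"
  unfolding wgt_def sum.distrib phi_cutoff_sum by (simp add: sum.delta)

lemma wgt_le_1: "wgt n I h i x \<le> 1"
  using cutoff_D(2-5)[OF h, of x] phi_bounds[OF I n, of i x] mult_right_mono[of "phi n I i x" 1 "h x"]
    mult_nonneg_nonneg[of "phi n I i x" "h x"]
  by (auto simp: wgt_def)

lemma cutoff_measurable [measurable]: "h \<in> borel_measurable borel"
  using cutoff_D(1)[OF h] Ck_vec_continuous borel_measurable_continuous_onI unfolding smooth_vec_def by blast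

lemma phi_measurable [measurable]: "phi n I i \<in> borel_measurable borel"
  using smooth_vec_phi[OF I n] Ck_vec_continuous borel_measurable_continuous_onI unfolding smooth_vec_def by blast

lemma wgt_measurable [measurable]: "wgt n I h i \<in> borel_measurable borel"
  unfolding wgt_def[abs_def] by measurable

lemma wgt_integrable:
  assumes "prob_space \<mu>" "sets \<mu> = sets borel"
  shows "integrable \<mu> (wgt n I h i)"
proof -
  interpret prob_space \<mu> by fact
  note [measurable_cong] = assms(2)
  show ?thesis using wgt_nonneg wgt_le_1 by (intro integrable_const_bound[where B=1]) auto
qed

lemma psi_eq:
  assumes "prob_space \<mu>" "sets \<mu> = sets borel"
  shows "psi n I h i \<mu> = (\<integral>x. wgt n I h i x \<partial>\<mu>)"
proof -
  interpret prob_space \<mu> by fact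
  note [measurable_cong] = assms(2)
  have b: "\<bar>phi n I i x * h x\<bar> \<le> 1" for x
    using cutoff_D(2-5)[OF h, of x] phi_bounds[OF I n, of i x] by (simp add: abs_mult mult_le_one)
  have "integrable \<mu> (\<lambda>x. phi n I i x * h x)"
    using b by (intro integrable_const_bound[where B=1]) auto
  moreover have "integrable \<mu> h" using cutoff_D[OF h] by (intro integrable_const_bound[where B=1]) auto
  then have "integrable \<mu> (\<lambda>x. 1 - h x)" by simp
  ultimately show ?thesis unfolding psi_def wgt_def by (cases "i = 0") simp_all
qed

lemma psi_nonneg: "prob_space \<mu> \<Longrightarrow> sets \<mu> = sets borel \<Longrightarrow> 0 \<le> psi n I h i \<mu>"
  by (simp add: psi_eq wgt_nonneg integral_nonneg)

lemma psi_sum: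
  assumes "prob_space \<mu>" "sets \<mu> = sets borel"
  shows "(\<Sum>i\<in>grid n. psi n I h i \<mu>) = 1"
proof -
  interpret prob_space \<mu> by fact
  have "(\<Sum>i\<in>grid n. psi n I h i \<mu>) = (\<integral>x. (\<Sum>i\<in>grid n. wgt n I h i x) \<partial>\<mu>)"
    using assms wgt_integrable by (simp add: psi_eq)
  then show ?thesis by (simp add: wgt_sum prob_space)
qed

end

definition node :: "nat \<Rightarrow> int^'d \<Rightarrow> real^'d" where
  "node n i = (\<chi> l. real_of_int (i $ l) / real n)"

lemma dist_node_le:
  fixes i :: "int^'d"
  assumes "0 < n" "\<And>l. \<bar>real n * x $ l - i $ l\<bar> \<le> c"
  shows "dist (node n i) x \<le> c * real CARD('d) / real n"
proof -
  have "dist (node n i) x \<le> (\<Sum>l\<in>UNIV. \<bar>(node n i - x) $ l\<bar>)"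
    unfolding dist_norm by (rule norm_le_l1_cart)
  also have "\<dots> \<le> (\<Sum>l\<in>(UNIV::'d set). c / real n)"
  proof (rule sum_mono)
    fix l
    have "\<bar>(node n i - x) $ l\<bar> = \<bar>real n * x $ l - i $ l\<bar> / real n"
      using assms(1) by (simp add: node_def field_simps abs_divide[symmetric] abs_minus_commute)
    then show "\<bar>(node n i - x) $ l\<bar> \<le> c / real n" using assms by (simp add: divide_right_mono)
  qed
  finally show ?thesis by (simp add: mult.commute)
qed


lemma norm_le_cubeQ:
  fixes x :: "real^'d"
  assumes "x \<in> cubeQ R"
  shows "norm x \<le> real CARD('d) * R"
proof -
  have "norm x \<le> (\<Sum>l\<in>UNIV. \<bar>x $ l\<bar>)" by (rule norm_le_l1_cart)
  also have "\<dots> \<le> (\<Sum>l\<in>(UNIV::'d set). R)" using assms by (intro sum_mono) (auto simp: cubeQ_def)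
  finally show ?thesis by simp
qed

text \<open>The first summand bounds the cost for points at distance at most 1/n: 4^d nodes, each at
  distance at most 2d/n, with slopes of order n. The second, \<open>2 * d + 1\<close>, covers points
  farther apart, and \<open>5 * d + 1\<close> covers the variation of the mass that the cutoff sends
  to the origin.\<close>

definition mollify_const :: "nat \<Rightarrow> real" where
  "mollify_const d = 4 ^ d * (2 * d) * (2 * d + 1) + (2 * d + 1) + (5 * d + 1)"

context
  fixes n I and h :: "real^'d \<Rightarrow> real"
  assumes I: "profile n I" and n: "3 \<le> n" and h: "cutoff n h"
begin

text \<open>All factors lie between 0 and 1, so a difference of products is at most the sum of the
  differences of the factors.\<close>

lemma phi_Lipschitz: "\<bar>phi n I i x - phi n I i y\<bar> \<le> (real n + 1) * real CARD('d) * dist x (y :: real^'d)"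
proof -
  have p1: "\<bar>phi1 n I k a - phi1 n I k b\<bar> \<le> (real n + 1) * \<bar>a - b\<bar>" for k a b
  proof -
    obtain E where E: "E 0 = phi1 n I k" "\<And>k x. (E k has_real_derivative E (Suc k) x) (at x)"
      "\<And>x. \<bar>E 1 x\<bar> \<le> real n + 1"
      using phi1_derivatives[OF I n, of k] by metis
    have "\<bar>phi1 n I k a - phi1 n I k b - 0 * (a - b)\<bar> \<le> (real n + 1) * \<bar>a - b\<bar>"
      by (rule mvt_affine_bound[where F'="E 1"]) (use E(2)[of 0] E(1,3) in auto)
    then show ?thesis by simp
  qed
  have "norm (phi n I i x - phi n I i y) \<le> (\<Sum>l\<in>UNIV. norm (phi1 n I (i $ l) (x $ l) - phi1 n I (i $ l) (y $ l)))"
    unfolding phi_def using phi1_bounds[OF I n] by (intro norm_prod_diff) auto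
  also have "\<dots> \<le> (\<Sum>l\<in>UNIV. (real n + 1) * \<bar>(x - y) $ l\<bar>)"
    using p1 by (intro sum_mono) auto
  also have "\<dots> \<le> (real n + 1) * (real CARD('d) * norm (x - y))"
    unfolding sum_distrib_left[symmetric] by (intro mult_left_mono sum_abs_le_card_norm) auto
  finally show ?thesis by (simp add: dist_norm mult.assoc)
qed

lemma dist_node_phi: "phi n I i x \<noteq> 0 \<Longrightarrow> dist (node n i) (x :: real^'d) \<le> real CARD('d) / real n"
  using dist_node_le[of n x i 1] phi_bounds(3)[OF I n, of i x] n by (auto intro: less_imp_le)

text \<open>The slope 3/n of the cutoff meets a norm of order n: if one of the points lies in the
  support cube, their product is at most 9d/2. When only \<open>y\<close> is known to lie in the
  cube, \<open>norm x\<close> exceeds \<open>norm y\<close> by at most the distance; this is the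
  extra 1.\<close>

lemma cutoff_variation_cost: "\<bar>h x - h y\<bar> * norm x \<le> (5 * real CARD('d) + 1) * dist x y"
proof -
  let ?d = "real CARD('d)" and ?D = "dist x y"
  have L: "\<bar>h x - h y\<bar> \<le> 3 / real n * ?D" by (rule cutoff_Lipschitz[OF h])
  have bd: "\<bar>h x - h y\<bar> * r \<le> 5 * ?d * ?D" if "0 \<le> r" "r \<le> ?d * (3 * real n / 2)" for r
  proof -
    have "\<bar>h x - h y\<bar> * r \<le> (3 / real n * ?D) * (?d * (3 * real n / 2))"
      using L that by (intro mult_mono) auto
    also have "\<dots> = 9 / 2 * ?d * ?D" using n by simp
    also have "\<dots> \<le> 5 * ?d * ?D" by (intro mult_right_mono) auto
    finally show ?thesis .
  qed
  consider "x \<in> cubeQ (3 * real n / 2)" | "y \<in> cubeQ (3 * real n / 2)"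
    | "x \<notin> cubeQ (3 * real n / 2)" "y \<notin> cubeQ (3 * real n / 2)" by blast
  then show ?thesis
  proof cases
    case 1
    then have "\<bar>h x - h y\<bar> * norm x \<le> 5 * ?d * ?D" by (intro bd norm_le_cubeQ) auto
    then show ?thesis unfolding distrib_right using zero_le_dist[of x y] by linarith
  next
    case 2
    then have b: "\<bar>h x - h y\<bar> * norm y \<le> 5 * ?d * ?D" by (intro bd norm_le_cubeQ) auto
    have "norm x \<le> norm y + ?D" using norm_triangle_sub[of x y] by (simp add: dist_norm)
    then have "\<bar>h x - h y\<bar> * norm x \<le> \<bar>h x - h y\<bar> * (norm y + ?D)"
      by (intro mult_left_mono) auto
    also have "\<dots> = \<bar>h x - h y\<bar> * norm y + \<bar>h x - h y\<bar> * ?D" by (rule distrib_left)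
    also have "\<bar>h x - h y\<bar> * ?D \<le> 1 * ?D"
      using cutoff_D(2,3)[OF h, of x] cutoff_D(2,3)[OF h, of y] by (intro mult_right_mono) (auto simp: abs_le_iff)
    finally show ?thesis using b by (simp add: distrib_right)
  next
    case 3
    then show ?thesis using cutoff_D(5)[OF h] by simp
  qed
qed

text \<open>The reason why the Lipschitz constant does not depend on \<open>n\<close>: the weights
  vary with slope of order n, but the nodes that exchange mass are at distance of order 1/n.
  Together with \<open>tv_coupling_cost\<close>, with \<open>x\<close> as the point of detour, this
  bounds the cost of passing from the weights at \<open>x\<close> to those at
  \<open>y\<close>.\<close>

lemma wgt_variation_cost:
  "(\<Sum>i\<in>grid n. \<bar>wgt n I h i x - wgt n I h i y\<bar> * dist (node n i) x) \<le> mollify_const CARD('d) * dist x y"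
proof -
  let ?d = "real CARD('d)" and ?D = "dist x y"
  define T where "T i = \<bar>phi n I i x * h x - phi n I i y * h y\<bar>" for i
  have d1: "1 \<le> ?d" by simp
  note hb = cutoff_D(2,3)[OF h] and pb = phi_bounds(1,2)[OF I n]
  have "(\<Sum>i\<in>grid n. \<bar>wgt n I h i x - wgt n I h i y\<bar> * dist (node n i) x)
      \<le> (\<Sum>i\<in>grid n. T i * dist (node n i) x + (if i = 0 then \<bar>h x - h y\<bar> * norm x else 0))"
  proof (rule sum_mono)
    fix i :: "int^'d"
    have "node n (0 :: int^'d) = 0" by (simp add: node_def vec_eq_iff)
    moreover have "\<bar>wgt n I h i x - wgt n I h i y\<bar> \<le> T i + (if i = 0 then \<bar>h x - h y\<bar> else 0)"
      unfolding wgt_def T_def by auto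
    then have "\<bar>wgt n I h i x - wgt n I h i y\<bar> * dist (node n i) x
        \<le> (T i + (if i = 0 then \<bar>h x - h y\<bar> else 0)) * dist (node n i) x"
      by (rule mult_right_mono) simp
    ultimately show "\<bar>wgt n I h i x - wgt n I h i y\<bar> * dist (node n i) x
        \<le> T i * dist (node n i) x + (if i = 0 then \<bar>h x - h y\<bar> * norm x else 0)"
      by (auto simp: distrib_right split: if_splits)
  qed
  also have "\<dots> = (\<Sum>i\<in>grid n. T i * dist (node n i) x) + \<bar>h x - h y\<bar> * norm x"
    by (simp add: sum.distrib)
  also have "(\<Sum>i\<in>grid n. T i * dist (node n i) x) \<le> (4 ^ CARD('d) * (2 * ?d) * (2 * ?d + 1) + (2 * ?d + 1)) * ?D"
  proof (cases "?D \<le> 1 / real n")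
    case True
    \<comment> \<open>A node whose weight changes satisfies
      \<open>\<bar>n * x $ l - i $ l\<bar> < 2\<close>, which leaves four integers per
      coordinate.\<close>
    define S :: "(int^'d) set" where "S = {i. \<forall>l. i $ l \<in> {\<lfloor>real n * x $ l\<rfloor> - 1..\<lfloor>real n * x $ l\<rfloor> + 2}}"
    have fS: "finite S" unfolding S_def by (rule finite_vec_set) simp
    have cS: "card S = 4 ^ CARD('d)" unfolding S_def by (subst card_vec_set) auto
    have near: "\<bar>real n * x $ l - i $ l\<bar> < 2" if "T i \<noteq> 0" for i l
    proof -
      have "phi n I i x \<noteq> 0 \<or> phi n I i y \<noteq> 0" using that by (auto simp: T_def)
      then show ?thesis
      proof
        assume "phi n I i x \<noteq> 0" then show ?thesis using phi_bounds(3)[OF I n, of i x l] by simp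
      next
        assume "phi n I i y \<noteq> 0" then have a: "\<bar>real n * y $ l - i $ l\<bar> < 1" using phi_bounds(3)[OF I n, of i y l] by simp
        have "\<bar>(x - y) $ l\<bar> \<le> 1 / real n"
          using component_le_norm_cart[of "x - y" l] True by (simp add: dist_norm)
        then have "real n * \<bar>(x - y) $ l\<bar> \<le> 1" using n by (simp add: field_simps)
        then have "\<bar>real n * x $ l - real n * y $ l\<bar> \<le> 1" by (simp add: abs_mult flip: right_diff_distrib)
        then show ?thesis using a by linarith
      qed
    qed
    have "i \<in> S" if "T i \<noteq> 0" for i
      unfolding S_def
    proof (intro CollectI allI)
      fix l
      show "i $ l \<in> {\<lfloor>real n * x $ l\<rfloor> - 1..\<lfloor>real n * x $ l\<rfloor> + 2}"
        using near[OF that, of l] unfolding atLeastAtMost_iff by linarith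
    qed
    then have "(\<Sum>i\<in>grid n. T i * dist (node n i) x) = (\<Sum>i\<in>grid n \<inter> S. T i * dist (node n i) x)"
      by (intro sum.mono_neutral_right) auto
    also have "\<dots> \<le> (\<Sum>i\<in>grid n \<inter> S. 2 * ?d * (2 * ?d + 1) * ?D)"
    proof (rule sum_mono)
      fix i
      show "T i * dist (node n i) x \<le> 2 * ?d * (2 * ?d + 1) * ?D"
      proof (cases "T i = 0")
        case False
        have dn: "dist (node n i) x \<le> 2 * ?d / real n"
          using near[OF False] n by (intro dist_node_le) (auto intro: less_imp_le)
        have "T i = \<bar>(phi n I i x - phi n I i y) * h x + phi n I i y * (h x - h y)\<bar>"
          by (simp add: T_def algebra_simps)
        also have "\<dots> \<le> \<bar>phi n I i x - phi n I i y\<bar> * \<bar>h x\<bar> + \<bar>phi n I i y\<bar> * \<bar>h x - h y\<bar>"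
          using abs_triangle_ineq[of "(phi n I i x - phi n I i y) * h x" "phi n I i y * (h x - h y)"]
          by (simp add: abs_mult)
        also have "\<dots> \<le> ((real n + 1) * ?d * ?D) * 1 + 1 * (3 / real n * ?D)"
          using phi_Lipschitz[of i x y] cutoff_Lipschitz[OF h, of x y] hb[of x] pb[of i y]
          by (intro add_mono mult_mono) auto
        finally have Ti: "T i \<le> (real n + 1) * ?d * ?D + 3 / real n * ?D" by simp
        have "T i * dist (node n i) x \<le> ((real n + 1) * ?d * ?D + 3 / real n * ?D) * (2 * ?d / real n)"
          using Ti dn by (intro mult_mono) auto
        also have "\<dots> = 2 * ?d * ((real n + 1) / real n * ?d + 3 / (real n * real n)) * ?D"
          by (simp add: divide_simps) (simp add: algebra_simps)
        also have "\<dots> \<le> 2 * ?d * (2 * ?d + 1) * ?D"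
        proof (intro mult_right_mono mult_left_mono add_mono)
          show "(real n + 1) / real n \<le> 2" using n by (simp add: divide_simps)
          have "3 * 3 \<le> real n * real n" using n by (intro mult_mono) auto
          then show "3 / (real n * real n) \<le> 1" by (simp add: divide_simps)
        qed auto
        finally show ?thesis .
      qed auto
    qed
    also have "\<dots> = real (card (grid n \<inter> S)) * (2 * ?d * (2 * ?d + 1) * ?D)" by simp
    also have "\<dots> \<le> 4 ^ CARD('d) * (2 * ?d * (2 * ?d + 1) * ?D)"
    proof (rule mult_right_mono)
      have "card (grid n \<inter> S) \<le> card S" by (rule card_mono[OF fS]) auto
      then show "real (card (grid n \<inter> S)) \<le> 4 ^ CARD('d)" unfolding cS by simp
    qed auto
    also have "\<dots> \<le> (4 ^ CARD('d) * (2 * ?d) * (2 * ?d + 1) + (2 * ?d + 1)) * ?D"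
      by (simp add: algebra_simps)
    finally show ?thesis .
  next
    \<comment> \<open>For distant points the Lipschitz bounds are replaced by the sum of both
      weights. The resulting 2d/n is then at most 2d times the distance.\<close>
    case False
    have "(\<Sum>i\<in>grid n. T i * dist (node n i) x)
        \<le> (\<Sum>i\<in>grid n. phi n I i x * h x * (?d / real n) + phi n I i y * h y * (?d / real n + ?D))"
    proof (rule sum_mono)
      fix i :: "int^'d"
      have nn: "0 \<le> phi n I i x * h x" "0 \<le> phi n I i y * h y" by (simp_all add: hb pb)
      have "phi n I i x * h x * dist (node n i) x \<le> phi n I i x * h x * (?d / real n)"
      proof (cases "phi n I i x = 0")
        case False
        show ?thesis by (rule mult_left_mono[OF dist_node_phi[OF False] nn(1)])
      qed simp
      moreover have "phi n I i y * h y * dist (node n i) x \<le> phi n I i y * h y * (?d / real n + ?D)"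
      proof (cases "phi n I i y = 0")
        case False
        then have "dist (node n i) x \<le> ?d / real n + ?D"
          using dist_node_phi[of i y] dist_triangle[of "node n i" x y] by (simp add: dist_commute)
        then show ?thesis using nn by (intro mult_left_mono)
      qed simp
      moreover have "T i \<le> phi n I i x * h x + phi n I i y * h y"
        using nn unfolding T_def by linarith
      then have "T i * dist (node n i) x \<le> (phi n I i x * h x + phi n I i y * h y) * dist (node n i) x"
        by (rule mult_right_mono) simp
      ultimately show "T i * dist (node n i) x
          \<le> phi n I i x * h x * (?d / real n) + phi n I i y * h y * (?d / real n + ?D)"
        by (simp add: distrib_right)
    qed
    also have "\<dots> = h x * (?d / real n) + h y * (?d / real n + ?D)"
      by (simp only: sum.distrib phi_cutoff_sum[OF I n h] flip: sum_distrib_right[of _ _ "?d / real n"]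
          sum_distrib_right[of _ _ "?d / real n + ?D"])
    also have "\<dots> \<le> 1 * (?d / real n) + 1 * (?d / real n + ?D)"
      using hb by (intro add_mono mult_right_mono) auto
    also have "\<dots> = 2 * ?d * (1 / real n) + ?D" by simp
    also have "\<dots> \<le> 2 * ?d * ?D + ?D" using False by (intro add_right_mono mult_left_mono) auto
    also have "\<dots> \<le> (4 ^ CARD('d) * (2 * ?d) * (2 * ?d + 1) + (2 * ?d + 1)) * ?D"
      by (simp add: algebra_simps)
    finally show ?thesis .
  qed
  also note cutoff_variation_cost[of x y]
  finally show ?thesis by (simp add: mollify_const_def algebra_simps)
qed

end

section \<open>Smoothing by convolution\<close>

abbreviation prodtop :: "'i set \<Rightarrow> ('i \<Rightarrow> real) topology" where
  "prodtop J \<equiv> product_topology (\<lambda>_. euclideanreal) J"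

text \<open>The product sigma-algebra is the Borel algebra when the product runs over a whole
  countable type. The map \<open>e\<close> extends a function by 0 to that type and
  \<open>\<rho>\<close> restricts it again to \<open>J\<close>, which carries continuity on
  \<open>S\<close> over to measurability.\<close>

lemma borel_measurable_PiM_continuous:
  fixes f :: "('i::countable \<Rightarrow> real) \<Rightarrow> real"
  assumes S: "closedin (prodtop J) S" and f: "continuous_map (subtopology (prodtop J) S) euclideanreal f"
  shows "(\<lambda>y. if y \<in> S then f y else 0) \<in> borel_measurable (Pi\<^sub>M J (\<lambda>_. lborel))"
proof -
  define \<rho> where "\<rho> y = restrict y J" for y :: "'i \<Rightarrow> real"
  have \<rho>: "continuous_map euclidean (prodtop J) \<rho>"
    unfolding continuous_map_componentwise \<rho>_def
    by (auto simp: continuous_map_iff_continuous2 intro!: continuous_intros continuous_on_product_coordinates)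
  have cl: "closed (\<rho> -` S)"
    using closedin_continuous_map_preimage[OF \<rho> S] by (simp add: vimage_def)
  have "continuous_map (subtopology euclidean (\<rho> -` S)) (subtopology (prodtop J) S) \<rho>"
    using \<rho> by (auto simp: continuous_map_in_subtopology intro: continuous_map_from_subtopology)
  then have "continuous_map (subtopology euclidean (\<rho> -` S)) euclideanreal (f \<circ> \<rho>)"
    using f by (rule continuous_map_compose)
  then have "continuous_on (\<rho> -` S) (f \<circ> \<rho>)" by simp
  then have m: "(\<lambda>y. indicator (\<rho> -` S) y *\<^sub>R (f \<circ> \<rho>) y) \<in> borel_measurable borel"
    by (rule borel_measurable_continuous_on_indicator[rotated]) (simp add: cl borel_closed)
  define e where "e y i = (if i \<in> J then y i else 0)" for y :: "'i \<Rightarrow> real" and i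
  have "e \<in> measurable (Pi\<^sub>M J (\<lambda>_. lborel)) (Pi\<^sub>M UNIV (\<lambda>_. borel))"
  proof (rule measurable_PiM_single')
    fix i
    show "(\<lambda>y. e y i) \<in> borel_measurable (Pi\<^sub>M J (\<lambda>_. lborel))"
      by (cases "i \<in> J") (auto simp: e_def)
  qed auto
  also have "measurable (Pi\<^sub>M J (\<lambda>_. lborel)) (Pi\<^sub>M UNIV (\<lambda>_. borel)) = measurable (Pi\<^sub>M J (\<lambda>_. lborel)) (borel :: ('i \<Rightarrow> real) measure)"
    by (rule measurable_cong_sets) (simp_all add: sets_PiM_equal_borel)
  finally have "(\<lambda>y. indicator (\<rho> -` S) (e y) *\<^sub>R (f \<circ> \<rho>) (e y)) \<in> borel_measurable (Pi\<^sub>M J (\<lambda>_. lborel))"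
    using m by (rule measurable_compose)
  then show ?thesis
  proof (subst measurable_cong)
    fix y assume "y \<in> space (Pi\<^sub>M J (\<lambda>_. lborel :: real measure))"
    then have "\<rho> (e y) = y" by (auto simp: \<rho>_def e_def space_PiM fun_eq_iff PiE_def extensional_def)
    then show "(if y \<in> S then f y else 0) = indicator (\<rho> -` S) (e y) *\<^sub>R (f \<circ> \<rho>) (e y)" by simp
  qed
qed

lemma Ck_fun_continuous: "Ck_fun k J f \<Longrightarrow> continuous_map (prodtop J) euclideanreal f"
  by (cases k) auto

lemma update_PiE_UNIV: "y \<in> J \<rightarrow>\<^sub>E UNIV \<Longrightarrow> j \<in> J \<Longrightarrow> y(j := t) \<in> J \<rightarrow>\<^sub>E UNIV"
  by (auto simp: PiE_iff extensional_def)

text \<open>Derivatives of different orders of smoothness are identified by uniqueness only at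
  extensional functions, so smoothness has to be insensitive to all other arguments.\<close>

lemma Ck_fun_cong:
  assumes "Ck_fun k J f" and eq: "\<And>y. y \<in> J \<rightarrow>\<^sub>E UNIV \<Longrightarrow> f y = g y"
  shows "Ck_fun k J g"
proof -
  have c: "continuous_map (prodtop J) euclideanreal g"
    using Ck_fun_continuous[OF assms(1)] by (rule continuous_map_eq) (use eq in auto)
  show ?thesis
  proof (cases k)
    case 0
    then show ?thesis using c by simp
  next
    case (Suc k')
    have "\<exists>g'. (\<forall>y\<in>J \<rightarrow>\<^sub>E UNIV. ((\<lambda>t. g (y(j := t))) has_real_derivative g' y) (at (y j))) \<and> Ck_fun k' J g'"
      if j: "j \<in> J" for j
    proof -
      obtain g' where g': "\<And>y. y\<in>J \<rightarrow>\<^sub>E UNIV \<Longrightarrow> ((\<lambda>t. f (y(j := t))) has_real_derivative g' y) (at (y j))" "Ck_fun k' J g'"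
        using assms(1) Suc j by fastforce
      have "(\<lambda>t. f (y(j := t))) = (\<lambda>t. g (y(j := t)))" if "y \<in> J \<rightarrow>\<^sub>E UNIV" for y
        using eq update_PiE_UNIV[OF that j] by blast
      then show ?thesis using g' by (intro exI[of _ g']) metis
    qed
    then show ?thesis using Suc c by simp
  qed
qed

lemma smooth_fun_partial:
  assumes "smooth_fun J f"
  obtains g where "\<And>j. j \<in> J \<Longrightarrow> smooth_fun J (g j)"
    "\<And>j y. j \<in> J \<Longrightarrow> y \<in> J \<rightarrow>\<^sub>E UNIV \<Longrightarrow> ((\<lambda>t. f (y(j := t))) has_real_derivative g j y) (at (y j))"
proof -
  have "\<exists>g. smooth_fun J g \<and> (\<forall>y\<in>J \<rightarrow>\<^sub>E UNIV. ((\<lambda>t. f (y(j := t))) has_real_derivative g y) (at (y j)))"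
    if j: "j \<in> J" for j
  proof -
    have "Ck_fun (Suc k) J f" for k using assms by (simp add: smooth_fun_def)
    then have "\<forall>k. \<exists>g. (\<forall>y\<in>J \<rightarrow>\<^sub>E UNIV. ((\<lambda>t. f (y(j := t))) has_real_derivative g y) (at (y j))) \<and> Ck_fun k J g"
      using j by simp
    then obtain g where g: "\<And>k y. y\<in>J \<rightarrow>\<^sub>E UNIV \<Longrightarrow> ((\<lambda>t. f (y(j := t))) has_real_derivative g k y) (at (y j))"
      "\<And>k. Ck_fun k J (g k)"
      by metis
    have "g k y = g 0 y" if "y \<in> J \<rightarrow>\<^sub>E UNIV" for k y using DERIV_unique[OF g(1) g(1)] that by blast
    then have "Ck_fun k J (g 0)" for k using Ck_fun_cong[OF g(2)] by blast
    then show ?thesis using g(1) unfolding smooth_fun_def by metis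
  qed
  then show ?thesis using that by metis
qed

section \<open>Smooth kernels supported in a box\<close>

text \<open>The properties of a mollifying kernel that survive differentiation. Sign and total mass
  are left out, since partial derivatives have neither.\<close>

definition kern :: "'i set \<Rightarrow> real \<Rightarrow> (('i \<Rightarrow> real) \<Rightarrow> real) \<Rightarrow> bool" where
  "kern J r \<zeta> \<longleftrightarrow> smooth_fun J \<zeta> \<and> (\<forall>y\<in>J \<rightarrow>\<^sub>E UNIV. (\<exists>j\<in>J. r < \<bar>y j\<bar>) \<longrightarrow> \<zeta> y = 0)"

lemma kern_continuous: "kern J r \<zeta> \<Longrightarrow> continuous_map (prodtop J) euclideanreal \<zeta>"
  using Ck_fun_continuous by (auto simp: kern_def smooth_fun_def)

lemma kern_bounded:
  assumes "kern J r \<zeta>"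
  obtains B where "0 \<le> B" "\<And>y. y \<in> J \<rightarrow>\<^sub>E UNIV \<Longrightarrow> \<bar>\<zeta> y\<bar> \<le> B"
proof -
  have "compactin (prodtop J) (\<Pi>\<^sub>E j\<in>J. {- r..r})"
    by (simp add: compactin_PiE)
  then have "compactin euclideanreal (\<zeta> ` (\<Pi>\<^sub>E j\<in>J. {- r..r}))"
    using kern_continuous[OF assms] by (rule image_compactin)
  then have "bounded (\<zeta> ` (\<Pi>\<^sub>E j\<in>J. {- r..r}))" by (simp add: compact_imp_bounded)
  then obtain B where B: "\<And>y. y \<in> (\<Pi>\<^sub>E j\<in>J. {- r..r}) \<Longrightarrow> \<bar>\<zeta> y\<bar> \<le> B"
    by (auto simp: bounded_iff)
  have "\<bar>\<zeta> y\<bar> \<le> max 0 B" if "y \<in> J \<rightarrow>\<^sub>E UNIV" for y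
  proof (cases "\<exists>j\<in>J. r < \<bar>y j\<bar>")
    case True
    then have "\<zeta> y = 0" using assms that unfolding kern_def by blast
    then show ?thesis by simp
  next
    case False
    then have "y \<in> (\<Pi>\<^sub>E j\<in>J. {- r..r})" using that by (force simp: PiE_iff abs_le_iff not_less)
    then have "\<bar>\<zeta> y\<bar> \<le> B" by (rule B)
    then show ?thesis by simp
  qed
  then show ?thesis using that[of "max 0 B"] by simp
qed

lemma kern_partial:
  assumes "kern J r \<zeta>"
  obtains g where "\<And>j. j \<in> J \<Longrightarrow> kern J r (g j)"
    "\<And>j y. j \<in> J \<Longrightarrow> y \<in> J \<rightarrow>\<^sub>E UNIV \<Longrightarrow> ((\<lambda>t. \<zeta> (y(j := t))) has_real_derivative g j y) (at (y j))"
proof -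
  obtain g where g: "\<And>j. j \<in> J \<Longrightarrow> smooth_fun J (g j)"
    "\<And>j y. j \<in> J \<Longrightarrow> y \<in> J \<rightarrow>\<^sub>E UNIV \<Longrightarrow> ((\<lambda>t. \<zeta> (y(j := t))) has_real_derivative g j y) (at (y j))"
    by (rule smooth_fun_partial[of J \<zeta>]) (use assms in \<open>simp add: kern_def\<close>, blast)
  have "g j y = 0" if j: "j \<in> J" and y: "y \<in> J \<rightarrow>\<^sub>E UNIV" and i: "i \<in> J" "r < \<bar>y i\<bar>" for i j y
  proof -
    \<comment> \<open>If the coordinate that leaves the box is the one being varied, it must be kept
      outside the box; otherwise every value is allowed.\<close>
    define S where "S = (if i = j then {t. r < \<bar>t\<bar>} else UNIV)"
    have S: "open S" "y j \<in> S"
      using i by (auto simp: S_def intro!: open_Collect_less continuous_intros)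
    have z: "0 = \<zeta> (y(j := t))" if "t \<in> S" for t
    proof -
      have "r < \<bar>(y(j := t)) i\<bar>" using that i by (auto simp: S_def)
      then show ?thesis using assms update_PiE_UNIV[OF y j] i(1) unfolding kern_def by metis
    qed
    have "((\<lambda>t. \<zeta> (y(j := t))) has_real_derivative 0) (at (y j))"
      by (rule has_field_derivative_transform_within_open[OF DERIV_const S z])
    from DERIV_unique[OF g(2)[OF j y] this] show ?thesis .
  qed
  then have "kern J r (g j)" if "j \<in> J" for j
    using g(1) that unfolding kern_def by blast
  then show ?thesis using that g(2) by blast
qed

lemma extensional_off: "y \<in> J \<rightarrow>\<^sub>E UNIV \<Longrightarrow> y' \<in> J \<rightarrow>\<^sub>E UNIV \<Longrightarrow> i \<notin> J \<Longrightarrow> y' i = y i"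
  by (metis PiE_arb)

lemma kern_Lipschitz:
  assumes J: "finite J" and "kern J r \<zeta>"
  obtains B where "0 \<le> B" "\<And>y y'. y \<in> J \<rightarrow>\<^sub>E UNIV \<Longrightarrow> y' \<in> J \<rightarrow>\<^sub>E UNIV \<Longrightarrow>
    \<bar>\<zeta> y' - \<zeta> y\<bar> \<le> B * (\<Sum>j\<in>J. \<bar>y' j - y j\<bar>)"
proof -
  obtain g where g: "\<And>j. j \<in> J \<Longrightarrow> kern J r (g j)"
    "\<And>j y. j \<in> J \<Longrightarrow> y \<in> J \<rightarrow>\<^sub>E UNIV \<Longrightarrow> ((\<lambda>t. \<zeta> (y(j := t))) has_real_derivative g j y) (at (y j))"
    using kern_partial[OF assms(2)] by blast
  have "\<exists>B. 0 \<le> B \<and> (\<forall>y\<in>J \<rightarrow>\<^sub>E UNIV. \<bar>g j y\<bar> \<le> B)" if "j \<in> J" for j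
    by (rule kern_bounded[OF g(1)[OF that]]) blast
  then have "\<forall>j. \<exists>B. j \<in> J \<longrightarrow> 0 \<le> B \<and> (\<forall>y\<in>J \<rightarrow>\<^sub>E UNIV. \<bar>g j y\<bar> \<le> B)" by blast
  from choice[OF this] obtain B where
    B: "\<And>j. j \<in> J \<Longrightarrow> 0 \<le> B j" "\<And>j y. j \<in> J \<Longrightarrow> y\<in>J \<rightarrow>\<^sub>E UNIV \<Longrightarrow> \<bar>g j y\<bar> \<le> B j" by blast
  define C where "C = (\<Sum>j\<in>J. B j)"
  have C: "0 \<le> C" "\<And>j. j \<in> J \<Longrightarrow> B j \<le> C"
    using B(1) member_le_sum[of _ J B] J by (auto simp: C_def sum_nonneg)
  show ?thesis
  proof (rule that[OF C(1)])
    fix y y' :: "'a \<Rightarrow> real" assume y: "y \<in> J \<rightarrow>\<^sub>E UNIV" "y' \<in> J \<rightarrow>\<^sub>E UNIV"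
    have "\<bar>\<zeta> y' - \<zeta> y - (\<Sum>j\<in>J. 0 * (y' j - y j))\<bar> \<le> C * (\<Sum>j\<in>J. \<bar>y' j - y j\<bar>)"
    proof (rule partial_derivatives_expansion[where Y="J \<rightarrow>\<^sub>E UNIV" and g=g])
      show "\<bar>g j u - 0\<bar> \<le> C" if "u \<in> J \<rightarrow>\<^sub>E UNIV" "j \<in> J" for u j
        using B(2)[OF that(2,1)] C(2)[OF that(2)] by simp
      show "y(j := t) \<in> J \<rightarrow>\<^sub>E UNIV" if "y \<in> J \<rightarrow>\<^sub>E UNIV" "j \<in> J" for y :: "'a \<Rightarrow> real" and j t
        using that by (rule update_PiE_UNIV)
    qed (use J y(1) g(2) extensional_off[OF y] in \<open>blast+\<close>)
    then show "\<bar>\<zeta> y' - \<zeta> y\<bar> \<le> C * (\<Sum>j\<in>J. \<bar>y' j - y j\<bar>)" by simp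
  qed
qed

lemma kern_expansion:
  assumes J: "finite J" and g: "\<And>j. j \<in> J \<Longrightarrow> kern J r (g j)"
    "\<And>j y. j \<in> J \<Longrightarrow> y \<in> J \<rightarrow>\<^sub>E UNIV \<Longrightarrow> ((\<lambda>t. \<zeta> (y(j := t))) has_real_derivative g j y) (at (y j))"
  obtains B where "0 \<le> B" "\<And>y y'. y \<in> J \<rightarrow>\<^sub>E UNIV \<Longrightarrow> y' \<in> J \<rightarrow>\<^sub>E UNIV \<Longrightarrow>
    \<bar>\<zeta> y' - \<zeta> y - (\<Sum>j\<in>J. g j y * (y' j - y j))\<bar> \<le> B * (\<Sum>j\<in>J. \<bar>y' j - y j\<bar>)\<^sup>2"
proof -
  have "\<exists>B. 0 \<le> B \<and> (\<forall>y\<in>J \<rightarrow>\<^sub>E UNIV. \<forall>y'\<in>J \<rightarrow>\<^sub>E UNIV. \<bar>g j y' - g j y\<bar> \<le> B * (\<Sum>j\<in>J. \<bar>y' j - y j\<bar>))"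
    if "j \<in> J" for j
    by (rule kern_Lipschitz[OF J g(1)[OF that]]) blast
  then have "\<forall>j. \<exists>B. j \<in> J \<longrightarrow> 0 \<le> B \<and> (\<forall>y\<in>J \<rightarrow>\<^sub>E UNIV. \<forall>y'\<in>J \<rightarrow>\<^sub>E UNIV. \<bar>g j y' - g j y\<bar> \<le> B * (\<Sum>j\<in>J. \<bar>y' j - y j\<bar>))"
    by blast
  from choice[OF this] obtain B where
    B': "\<forall>j. j \<in> J \<longrightarrow> 0 \<le> B j \<and> (\<forall>y\<in>J \<rightarrow>\<^sub>E UNIV. \<forall>y'\<in>J \<rightarrow>\<^sub>E UNIV. \<bar>g j y' - g j y\<bar> \<le> B j * (\<Sum>j\<in>J. \<bar>y' j - y j\<bar>))" ..
  have B: "\<And>j. j \<in> J \<Longrightarrow> 0 \<le> B j"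
    "\<And>j y y'. j \<in> J \<Longrightarrow> y\<in>J \<rightarrow>\<^sub>E UNIV \<Longrightarrow> y'\<in>J \<rightarrow>\<^sub>E UNIV \<Longrightarrow> \<bar>g j y' - g j y\<bar> \<le> B j * (\<Sum>j\<in>J. \<bar>y' j - y j\<bar>)"
    using B' by simp_all
  define C where "C = (\<Sum>j\<in>J. B j)"
  have C: "0 \<le> C" "\<And>j. j \<in> J \<Longrightarrow> B j \<le> C"
    using B(1) member_le_sum[of _ J B] J by (auto simp: C_def sum_nonneg)
  show ?thesis
  proof (rule that[OF C(1)])
    fix y y' :: "'a \<Rightarrow> real" assume y: "y \<in> J \<rightarrow>\<^sub>E UNIV" "y' \<in> J \<rightarrow>\<^sub>E UNIV"
    let ?s = "\<Sum>j\<in>J. \<bar>y' j - y j\<bar>"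
    have s: "0 \<le> ?s" by (simp add: sum_nonneg)
    have "\<bar>\<zeta> y' - \<zeta> y - (\<Sum>j\<in>J. g j y * (y' j - y j))\<bar> \<le> (C * ?s) * ?s"
    proof (rule partial_derivatives_expansion[where Y="J \<rightarrow>\<^sub>E UNIV" and g=g])
      fix u j assume u: "u \<in> J \<rightarrow>\<^sub>E UNIV" "j \<in> J" "\<And>i. i \<in> J \<Longrightarrow> \<bar>u i - y i\<bar> \<le> \<bar>y' i - y i\<bar>"
      have "\<bar>g j u - g j y\<bar> \<le> B j * (\<Sum>j\<in>J. \<bar>u j - y j\<bar>)" by (rule B(2)[OF u(2) y(1) u(1)])
      also have "\<dots> \<le> C * ?s"
        using C u B(1) by (intro mult_mono sum_mono sum_nonneg) auto
      finally show "\<bar>g j u - g j y\<bar> \<le> C * ?s" .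
    next
      show "y(j := t) \<in> J \<rightarrow>\<^sub>E UNIV" if "y \<in> J \<rightarrow>\<^sub>E UNIV" "j \<in> J" for y :: "'a \<Rightarrow> real" and j t
        using that by (rule update_PiE_UNIV)
    qed (use J y(1) g(2) extensional_off[OF y] in \<open>blast+\<close>)
    then show "\<bar>\<zeta> y' - \<zeta> y - (\<Sum>j\<in>J. g j y * (y' j - y j))\<bar> \<le> C * ?s\<^sup>2"
      by (simp add: power2_eq_square mult.assoc)
  qed
qed

lemma kern_measurable:
  fixes \<zeta> :: "('i::countable \<Rightarrow> real) \<Rightarrow> real"
  assumes "kern J r \<zeta>"
  shows "\<zeta> \<in> borel_measurable (Pi\<^sub>M J (\<lambda>_. lborel))"
proof -
  have "(\<lambda>y. if y \<in> topspace (prodtop J) then \<zeta> y else 0) \<in> borel_measurable (Pi\<^sub>M J (\<lambda>_. lborel))"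
    by (rule borel_measurable_PiM_continuous) (use kern_continuous[OF assms] in \<open>simp_all only: closedin_topspace subtopology_topspace\<close>)
  then show ?thesis
    by (subst measurable_cong[where g="\<lambda>y. if y \<in> topspace (prodtop J) then \<zeta> y else 0"]) (auto simp: space_PiM)
qed

text \<open>The translation acts on the kernel, so that differentiating in \<open>z\<close> never touches \<open>V\<close>.\<close>

definition shift_conv :: "'i set \<Rightarrow> (('i \<Rightarrow> real) \<Rightarrow> real) \<Rightarrow> (('i \<Rightarrow> real) \<Rightarrow> real) \<Rightarrow> ('i \<Rightarrow> real) \<Rightarrow> real" where
  "shift_conv J V \<zeta> z = (\<integral>w. \<zeta> (\<lambda>j\<in>J. w j - z j) * V w \<partial>Pi\<^sub>M J (\<lambda>_. lborel))"

context
  fixes J :: "'i::countable set" and V :: "('i \<Rightarrow> real) \<Rightarrow> real"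
  assumes J: "finite J" and V: "integrable (Pi\<^sub>M J (\<lambda>_. lborel)) V"
begin

lemma shift_conv_integrable:
  assumes "kern J r \<zeta>"
  shows "integrable (Pi\<^sub>M J (\<lambda>_. lborel)) (\<lambda>w. \<zeta> (\<lambda>j\<in>J. w j - z j) * V w)"
proof -
  obtain B where B: "0 \<le> B" "\<And>y. y \<in> J \<rightarrow>\<^sub>E UNIV \<Longrightarrow> \<bar>\<zeta> y\<bar> \<le> B" using kern_bounded[OF assms] by blast
  have [measurable]: "V \<in> borel_measurable (Pi\<^sub>M J (\<lambda>_. lborel))" using V by auto
  note [measurable] = kern_measurable[OF assms]
  show ?thesis
  proof (rule Bochner_Integration.integrable_bound)
    show "integrable (Pi\<^sub>M J (\<lambda>_. lborel)) (\<lambda>w. B * V w)" using V by simp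
    show "AE w in Pi\<^sub>M J (\<lambda>_. lborel). norm (\<zeta> (\<lambda>j\<in>J. w j - z j) * V w) \<le> norm (B * V w)"
      using B by (intro AE_I2) (auto simp: abs_mult intro!: mult_right_mono)
  qed measurable
qed

lemma shift_conv_Lipschitz:
  assumes "kern J r \<zeta>"
  obtains B where "0 \<le> B"
    "\<And>z z'. \<bar>shift_conv J V \<zeta> z' - shift_conv J V \<zeta> z\<bar> \<le> B * (\<Sum>j\<in>J. \<bar>z' j - z j\<bar>)"
proof -
  let ?M = "Pi\<^sub>M J (\<lambda>_. lborel :: real measure)"
  obtain B where B: "0 \<le> B" "\<And>y y'. y \<in> J \<rightarrow>\<^sub>E UNIV \<Longrightarrow> y' \<in> J \<rightarrow>\<^sub>E UNIV \<Longrightarrow>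
    \<bar>\<zeta> y' - \<zeta> y\<bar> \<le> B * (\<Sum>j\<in>J. \<bar>y' j - y j\<bar>)" using kern_Lipschitz[OF J assms] by blast
  note i = shift_conv_integrable[OF assms]
  show ?thesis
  proof (rule that)
    show "0 \<le> B * (\<integral>w. \<bar>V w\<bar> \<partial>?M)" using B by simp
    fix z z' :: "'i \<Rightarrow> real"
    let ?s = "\<Sum>j\<in>J. \<bar>z' j - z j\<bar>"
    have "\<bar>shift_conv J V \<zeta> z' - shift_conv J V \<zeta> z\<bar>
        = \<bar>\<integral>w. (\<zeta> (\<lambda>j\<in>J. w j - z' j) - \<zeta> (\<lambda>j\<in>J. w j - z j)) * V w \<partial>?M\<bar>"
      unfolding shift_conv_def using i by (simp add: left_diff_distrib)
    also have "\<dots> \<le> (\<integral>w. B * ?s * \<bar>V w\<bar> \<partial>?M)"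
    proof (rule integral_abs_bound[THEN order_trans], rule integral_mono)
      show "integrable ?M (\<lambda>w. \<bar>(\<zeta> (\<lambda>j\<in>J. w j - z' j) - \<zeta> (\<lambda>j\<in>J. w j - z j)) * V w\<bar>)"
        unfolding left_diff_distrib using i by (intro integrable_abs Bochner_Integration.integrable_diff)
      fix w
      have "\<bar>\<zeta> (\<lambda>j\<in>J. w j - z' j) - \<zeta> (\<lambda>j\<in>J. w j - z j)\<bar> \<le> B * (\<Sum>j\<in>J. \<bar>(\<lambda>j\<in>J. w j - z' j) j - (\<lambda>j\<in>J. w j - z j) j\<bar>)"
        by (rule B(2)) auto
      also have "(\<Sum>j\<in>J. \<bar>(\<lambda>j\<in>J. w j - z' j) j - (\<lambda>j\<in>J. w j - z j) j\<bar>) = ?s" by (intro sum.cong) auto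
      finally show "\<bar>(\<zeta> (\<lambda>j\<in>J. w j - z' j) - \<zeta> (\<lambda>j\<in>J. w j - z j)) * V w\<bar> \<le> B * ?s * \<bar>V w\<bar>"
        unfolding abs_mult by (rule mult_right_mono) simp
    qed (use V in auto)
    finally show "\<bar>shift_conv J V \<zeta> z' - shift_conv J V \<zeta> z\<bar> \<le> B * (\<integral>w. \<bar>V w\<bar> \<partial>?M) * ?s"
      by (simp add: mult_ac)
  qed
qed

text \<open>The kernel is evaluated at \<open>w - z\<close>, so the partial derivatives in
  \<open>z\<close> are the convolutions with \<open>- g j\<close>; hence the plus sign in front of
  the linear term. The quadratic remainder of the kernel is integrated against
  \<open>\<bar>V w\<bar>\<close>.\<close>

lemma shift_conv_expansion:
  assumes \<zeta>: "kern J r \<zeta>" and g: "\<And>j. j \<in> J \<Longrightarrow> kern J r (g j)"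
    "\<And>j y. j \<in> J \<Longrightarrow> y \<in> J \<rightarrow>\<^sub>E UNIV \<Longrightarrow> ((\<lambda>t. \<zeta> (y(j := t))) has_real_derivative g j y) (at (y j))"
  obtains B where "0 \<le> B"
    "\<And>z z'. \<bar>shift_conv J V \<zeta> z' - shift_conv J V \<zeta> z + (\<Sum>j\<in>J. shift_conv J V (g j) z * (z' j - z j))\<bar>
      \<le> B * (\<Sum>j\<in>J. \<bar>z' j - z j\<bar>)\<^sup>2"
proof -
  let ?M = "Pi\<^sub>M J (\<lambda>_. lborel :: real measure)"
  obtain B where B: "0 \<le> B" "\<And>y y'. y \<in> J \<rightarrow>\<^sub>E UNIV \<Longrightarrow> y' \<in> J \<rightarrow>\<^sub>E UNIV \<Longrightarrow>
    \<bar>\<zeta> y' - \<zeta> y - (\<Sum>j\<in>J. g j y * (y' j - y j))\<bar> \<le> B * (\<Sum>j\<in>J. \<bar>y' j - y j\<bar>)\<^sup>2"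
    using kern_expansion[OF J g] by blast
  note i = shift_conv_integrable[OF \<zeta>] and ig = shift_conv_integrable[OF g(1)]
  show ?thesis
  proof (rule that)
    show "0 \<le> B * (\<integral>w. \<bar>V w\<bar> \<partial>?M)" using B by simp
    fix z z' :: "'i \<Rightarrow> real"
    let ?s = "\<Sum>j\<in>J. \<bar>z' j - z j\<bar>"
    let ?R = "\<lambda>w. \<zeta> (\<lambda>j\<in>J. w j - z' j) * V w - \<zeta> (\<lambda>j\<in>J. w j - z j) * V w
        + (\<Sum>j\<in>J. g j (\<lambda>j\<in>J. w j - z j) * V w * (z' j - z j))"
    have iR: "integrable ?M ?R"
      using i ig by (intro Bochner_Integration.integrable_add Bochner_Integration.integrable_diff
          Bochner_Integration.integrable_sum integrable_mult_left) auto
    have eq: "shift_conv J V \<zeta> z' - shift_conv J V \<zeta> z + (\<Sum>j\<in>J. shift_conv J V (g j) z * (z' j - z j)) = (\<integral>w. ?R w \<partial>?M)"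
      unfolding shift_conv_def using i ig by simp
    have le: "\<bar>\<integral>w. ?R w \<partial>?M\<bar> \<le> (\<integral>w. B * ?s\<^sup>2 * \<bar>V w\<bar> \<partial>?M)"
    proof (rule integral_abs_bound[THEN order_trans], rule integral_mono)
      show "integrable ?M (\<lambda>w. \<bar>?R w\<bar>)" using iR by (rule integrable_abs)
      fix w
      let ?y = "\<lambda>j\<in>J. w j - z j" and ?y' = "\<lambda>j\<in>J. w j - z' j"
      have "\<bar>\<zeta> ?y' - \<zeta> ?y - (\<Sum>j\<in>J. g j ?y * (?y' j - ?y j))\<bar> \<le> B * (\<Sum>j\<in>J. \<bar>?y' j - ?y j\<bar>)\<^sup>2"
        by (rule B(2)) auto
      moreover have "(\<Sum>j\<in>J. \<bar>?y' j - ?y j\<bar>) = ?s" by (intro sum.cong) auto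
      moreover have "(\<Sum>j\<in>J. g j ?y * (?y' j - ?y j)) = - (\<Sum>j\<in>J. g j ?y * (z' j - z j))"
        unfolding sum_negf[symmetric] by (intro sum.cong) (auto simp: algebra_simps)
      ultimately have b: "\<bar>\<zeta> ?y' - \<zeta> ?y + (\<Sum>j\<in>J. g j ?y * (z' j - z j))\<bar> \<le> B * ?s\<^sup>2"
        by (simp only: diff_minus_eq_add)
      have "(\<Sum>j\<in>J. g j ?y * V w * (z' j - z j)) = (\<Sum>j\<in>J. g j ?y * (z' j - z j)) * V w"
        unfolding sum_distrib_right by (intro sum.cong refl) (simp only: mult_ac)
      then have R: "?R w = (\<zeta> ?y' - \<zeta> ?y + (\<Sum>j\<in>J. g j ?y * (z' j - z j))) * V w"
        by (simp only: distrib_right left_diff_distrib)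
      show "\<bar>?R w\<bar> \<le> B * ?s\<^sup>2 * \<bar>V w\<bar>"
        unfolding R abs_mult by (rule mult_right_mono[OF b abs_ge_zero])
    qed (use V in auto)
    have r: "(\<integral>w. B * ?s\<^sup>2 * \<bar>V w\<bar> \<partial>?M) = B * (\<integral>w. \<bar>V w\<bar> \<partial>?M) * ?s\<^sup>2" by simp
    show "\<bar>shift_conv J V \<zeta> z' - shift_conv J V \<zeta> z + (\<Sum>j\<in>J. shift_conv J V (g j) z * (z' j - z j))\<bar>
        \<le> B * (\<integral>w. \<bar>V w\<bar> \<partial>?M) * ?s\<^sup>2"
      using le unfolding eq r .
  qed
qed

end

section \<open>Smooth functions of finitely many moments\<close>

lemma L2_D:
  assumes "prob_space M" "\<eta> \<in> L2 M"
  shows "\<eta> \<in> borel_measurable M" "integrable M (\<lambda>\<omega>. norm (\<eta> \<omega>))" "(\<integral>\<omega>. norm (\<eta> \<omega>) \<partial>M) \<le> L2norm M \<eta>"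
    "integrable M (\<lambda>\<omega>. (norm (\<eta> \<omega>))\<^sup>2)" "(\<integral>\<omega>. (norm (\<eta> \<omega>))\<^sup>2 \<partial>M) = (L2norm M \<eta>)\<^sup>2" "0 \<le> L2norm M \<eta>"
proof -
  interpret prob_space M by fact
  show m [measurable]: "\<eta> \<in> borel_measurable M" and i: "integrable M (\<lambda>\<omega>. (norm (\<eta> \<omega>))\<^sup>2)"
    using assms by (auto simp: L2_def)
  show n: "0 \<le> L2norm M \<eta>" and e: "(\<integral>\<omega>. (norm (\<eta> \<omega>))\<^sup>2 \<partial>M) = (L2norm M \<eta>)\<^sup>2"
    by (auto simp: L2norm_def)
  show "integrable M (\<lambda>\<omega>. norm (\<eta> \<omega>))" "(\<integral>\<omega>. norm (\<eta> \<omega>) \<partial>M) \<le> L2norm M \<eta>"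
    using Jensen_power_le[of "\<lambda>\<omega>. norm (\<eta> \<omega>)" 2 "L2norm M \<eta>"] i n e by auto
qed

lemma distr_L2_Pp:
  assumes "prob_space M" "\<xi> \<in> L2 M"
  shows "distr M borel \<xi> \<in> Pp 2"
proof -
  interpret prob_space M by fact
  note D = L2_D[OF assms]
  have "integrable (distr M borel \<xi>) (\<lambda>x. (norm x)\<^sup>2)"
    using D by (subst integrable_distr_eq) auto
  then show ?thesis using D(1) by (simp add: Pp_def prob_space_distr)
qed

lemma L2_add: "\<xi> \<in> L2 M \<Longrightarrow> \<eta> \<in> L2 M \<Longrightarrow> (\<lambda>\<omega>. \<xi> \<omega> + \<eta> \<omega>) \<in> L2 M"
proof -
  assume a: "\<xi> \<in> L2 M" "\<eta> \<in> L2 M"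
  then have [measurable]: "\<xi> \<in> borel_measurable M" "\<eta> \<in> borel_measurable M" by (auto simp: L2_def)
  have "integrable M (\<lambda>\<omega>. (norm (\<xi> \<omega> + \<eta> \<omega>))\<^sup>2)"
  proof (rule Bochner_Integration.integrable_bound)
    show "integrable M (\<lambda>\<omega>. 2 ^ 2 * ((norm (\<xi> \<omega>))\<^sup>2 + (norm (\<eta> \<omega>))\<^sup>2))"
      using a by (auto simp: L2_def)
    have "(norm (x + y))\<^sup>2 \<le> 2 ^ 2 * ((norm x)\<^sup>2 + (norm y)\<^sup>2)" for x y :: "real^'b"
      using power_mono[OF norm_triangle_ineq[of x y], of 2] power_sum_le[of "norm x" "norm y" 2] by (meson norm_ge_zero order_trans)
    then show "AE \<omega> in M. norm ((norm (\<xi> \<omega> + \<eta> \<omega>))\<^sup>2) \<le> norm (2 ^ 2 * ((norm (\<xi> \<omega>))\<^sup>2 + (norm (\<eta> \<omega>))\<^sup>2))"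
      by (intro AE_I2) simp
  qed measurable
  then show ?thesis by (simp add: L2_def)
qed

lemma has_wderiv_cong:
  assumes "has_wderiv U D" and eq: "\<And>\<mu>. \<mu> \<in> Pp 2 \<Longrightarrow> U \<mu> = U' \<mu>"
    and eqD: "\<And>\<mu> x. \<mu> \<in> Pp 2 \<Longrightarrow> D \<mu> x = D' \<mu> x"
  shows "has_wderiv U' D'"
  unfolding has_wderiv_def
proof (intro allI impI ballI)
  fix M :: "((real^'a) \<times> (real^'a)) measure" and \<xi> :: "(real^'a) \<times> (real^'a) \<Rightarrow> real^'a"
  assume M: "prob_space M" and \<xi>: "\<xi> \<in> L2 M"
  have m: "distr M borel \<xi> \<in> Pp 2" by (rule distr_L2_Pp[OF M \<xi>])
  have s: "distr M borel (\<lambda>\<omega>. \<xi> \<omega> + \<eta> \<omega>) \<in> Pp 2" if "\<eta> \<in> L2 M" for \<eta>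
    by (rule distr_L2_Pp[OF M L2_add]) (use \<xi> that in auto)
  show "(\<forall>\<eta>\<in>L2 M. integrable M (\<lambda>\<omega>. D' (distr M borel \<xi>) (\<xi> \<omega>) \<bullet> \<eta> \<omega>)) \<and>
        (\<forall>\<epsilon>>0. \<exists>\<delta>>0. \<forall>\<eta>\<in>L2 M. L2norm M \<eta> \<le> \<delta> \<longrightarrow>
           \<bar>U' (distr M borel (\<lambda>\<omega>. \<xi> \<omega> + \<eta> \<omega>)) - U' (distr M borel \<xi>)
             - (\<integral>\<omega>. D' (distr M borel \<xi>) (\<xi> \<omega>) \<bullet> \<eta> \<omega> \<partial>M)\<bar> \<le> \<epsilon> * L2norm M \<eta>)"
    using assms(1) M \<xi> unfolding has_wderiv_def by (simp add: eq[OF m, symmetric] eq[OF s, symmetric] eqD[OF m, symmetric])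
qed

lemma has_wderiv_const: "has_wderiv (\<lambda>_. c) (\<lambda>_ _. 0)"
  by (auto simp: has_wderiv_def L2_D intro!: exI[of _ 1])

lemma has_wderiv_add:
  assumes "has_wderiv U D" "has_wderiv U' D'"
  shows "has_wderiv (\<lambda>\<mu>. U \<mu> + U' \<mu>) (\<lambda>\<mu> x. D \<mu> x + D' \<mu> x)"
  unfolding has_wderiv_def
proof (intro allI impI ballI conjI)
  fix M :: "((real^'a) \<times> (real^'a)) measure" and \<xi> :: "(real^'a) \<times> (real^'a) \<Rightarrow> real^'a"
  assume M: "prob_space M" and \<xi>: "\<xi> \<in> L2 M"
  let ?m = "distr M borel \<xi>"
  have i: "integrable M (\<lambda>\<omega>. D ?m (\<xi> \<omega>) \<bullet> \<eta> \<omega>)" "integrable M (\<lambda>\<omega>. D' ?m (\<xi> \<omega>) \<bullet> \<eta> \<omega>)" if "\<eta> \<in> L2 M" for \<eta> :: "(real^'a) \<times> (real^'a) \<Rightarrow> real^'a"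
    using assms M \<xi> that by (auto simp: has_wderiv_def)
  then show "integrable M (\<lambda>\<omega>. (D ?m (\<xi> \<omega>) + D' ?m (\<xi> \<omega>)) \<bullet> \<eta> \<omega>)" if "\<eta> \<in> L2 M" for \<eta> :: "(real^'a) \<times> (real^'a) \<Rightarrow> real^'a"
    using that by (simp add: inner_add_left)
  fix \<epsilon> :: real assume "0 < \<epsilon>"
  then have \<epsilon>: "0 < \<epsilon> / 2" by simp
  obtain \<delta> where \<delta>: "0 < \<delta>" "\<And>\<eta>. \<eta> \<in> L2 M \<Longrightarrow> L2norm M \<eta> \<le> \<delta> \<Longrightarrow>
           \<bar>U (distr M borel (\<lambda>\<omega>. \<xi> \<omega> + \<eta> \<omega>)) - U ?m - (\<integral>\<omega>. D ?m (\<xi> \<omega>) \<bullet> \<eta> \<omega> \<partial>M)\<bar> \<le> \<epsilon> / 2 * L2norm M \<eta>"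
    using assms(1) M \<xi> \<epsilon> unfolding has_wderiv_def by meson
  obtain \<delta>' where \<delta>': "0 < \<delta>'" "\<And>\<eta>. \<eta> \<in> L2 M \<Longrightarrow> L2norm M \<eta> \<le> \<delta>' \<Longrightarrow>
           \<bar>U' (distr M borel (\<lambda>\<omega>. \<xi> \<omega> + \<eta> \<omega>)) - U' ?m - (\<integral>\<omega>. D' ?m (\<xi> \<omega>) \<bullet> \<eta> \<omega> \<partial>M)\<bar> \<le> \<epsilon> / 2 * L2norm M \<eta>"
    using assms(2) M \<xi> \<epsilon> unfolding has_wderiv_def by meson
  show "\<exists>\<delta>>0. \<forall>\<eta>\<in>L2 M. L2norm M \<eta> \<le> \<delta> \<longrightarrow>
           \<bar>U (distr M borel (\<lambda>\<omega>. \<xi> \<omega> + \<eta> \<omega>)) + U' (distr M borel (\<lambda>\<omega>. \<xi> \<omega> + \<eta> \<omega>)) - (U ?m + U' ?m)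
             - (\<integral>\<omega>. (D ?m (\<xi> \<omega>) + D' ?m (\<xi> \<omega>)) \<bullet> \<eta> \<omega> \<partial>M)\<bar> \<le> \<epsilon> * L2norm M \<eta>"
  proof (intro exI[of _ "min \<delta> \<delta>'"] conjI ballI impI)
    fix \<eta> :: "(real^'a) \<times> (real^'a) \<Rightarrow> real^'a" assume \<eta>: "\<eta> \<in> L2 M" "L2norm M \<eta> \<le> min \<delta> \<delta>'"
    have "(\<integral>\<omega>. (D ?m (\<xi> \<omega>) + D' ?m (\<xi> \<omega>)) \<bullet> \<eta> \<omega> \<partial>M) = (\<integral>\<omega>. D ?m (\<xi> \<omega>) \<bullet> \<eta> \<omega> \<partial>M) + (\<integral>\<omega>. D' ?m (\<xi> \<omega>) \<bullet> \<eta> \<omega> \<partial>M)"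
      using i[OF \<eta>(1)] by (simp add: inner_add_left)
    note eq = this
    have tri: "\<bar>a + a' - (b + b') - (d + d')\<bar> \<le> \<epsilon> * n"
      if "\<bar>a - b - d\<bar> \<le> \<epsilon> / 2 * n" "\<bar>a' - b' - d'\<bar> \<le> \<epsilon> / 2 * n" for a b d a' b' d' n
      using that by linarith
    show "\<bar>U (distr M borel (\<lambda>\<omega>. \<xi> \<omega> + \<eta> \<omega>)) + U' (distr M borel (\<lambda>\<omega>. \<xi> \<omega> + \<eta> \<omega>)) - (U ?m + U' ?m)
             - (\<integral>\<omega>. (D ?m (\<xi> \<omega>) + D' ?m (\<xi> \<omega>)) \<bullet> \<eta> \<omega> \<partial>M)\<bar> \<le> \<epsilon> * L2norm M \<eta>"
      unfolding eq by (rule tri[OF \<delta>(2) \<delta>'(2)]) (use \<eta> in auto)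
  qed (use \<delta> \<delta>' in auto)
qed

lemma Ck_P2_continuous:
  "Ck_P2 k m F \<Longrightarrow> continuous_map (prod_topology (wtop 2) (product_topology (\<lambda>_. euclidean) {..<m})) euclideanreal F"
  by (cases k) auto

lemma Ck_P2_const0: "Ck_P2 k m (\<lambda>_. 0)"
proof (induction k arbitrary: m)
  case (Suc k)
  have "(\<chi> l. 0) = (0 :: real^'a)" by (simp add: vec_eq_iff)
  then have "has_wderiv (\<lambda>\<mu>::(real^'a) measure. 0) (\<lambda>\<mu> x. \<chi> l. 0)" using has_wderiv_const[of 0] by simp
  then show ?case using Suc
    by (auto intro!: exI[of _ "\<lambda>_ _. 0"] exI[of _ "\<lambda>_. 0"])
qed simp

lemma Ck_P2_SucD:
  assumes "Ck_P2 (Suc k) m F"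
  shows "\<exists>D. (\<forall>X\<in>{..<m} \<rightarrow>\<^sub>E UNIV. has_wderiv (\<lambda>\<mu>. F (\<mu>, X)) (\<lambda>\<mu> x. \<chi> l. D l (\<mu>, X(m := x)))) \<and>
    (\<forall>l. Ck_P2 k (Suc m) (D l))"
  by (rule conjunct1[OF conjunct2[OF assms[unfolded Ck_P2.simps]]])

lemma Ck_P2_add: "Ck_P2 k m F \<Longrightarrow> Ck_P2 k m F' \<Longrightarrow> Ck_P2 k m (\<lambda>z. F z + F' z)"
proof (induction k arbitrary: m F F')
  case 0
  then show ?case by (simp add: continuous_map_add)
next
  case (Suc k)
  from Ck_P2_SucD[OF Suc.prems(1)] obtain D where
    "\<forall>X\<in>{..<m} \<rightarrow>\<^sub>E UNIV. has_wderiv (\<lambda>\<mu>. F (\<mu>, X)) (\<lambda>\<mu> x. \<chi> l. D l (\<mu>, X(m := x)))"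
    "\<forall>l. Ck_P2 k (Suc m) (D l)" by (elim exE conjE)
  note D = bspec[OF this(1)] spec[OF this(2)]
  from Ck_P2_SucD[OF Suc.prems(2)] obtain D' where
    "\<forall>X\<in>{..<m} \<rightarrow>\<^sub>E UNIV. has_wderiv (\<lambda>\<mu>. F' (\<mu>, X)) (\<lambda>\<mu> x. \<chi> l. D' l (\<mu>, X(m := x)))"
    "\<forall>l. Ck_P2 k (Suc m) (D' l)" by (elim exE conjE)
  note D' = bspec[OF this(1)] spec[OF this(2)]
  have w: "has_wderiv (\<lambda>\<mu>. F (\<mu>, X) + F' (\<mu>, X)) (\<lambda>\<mu> x. \<chi> l. D l (\<mu>, X(m := x)) + D' l (\<mu>, X(m := x)))"
    if "X \<in> {..<m} \<rightarrow>\<^sub>E UNIV" for X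
    using has_wderiv_add[OF D(1)[OF that] D'(1)[OF that]] by (simp add: plus_vec_def)
  have g: "\<exists>G. (\<forall>\<mu>\<in>Pp 2. \<forall>X \<in> {..<m} \<rightarrow>\<^sub>E UNIV.
             ((\<lambda>t. F (\<mu>, X(j := X j + t *\<^sub>R axis l 1)) + F' (\<mu>, X(j := X j + t *\<^sub>R axis l 1))) has_real_derivative G (\<mu>, X)) (at 0)) \<and>
          Ck_P2 k m G" if j: "j < m" for j l
  proof -
    obtain G where "\<forall>\<mu>\<in>Pp 2. \<forall>X \<in> {..<m} \<rightarrow>\<^sub>E UNIV.
             ((\<lambda>t. F (\<mu>, X(j := X j + t *\<^sub>R axis l 1))) has_real_derivative G (\<mu>, X)) (at 0)" "Ck_P2 k m G"
      using conjunct2[OF conjunct2[OF Suc.prems(1)[unfolded Ck_P2.simps]], rule_format, OF j, of l] by (elim exE conjE)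
    moreover obtain G' where "\<forall>\<mu>\<in>Pp 2. \<forall>X \<in> {..<m} \<rightarrow>\<^sub>E UNIV.
             ((\<lambda>t. F' (\<mu>, X(j := X j + t *\<^sub>R axis l 1))) has_real_derivative G' (\<mu>, X)) (at 0)" "Ck_P2 k m G'"
      using conjunct2[OF conjunct2[OF Suc.prems(2)[unfolded Ck_P2.simps]], rule_format, OF j, of l] by (elim exE conjE)
    ultimately show ?thesis
      using Suc.IH by (intro exI[of _ "\<lambda>z. G z + G' z"]) (auto intro!: DERIV_add)
  qed
  show ?case
    unfolding Ck_P2.simps
  proof (intro conjI)
    show "\<exists>D. (\<forall>X\<in>{..<m} \<rightarrow>\<^sub>E UNIV. has_wderiv (\<lambda>\<mu>. F (\<mu>, X) + F' (\<mu>, X)) (\<lambda>\<mu> x. \<chi> l. D l (\<mu>, X(m := x)))) \<and> (\<forall>l. Ck_P2 k (Suc m) (D l))"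
      using w Suc.IH[OF D(2) D'(2)] by (intro exI[of _ "\<lambda>l z. D l z + D' l z"]) auto
  qed (use g Suc.prems in \<open>auto intro: continuous_map_add\<close>)
qed

lemma Ck_P2_sum: "(\<And>i. i \<in> S \<Longrightarrow> Ck_P2 k m (F i)) \<Longrightarrow> Ck_P2 k m (\<lambda>z. \<Sum>i\<in>S. F i z)"
  by (induction S rule: infinite_finite_induct) (auto simp: Ck_P2_const0 intro: Ck_P2_add)

lemma Ck_P2_cong:
  assumes F: "Ck_P2 k m F" and eq: "\<And>\<mu> X. \<mu> \<in> Pp 2 \<Longrightarrow> X \<in> {..<m} \<rightarrow>\<^sub>E UNIV \<Longrightarrow> F (\<mu>, X) = F' (\<mu>, X)"
  shows "Ck_P2 k m F'"
proof -
  have c: "continuous_map (prod_topology (wtop 2) (product_topology (\<lambda>_. euclidean) {..<m})) euclideanreal F'"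
  proof (rule continuous_map_eq[OF Ck_P2_continuous[OF F]])
    fix z :: "(real^'a) measure \<times> (nat \<Rightarrow> real^'a)" assume "z \<in> topspace (prod_topology (wtop 2) (product_topology (\<lambda>_. euclidean :: (real^'a) topology) {..<m}))"
    then have "fst z \<in> Pp 2" "snd z \<in> {..<m} \<rightarrow>\<^sub>E UNIV"
      by (auto simp only: topspace_prod_topology topspace_product_topology topspace_euclidean topspace_wtop[OF zero_less_numeral] mem_Times_iff o_def)
    then show "F z = F' z" using eq[of "fst z" "snd z"] by simp
  qed
  show ?thesis
  proof (cases k)
    case 0
    then show ?thesis using c by simp
  next
    case (Suc k')
    have "\<exists>D. (\<forall>X\<in>{..<m} \<rightarrow>\<^sub>E UNIV. has_wderiv (\<lambda>\<mu>. F' (\<mu>, X)) (\<lambda>\<mu> x. \<chi> l. D l (\<mu>, X(m := x)))) \<and> (\<forall>l. Ck_P2 k' (Suc m) (D l))"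
    proof -
      from Ck_P2_SucD[OF F[unfolded Suc]] obtain D where
    "\<forall>X\<in>{..<m} \<rightarrow>\<^sub>E UNIV. has_wderiv (\<lambda>\<mu>. F (\<mu>, X)) (\<lambda>\<mu> x. \<chi> l. D l (\<mu>, X(m := x)))"
    "\<forall>l. Ck_P2 k' (Suc m) (D l)" by (elim exE conjE)
  note D = bspec[OF this(1)] spec[OF this(2)]
      show ?thesis
      proof (intro exI[of _ D] conjI ballI allI D(2))
        fix X :: "nat \<Rightarrow> real^'a" assume X: "X \<in> {..<m} \<rightarrow>\<^sub>E UNIV"
        show "has_wderiv (\<lambda>\<mu>. F' (\<mu>, X)) (\<lambda>\<mu> x. \<chi> l. D l (\<mu>, X(m := x)))"
          by (rule has_wderiv_cong[OF D(1)[OF X]]) (simp_all add: eq X)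
      qed
    qed
    moreover have "\<exists>G. (\<forall>\<mu>\<in>Pp 2. \<forall>X \<in> {..<m} \<rightarrow>\<^sub>E UNIV.
             ((\<lambda>t. F' (\<mu>, X(j := X j + t *\<^sub>R axis l 1))) has_real_derivative G (\<mu>, X)) (at 0)) \<and>
          Ck_P2 k' m G" if j: "j < m" for j l
    proof -
      obtain G where G: "\<forall>\<mu>\<in>Pp 2. \<forall>X \<in> {..<m} \<rightarrow>\<^sub>E UNIV.
             ((\<lambda>t. F (\<mu>, X(j := X j + t *\<^sub>R axis l 1))) has_real_derivative G (\<mu>, X)) (at 0)" "Ck_P2 k' m G"
        using conjunct2[OF conjunct2[OF F[unfolded Suc Ck_P2.simps]], rule_format, OF j, of l] by (elim exE conjE)
      have "X(j := v) \<in> {..<m} \<rightarrow>\<^sub>E UNIV" if "X \<in> {..<m} \<rightarrow>\<^sub>E UNIV" for X and v :: "real^'a"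
        using that j by (auto simp: PiE_iff extensional_def)
      then show ?thesis using G by (intro exI[of _ G]) (auto simp: eq[symmetric])
    qed
    ultimately show ?thesis using Suc c by simp
  qed
qed

context
  fixes J :: "'i::countable set" and V :: "('i \<Rightarrow> real) \<Rightarrow> real" and q :: "'i \<Rightarrow> real^'d \<Rightarrow> real"
    and q' :: "'i \<Rightarrow> 'd \<Rightarrow> real^'d \<Rightarrow> real" and R r :: real
  assumes J: "finite J" and V: "integrable (Pi\<^sub>M J (\<lambda>_. lborel)) V"
    and q: "\<And>i. i \<in> J \<Longrightarrow> test_fun R (q i)"
    and q': "\<And>i l. i \<in> J \<Longrightarrow> test_fun R (q' i l)"
      "\<And>i l x. i \<in> J \<Longrightarrow> ((\<lambda>t. q i (x + t *\<^sub>R axis l 1)) has_real_derivative q' i l x) (at 0)"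
begin

abbreviation moments :: "(real^'d) measure \<Rightarrow> 'i \<Rightarrow> real" where
  "moments \<mu> i \<equiv> (\<integral>x. q i x \<partial>\<mu>)"

lemma test_fun_integrable:
  assumes "prob_space \<mu>" "sets \<mu> = sets borel" "test_fun R f"
  shows "integrable \<mu> f"
proof -
  interpret prob_space \<mu> by fact
  obtain B where "\<And>x. \<bar>f x\<bar> \<le> B" using test_fun_bounded[OF assms(3)] by blast
  moreover have "f \<in> borel_measurable \<mu>"
    using test_fun_measurable[OF assms(3)] measurable_cong_sets[OF assms(2) refl] by blast
  ultimately show ?thesis by (intro integrable_const_bound[where B=B]) auto
qed

lemma moments_Lipschitz:
  assumes "0 < p"
  obtains B where "0 \<le> B" "\<And>\<mu> \<nu>. \<mu> \<in> Pp p \<Longrightarrow> \<nu> \<in> Pp p \<Longrightarrow>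
    (\<Sum>i\<in>J. \<bar>moments \<nu> i - moments \<mu> i\<bar>) \<le> B * wasserstein p \<mu> \<nu>"
proof -
  have "\<exists>B. 0 \<le> B \<and> (\<forall>x y. \<bar>q i x - q i y\<bar> \<le> B * dist x y)" if "i \<in> J" for i
    by (rule test_fun_Lipschitz[OF q[OF that]]) blast
  then have "\<forall>i. \<exists>B. i \<in> J \<longrightarrow> 0 \<le> B \<and> (\<forall>x y. \<bar>q i x - q i y\<bar> \<le> B * dist x y)" by blast
  from choice[OF this] obtain B where B: "\<And>i. i \<in> J \<Longrightarrow> 0 \<le> B i" "\<And>i x y. i \<in> J \<Longrightarrow> \<bar>q i x - q i y\<bar> \<le> B i * dist x y"
    by blast
  show ?thesis
  proof (rule that[of "\<Sum>i\<in>J. B i"])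
    show "0 \<le> (\<Sum>i\<in>J. B i)" using B by (simp add: sum_nonneg)
    fix \<mu> \<nu> :: "(real^'d) measure" assume m: "\<mu> \<in> Pp p" "\<nu> \<in> Pp p"
    have "\<bar>moments \<nu> i - moments \<mu> i\<bar> \<le> B i * wasserstein p \<mu> \<nu>" if i: "i \<in> J" for i
      using wasserstein_Lipschitz_integral[OF m assms B(1)[OF i] B(2)[OF i]] test_fun_integrable[OF _ _ q[OF i]] Pp_D[OF m(1)] Pp_D[OF m(2)]
      by (simp add: abs_minus_commute)
    then show "(\<Sum>i\<in>J. \<bar>moments \<nu> i - moments \<mu> i\<bar>) \<le> (\<Sum>i\<in>J. B i) * wasserstein p \<mu> \<nu>"
      unfolding sum_distrib_right by (rule sum_mono)
  qed
qed

lemma shift_conv_moments_continuous: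
  assumes "kern J r \<zeta>" "0 < p"
  shows "continuous_map (wtop p) euclideanreal (\<lambda>\<mu>. shift_conv J V \<zeta> (moments \<mu>))"
  unfolding continuous_map_wtop_euclidean[OF assms(2)]
proof (intro ballI allI impI)
  fix \<mu> :: "(real^'d) measure" and \<epsilon> :: real assume \<mu>: "\<mu> \<in> Pp p" and \<epsilon>: "0 < \<epsilon>"
  obtain B where B: "0 \<le> B"
    "\<And>z z'. \<bar>shift_conv J V \<zeta> z' - shift_conv J V \<zeta> z\<bar> \<le> B * (\<Sum>j\<in>J. \<bar>z' j - z j\<bar>)"
    using shift_conv_Lipschitz[OF J V assms(1)] by blast
  obtain C where C: "0 \<le> C" "\<And>\<mu> \<nu>. \<mu> \<in> Pp p \<Longrightarrow> \<nu> \<in> Pp p \<Longrightarrow>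
    (\<Sum>i\<in>J. \<bar>moments \<nu> i - moments \<mu> i\<bar>) \<le> C * wasserstein p \<mu> \<nu>"
    using moments_Lipschitz[OF assms(2)] by blast
  show "\<exists>\<delta>>0. \<forall>\<nu>\<in>Pp p. wasserstein p \<mu> \<nu> < \<delta> \<longrightarrow>
      dist (shift_conv J V \<zeta> (moments \<mu>)) (shift_conv J V \<zeta> (moments \<nu>)) < \<epsilon>"
  proof (intro exI[of _ "\<epsilon> / (B * C + 1)"] conjI ballI impI)
    have BC: "0 < B * C + 1" using B C by (simp add: add_nonneg_pos)
    then show "0 < \<epsilon> / (B * C + 1)" using \<epsilon> by simp
    fix \<nu> :: "(real^'d) measure" assume \<nu>: "\<nu> \<in> Pp p" and W: "wasserstein p \<mu> \<nu> < \<epsilon> / (B * C + 1)"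
    have "\<bar>shift_conv J V \<zeta> (moments \<nu>) - shift_conv J V \<zeta> (moments \<mu>)\<bar> \<le> B * (C * wasserstein p \<mu> \<nu>)"
      using B(2)[of "moments \<nu>" "moments \<mu>"] mult_left_mono[OF C(2)[OF \<mu> \<nu>] B(1)] by linarith
    also have "\<dots> \<le> (B * C + 1) * wasserstein p \<mu> \<nu>"
      using wasserstein_nonneg[OF assms(2), of \<mu> \<nu>] by (simp add: algebra_simps)
    also have "\<dots> < \<epsilon>" using W BC by (simp add: pos_less_divide_eq mult.commute)
    finally show "dist (shift_conv J V \<zeta> (moments \<mu>)) (shift_conv J V \<zeta> (moments \<nu>)) < \<epsilon>"
      by (simp add: dist_real_def abs_minus_commute)
  qed
qed

text \<open>Chain rule: moments change by the expectation of the gradient of \<open>q i\<close>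
  against \<eta> up to a quadratic error, and the convolution is expanded in the moments. The factor
  \<open>c\<close> will carry the space variables, which are frozen while the measure
  varies.\<close>

lemma has_wderiv_shift_conv:
  assumes \<zeta>: "kern J r \<zeta>" and g: "\<And>j. j \<in> J \<Longrightarrow> kern J r (g j)"
    "\<And>j y. j \<in> J \<Longrightarrow> y \<in> J \<rightarrow>\<^sub>E UNIV \<Longrightarrow> ((\<lambda>t. \<zeta> (y(j := t))) has_real_derivative g j y) (at (y j))"
  shows "has_wderiv (\<lambda>\<mu>. c * shift_conv J V \<zeta> (moments \<mu>))
    (\<lambda>\<mu> x. \<chi> l. \<Sum>i\<in>J. - c * shift_conv J V (g i) (moments \<mu>) * q' i l x)"
  unfolding has_wderiv_def
proof (intro allI impI ballI conjI)
  fix M :: "((real^'d) \<times> (real^'d)) measure" and \<xi> :: "(real^'d) \<times> (real^'d) \<Rightarrow> real^'d"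
  assume M: "prob_space M" and \<xi>: "\<xi> \<in> L2 M"
  interpret prob_space M by fact
  note D\<xi> = L2_D[OF M \<xi>]
  note [measurable] = D\<xi>(1)
  let ?m = "distr M borel \<xi>"
  let ?z = "moments ?m"
  have q'm [measurable]: "i \<in> J \<Longrightarrow> q' i l \<in> borel_measurable borel" for i l
    using q'(1) test_fun_measurable by blast
  have gm [measurable]: "i \<in> J \<Longrightarrow> (\<lambda>x. \<chi> l. q' i l x) \<in> borel_measurable borel" for i
    by (subst borel_measurable_euclidean_space) (auto simp: Basis_vec_def inner_axis)
  have lin: "(\<chi> l. \<Sum>i\<in>J. - c * shift_conv J V (g i) ?z * q' i l x) \<bullet> v
      = (\<Sum>i\<in>J. - c * shift_conv J V (g i) ?z * ((\<chi> l. q' i l x) \<bullet> v))" for x v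
  proof -
    have "(\<chi> l. \<Sum>i\<in>J. - c * shift_conv J V (g i) ?z * q' i l x) \<bullet> v
        = (\<Sum>l\<in>UNIV. \<Sum>i\<in>J. - c * shift_conv J V (g i) ?z * (q' i l x * v $ l))"
      by (simp only: inner_vec_def inner_real_def vec_lambda_beta sum_distrib_right mult.assoc)
    also have "\<dots> = (\<Sum>i\<in>J. \<Sum>l\<in>UNIV. - c * shift_conv J V (g i) ?z * (q' i l x * v $ l))" by (rule sum.swap)
    also have "\<dots> = (\<Sum>i\<in>J. - c * shift_conv J V (g i) ?z * ((\<chi> l. q' i l x) \<bullet> v))"
      by (simp only: inner_vec_def inner_real_def vec_lambda_beta sum_distrib_left)
    finally show ?thesis .
  qed
  have ib: "integrable M (\<lambda>\<omega>. (\<chi> l. q' i l (\<xi> \<omega>)) \<bullet> \<eta> \<omega>)" if i: "i \<in> J" and \<eta>: "\<eta> \<in> L2 M" for i \<eta>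
  proof -
    note D = L2_D[OF M \<eta>]
    note [measurable] = D(1) gm[OF i]
    have "\<exists>B. 0 \<le> B \<and> (\<forall>x. \<bar>q' i l x\<bar> \<le> B)" for l
      by (rule test_fun_bounded[OF q'(1)[OF i, of l]]) blast
    then obtain B where B: "\<And>l. 0 \<le> B l" "\<And>l x. \<bar>q' i l x\<bar> \<le> B l" by metis
    have nb: "norm (\<chi> l. q' i l x) \<le> (\<Sum>l\<in>UNIV. B l)" for x
    proof -
      have "norm (\<chi> l. q' i l x) \<le> (\<Sum>l\<in>UNIV. \<bar>(\<chi> l. q' i l x) $ l\<bar>)" by (rule norm_le_l1_cart)
      also have "\<dots> \<le> (\<Sum>l\<in>UNIV. B l)" unfolding vec_lambda_beta by (rule sum_mono) (rule B(2))
      finally show ?thesis .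
    qed
    have bd: "\<bar>(\<chi> l. q' i l (\<xi> \<omega>)) \<bullet> \<eta> \<omega>\<bar> \<le> (\<Sum>l\<in>UNIV. B l) * norm (\<eta> \<omega>)" for \<omega>
      by (rule order_trans[OF Cauchy_Schwarz_ineq2 mult_right_mono[OF nb norm_ge_zero]])
    show ?thesis
    proof (rule Bochner_Integration.integrable_bound)
      show "integrable M (\<lambda>\<omega>. (\<Sum>l\<in>UNIV. B l) * norm (\<eta> \<omega>))" using D(2) by simp
      show "AE \<omega> in M. norm ((\<chi> l. q' i l (\<xi> \<omega>)) \<bullet> \<eta> \<omega>) \<le> norm ((\<Sum>l\<in>UNIV. B l) * norm (\<eta> \<omega>))"
        unfolding real_norm_def by (rule AE_I2) (rule order_trans[OF bd abs_ge_self])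
    qed measurable
  qed
  show "integrable M (\<lambda>\<omega>. (\<chi> l. \<Sum>i\<in>J. - c * shift_conv J V (g i) ?z * q' i l (\<xi> \<omega>)) \<bullet> \<eta> \<omega>)"
    if "\<eta> \<in> L2 M" for \<eta>
    unfolding lin using ib[OF _ that] by (intro Bochner_Integration.integrable_sum integrable_mult_right) auto
  fix \<epsilon> :: real assume \<epsilon>: "0 < \<epsilon>"
  have "\<exists>B. 0 \<le> B \<and> (\<forall>x v. \<bar>q i (x + v) - q i x - (\<chi> l. q' i l x) \<bullet> v\<bar> \<le> B * (norm v)\<^sup>2)" if "i \<in> J" for i
    by (rule test_fun_expansion[OF q'(1)[OF that] q'(2)[OF that]]) blast+
  then have "\<forall>i. \<exists>B. i \<in> J \<longrightarrow> 0 \<le> B \<and> (\<forall>x v. \<bar>q i (x + v) - q i x - (\<chi> l. q' i l x) \<bullet> v\<bar> \<le> B * (norm v)\<^sup>2)" by blast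
  from choice[OF this] obtain B where B: "\<And>i. i \<in> J \<Longrightarrow> 0 \<le> B i"
    "\<And>i x v. i \<in> J \<Longrightarrow> \<bar>q i (x + v) - q i x - (\<chi> l. q' i l x) \<bullet> v\<bar> \<le> B i * (norm v)\<^sup>2" by blast
  have "\<exists>B. 0 \<le> B \<and> (\<forall>x y. \<bar>q i x - q i y\<bar> \<le> B * dist x y)" if "i \<in> J" for i
    by (rule test_fun_Lipschitz[OF q[OF that]]) blast
  then have "\<forall>i. \<exists>B. i \<in> J \<longrightarrow> 0 \<le> B \<and> (\<forall>x y. \<bar>q i x - q i y\<bar> \<le> B * dist x y)" by blast
  from choice[OF this] obtain L where L: "\<And>i. i \<in> J \<Longrightarrow> 0 \<le> L i" "\<And>i x y. i \<in> J \<Longrightarrow> \<bar>q i x - q i y\<bar> \<le> L i * dist x y"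
    by blast
  obtain C where C: "0 \<le> C"
    "\<And>z z'. \<bar>shift_conv J V \<zeta> z' - shift_conv J V \<zeta> z + (\<Sum>j\<in>J. shift_conv J V (g j) z * (z' j - z j))\<bar>
      \<le> C * (\<Sum>j\<in>J. \<bar>z' j - z j\<bar>)\<^sup>2"
    using shift_conv_expansion[OF J V \<zeta> g] by blast
  \<comment> \<open>The first summand is the remainder of the outer expansion, where moments move by
    at most \<open>L i\<close> times the norm; the second is the remainder of the moments, weighted
    with the outer derivatives.\<close>
  define K where "K = \<bar>c\<bar> * (C * (\<Sum>i\<in>J. L i)\<^sup>2 + (\<Sum>i\<in>J. \<bar>shift_conv J V (g i) ?z\<bar> * B i))"
  have K: "0 \<le> K" unfolding K_def using C(1) B(1) by (auto intro!: mult_nonneg_nonneg add_nonneg_nonneg sum_nonneg)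
  have main: "\<bar>c * shift_conv J V \<zeta> (moments (distr M borel (\<lambda>\<omega>. \<xi> \<omega> + \<eta> \<omega>))) - c * shift_conv J V \<zeta> ?z
      - (\<integral>\<omega>. (\<chi> l. \<Sum>i\<in>J. - c * shift_conv J V (g i) ?z * q' i l (\<xi> \<omega>)) \<bullet> \<eta> \<omega> \<partial>M)\<bar> \<le> K * (L2norm M \<eta>)\<^sup>2"
    if \<eta>: "\<eta> \<in> L2 M" for \<eta>
  proof -
    note D = L2_D[OF M \<eta>]
    note [measurable] = D(1)
    let ?N = "L2norm M \<eta>"
    let ?z' = "moments (distr M borel (\<lambda>\<omega>. \<xi> \<omega> + \<eta> \<omega>))"
    define b where "b i = (\<integral>\<omega>. (\<chi> l. q' i l (\<xi> \<omega>)) \<bullet> \<eta> \<omega> \<partial>M)" for i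
    have i1: "integrable M (\<lambda>\<omega>. q i (\<xi> \<omega>))" and i2: "integrable M (\<lambda>\<omega>. q i (\<xi> \<omega> + \<eta> \<omega>))" if "i \<in> J" for i
    proof -
      obtain T where "\<And>x. \<bar>q i x\<bar> \<le> T" using test_fun_bounded[OF q[OF \<open>i \<in> J\<close>]] by blast
      moreover note [measurable] = test_fun_measurable[OF q[OF \<open>i \<in> J\<close>]]
      ultimately show "integrable M (\<lambda>\<omega>. q i (\<xi> \<omega>))" "integrable M (\<lambda>\<omega>. q i (\<xi> \<omega> + \<eta> \<omega>))"
        by (auto intro!: integrable_const_bound[where B=T])
    qed
    have dz: "?z' i - ?z i = (\<integral>\<omega>. q i (\<xi> \<omega> + \<eta> \<omega>) - q i (\<xi> \<omega>) \<partial>M)" if i: "i \<in> J" for i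
      using i1[OF i] i2[OF i] test_fun_measurable[OF q[OF i]] by (simp add: integral_distr)
    have d1: "\<bar>?z' i - ?z i\<bar> \<le> L i * ?N" if i: "i \<in> J" for i
    proof -
      have "\<bar>?z' i - ?z i\<bar> \<le> (\<integral>\<omega>. \<bar>q i (\<xi> \<omega> + \<eta> \<omega>) - q i (\<xi> \<omega>)\<bar> \<partial>M)"
        unfolding dz[OF i] by (rule integral_abs_bound)
      also have "\<dots> \<le> (\<integral>\<omega>. L i * norm (\<eta> \<omega>) \<partial>M)"
      proof (rule integral_mono)
        show "\<bar>q i (\<xi> \<omega> + \<eta> \<omega>) - q i (\<xi> \<omega>)\<bar> \<le> L i * norm (\<eta> \<omega>)" for \<omega>
          using L(2)[OF i, of "\<xi> \<omega> + \<eta> \<omega>" "\<xi> \<omega>"] by (simp add: dist_norm)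
      qed (use i1[OF i] i2[OF i] D in auto)
      also have "\<dots> \<le> L i * ?N" using D(3) L(1)[OF i] by (simp add: mult_left_mono)
      finally show ?thesis .
    qed
    have d2: "\<bar>?z' i - ?z i - b i\<bar> \<le> B i * ?N\<^sup>2" if i: "i \<in> J" for i
    proof -
      have "?z' i - ?z i - b i = (\<integral>\<omega>. q i (\<xi> \<omega> + \<eta> \<omega>) - q i (\<xi> \<omega>) - (\<chi> l. q' i l (\<xi> \<omega>)) \<bullet> \<eta> \<omega> \<partial>M)"
        unfolding dz[OF i] b_def using i1[OF i] i2[OF i] ib[OF i \<eta>] by simp
      also have "\<bar>\<dots>\<bar> \<le> (\<integral>\<omega>. \<bar>q i (\<xi> \<omega> + \<eta> \<omega>) - q i (\<xi> \<omega>) - (\<chi> l. q' i l (\<xi> \<omega>)) \<bullet> \<eta> \<omega>\<bar> \<partial>M)"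
        by (rule integral_abs_bound)
      also have "\<dots> \<le> (\<integral>\<omega>. B i * (norm (\<eta> \<omega>))\<^sup>2 \<partial>M)"
      proof (rule integral_mono)
        show "\<bar>q i (\<xi> \<omega> + \<eta> \<omega>) - q i (\<xi> \<omega>) - (\<chi> l. q' i l (\<xi> \<omega>)) \<bullet> \<eta> \<omega>\<bar> \<le> B i * (norm (\<eta> \<omega>))\<^sup>2" for \<omega>
          by (rule B(2)[OF i])
        show "integrable M (\<lambda>\<omega>. \<bar>q i (\<xi> \<omega> + \<eta> \<omega>) - q i (\<xi> \<omega>) - (\<chi> l. q' i l (\<xi> \<omega>)) \<bullet> \<eta> \<omega>\<bar>)"
          using i1[OF i] i2[OF i] ib[OF i \<eta>] by (intro integrable_abs Bochner_Integration.integrable_diff)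
      qed (use D(4) in simp)
      finally show ?thesis using D(5) by simp
    qed
    have int: "(\<integral>\<omega>. (\<chi> l. \<Sum>i\<in>J. - c * shift_conv J V (g i) ?z * q' i l (\<xi> \<omega>)) \<bullet> \<eta> \<omega> \<partial>M)
        = - c * (\<Sum>i\<in>J. shift_conv J V (g i) ?z * b i)"
    proof -
      have "(\<integral>\<omega>. (\<chi> l. \<Sum>i\<in>J. - c * shift_conv J V (g i) ?z * q' i l (\<xi> \<omega>)) \<bullet> \<eta> \<omega> \<partial>M)
        = (\<Sum>i\<in>J. - c * shift_conv J V (g i) ?z * b i)"
        unfolding lin b_def using ib[OF _ \<eta>]
        by (subst Bochner_Integration.integral_sum) (auto intro!: sum.cong)
      then show ?thesis by (simp add: sum_distrib_left mult.assoc)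
    qed
    have "(\<Sum>j\<in>J. \<bar>?z' j - ?z j\<bar>)\<^sup>2 \<le> ((\<Sum>i\<in>J. L i) * ?N)\<^sup>2"
      unfolding sum_distrib_right using d1 by (intro power_mono sum_mono sum_nonneg) auto
    from order_trans[OF C(2)[of ?z' ?z] mult_left_mono[OF this C(1)]]
    have e1: "\<bar>shift_conv J V \<zeta> ?z' - shift_conv J V \<zeta> ?z + (\<Sum>j\<in>J. shift_conv J V (g j) ?z * (?z' j - ?z j))\<bar>
        \<le> C * (\<Sum>i\<in>J. L i)\<^sup>2 * ?N\<^sup>2"
      by (simp only: power_mult_distrib mult.assoc)
    have "\<bar>\<Sum>i\<in>J. shift_conv J V (g i) ?z * (?z' i - ?z i - b i)\<bar> \<le> (\<Sum>i\<in>J. \<bar>shift_conv J V (g i) ?z\<bar> * (B i * ?N\<^sup>2))"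
      by (rule order_trans[OF sum_abs sum_mono]) (unfold abs_mult, rule mult_left_mono[OF d2 abs_ge_zero])
    then have e2: "\<bar>\<Sum>i\<in>J. shift_conv J V (g i) ?z * (?z' i - ?z i - b i)\<bar> \<le> (\<Sum>i\<in>J. \<bar>shift_conv J V (g i) ?z\<bar> * B i) * ?N\<^sup>2"
      by (simp add: sum_distrib_right mult.assoc)
    \<comment> \<open>The total remainder splits into the remainder of the convolution and the
      remainders of the moments.\<close>
    have eq: "c * shift_conv J V \<zeta> ?z' - c * shift_conv J V \<zeta> ?z + c * (\<Sum>i\<in>J. shift_conv J V (g i) ?z * b i)
      = c * ((shift_conv J V \<zeta> ?z' - shift_conv J V \<zeta> ?z + (\<Sum>j\<in>J. shift_conv J V (g j) ?z * (?z' j - ?z j)))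
          - (\<Sum>i\<in>J. shift_conv J V (g i) ?z * (?z' i - ?z i - b i)))"
    proof -
      have "(\<Sum>i\<in>J. shift_conv J V (g i) ?z * (?z' i - ?z i - b i))
          = (\<Sum>i\<in>J. shift_conv J V (g i) ?z * (?z' i - ?z i)) - (\<Sum>i\<in>J. shift_conv J V (g i) ?z * b i)"
        by (simp only: right_diff_distrib[of _ _ "b _"] sum_subtractf)
      then show ?thesis by (simp only:) (simp add: algebra_simps del: sum_distrib_left)
    qed
    have le: "\<bar>c\<bar> * \<bar>a - b\<bar> \<le> \<bar>c\<bar> * (A + B)" if "\<bar>a\<bar> \<le> A" "\<bar>b\<bar> \<le> B" for a b A B :: real
      using that by (intro mult_left_mono) auto
    have K': "K * ?N\<^sup>2 = \<bar>c\<bar> * (C * (\<Sum>i\<in>J. L i)\<^sup>2 * ?N\<^sup>2 + (\<Sum>i\<in>J. \<bar>shift_conv J V (g i) ?z\<bar> * B i) * ?N\<^sup>2)"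
      by (simp only: K_def distrib_right distrib_left mult.assoc)
    have "\<bar>c * shift_conv J V \<zeta> ?z' - c * shift_conv J V \<zeta> ?z + c * (\<Sum>i\<in>J. shift_conv J V (g i) ?z * b i)\<bar> \<le> K * ?N\<^sup>2"
      unfolding eq K' abs_mult by (rule le[OF e1 e2])
    then show ?thesis unfolding int by simp
  qed
  show "\<exists>\<delta>>0. \<forall>\<eta>\<in>L2 M. L2norm M \<eta> \<le> \<delta> \<longrightarrow>
    \<bar>c * shift_conv J V \<zeta> (moments (distr M borel (\<lambda>\<omega>. \<xi> \<omega> + \<eta> \<omega>))) - c * shift_conv J V \<zeta> ?z
      - (\<integral>\<omega>. (\<chi> l. \<Sum>i\<in>J. - c * shift_conv J V (g i) ?z * q' i l (\<xi> \<omega>)) \<bullet> \<eta> \<omega> \<partial>M)\<bar> \<le> \<epsilon> * L2norm M \<eta>"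
  \<comment> \<open>A quadratic remainder is below \<epsilon> times the norm on this ball;
    \<open>K + 1\<close> excludes a division by 0.\<close>
  proof (intro exI[of _ "\<epsilon> / (K + 1)"] conjI ballI impI)
    show "0 < \<epsilon> / (K + 1)" using \<epsilon> K by simp
    fix \<eta> :: "(real^'d) \<times> (real^'d) \<Rightarrow> real^'d" assume \<eta>: "\<eta> \<in> L2 M" "L2norm M \<eta> \<le> \<epsilon> / (K + 1)"
    have N: "0 \<le> L2norm M \<eta>" using L2_D(6)[OF M \<eta>(1)] .
    have "K * (L2norm M \<eta>)\<^sup>2 = (K * L2norm M \<eta>) * L2norm M \<eta>" by (simp add: power2_eq_square)
    also have "\<dots> \<le> \<epsilon> * L2norm M \<eta>"
    proof (rule mult_right_mono[OF _ N])
      have "K * L2norm M \<eta> \<le> (K + 1) * L2norm M \<eta>" using N by (simp add: distrib_right)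
      also have "\<dots> \<le> \<epsilon>" using \<eta>(2) K by (simp add: pos_le_divide_eq mult.commute)
      finally show "K * L2norm M \<eta> \<le> \<epsilon>" .
    qed
    finally show "\<bar>c * shift_conv J V \<zeta> (moments (distr M borel (\<lambda>\<omega>. \<xi> \<omega> + \<eta> \<omega>))) - c * shift_conv J V \<zeta> ?z
      - (\<integral>\<omega>. (\<chi> l. \<Sum>i\<in>J. - c * shift_conv J V (g i) ?z * q' i l (\<xi> \<omega>)) \<bullet> \<eta> \<omega> \<partial>M)\<bar> \<le> \<epsilon> * L2norm M \<eta>"
      using main[OF \<eta>(1)] by linarith
  qed
qed

lemma term_continuous:
  fixes p :: "nat \<Rightarrow> real^'d \<Rightarrow> real"
  assumes \<zeta>: "kern J r \<zeta>" and p: "\<And>j. j < m \<Longrightarrow> test_fun R (p j)"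
  shows "continuous_map (prod_topology (wtop 2) (product_topology (\<lambda>_. euclidean) {..<m})) euclideanreal
      (\<lambda>z. c * shift_conv J V \<zeta> (moments (fst z)) * (\<Prod>j<m. p j (snd z j)))"
proof -
  let ?X = "prod_topology (wtop 2) (product_topology (\<lambda>_. euclidean :: (real^'d) topology) {..<m})"
  have 1: "continuous_map ?X euclideanreal (\<lambda>z. shift_conv J V \<zeta> (moments (fst z)))"
    using continuous_map_compose[OF continuous_map_fst shift_conv_moments_continuous[OF \<zeta>, of 2]] by (simp add: comp_def)
  have 2: "continuous_map ?X euclideanreal (\<lambda>z. p j (snd z j))" if j: "j \<in> {..<m}" for j
  proof -
    have "continuous_map ?X euclidean (\<lambda>z. snd z j)"
      using continuous_map_compose[OF continuous_map_snd continuous_map_product_projection[OF j]] by (simp add: comp_def)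
    moreover have "continuous_map euclidean euclideanreal (p j)"
      using p j Ck_vec_continuous unfolding test_fun_def smooth_vec_def by fastforce
    ultimately show ?thesis
      using continuous_map_compose[of ?X euclidean "\<lambda>z. snd z j" euclideanreal "p j"] by (simp add: comp_def)
  qed
  show ?thesis
    by (rule continuous_map_real_mult[OF continuous_map_real_mult_left[OF 1] continuous_map_prod[OF finite_lessThan 2]])
qed

text \<open>Up to finite sums, terms of this form are closed under every differentiation. A
  derivative in the measure replaces the kernel by its partial derivatives and appends a factor
  \<open>q' i l\<close> in a new variable; a derivative in a space variable replaces one factor
  \<open>p j\<close>. Hence the induction must vary \<open>m\<close>, \<zeta>, \<open>p\<close> and
  \<open>c\<close>.\<close>

lemma Ck_P2_shift_conv:
  fixes p :: "nat \<Rightarrow> real^'d \<Rightarrow> real"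
  shows "kern J r \<zeta> \<Longrightarrow> (\<And>j. j < m \<Longrightarrow> test_fun R (p j)) \<Longrightarrow>
    Ck_P2 k m (\<lambda>z. c * shift_conv J V \<zeta> (moments (fst z)) * (\<Prod>j<m. p j (snd z j)))"
proof (induction k arbitrary: m \<zeta> p c)
  case (0 m \<zeta> p c)
  show ?case
    unfolding Ck_P2.simps by (rule term_continuous[OF 0])
next
  case (Suc k m \<zeta> p c)
  note \<zeta> = Suc.prems(1) and p = Suc.prems(2)
  obtain g where g: "\<And>j. j \<in> J \<Longrightarrow> kern J r (g j)"
    "\<And>j y. j \<in> J \<Longrightarrow> y \<in> J \<rightarrow>\<^sub>E UNIV \<Longrightarrow> ((\<lambda>t. \<zeta> (y(j := t))) has_real_derivative g j y) (at (y j))"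
    using kern_partial[OF \<zeta>] by blast
  define D where "D l z = (\<Sum>i\<in>J. - c * shift_conv J V (g i) (moments (fst z))
      * (\<Prod>j<Suc m. (p(m := q' i l)) j (snd z j)))" for l and z :: "(real^'d) measure \<times> (nat \<Rightarrow> real^'d)"
  have D1: "Ck_P2 k (Suc m) (D l)" for l
    unfolding D_def[abs_def]
  proof (intro Ck_P2_sum Suc.IH g(1))
    fix i j assume "i \<in> J" "j < Suc m"
    then show "test_fun R ((p(m := q' i l)) j)" using p[of j] q'(1) by auto
  qed
  have D2: "has_wderiv (\<lambda>\<mu>. c * shift_conv J V \<zeta> (moments (fst (\<mu>, X))) * (\<Prod>j<m. p j (snd (\<mu>, X) j)))
      (\<lambda>\<mu> x. \<chi> l. D l (\<mu>, X(m := x)))" for X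
  proof -
    \<comment> \<open>The old space variables are fixed here, so their factors are absorbed into the
      constant.\<close>
    let ?P = "\<Prod>j<m. p j (X j)"
    have e: "(\<Prod>j<Suc m. (p(m := q' i l)) j ((X(m := x)) j)) = ?P * q' i l x" for i l x
      by (simp add: prod.lessThan_Suc)
    have D': "D l (\<mu>, X(m := x)) = (\<Sum>i\<in>J. - (c * ?P) * shift_conv J V (g i) (moments \<mu>) * q' i l x)" for l \<mu> x
      unfolding D_def snd_conv fst_conv e by (intro sum.cong refl) (simp add: mult_ac)
    have "has_wderiv (\<lambda>\<mu>. c * ?P * shift_conv J V \<zeta> (moments \<mu>)) (\<lambda>\<mu> x. \<chi> l. D l (\<mu>, X(m := x)))"
      unfolding D' by (rule has_wderiv_shift_conv[OF \<zeta> g])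
    then show ?thesis by (rule has_wderiv_cong) (simp_all add: mult_ac)
  qed
  have D3: "\<exists>G. (\<forall>\<mu>\<in>Pp 2. \<forall>X\<in>{..<m} \<rightarrow>\<^sub>E UNIV.
       ((\<lambda>t. c * shift_conv J V \<zeta> (moments (fst (\<mu>, X(j := X j + t *\<^sub>R axis l 1))))
          * (\<Prod>ja<m. p ja (snd (\<mu>, X(j := X j + t *\<^sub>R axis l 1)) ja))) has_real_derivative G (\<mu>, X)) (at 0)) \<and>
       Ck_P2 k m G" if j: "j < m" for j l
  proof -
    obtain p' where p': "\<And>l. test_fun R (p' l)"
      "\<And>l x. ((\<lambda>t. p j (x + t *\<^sub>R axis l 1)) has_real_derivative p' l x) (at 0)"
      by (rule test_fun_partial[OF p[OF j]]) blast
    define G where "G z = c * shift_conv J V \<zeta> (moments (fst z)) * (\<Prod>ja<m. (p(j := p' l)) ja (snd z ja))"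
      for z :: "(real^'d) measure \<times> (nat \<Rightarrow> real^'d)"
    have "Ck_P2 k m G"
      unfolding G_def[abs_def] using \<zeta> p p'(1) by (intro Suc.IH) auto
    moreover have "((\<lambda>t. c * shift_conv J V \<zeta> (moments (fst (\<mu>, X(j := X j + t *\<^sub>R axis l 1))))
          * (\<Prod>ja<m. p ja (snd (\<mu>, X(j := X j + t *\<^sub>R axis l 1)) ja))) has_real_derivative G (\<mu>, X)) (at 0)" for \<mu> X
    proof -
      let ?S = "{..<m} - {j}"
      have e: "(\<Prod>ja<m. f ja) = f j * (\<Prod>ja\<in>?S. f ja)" for f :: "nat \<Rightarrow> real"
        using j by (intro prod.remove) auto
      have 1: "(\<Prod>ja<m. p ja ((X(j := X j + t *\<^sub>R axis l 1)) ja)) = p j (X j + t *\<^sub>R axis l 1) * (\<Prod>ja\<in>?S. p ja (X ja))" for t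
        unfolding e by (intro arg_cong2[where f="(*)"] prod.cong) auto
      have 2: "(\<Prod>ja<m. (p(j := p' l)) ja (X ja)) = p' l (X j) * (\<Prod>ja\<in>?S. p ja (X ja))"
        unfolding e by (intro arg_cong2[where f="(*)"] prod.cong) auto
      show ?thesis
        unfolding G_def fst_conv snd_conv 1 2
        by (rule DERIV_cmult) (rule DERIV_cmult_right[OF p'(2)])
    qed
    ultimately show ?thesis by blast
  qed
  show ?case
    unfolding Ck_P2.simps
  proof (intro conjI allI impI)
    show "\<exists>D. (\<forall>X\<in>{..<m} \<rightarrow>\<^sub>E UNIV. has_wderiv (\<lambda>\<mu>. c * shift_conv J V \<zeta> (moments (fst (\<mu>, X))) * (\<Prod>j<m. p j (snd (\<mu>, X) j)))
        (\<lambda>\<mu> x. \<chi> l. D l (\<mu>, X(m := x)))) \<and> (\<forall>l. Ck_P2 k (Suc m) (D l))"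
      using D1 D2 by blast
  qed (rule term_continuous[OF \<zeta> p], assumption, rule D3)
qed

end

section \<open>Mollification as a function of moments\<close>

interpretation lborel_product: product_sigma_finite "\<lambda>_. lborel :: real measure"
  by standard

lemma PiM_lborel_translation:
  fixes J :: "'i set"
  assumes J: "finite J"
  shows "distr (Pi\<^sub>M J (\<lambda>_. lborel)) (Pi\<^sub>M J (\<lambda>_. lborel)) (\<lambda>w. \<lambda>j\<in>J. w j + z j) = Pi\<^sub>M J (\<lambda>_. lborel :: real measure)"
proof (rule lborel_product.PiM_eqI[OF J])
  let ?M = "Pi\<^sub>M J (\<lambda>_. lborel :: real measure)" and ?T = "\<lambda>w. \<lambda>j\<in>J. w j + (z j :: real)"
  have T: "?T \<in> measurable ?M ?M" by (rule measurable_restrict) simp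
  show "sets (distr ?M ?M ?T) = sets ?M" by simp
  fix A :: "'i \<Rightarrow> real set" assume A: "\<And>i. i \<in> J \<Longrightarrow> A i \<in> sets lborel"
  have B: "(\<lambda>x. x + z i) -` A i \<in> sets lborel" if "i \<in> J" for i
    using measurable_sets[of "\<lambda>x. x + z i" lborel lborel "A i"] A[OF that] by simp
  have "emeasure (distr ?M ?M ?T) (Pi\<^sub>E J A) = emeasure ?M (?T -` (Pi\<^sub>E J A) \<inter> space ?M)"
    using A J by (intro emeasure_distr[OF T] sets_PiM_I_finite) auto
  also have "?T -` (Pi\<^sub>E J A) \<inter> space ?M = Pi\<^sub>E J (\<lambda>i. (\<lambda>x. x + z i) -` A i)"
    by (auto simp: space_PiM PiE_iff)
  also have "emeasure ?M \<dots> = (\<Prod>i\<in>J. emeasure lborel ((\<lambda>x. x + z i) -` A i))"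
    using J B by (intro lborel_product.emeasure_PiM) auto
  also have "\<dots> = (\<Prod>i\<in>J. emeasure lborel (A i))"
  proof (rule prod.cong[OF refl])
    fix i assume i: "i \<in> J"
    have "emeasure lborel (A i) = emeasure (distr lborel borel ((+) (z i))) (A i)"
      by (simp add: lborel_distr_plus)
    also have "\<dots> = emeasure lborel ((+) (z i) -` A i)"
      using A[OF i] by (subst emeasure_distr) auto
    finally show "emeasure lborel ((\<lambda>x. x + z i) -` A i) = emeasure lborel (A i)"
      by (simp add: vimage_def add.commute)
  qed
  finally show "emeasure (distr ?M ?M ?T) (Pi\<^sub>E J A) = (\<Prod>i\<in>J. emeasure lborel (A i))" .
qed

text \<open>Substituting \<open>w = z + y\<close> moves the translation from the kernel back to
  \<open>V\<close>. This is the form in which the mollification is given, while the other form is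
  the one that can be differentiated.\<close>

lemma shift_conv_eq:
  fixes J :: "'i::countable set"
  assumes J: "finite J" and V: "integrable (Pi\<^sub>M J (\<lambda>_. lborel)) V" and \<zeta>: "kern J r \<zeta>"
  shows "shift_conv J V \<zeta> z = (\<integral>y. \<zeta> y * V (\<lambda>j\<in>J. z j + y j) \<partial>Pi\<^sub>M J (\<lambda>_. lborel))"
    "integrable (Pi\<^sub>M J (\<lambda>_. lborel)) (\<lambda>y. \<zeta> y * V (\<lambda>j\<in>J. z j + y j))"
proof -
  let ?M = "Pi\<^sub>M J (\<lambda>_. lborel :: real measure)" and ?T = "\<lambda>w. \<lambda>j\<in>J. w j + z j"
  have T: "?T \<in> measurable ?M ?M" by (rule measurable_restrict) simp
  have e: "?M = distr ?M ?M ?T" by (rule PiM_lborel_translation[OF J, symmetric])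
  note i = shift_conv_integrable[OF J V \<zeta>, of z]
  have c: "\<zeta> (\<lambda>j\<in>J. ?T y j - z j) * V (?T y) = \<zeta> y * V (\<lambda>j\<in>J. z j + y j)" if "y \<in> space ?M" for y
  proof -
    have "(\<lambda>j\<in>J. ?T y j - z j) = y" using that by (auto simp: space_PiM PiE_iff extensional_def)
    moreover have "?T y = (\<lambda>j\<in>J. z j + y j)" by (auto simp: add.commute)
    ultimately show ?thesis by simp
  qed
  have "shift_conv J V \<zeta> z = (\<integral>w. \<zeta> (\<lambda>j\<in>J. w j - z j) * V w \<partial>distr ?M ?M ?T)"
    using e by (simp add: shift_conv_def)
  also have "\<dots> = (\<integral>y. \<zeta> (\<lambda>j\<in>J. ?T y j - z j) * V (?T y) \<partial>?M)"
    using i by (intro integral_distr[OF T]) auto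
  also have "\<dots> = (\<integral>y. \<zeta> y * V (\<lambda>j\<in>J. z j + y j) \<partial>?M)"
    by (rule Bochner_Integration.integral_cong[OF refl c])
  finally show "shift_conv J V \<zeta> z = (\<integral>y. \<zeta> y * V (\<lambda>j\<in>J. z j + y j) \<partial>?M)" .
  have "integrable (distr ?M ?M ?T) (\<lambda>w. \<zeta> (\<lambda>j\<in>J. w j - z j) * V w)" using i e by simp
  then have "integrable ?M (\<lambda>y. \<zeta> (\<lambda>j\<in>J. ?T y j - z j) * V (?T y))" by (rule integrable_distr[OF T])
  then show "integrable ?M (\<lambda>y. \<zeta> y * V (\<lambda>j\<in>J. z j + y j))"
    by (subst (asm) Bochner_Integration.integrable_cong[OF refl c]) auto
qed

text \<open>One fixed \<open>n\<close>. The number of nodes is a parameter tied to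
  \<open>Ngrid\<close> by an assumption, which gives it a short name inside the locale.\<close>

locale mollifier =
  fixes n :: nat and I :: "real \<Rightarrow> real" and h :: "real^'d \<Rightarrow> real" and \<zeta> :: "(int^'d \<Rightarrow> real) \<Rightarrow> real"
    and U :: "(real^'d) measure \<Rightarrow> real" and N :: real
  assumes N: "N = Ngrid TYPE('d) n" and n: "3 \<le> n" and I: "profile n I" and h: "cutoff n h" and \<zeta>: "kernel n \<zeta>" and U: "C0_P 1 U"
begin

abbreviation J :: "(int^'d) set" where "J \<equiv> grid0 n"
abbreviation M :: "(int^'d \<Rightarrow> real) measure" where "M \<equiv> Pi\<^sub>M (grid0 n) (\<lambda>_. lborel)"

text \<open>The coordinate at 0 is not an independent variable; it is determined by the total mass 1.\<close>

definition full :: "(int^'d \<Rightarrow> real) \<Rightarrow> int^'d \<Rightarrow> real" where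
  "full w i = (if i = 0 then 1 - (\<Sum>j\<in>J. w j) else w i)"

definition wt :: "(int^'d \<Rightarrow> real) \<Rightarrow> int^'d \<Rightarrow> real" where
  "wt w i = N / (N + 1) * (full w i + 1 / N\<^sup>2)"

text \<open>The parameters for which \<open>wt\<close> is a probability vector: a compact
  simplex.\<close>

definition Sp :: "(int^'d \<Rightarrow> real) set" where
  "Sp = {w \<in> J \<rightarrow>\<^sub>E UNIV. \<forall>i\<in>grid n. 0 \<le> full w i + 1 / N\<^sup>2}"

definition nu :: "(int^'d \<Rightarrow> real) \<Rightarrow> (real^'d) measure" where
  "nu w = atomic (grid n) (wt w) (node n)"

text \<open>The value outside \<open>Sp\<close> is irrelevant: \<open>w\<close> stays in \<open>Sp\<close> as long as the kernel does not
  vanish.\<close>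

definition V :: "(int^'d \<Rightarrow> real) \<Rightarrow> real" where
  "V w = (if w \<in> Sp then U (nu w) else 0)"

text \<open>Bounds on all coordinates, the dependent one included, since each of them enters a
  weight. These bounds are what makes the weights nonnegative.\<close>

definition adm :: "(int^'d \<Rightarrow> real) set" where
  "adm = {y \<in> J \<rightarrow>\<^sub>E UNIV. \<forall>i\<in>grid n. \<bar>ycoord n y i\<bar> \<le> 1 / N\<^sup>2}"

text \<open>Away from the node 0 this is \<open>psi\<close>, written as a moment of a compactly
  supported function.\<close>

definition zc :: "(real^'d) measure \<Rightarrow> int^'d \<Rightarrow> real" where
  "zc \<mu> j = (\<integral>x. phi n I j x * h x \<partial>\<mu>)"

lemma N_pos: "0 < N" "1 \<le> N" "N \<noteq> 0"
proof -
  show "1 \<le> N" using Ngrid_ge[where 'd='d, of n, folded N] by (smt (verit) zero_le_power2)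
  then show "0 < N" "N \<noteq> 0" by auto
qed

lemma finite_J: "finite J" by simp

lemma card_grid: "real (card (grid n :: (int^'d) set)) = N"
  by (simp add: N Ngrid_def)

lemma card_J: "real (card J) = N - 1"
proof -
  have "0 < card (grid n :: (int^'d) set)" using zero_in_grid[of n] finite_grid[of n] unfolding card_gt_0_iff by blast
  then show ?thesis using card_grid by (simp add: card_Diff_singleton of_nat_diff)
qed

lemma sum_grid: "(\<Sum>i\<in>grid n. f i) = f 0 + (\<Sum>j\<in>J. f j)" for f :: "int^'d \<Rightarrow> real"
  by (rule sum.remove) auto

lemma full_sum: "(\<Sum>i\<in>grid n. full w i) = 1"
proof -
  have "(\<Sum>j\<in>J. full w j) = (\<Sum>j\<in>J. w j)" by (rule sum.cong) (auto simp: full_def)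
  then show ?thesis unfolding sum_grid by (simp add: full_def)
qed

lemma wt_sum: "(\<Sum>i\<in>grid n. wt w i) = 1"
proof -
  have "(\<Sum>i\<in>grid n. wt w i) = N / (N + 1) * ((\<Sum>i\<in>grid n. full w i) + real (card (grid n :: (int^'d) set)) * (1 / N\<^sup>2))"
    unfolding wt_def sum_distrib_left[symmetric] sum.distrib by simp
  also have "\<dots> = N / (N + 1) * (1 + 1 / N)"
    unfolding full_sum card_grid using N_pos by (simp add: power2_eq_square)
  also have "\<dots> = 1" using N_pos by (simp add: divide_simps)
  finally show ?thesis .
qed

lemma wt_nonneg: "w \<in> Sp \<Longrightarrow> i \<in> grid n \<Longrightarrow> 0 \<le> wt w i"
  unfolding wt_def Sp_def using N_pos by (intro mult_nonneg_nonneg) auto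

lemma nu_Pp: "w \<in> Sp \<Longrightarrow> nu w \<in> Pp p"
  unfolding nu_def using wt_nonneg wt_sum by (intro atomic_Pp) auto

lemma nu_dist:
  assumes "w \<in> Sp" "w' \<in> Sp"
  shows "wasserstein 1 (nu w) (nu w') \<le> (\<Sum>i\<in>grid n. \<bar>wt w i - wt w' i\<bar> * norm (node n i :: real^'d))"
  unfolding nu_def using wasserstein_atomic_weights_le[of "grid n" "wt w" "wt w'" "node n" 0] wt_nonneg assms wt_sum by simp

lemma coordinate_continuous: "i \<in> J \<Longrightarrow> continuous_map (prodtop J) euclideanreal (\<lambda>w. w i)"
  by (rule continuous_map_product_projection)

lemma full_continuous: "i \<in> grid n \<Longrightarrow> continuous_map (prodtop J) euclideanreal (\<lambda>w. full w i)"
  unfolding full_def by (cases "i = 0")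
    (auto intro!: continuous_map_diff continuous_map_sum coordinate_continuous)

lemma wt_continuous: "i \<in> grid n \<Longrightarrow> continuous_map (prodtop J) euclideanreal (\<lambda>w. wt w i)"
  unfolding wt_def by (intro continuous_map_real_mult_left continuous_map_add full_continuous) auto

lemma closedin_Sp: "closedin (prodtop J) Sp"
proof -
  have "closedin (prodtop J) {w \<in> topspace (prodtop J). full w i + 1 / N\<^sup>2 \<in> {0..}}" if "i \<in> grid n" for i
    by (rule closedin_continuous_map_preimage[where Y=euclideanreal])
      (use that in \<open>auto intro!: continuous_map_add full_continuous\<close>)
  then have "closedin (prodtop J) (\<Inter>i\<in>grid n. {w \<in> topspace (prodtop J). full w i + 1 / N\<^sup>2 \<in> {0..}})"
    by (intro closedin_Inter) (use zero_in_grid[of n] in \<open>blast+\<close>)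
  moreover have "(\<Inter>i\<in>grid n. {w \<in> topspace (prodtop J). full w i + 1 / N\<^sup>2 \<in> {0..}}) = Sp"
  proof (intro set_eqI iffI)
    fix w assume w: "w \<in> (\<Inter>i\<in>grid n. {w \<in> topspace (prodtop J). full w i + 1 / N\<^sup>2 \<in> {0..}})"
    have "w \<in> topspace (prodtop J)" using INT_D[OF w zero_in_grid] by simp
    moreover have "0 \<le> full w i + 1 / N\<^sup>2" if "i \<in> grid n" for i using INT_D[OF w that] by simp
    ultimately show "w \<in> Sp" by (simp add: Sp_def)
  next
    fix w assume w: "w \<in> Sp"
    show "w \<in> (\<Inter>i\<in>grid n. {w \<in> topspace (prodtop J). full w i + 1 / N\<^sup>2 \<in> {0..}})"
    proof (rule INT_I)
      fix i :: "int^'d" assume "i \<in> grid n"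
      then show "w \<in> {w \<in> topspace (prodtop J). full w i + 1 / N\<^sup>2 \<in> {0..}}" using w by (simp add: Sp_def)
    qed
  qed
  ultimately show ?thesis by simp
qed

lemma Sp_box: "Sp \<subseteq> (\<Pi>\<^sub>E j\<in>J. {- 1..2})"
proof
  fix w assume w: "w \<in> Sp"
  have "w j \<in> {- 1..2}" if j: "j \<in> J" for j
  proof -
    have lo: "0 \<le> full w i + 1 / N\<^sup>2" if "i \<in> grid n" for i using w that by (simp add: Sp_def)
    have N2: "1 / N\<^sup>2 \<le> 1" using N_pos by (simp add: one_le_power)
    \<comment> \<open>The shifted coordinates are nonnegative and sum to \<open>1 + 1 / N\<close>,
      so none of them exceeds 2.\<close>
    have "full w j + 1 / N\<^sup>2 \<le> (\<Sum>i\<in>grid n. full w i + 1 / N\<^sup>2)"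
      using j lo by (intro member_le_sum) auto
    also have "\<dots> = 1 + N * (1 / N\<^sup>2)" unfolding sum.distrib full_sum by (simp add: card_grid)
    also have "N * (1 / N\<^sup>2) = 1 / N" using N_pos by (simp add: power2_eq_square)
    also have "1 + 1 / N \<le> 2" using N_pos by (simp add: divide_le_eq_1)
    finally have "full w j + 1 / N\<^sup>2 \<le> 2" .
    moreover have "0 \<le> 1 / N\<^sup>2" by simp
    moreover have "w j = full w j" using j by (simp add: full_def)
    moreover have "0 \<le> full w j + 1 / N\<^sup>2" using lo j by blast
    ultimately have "- 1 \<le> w j" "w j \<le> 2" using N2 by linarith+
    then show ?thesis by simp
  qed
  then show "w \<in> (\<Pi>\<^sub>E j\<in>J. {- 1..2})" using w by (auto simp: Sp_def PiE_iff)
qed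

lemma nu_continuous: "continuous_map (subtopology (prodtop J) Sp) (wtop 1) nu"
proof -
  interpret Metric_space "Pp 1 :: (real^'d) measure set" "wasserstein 1" by (rule Metric_space_wasserstein) simp
  show ?thesis
    unfolding wtop_def continuous_map_to_metric
  proof (intro ballI allI impI)
    fix w and \<epsilon> :: real assume w: "w \<in> topspace (subtopology (prodtop J) Sp)" and \<epsilon>: "0 < \<epsilon>"
    then have wS: "w \<in> Sp" by simp
    define f where "f w' = (\<Sum>i\<in>grid n. \<bar>wt w i - wt w' i\<bar> * norm (node n i :: real^'d))" for w'
    have "continuous_map (prodtop J) euclideanreal f"
      unfolding f_def
      by (intro continuous_map_sum continuous_map_real_mult_right continuous_map_real_abs continuous_map_diff wt_continuous) auto
    then have o: "openin (prodtop J) {w' \<in> topspace (prodtop J). f w' \<in> {..<\<epsilon>}}"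
      by (rule openin_continuous_map_preimage) (simp flip: open_openin)
    show "\<exists>T. openin (subtopology (prodtop J) Sp) T \<and> w \<in> T \<and> (\<forall>y\<in>T. nu y \<in> mball (nu w) \<epsilon>)"
    proof (intro exI conjI)
      show "openin (subtopology (prodtop J) Sp) ({w' \<in> topspace (prodtop J). f w' \<in> {..<\<epsilon>}} \<inter> Sp)"
        using o by (rule openin_subtopology_Int)
      show "w \<in> {w' \<in> topspace (prodtop J). f w' \<in> {..<\<epsilon>}} \<inter> Sp"
        using w \<epsilon> by (simp add: f_def)
      show "\<forall>y\<in>{w' \<in> topspace (prodtop J). f w' \<in> {..<\<epsilon>}} \<inter> Sp. nu y \<in> mball (nu w) \<epsilon>"
      proof
        fix y assume "y \<in> {w' \<in> topspace (prodtop J). f w' \<in> {..<\<epsilon>}} \<inter> Sp"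
        then have y: "y \<in> Sp" "f y < \<epsilon>" by auto
        have "wasserstein 1 (nu w) (nu y) < \<epsilon>"
          using nu_dist[OF wS y(1)] y(2) unfolding f_def by (rule le_less_trans)
        then show "nu y \<in> mball (nu w) \<epsilon>" using nu_Pp[OF wS] nu_Pp[OF y(1)] by (simp only: in_mball)
      qed
    qed
  qed
qed

lemma U_nu_continuous: "continuous_map (subtopology (prodtop J) Sp) euclideanreal (\<lambda>w. U (nu w))"
  using continuous_map_compose[OF nu_continuous, of euclideanreal U] U by (simp add: C0_P_def comp_def)

text \<open>Continuity of \<open>U\<close> is all that is available, so boundedness comes from
  compactness of the simplex \<open>Sp\<close>. On its complement \<open>V\<close> is 0, and
  closedness of \<open>Sp\<close> makes this cut measurable.\<close>

lemma V_integrable: "integrable M V"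
proof -
  have comp: "compactin (prodtop J) Sp"
    by (rule closed_compactin[OF _ Sp_box closedin_Sp]) (simp add: compactin_PiE)
  then have "compactin (subtopology (prodtop J) Sp) Sp" by (simp add: compactin_subtopology)
  then have "compactin euclideanreal ((\<lambda>w. U (nu w)) ` Sp)" using U_nu_continuous by (rule image_compactin)
  then have "bounded ((\<lambda>w. U (nu w)) ` Sp)" by (simp add: compact_imp_bounded)
  then obtain B where B: "\<And>w. w \<in> Sp \<Longrightarrow> \<bar>U (nu w)\<bar> \<le> B" by (auto simp: bounded_iff)
  have [measurable]: "V \<in> borel_measurable M"
    unfolding V_def[abs_def] using closedin_Sp U_nu_continuous by (rule borel_measurable_PiM_continuous)
  let ?A = "\<Pi>\<^sub>E j\<in>J. {- 1..2 :: real}"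
  have "emeasure M ?A = (\<Prod>j\<in>J. emeasure lborel {- 1..2 :: real})"
    by (rule lborel_product.emeasure_PiM) auto
  also have "\<dots> = ennreal (3 ^ card J)" by (simp flip: ennreal_power)
  also have "\<dots> < \<infinity>" by simp
  finally have A: "emeasure M ?A < \<infinity>" .
  show ?thesis
  proof (rule integrableI_bounded_set[where A="?A" and B="max 0 B"])
    show "AE x in M. x \<in> ?A \<longrightarrow> norm (V x) \<le> max 0 B"
      using B by (intro AE_I2) (fastforce simp: V_def)
    show "AE x in M. x \<notin> ?A \<longrightarrow> V x = 0"
      using Sp_box by (intro AE_I2) (auto simp: V_def)
  qed (use A in \<open>auto intro!: sets_PiM_I_finite\<close>)
qed

lemma kernel_D:
  shows "kern J (1 / N ^ 3) \<zeta>" "\<And>y. y \<in> J \<rightarrow>\<^sub>E UNIV \<Longrightarrow> 0 \<le> \<zeta> y" "integrable M \<zeta>" "(\<integral>y. \<zeta> y \<partial>M) = 1"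
    "\<And>y. y \<in> J \<rightarrow>\<^sub>E UNIV \<Longrightarrow> y \<notin> Delta n \<Longrightarrow> \<zeta> y = 0"
proof -
  have cl: "prodtop J closure_of {y \<in> J \<rightarrow>\<^sub>E UNIV. \<zeta> y \<noteq> 0} = Delta n" using \<zeta> by (simp add: kernel_def)
  have "{y \<in> J \<rightarrow>\<^sub>E UNIV. \<zeta> y \<noteq> 0} \<subseteq> prodtop J closure_of {y \<in> J \<rightarrow>\<^sub>E UNIV. \<zeta> y \<noteq> 0}"
    by (rule closure_of_subset) auto
  then show out: "\<And>y. y \<in> J \<rightarrow>\<^sub>E UNIV \<Longrightarrow> y \<notin> Delta n \<Longrightarrow> \<zeta> y = 0"
    unfolding cl by blast
  show "kern J (1 / N ^ 3) \<zeta>"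
    unfolding kern_def
  proof (intro conjI ballI impI)
    show "smooth_fun J \<zeta>" using \<zeta> by (simp add: kernel_def)
    fix y :: "int^'d \<Rightarrow> real" assume y: "y \<in> J \<rightarrow>\<^sub>E UNIV" "\<exists>j\<in>J. 1 / N ^ 3 < \<bar>y j\<bar>"
    then have "y \<notin> Delta n" by (auto simp: Delta_def N not_le)
    then show "\<zeta> y = 0" using out y by blast
  qed
  show "\<And>y. y \<in> J \<rightarrow>\<^sub>E UNIV \<Longrightarrow> 0 \<le> \<zeta> y" using \<zeta> by (simp add: kernel_def)
  show "integrable M \<zeta>" "(\<integral>y. \<zeta> y \<partial>M) = 1" using \<zeta> by (auto simp: kernel_def has_bochner_integral_iff)
qed

text \<open>The bound is \<open>(N - 1) / N ^ 3\<close>, attained by the dependent coordinate as a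
  sum of \<open>N - 1\<close> free ones. The gap of \<open>1 / N ^ 3\<close> below 1/N^2 is the mass
  that remains available at every node.\<close>

lemma Delta_ycoord:
  assumes "y \<in> Delta n"
  shows "y \<in> J \<rightarrow>\<^sub>E UNIV" "i \<in> grid n \<Longrightarrow> \<bar>ycoord n y i\<bar> \<le> 1 / N\<^sup>2 - 1 / N ^ 3"
proof -
  show "y \<in> J \<rightarrow>\<^sub>E UNIV" using assms by (simp add: Delta_def N)
  have b: "\<bar>y j\<bar> \<le> 1 / N ^ 3" if "j \<in> J" for j using assms that by (simp add: Delta_def N)
  have N2: "1 / N\<^sup>2 - 1 / N ^ 3 = (N - 1) * (1 / N ^ 3)"
    using N_pos by (simp add: power2_eq_square power3_eq_cube field_simps)
  show "\<bar>ycoord n y i\<bar> \<le> 1 / N\<^sup>2 - 1 / N ^ 3" if i: "i \<in> grid n"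
  proof (cases "i = 0")
    case True
    have "\<bar>ycoord n y i\<bar> \<le> (\<Sum>j\<in>J. \<bar>y j\<bar>)" using True by (simp add: ycoord_def sum_abs)
    also have "\<dots> \<le> (\<Sum>j\<in>J. 1 / N ^ 3)" using b by (rule sum_mono)
    also have "\<dots> = (N - 1) * (1 / N ^ 3)" by (simp add: card_J[symmetric] del: card_Diff_insert)
    finally show ?thesis unfolding N2 .
  next
    case False
    \<comment> \<open>Ensures that a single free coordinate, of size \<open>1 / N ^ 3\<close>, also
      obeys the bound for the sum of all of them.\<close>
    have "2 \<le> N" using Ngrid_ge[where 'd='d, of n, folded N] n power_mono[of 3 "real n" 2] by simp
    then have "1 * (1 / N ^ 3) \<le> (N - 1) * (1 / N ^ 3)" by (intro mult_right_mono) auto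
    then show ?thesis unfolding N2 using False b[of i] i by (simp add: ycoord_def)
  qed
qed

lemma Delta_adm: "Delta n \<subseteq> adm"
proof
  fix y :: "int^'d \<Rightarrow> real" assume y: "y \<in> Delta n"
  have "0 \<le> 1 / N ^ 3" using N_pos by simp
  then have "\<bar>ycoord n y i\<bar> \<le> 1 / N\<^sup>2" if "i \<in> grid n" for i
    using Delta_ycoord(2)[OF y that] by linarith
  then show "y \<in> adm" using Delta_ycoord(1)[OF y] by (simp add: adm_def)
qed

lemma full_zc:
  assumes m: "prob_space \<mu>" "sets \<mu> = sets borel" and i: "i \<in> grid n"
  shows "full (\<lambda>j\<in>J. zc \<mu> j + y j) i = psi n I h i \<mu> + ycoord n y i"
proof -
  have z: "zc \<mu> j = psi n I h j \<mu>" if "j \<in> J" for j using that by (simp add: zc_def psi_def)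
  have s: "(\<Sum>j\<in>J. zc \<mu> j) = 1 - psi n I h 0 \<mu>"
    using psi_sum[OF I n h m] z unfolding sum_grid by simp
  show ?thesis
    using z[of i] i s by (auto simp: full_def ycoord_def sum.distrib)
qed

lemma shifted_in_Sp:
  assumes m: "prob_space \<mu>" "sets \<mu> = sets borel" and y: "y \<in> adm"
  shows "(\<lambda>j\<in>J. zc \<mu> j + y j) \<in> Sp"
proof -
  have "0 \<le> full (\<lambda>j\<in>J. zc \<mu> j + y j) i + 1 / N\<^sup>2" if i: "i \<in> grid n" for i
  proof -
    have "\<bar>ycoord n y i\<bar> \<le> 1 / N\<^sup>2" using y i by (simp add: adm_def)
    then show ?thesis
      using psi_nonneg[OF I n h m, of i] unfolding full_zc[OF m i] by (simp add: abs_le_iff)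
  qed
  then show ?thesis unfolding Sp_def by auto
qed

lemma mu_n_eq:
  assumes m: "prob_space \<mu>" "sets \<mu> = sets borel"
  shows "mu_n n I h \<mu> y = nu (\<lambda>j\<in>J. zc \<mu> j + y j)"
proof -
  have e: "wt (\<lambda>j\<in>J. zc \<mu> j + y j) i = N / (N + 1) * (psi n I h i \<mu> + 1 / N\<^sup>2 + ycoord n y i)" if "i \<in> grid n" for i
    unfolding wt_def full_zc[OF m that] by (simp add: algebra_simps)
  have p: "point_measure (grid n) (\<lambda>i. ennreal (N / (N + 1) * (psi n I h i \<mu> + 1 / N\<^sup>2 + ycoord n y i)))
      = point_measure (grid n) (\<lambda>i. ennreal (wt (\<lambda>j\<in>J. zc \<mu> j + y j) i))"
    unfolding point_measure_def by (rule density_cong) (auto simp: e AE_count_space)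
  show ?thesis
    unfolding mu_n_def N[symmetric] nu_def atomic_def p node_def[abs_def] ..
qed

lemma V_shifted:
  assumes m: "prob_space \<mu>" "sets \<mu> = sets borel" and y: "y \<in> adm"
  shows "V (\<lambda>j\<in>J. zc \<mu> j + y j) = U (mu_n n I h \<mu> y)"
  using shifted_in_Sp[OF m y] mu_n_eq[OF m] by (simp add: V_def)

lemma mollify_eq:
  assumes m: "prob_space \<mu>" "sets \<mu> = sets borel"
  shows "mollify n I h \<zeta> U \<mu> = shift_conv J V \<zeta> (zc \<mu>)"
    "mollify n I h \<zeta> U \<mu> = (\<integral>y. \<zeta> y * V (\<lambda>j\<in>J. zc \<mu> j + y j) \<partial>M)"
proof -
  show "mollify n I h \<zeta> U \<mu> = (\<integral>y. \<zeta> y * V (\<lambda>j\<in>J. zc \<mu> j + y j) \<partial>M)"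
    unfolding mollify_def set_lebesgue_integral_def
  proof (rule Bochner_Integration.integral_cong[OF refl])
    fix y assume y: "y \<in> space M"
    show "indicator (Delta n) y *\<^sub>R (\<zeta> y * U (mu_n n I h \<mu> y)) = \<zeta> y * V (\<lambda>j\<in>J. zc \<mu> j + y j)"
    proof (cases "y \<in> Delta n")
      case True
      then show ?thesis using V_shifted[OF m] Delta_adm by auto
    next
      case False
      then show ?thesis using kernel_D(5)[of y] y by (simp add: space_PiM)
    qed
  qed
  then show "mollify n I h \<zeta> U \<mu> = shift_conv J V \<zeta> (zc \<mu>)"
    using shift_conv_eq(1)[OF finite_J V_integrable kernel_D(1)] by simp
qed

lemma integrable_zeta_V: "integrable M (\<lambda>y. \<zeta> y * V (\<lambda>j\<in>J. z j + y j))"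
  by (rule shift_conv_eq(2)[OF finite_J V_integrable kernel_D(1)])

lemma test_fun_q: "test_fun (3 * real n / 2) (\<lambda>x. phi n I i x * h x)"
  by (rule test_fun_phi_cutoff[OF I n h])

lemma q_partials:
  obtains q' where "\<And>i l. test_fun (3 * real n / 2) (q' i l :: real^'d \<Rightarrow> real)"
    "\<And>i l x. ((\<lambda>t. phi n I i (x + t *\<^sub>R axis l 1) * h (x + t *\<^sub>R axis l 1)) has_real_derivative q' i l x) (at 0)"
proof -
  have "\<exists>g. (\<forall>l. test_fun (3 * real n / 2) (g l)) \<and>
    (\<forall>l x. ((\<lambda>t. phi n I i (x + t *\<^sub>R axis l 1) * h (x + t *\<^sub>R axis l 1)) has_real_derivative g l x) (at 0))" for i
    by (rule test_fun_partial[OF test_fun_q[of i]]) blast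
  then have "\<forall>i. \<exists>g. (\<forall>l. test_fun (3 * real n / 2) (g l)) \<and>
    (\<forall>l x. ((\<lambda>t. phi n I i (x + t *\<^sub>R axis l 1) * h (x + t *\<^sub>R axis l 1)) has_real_derivative g l x) (at 0))" ..
  from choice[OF this] obtain q' where
    "\<forall>i. (\<forall>l. test_fun (3 * real n / 2) (q' i l)) \<and>
    (\<forall>l x. ((\<lambda>t. phi n I i (x + t *\<^sub>R axis l 1) * h (x + t *\<^sub>R axis l 1)) has_real_derivative q' i l x) (at 0))" ..
  then show ?thesis by (intro that[of q']) simp_all
qed

lemma mollify_smooth: "Cinf_P2 (mollify n I h \<zeta> U)"
  unfolding Cinf_P2_def
proof
  fix k
  obtain q' where q': "\<And>i l. test_fun (3 * real n / 2) (q' i l :: real^'d \<Rightarrow> real)"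
    "\<And>i l x. ((\<lambda>t. phi n I i (x + t *\<^sub>R axis l 1) * h (x + t *\<^sub>R axis l 1)) has_real_derivative q' i l x) (at 0)"
    using q_partials by blast
  \<comment> \<open>No space variables at the start: the product is empty and the constant is
    1.\<close>
  have "Ck_P2 k 0 (\<lambda>z. 1 * shift_conv J V \<zeta> (\<lambda>i. \<integral>x. phi n I i x * h x \<partial>fst z) * (\<Prod>j<0. (\<lambda>_ _. 0) j (snd z j)))"
    by (rule Ck_P2_shift_conv[OF finite_J V_integrable test_fun_q q' kernel_D(1)]) simp
  then show "Ck_P2 k 0 (\<lambda>(\<mu>, X). mollify n I h \<zeta> U \<mu>)"
    by (rule Ck_P2_cong) (simp add: mollify_eq(1) Pp_D zc_def[abs_def])
qed

lemma mollify_continuous: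
  assumes "0 < p" shows "C0_P p (mollify n I h \<zeta> U)"
proof -
  obtain q' where q': "\<And>i l. test_fun (3 * real n / 2) (q' i l :: real^'d \<Rightarrow> real)"
    "\<And>i l x. ((\<lambda>t. phi n I i (x + t *\<^sub>R axis l 1) * h (x + t *\<^sub>R axis l 1)) has_real_derivative q' i l x) (at 0)"
    using q_partials by blast
  have "continuous_map (wtop p) euclideanreal (\<lambda>\<mu>. shift_conv J V \<zeta> (\<lambda>i. \<integral>x. phi n I i x * h x \<partial>\<mu>))"
    by (rule shift_conv_moments_continuous[OF finite_J V_integrable test_fun_q q' kernel_D(1) assms])
  then show ?thesis
    unfolding C0_P_def
    by (rule continuous_map_eq) (simp add: assms mollify_eq(1) Pp_D zc_def[abs_def])
qed

end

section \<open>Convergence and the Lipschitz bound\<close>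

lemma compactin_wtop_finite_cover:
  fixes \<M> :: "(real^'d) measure set"
  assumes "0 < p" "compactin (wtop p) \<M>" "\<And>\<mu>. \<mu> \<in> \<M> \<Longrightarrow> 0 < \<delta> \<mu>"
  obtains F where "finite F" "F \<subseteq> \<M>" "\<And>\<mu>. \<mu> \<in> \<M> \<Longrightarrow> \<exists>\<nu>\<in>F. wasserstein p \<nu> \<mu> < \<delta> \<nu>"
proof -
  interpret Metric_space "Pp p :: (real^'d) measure set" "wasserstein p" by (rule Metric_space_wasserstein) fact
  have sub: "\<M> \<subseteq> Pp p" using compactin_subset_topspace[OF assms(2)] assms(1) by simp
  have "\<exists>F. finite F \<and> F \<subseteq> (\<lambda>\<mu>. mball \<mu> (\<delta> \<mu>)) ` \<M> \<and> \<M> \<subseteq> \<Union>F"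
  proof (rule compactinD[OF assms(2)])
    show "openin (wtop p) T" if "T \<in> (\<lambda>\<mu>. mball \<mu> (\<delta> \<mu>)) ` \<M>" for T using that by (auto simp: wtop_def)
    show "\<M> \<subseteq> \<Union> ((\<lambda>\<mu>. mball \<mu> (\<delta> \<mu>)) ` \<M>)"
    proof
      fix \<mu> assume \<mu>: "\<mu> \<in> \<M>"
      then have "\<mu> \<in> mball \<mu> (\<delta> \<mu>)" using sub assms(3) by (auto simp: centre_in_mball_iff)
      then show "\<mu> \<in> \<Union> ((\<lambda>\<mu>. mball \<mu> (\<delta> \<mu>)) ` \<M>)" using \<mu> by blast
    qed
  qed
  then obtain \<F> where \<F>: "finite \<F>" "\<F> \<subseteq> (\<lambda>\<mu>. mball \<mu> (\<delta> \<mu>)) ` \<M>" "\<M> \<subseteq> \<Union>\<F>" by blast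
  then obtain F where F: "F \<subseteq> \<M>" "finite F" "\<F> = (\<lambda>\<mu>. mball \<mu> (\<delta> \<mu>)) ` F"
    by (meson finite_subset_image)
  show ?thesis
  proof (rule that[OF F(2,1)])
    fix \<mu> assume "\<mu> \<in> \<M>"
    then obtain \<nu> where "\<nu> \<in> F" "\<mu> \<in> mball \<nu> (\<delta> \<nu>)" using \<F>(3) F(3) by blast
    then show "\<exists>\<nu>\<in>F. wasserstein p \<nu> \<mu> < \<delta> \<nu>" by auto
  qed
qed

text \<open>A Lebesgue number argument: finitely many balls of half the local radius cover the
  compact set, so a second measure close to it still lies in the full ball. That second measure may
  lie outside the compact set, as quantized measures do.\<close>

lemma uniformly_continuous_near_compact:
  fixes \<M> :: "(real^'d) measure set"
  assumes U: "C0_P 1 U" and \<M>: "compactin (wtop 1) \<M>" and \<epsilon>: "0 < \<epsilon>"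
  obtains \<delta> where "0 < \<delta>" "\<And>\<mu> \<nu>. \<mu> \<in> \<M> \<Longrightarrow> \<nu> \<in> Pp 1 \<Longrightarrow> wasserstein 1 \<mu> \<nu> < \<delta> \<Longrightarrow> \<bar>U \<nu> - U \<mu>\<bar> < \<epsilon>"
proof -
  have sub: "\<M> \<subseteq> Pp 1" using compactin_subset_topspace[OF \<M>] by simp
  have U': "\<forall>\<mu>\<in>Pp 1. \<forall>\<epsilon>>0. \<exists>\<delta>>0. \<forall>\<nu>\<in>Pp 1. wasserstein 1 \<mu> \<nu> < \<delta> \<longrightarrow> dist (U \<mu>) (U \<nu>) < \<epsilon>"
    using U continuous_map_wtop_euclidean[of 1 U] by (simp add: C0_P_def)
  have "\<forall>\<mu>. \<exists>\<delta>. \<mu> \<in> \<M> \<longrightarrow> 0 < \<delta> \<and> (\<forall>\<nu>\<in>Pp 1. wasserstein 1 \<mu> \<nu> < \<delta> \<longrightarrow> dist (U \<mu>) (U \<nu>) < \<epsilon> / 2)"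
    using U' sub \<epsilon> by (meson half_gt_zero subsetD)
  from choice[OF this] obtain \<delta> where \<delta>: "\<And>\<mu>. \<mu> \<in> \<M> \<Longrightarrow> 0 < \<delta> \<mu>"
    "\<And>\<mu> \<nu>. \<mu> \<in> \<M> \<Longrightarrow> \<nu> \<in> Pp 1 \<Longrightarrow> wasserstein 1 \<mu> \<nu> < \<delta> \<mu> \<Longrightarrow> dist (U \<mu>) (U \<nu>) < \<epsilon> / 2" by blast
  obtain F where F: "finite F" "F \<subseteq> \<M>" "\<And>\<mu>. \<mu> \<in> \<M> \<Longrightarrow> \<exists>\<nu>\<in>F. wasserstein 1 \<nu> \<mu> < \<delta> \<nu> / 2"
    using compactin_wtop_finite_cover[OF _ \<M>, of "\<lambda>\<mu>. \<delta> \<mu> / 2"] \<delta>(1) by auto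
  define \<delta>' where "\<delta>' = Min (insert 1 ((\<lambda>\<nu>. \<delta> \<nu> / 2) ` F))"
  have "0 < \<delta>'" using F \<delta>(1) by (auto simp: \<delta>'_def)
  moreover have "\<bar>U \<nu> - U \<mu>\<bar> < \<epsilon>" if m: "\<mu> \<in> \<M>" "\<nu> \<in> Pp 1" "wasserstein 1 \<mu> \<nu> < \<delta>'" for \<mu> \<nu>
  proof -
    obtain \<rho> where \<rho>: "\<rho> \<in> F" "wasserstein 1 \<rho> \<mu> < \<delta> \<rho> / 2" using F(3)[OF m(1)] by blast
    have "\<delta>' \<le> \<delta> \<rho> / 2" unfolding \<delta>'_def using F(1) \<rho>(1) by (intro Min_le) auto
    moreover have "wasserstein 1 \<rho> \<nu> \<le> wasserstein 1 \<rho> \<mu> + wasserstein 1 \<mu> \<nu>"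
      using \<rho>(1) F(2) sub m by (intro wasserstein_triangle) auto
    ultimately have "wasserstein 1 \<rho> \<nu> < \<delta> \<rho>" using \<rho>(2) m(3) by linarith
    then have "dist (U \<rho>) (U \<nu>) < \<epsilon> / 2" using \<delta>(2) \<rho>(1) F(2) m(2) by blast
    moreover have "0 < \<delta> \<rho>" using \<delta>(1) \<rho>(1) F(2) by blast
    then have "dist (U \<rho>) (U \<mu>) < \<epsilon> / 2" using \<delta>(2)[of \<rho> \<mu>] \<rho> F(2) sub m(1) by auto
    ultimately show ?thesis unfolding dist_real_def by linarith
  qed
  ultimately show ?thesis using that by blast
qed

section \<open>Uniform tails and quantization\<close>

text \<open>A Lipschitz substitute for the norm cut off below \<open>R\<close>. Being 1-Lipschitz,
  its integral varies by at most the Wasserstein distance of order 1.\<close>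

definition tail :: "real \<Rightarrow> real^'d \<Rightarrow> real" where "tail R x = max 0 (norm x - R)"

lemma tail_facts:
  shows "0 \<le> tail R x" "R \<le> R' \<Longrightarrow> tail R' x \<le> tail R x" "\<bar>tail R x - tail R y\<bar> \<le> 1 * dist x y"
proof -
  have "\<bar>norm x - norm y\<bar> \<le> dist x y" by (simp add: dist_norm norm_triangle_ineq3)
  then show "\<bar>tail R x - tail R y\<bar> \<le> 1 * dist x y" unfolding tail_def by linarith
qed (auto simp: tail_def)

lemma tail_measurable [measurable]: "tail R \<in> borel_measurable borel"
  unfolding tail_def[abs_def] by measurable

lemma tail_integrable:
  assumes "\<mu> \<in> Pp 1" "0 \<le> R"
  shows "integrable \<mu> (tail R)"
proof (rule Bochner_Integration.integrable_bound)
  note D = Pp_D[OF assms(1)]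
  note [measurable_cong] = D(2)
  show "integrable \<mu> norm" using D(4) by simp
  show "AE x in \<mu>. norm (tail R x) \<le> norm (norm x)" using assms(2) by (intro AE_I2) (auto simp: tail_def)
  show "tail R \<in> borel_measurable \<mu>" by measurable
qed

text \<open>For one measure the tail tends to 0 by dominated convergence. A finite cover by balls of
  radius \<epsilon>/2 makes this uniform, because moving from a centre to a point of its ball
  changes the integral by less than \<epsilon>/2.\<close>

lemma compact_uniform_tail:
  fixes \<M> :: "(real^'d) measure set"
  assumes \<M>: "compactin (wtop 1) \<M>" and \<epsilon>: "0 < \<epsilon>"
  obtains R where "0 \<le> R" "\<And>\<mu>. \<mu> \<in> \<M> \<Longrightarrow> (\<integral>x. tail R x \<partial>\<mu>) < \<epsilon>"
proof -
  have sub: "\<M> \<subseteq> Pp 1" using compactin_subset_topspace[OF \<M>] by simp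
  have "\<exists>k::nat. (\<integral>x. tail (real k) x \<partial>\<mu>) < \<epsilon> / 2" if \<mu>: "\<mu> \<in> Pp 1" for \<mu> :: "(real^'d) measure"
  proof -
    note D = Pp_D[OF \<mu>]
    note [measurable_cong] = D(2)
    have "(\<lambda>k. \<integral>x. tail (real k) x \<partial>\<mu>) \<longlonglongrightarrow> (\<integral>x. 0 \<partial>\<mu>)"
    proof (rule integral_dominated_convergence[where w=norm])
      show "AE x in \<mu>. (\<lambda>k. tail (real k) x) \<longlonglongrightarrow> 0"
      proof (rule AE_I2)
        fix x :: "real^'d"
        obtain k0 where "norm x < real k0" using reals_Archimedean2 by blast
        then have "\<forall>\<^sub>F k in sequentially. tail (real k) x = 0"
          unfolding eventually_sequentially tail_def by (intro exI[of _ k0]) auto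
        then show "(\<lambda>k. tail (real k) x) \<longlonglongrightarrow> 0" by (rule tendsto_eventually)
      qed
      show "AE x in \<mu>. norm (tail (real k) x) \<le> norm x" for k by (intro AE_I2) (auto simp: tail_def)
    qed (use D(4) in auto)
    then have "\<forall>\<^sub>F k in sequentially. (\<integral>x. tail (real k) x \<partial>\<mu>) < \<epsilon> / 2"
      using \<epsilon> by (intro order_tendstoD) auto
    then show ?thesis by (auto simp: eventually_sequentially)
  qed
  then have "\<forall>\<mu>. \<exists>k::nat. \<mu> \<in> \<M> \<longrightarrow> (\<integral>x. tail (real k) x \<partial>\<mu>) < \<epsilon> / 2" using sub by blast
  from choice[OF this] obtain k where k: "\<And>\<mu>. \<mu> \<in> \<M> \<Longrightarrow> (\<integral>x. tail (real (k \<mu>)) x \<partial>\<mu>) < \<epsilon> / 2" by blast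
  obtain F where F: "finite F" "F \<subseteq> \<M>" "\<And>\<mu>. \<mu> \<in> \<M> \<Longrightarrow> \<exists>\<nu>\<in>F. wasserstein 1 \<nu> \<mu> < \<epsilon> / 2"
    using compactin_wtop_finite_cover[OF _ \<M>, of "\<lambda>_. \<epsilon> / 2"] \<epsilon> by auto
  define K where "K = Max (insert 0 (k ` F))"
  show ?thesis
  proof (rule that[of "real K"])
    fix \<mu> assume \<mu>: "\<mu> \<in> \<M>"
    then obtain \<nu> where \<nu>: "\<nu> \<in> F" "wasserstein 1 \<nu> \<mu> < \<epsilon> / 2" using F(3) by blast
    have m: "\<mu> \<in> Pp 1" "\<nu> \<in> Pp 1" using \<mu> \<nu> F(2) sub by auto
    have "k \<nu> \<le> K" using F(1) \<nu>(1) by (auto simp: K_def)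
    then have "(\<integral>x. tail (real K) x \<partial>\<mu>) \<le> (\<integral>x. tail (real (k \<nu>)) x \<partial>\<mu>)"
      using m by (intro integral_mono tail_integrable tail_facts) auto
    also have "\<dots> \<le> (\<integral>x. tail (real (k \<nu>)) x \<partial>\<nu>) + 1 * wasserstein 1 \<mu> \<nu>"
      using wasserstein_Lipschitz_integral[OF m _ _ tail_facts(3), of "real (k \<nu>)"]
        tail_integrable[OF m(1), of "real (k \<nu>)"] tail_integrable[OF m(2), of "real (k \<nu>)"] by simp
    also have "\<dots> < \<epsilon>" using k[of \<nu>] \<nu> F(2) wasserstein_commute[of 1 \<mu> \<nu>] by auto
    finally show "(\<integral>x. tail (real K) x \<partial>\<mu>) < \<epsilon>" .
  qed simp
qed

lemma norm_node_le:
  fixes i :: "int^'d"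
  assumes "0 < n" "i \<in> grid n"
  shows "norm (node n i) \<le> real CARD('d) * (2 * real n)"
proof (rule norm_le_cubeQ)
  have "\<bar>real_of_int (i $ l) / real n\<bar> \<le> 2 * real n" for l
  proof -
    have "\<bar>i $ l\<bar> \<le> 2 * (int n)\<^sup>2" using assms(2) by (simp add: grid_def)
    then have "real_of_int \<bar>i $ l\<bar> \<le> real_of_int (2 * (int n)\<^sup>2)" by (rule of_int_le_iff[THEN iffD2])
    then have "\<bar>real_of_int (i $ l)\<bar> \<le> 2 * real n * real n" by (simp add: power2_eq_square)
    then show ?thesis using assms(1) by (simp add: abs_divide pos_divide_le_eq)
  qed
  then show "node n i \<in> cubeQ (2 * real n)" by (simp add: cubeQ_def node_def)
qed

text \<open>Mass kept by the cutoff moves by at most d/n. The rest goes to the origin at cost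
  \<open>norm x\<close>, and only from points of norm above \<open>n\<close>, where
  \<open>norm x \<le> 2 * (norm x - n / 2)\<close>; this is the origin of the radius
  \<open>n / 2\<close> and the factor 2.\<close>

lemma wgt_quantization_cost:
  fixes x :: "real^'d"
  assumes I: "profile n I" and n: "3 \<le> n" and h: "cutoff n h"
  shows "(\<Sum>i\<in>grid n. wgt n I h i x * dist x (node n i)) \<le> real CARD('d) / real n + 2 * tail (real n / 2) x"
proof -
  note hb = cutoff_D(2,3)[OF h, of x] and pb = phi_bounds(1,2)[OF I n]
  have "(\<Sum>i\<in>grid n. wgt n I h i x * dist x (node n i))
      \<le> (\<Sum>i\<in>grid n. phi n I i x * h x * (real CARD('d) / real n) + (if i = 0 then (1 - h x) * norm x else 0))"
  proof (rule sum_mono)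
    fix i :: "int^'d"
    have "phi n I i x * h x * dist x (node n i) \<le> phi n I i x * h x * (real CARD('d) / real n)"
    proof (cases "phi n I i x = 0")
      case False
      then show ?thesis using dist_node_phi[OF I n h False] hb pb
        by (intro mult_left_mono mult_nonneg_nonneg) (auto simp: dist_commute)
    qed simp
    moreover have "node n (0 :: int^'d) = 0" by (simp add: node_def vec_eq_iff)
    ultimately show "wgt n I h i x * dist x (node n i)
        \<le> phi n I i x * h x * (real CARD('d) / real n) + (if i = 0 then (1 - h x) * norm x else 0)"
      by (cases "i = 0") (simp_all add: wgt_def distrib_right)
  qed
  also have "\<dots> = h x * (real CARD('d) / real n) + (1 - h x) * norm x"
    unfolding sum.distrib
    by (simp only: phi_cutoff_sum[OF I n h] sum.delta finite_grid zero_in_grid if_True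
        flip: sum_distrib_right[of _ _ "real CARD('d) / real n"])
  also have "\<dots> \<le> 1 * (real CARD('d) / real n) + 2 * tail (real n / 2) x"
  proof (rule add_mono)
    show "h x * (real CARD('d) / real n) \<le> 1 * (real CARD('d) / real n)" using hb by (intro mult_right_mono) auto
    show "(1 - h x) * norm x \<le> 2 * tail (real n / 2) x"
    proof (cases "x \<in> cubeQ (real n)")
      case True
      then show ?thesis using cutoff_D(4)[OF h True] tail_facts(1) by simp
    next
      case False
      then obtain l where "real n < \<bar>x $ l\<bar>" by (auto simp: cubeQ_def not_le)
      then have nx: "real n < norm x" using component_le_norm_cart[of x l] by linarith
      have "(1 - h x) * norm x \<le> 1 * norm x" using hb by (intro mult_right_mono) auto
      also have "\<dots> \<le> 2 * tail (real n / 2) x" using nx by (simp add: tail_def)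
      finally show ?thesis .
    qed
  qed
  finally show ?thesis by simp
qed

text \<open>The coupling of \<open>\<mu>\<close> with its quantization: mass at \<open>x\<close> is sent to the nodes
  with the probabilities given by the weights.\<close>

lemma wasserstein_quantization:
  fixes \<mu> :: "(real^'d) measure"
  assumes I: "profile n I" and n: "3 \<le> n" and h: "cutoff n h" and \<mu>: "\<mu> \<in> Pp 1"
  shows "wasserstein 1 \<mu> (atomic (grid n) (\<lambda>i. psi n I h i \<mu>) (node n))
    \<le> real CARD('d) / real n + 2 * (\<integral>x. tail (real n / 2) x \<partial>\<mu>)"
proof -
  note D = Pp_D[OF \<mu>]
  interpret prob_space \<mu> by fact
  let ?G = "grid n :: (int^'d) set"
  let ?C = "count_space ?G"
  let ?B = "borel \<Otimes>\<^sub>M borel :: ((real^'d) \<times> (real^'d)) measure"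
  note [measurable_cong] = D(2)
  note wm [measurable] = wgt_measurable[OF I n h]
  have wm' [measurable]: "(\<lambda>z. ennreal (wgt n I h (fst z) (snd z))) \<in> borel_measurable (?C \<Otimes>\<^sub>M \<mu>)"
    by (rule measurable_pair_measure_countable1) (auto simp: countable_finite)
  have int: "(\<integral>\<^sup>+z. F z \<partial>density (?C \<Otimes>\<^sub>M \<mu>) (\<lambda>z. ennreal (wgt n I h (fst z) (snd z))))
      = (\<Sum>i\<in>?G. \<integral>\<^sup>+x. ennreal (wgt n I h i x) * F (i, x) \<partial>\<mu>)"
    if [measurable]: "F \<in> borel_measurable (?C \<Otimes>\<^sub>M \<mu>)" for F
    by (simp add: nn_integral_density nn_integral_fst[symmetric] nn_integral_count_space_finite)
  \<comment> \<open>The joint law of the node index and the point, with the weight as density with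
    respect to counting measure times \<mu>. The map \<open>T\<close> then turns the index into the
    node.\<close>
  define P where "P = density (?C \<Otimes>\<^sub>M \<mu>) (\<lambda>z. ennreal (wgt n I h (fst z) (snd z)))"
  define T where "T z = (snd z, node n (fst z))" for z :: "(int^'d) \<times> (real^'d)"
  have nm [measurable]: "(\<lambda>z. node n (fst z)) \<in> borel_measurable (?C \<Otimes>\<^sub>M \<mu>)"
    by (rule measurable_pair_measure_countable1) (auto simp: countable_finite)
  have T [measurable]: "T \<in> measurable P ?B"
    unfolding P_def T_def by measurable
  have sum1: "(\<Sum>i\<in>?G. ennreal (wgt n I h i x)) = 1" for x
    using wgt_sum[OF I n h, of x] wgt_nonneg[OF I n h] by (simp add: sum_ennreal)
  have prob: "prob_space P"
  proof (rule prob_spaceI)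
    have "emeasure P (space P) = (\<integral>\<^sup>+z. 1 \<partial>P)" by simp
    also have "\<dots> = (\<Sum>i\<in>?G. \<integral>\<^sup>+x. ennreal (wgt n I h i x) * 1 \<partial>\<mu>)"
      unfolding P_def by (rule int) simp
    also have "\<dots> = (\<integral>\<^sup>+x. (\<Sum>i\<in>?G. ennreal (wgt n I h i x)) \<partial>\<mu>)"
      by (subst nn_integral_sum) auto
    finally show "emeasure P (space P) = 1" by (simp add: sum1 emeasure_space_1)
  qed
  have m1: "distr (distr P ?B T) borel fst = \<mu>"
  proof (rule measure_eqI)
    fix A assume "A \<in> sets (distr (distr P ?B T) borel fst)"
    then have A [measurable]: "A \<in> sets borel" by simp
    have "emeasure (distr (distr P ?B T) borel fst) A = (\<integral>\<^sup>+a. indicator A a \<partial>distr (distr P ?B T) borel fst)" by simp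
    also have "\<dots> = (\<integral>\<^sup>+z. indicator A (snd z) \<partial>P)"
      by (subst nn_integral_distr, simp_all, subst nn_integral_distr) (auto simp: T_def)
    also have "\<dots> = (\<Sum>i\<in>?G. \<integral>\<^sup>+x. ennreal (wgt n I h i x) * indicator A (snd (i, x)) \<partial>\<mu>)"
      unfolding P_def by (rule int) measurable
    also have "\<dots> = (\<integral>\<^sup>+x. (\<Sum>i\<in>?G. ennreal (wgt n I h i x) * indicator A x) \<partial>\<mu>)"
      by (subst nn_integral_sum) auto
    also have "\<dots> = (\<integral>\<^sup>+x. (\<Sum>i\<in>?G. ennreal (wgt n I h i x)) * indicator A x \<partial>\<mu>)"
      by (simp only: sum_distrib_right)
    also have "\<dots> = emeasure \<mu> A" using A D(2) by (simp add: sum1)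
    finally show "emeasure (distr (distr P ?B T) borel fst) A = emeasure \<mu> A" .
  qed (simp add: D(2))
  have m2: "distr (distr P ?B T) borel snd = atomic ?G (\<lambda>i. psi n I h i \<mu>) (node n)"
  proof (rule measure_eqI)
    fix A assume "A \<in> sets (distr (distr P ?B T) borel snd)"
    then have A [measurable]: "A \<in> sets borel" by simp
    have "emeasure (distr (distr P ?B T) borel snd) A = (\<integral>\<^sup>+a. indicator A a \<partial>distr (distr P ?B T) borel snd)" by simp
    also have "\<dots> = (\<integral>\<^sup>+z. indicator A (node n (fst z)) \<partial>P)"
      by (subst nn_integral_distr, simp_all, subst nn_integral_distr) (auto simp: T_def)
    also have "\<dots> = (\<Sum>i\<in>?G. \<integral>\<^sup>+x. ennreal (wgt n I h i x) * indicator A (node n (fst (i, x))) \<partial>\<mu>)"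
      unfolding P_def by (rule int) measurable
    also have "\<dots> = (\<Sum>i\<in>?G. ennreal (psi n I h i \<mu> * indicator A (node n i)))"
    proof (rule sum.cong[OF refl])
      fix i
      have "(\<integral>\<^sup>+x. ennreal (wgt n I h i x) * indicator A (node n (fst (i, x))) \<partial>\<mu>)
          = (\<integral>\<^sup>+x. ennreal (wgt n I h i x) \<partial>\<mu>) * indicator A (node n i)"
        by (simp add: nn_integral_multc)
      also have "(\<integral>\<^sup>+x. ennreal (wgt n I h i x) \<partial>\<mu>) = ennreal (psi n I h i \<mu>)"
        unfolding psi_eq[OF I n h D(1,2)]
        by (intro nn_integral_eq_integral wgt_integrable[OF I n h D(1,2)] AE_I2 wgt_nonneg[OF I n h])
      finally show "(\<integral>\<^sup>+x. ennreal (wgt n I h i x) * indicator A (node n (fst (i, x))) \<partial>\<mu>)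
          = ennreal (psi n I h i \<mu> * indicator A (node n i))" by (simp add: indicator_def)
    qed
    also have "\<dots> = emeasure (atomic ?G (\<lambda>i. psi n I h i \<mu>) (node n)) A"
      using psi_nonneg[OF I n h D(1,2)] A by (subst emeasure_atomic) (auto intro!: sum_ennreal mult_nonneg_nonneg)
    finally show "emeasure (distr (distr P ?B T) borel snd) A = emeasure (atomic ?G (\<lambda>i. psi n I h i \<mu>) (node n)) A" .
  qed simp
  have cp: "distr P ?B T \<in> couplings \<mu> (atomic ?G (\<lambda>i. psi n I h i \<mu>) (node n))"
    using m1 m2 prob_space.prob_space_distr[OF prob T] by (simp add: couplings_def)
  let ?c = "\<integral>x. tail (real n / 2) x \<partial>\<mu>"
  have it: "integrable \<mu> (tail (real n / 2))" using \<mu> by (intro tail_integrable) auto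
  have "(\<integral>\<^sup>+z. ennreal (dist (fst z) (snd z) ^ 1) \<partial>distr P ?B T) = (\<integral>\<^sup>+z. ennreal (dist (snd z) (node n (fst z))) \<partial>P)"
    by (subst nn_integral_distr) (auto simp: T_def)
  also have "\<dots> = (\<Sum>i\<in>?G. \<integral>\<^sup>+x. ennreal (wgt n I h i x) * ennreal (dist (snd (i, x)) (node n (fst (i, x)))) \<partial>\<mu>)"
    unfolding P_def by (rule int) measurable
  also have "\<dots> = (\<integral>\<^sup>+x. (\<Sum>i\<in>?G. ennreal (wgt n I h i x) * ennreal (dist x (node n i))) \<partial>\<mu>)"
    by (subst nn_integral_sum) auto
  also have "\<dots> = (\<integral>\<^sup>+x. ennreal (\<Sum>i\<in>?G. wgt n I h i x * dist x (node n i)) \<partial>\<mu>)"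
    using wgt_nonneg[OF I n h] by (simp add: ennreal_mult sum_ennreal[symmetric])
  also have "\<dots> \<le> (\<integral>\<^sup>+x. ennreal (real CARD('d) / real n + 2 * tail (real n / 2) x) \<partial>\<mu>)"
    by (intro nn_integral_mono ennreal_leI wgt_quantization_cost[OF I n h])
  also have "\<dots> = ennreal (\<integral>x. real CARD('d) / real n + 2 * tail (real n / 2) x \<partial>\<mu>)"
    using it tail_facts(1) by (intro nn_integral_eq_integral) (auto intro!: AE_I2 add_nonneg_nonneg)
  also have "(\<integral>x. real CARD('d) / real n + 2 * tail (real n / 2) x \<partial>\<mu>) = (real CARD('d) / real n + 2 * ?c) ^ 1"
    using it by (simp add: prob_space)
  finally show ?thesis
    using tail_facts(1) by (intro wasserstein_le[OF cp]) (auto intro!: add_nonneg_nonneg Bochner_Integration.integral_nonneg)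
qed

context mollifier
begin

lemma wt_zc:
  assumes "prob_space \<mu>" "sets \<mu> = sets borel" "i \<in> grid n"
  shows "wt (\<lambda>j\<in>J. zc \<mu> j + y j) i = N / (N + 1) * (psi n I h i \<mu> + 1 / N\<^sup>2 + ycoord n y i)"
  unfolding wt_def full_zc[OF assms] by (simp add: algebra_simps)

text \<open>The quantization contributes d/n and the tail. The normalization, the uniform part and
  the perturbation change the weights by 3/N in total, at nodes of norm at most 2dn; as
  \<open>N\<close> is at least 4n^2, this costs at most 2d/n.\<close>

lemma mu_n_close:
  assumes \<mu>: "\<mu> \<in> Pp 1" and y: "y \<in> adm"
  shows "wasserstein 1 \<mu> (nu (\<lambda>j\<in>J. zc \<mu> j + y j))
    \<le> 3 * real CARD('d) / real n + 2 * (\<integral>x. tail (real n / 2) x \<partial>\<mu>)"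
proof -
  note D = Pp_D(1,2)[OF \<mu>]
  let ?d = "real CARD('d)"
  let ?w = "\<lambda>j\<in>J. zc \<mu> j + y j"
  let ?\<rho> = "atomic (grid n) (\<lambda>i. psi n I h i \<mu>) (node n)"
  have S: "?w \<in> Sp" by (rule shifted_in_Sp[OF D y])
  have p0: "0 \<le> psi n I h i \<mu>" for i by (rule psi_nonneg[OF I n h D])
  have p1: "(\<Sum>i\<in>grid n. psi n I h i \<mu>) = 1" by (rule psi_sum[OF I n h D])
  have \<rho>: "?\<rho> \<in> Pp 1" using p0 p1 by (intro atomic_Pp) auto
  \<comment> \<open>The term \<open>psi / N\<close> comes from the factor
    \<open>N / (N + 1)\<close>, and 2/N^2 from the uniform share together with the
    perturbation.\<close>
  have df: "\<bar>psi n I h i \<mu> - wt ?w i\<bar> \<le> psi n I h i \<mu> / N + 2 / N\<^sup>2" if i: "i \<in> grid n" for i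
  proof -
    let ?p = "psi n I h i \<mu>" and ?c = "ycoord n y i"
    have c: "\<bar>?c\<bar> \<le> 1 / N\<^sup>2" using y i by (simp add: adm_def)
    have eq: "?p - wt ?w i = ?p * (1 - N / (N + 1)) - N / (N + 1) * (1 / N\<^sup>2 + ?c)"
      unfolding wt_zc[OF D i] by (simp add: algebra_simps)
    have N1: "1 - N / (N + 1) = 1 / (N + 1)" using N_pos by (simp add: field_simps)
    have "\<bar>?p - wt ?w i\<bar> \<le> \<bar>?p * (1 / (N + 1))\<bar> + \<bar>N / (N + 1) * (1 / N\<^sup>2 + ?c)\<bar>"
      unfolding eq N1 by (rule abs_triangle_ineq4)
    also have "\<dots> = ?p * (1 / (N + 1)) + N / (N + 1) * \<bar>1 / N\<^sup>2 + ?c\<bar>"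
      using p0[of i] N_pos by (simp add: abs_mult)
    also have "\<dots> \<le> ?p * (1 / N) + 1 * (2 / N\<^sup>2)"
    proof (intro add_mono mult_mono)
      show "1 / (N + 1) \<le> 1 / N" using N_pos by (simp add: field_simps)
      show "N / (N + 1) \<le> 1" using N_pos by simp
      show "\<bar>1 / N\<^sup>2 + ?c\<bar> \<le> 2 / N\<^sup>2" using c abs_triangle_ineq[of "1 / N\<^sup>2" ?c] by simp
    qed (use p0 N_pos in auto)
    finally show ?thesis by simp
  qed
  have "wasserstein 1 ?\<rho> (nu ?w) \<le> (\<Sum>i\<in>grid n. \<bar>psi n I h i \<mu> - wt ?w i\<bar> * dist (node n i) 0)"
    unfolding nu_def using p0 p1 wt_nonneg[OF S] wt_sum by (intro wasserstein_atomic_weights_le) auto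
  also have "\<dots> \<le> (\<Sum>i\<in>grid n. (psi n I h i \<mu> / N + 2 / N\<^sup>2) * (?d * (2 * real n)))"
    using df norm_node_le[of n] n p0 N_pos by (intro sum_mono mult_mono) auto
  also have "\<dots> = ((\<Sum>i\<in>grid n. psi n I h i \<mu>) / N + real (card (grid n :: (int^'d) set)) * (2 / N\<^sup>2)) * (?d * (2 * real n))"
    unfolding sum_distrib_right[symmetric] sum.distrib sum_divide_distrib by simp
  also have "\<dots> = 3 / N * (?d * (2 * real n))"
    unfolding p1 card_grid using N_pos by (simp add: power2_eq_square)
  also have "\<dots> \<le> 3 / (4 * (real n)\<^sup>2) * (?d * (2 * real n))"
    using Ngrid_ge[where 'd='d, of n, folded N] n by (intro mult_right_mono divide_left_mono) (auto intro!: mult_pos_pos N_pos)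
  also have "\<dots> = 3 / 2 * ?d / real n" using n by (simp add: power2_eq_square)
  also have "\<dots> \<le> 2 * ?d / real n" by (intro divide_right_mono mult_right_mono) auto
  finally have 1: "wasserstein 1 ?\<rho> (nu ?w) \<le> 2 * ?d / real n" .
  have "wasserstein 1 \<mu> (nu ?w) \<le> wasserstein 1 \<mu> ?\<rho> + wasserstein 1 ?\<rho> (nu ?w)"
    by (rule wasserstein_triangle[OF _ \<mu> \<rho> nu_Pp[OF S]]) simp
  then show ?thesis using 1 wasserstein_quantization[OF I n h \<mu>] by (simp add: add_divide_distrib[symmetric])
qed

text \<open>The kernel is a probability density supported in \<open>Delta n\<close>, so averages
  inherit bounds that hold there. It is used for values of \<open>U\<close>, for differences over
  two measures and for differences along a transfer of mass.\<close>

lemma kernel_average: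
  assumes i: "integrable M (\<lambda>y. \<zeta> y * f y)" and b: "\<And>y. y \<in> Delta n \<Longrightarrow> \<bar>f y - c\<bar> \<le> \<epsilon>"
  shows "\<bar>(\<integral>y. \<zeta> y * f y \<partial>M) - c\<bar> \<le> \<epsilon>"
proof -
  note k = kernel_D
  have "(\<integral>y. \<zeta> y * f y \<partial>M) - c = (\<integral>y. \<zeta> y * f y \<partial>M) - (\<integral>y. \<zeta> y * c \<partial>M)" using k(3,4) by simp
  also have "\<dots> = (\<integral>y. \<zeta> y * f y - \<zeta> y * c \<partial>M)" using i k(3) by simp
  also have "\<bar>\<dots>\<bar> \<le> (\<integral>y. \<bar>\<zeta> y * f y - \<zeta> y * c\<bar> \<partial>M)" by (rule integral_abs_bound)
  also have "\<dots> \<le> (\<integral>y. \<zeta> y * \<epsilon> \<partial>M)"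
  proof (rule integral_mono)
    fix y assume "y \<in> space M"
    then have y: "y \<in> J \<rightarrow>\<^sub>E UNIV" by (simp add: space_PiM)
    show "\<bar>\<zeta> y * f y - \<zeta> y * c\<bar> \<le> \<zeta> y * \<epsilon>"
    proof (cases "y \<in> Delta n")
      case True
      then show ?thesis
        using mult_left_mono[OF b[OF True] k(2)[OF y]] k(2)[OF y] by (simp add: abs_mult right_diff_distrib[symmetric])
    next
      case False
      then show ?thesis using k(5)[OF y] by simp
    qed
  qed (use i k(3) in auto)
  also have "\<dots> = \<epsilon>" using k(3,4) by simp
  finally show ?thesis .
qed

lemma mollify_close:
  assumes \<mu>: "\<mu> \<in> Pp 1" and b: "\<And>y. y \<in> Delta n \<Longrightarrow> \<bar>U (nu (\<lambda>j\<in>J. zc \<mu> j + y j)) - c\<bar> \<le> \<epsilon>"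
  shows "\<bar>mollify n I h \<zeta> U \<mu> - c\<bar> \<le> \<epsilon>"
  unfolding mollify_eq(2)[OF Pp_D(1,2)[OF \<mu>]]
proof (rule kernel_average[OF integrable_zeta_V])
  fix y :: "int^'d \<Rightarrow> real" assume y: "y \<in> Delta n"
  then have "(\<lambda>j\<in>J. zc \<mu> j + y j) \<in> Sp" using shifted_in_Sp[OF Pp_D(1,2)[OF \<mu>]] Delta_adm by blast
  then show "\<bar>V (\<lambda>j\<in>J. zc \<mu> j + y j) - c\<bar> \<le> \<epsilon>" using b[OF y] by (simp add: V_def)
qed

text \<open>Coupling the weights at the two ends of a pair of points and averaging over a nearly
  optimal coupling of \<mu> and \<nu> gives a transport plan between the quantized measures.
  Pointwise its cost is at most a multiple of the distance of the pair; the parts common to both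
  measures stay in place.\<close>

lemma nu_Lipschitz:
  assumes m: "\<mu> \<in> Pp 1" "\<nu> \<in> Pp 1" and y: "y \<in> adm"
  shows "wasserstein 1 (nu (\<lambda>j\<in>J. zc \<mu> j + y j)) (nu (\<lambda>j\<in>J. zc \<nu> j + y j))
    \<le> mollify_const CARD('d) * wasserstein 1 \<mu> \<nu>"
proof -
  note D\<mu> = Pp_D(1,2)[OF m(1)] and D\<nu> = Pp_D(1,2)[OF m(2)]
  let ?C = "mollify_const CARD('d)"
  let ?G = "grid n :: (int^'d) set"
  have C: "0 \<le> ?C" by (simp add: mollify_const_def)
  let ?w = "\<lambda>\<mu>. \<lambda>j\<in>J. zc \<mu> j + y j"
  define g where "g x x' i j = tv_coupling ?G (\<lambda>i. wgt n I h i x) (\<lambda>i. wgt n I h i x') i j" for x x' i j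
  have tv: "finite ?G" "(\<Sum>i\<in>?G. wgt n I h i x) = (\<Sum>i\<in>?G. wgt n I h i x')"
    "\<And>i. i \<in> ?G \<Longrightarrow> 0 \<le> wgt n I h i x" "\<And>i. i \<in> ?G \<Longrightarrow> 0 \<le> wgt n I h i x'" for x x'
    by (auto simp: wgt_sum[OF I n h] wgt_nonneg[OF I n h])
  have g0: "0 \<le> g x x' i j" if "i \<in> ?G" for x x' i j
    unfolding g_def by (rule tv_coupling_nonneg[OF tv that])
  have g1: "(\<Sum>j\<in>?G. g x x' i j) = wgt n I h i x" if "i \<in> ?G" for x x' i
    unfolding g_def by (rule tv_coupling_marginal1[OF tv that])
  have g2: "(\<Sum>i\<in>?G. g x x' i j) = wgt n I h j x'" if "j \<in> ?G" for x x' j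
    unfolding g_def by (rule tv_coupling_marginal2[OF tv that])
  have g_le: "g x x' i j \<le> 1" if "i \<in> ?G" "j \<in> ?G" for x x' i j
    using member_le_sum[of j ?G "g x x' i"] g0 g1[OF that(1), of x x'] wgt_le_1[OF I n h, of i x] that by fastforce
  have gc: "(\<Sum>i\<in>?G. \<Sum>j\<in>?G. g x x' i j * dist (node n i) (node n j)) \<le> ?C * dist x x'" for x x'
    unfolding g_def by (rule order_trans[OF tv_coupling_cost[OF tv] wgt_variation_cost[OF I n h]])
  note wm [measurable] = wgt_measurable[OF I n h]
  have "wasserstein 1 (nu (?w \<mu>)) (nu (?w \<nu>)) \<le> ?C * e" if e: "wasserstein 1 \<mu> \<nu> < e" for e
  proof -
    obtain \<pi> where \<pi>: "\<pi> \<in> couplings \<mu> \<nu>" "(\<integral>z. dist (fst z) (snd z) ^ 1 \<partial>\<pi>) < e ^ 1"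
      by (rule wasserstein_lt[OF m _ e]) auto
    note D\<pi> = couplings_D[OF \<pi>(1)]
    interpret \<pi>: prob_space \<pi> by fact
    note [measurable_cong] = D\<pi>(2)
    have id: "integrable \<pi> (\<lambda>z. dist (fst z) (snd z))"
      using coupling_cost_integrable[OF m \<pi>(1)] by simp
    have ig: "integrable \<pi> (\<lambda>z. g (fst z) (snd z) i j)" if "i \<in> ?G" "j \<in> ?G" for i j
    proof (rule \<pi>.integrable_const_bound[where B=1])
      show "(\<lambda>z. g (fst z) (snd z) i j) \<in> borel_measurable \<pi>"
        unfolding g_def tv_coupling_def by measurable
    qed (use g0 g_le that in auto)
    define b where "b i = 1 / N\<^sup>2 + ycoord n y i" for i
    have b0: "0 \<le> b i" if "i \<in> ?G" for i using y that by (auto simp: adm_def b_def abs_le_iff)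
    \<comment> \<open>On the diagonal sits \<open>b\<close>, the uniform share together with the
      perturbation. It is the same for both measures and contributes to the marginals but not to the
      cost.\<close>
    define a where "a i j = N / (N + 1) * ((\<integral>z. g (fst z) (snd z) i j \<partial>\<pi>) + (if i = j then b i else 0))" for i j
    have a0: "0 \<le> a i j" if "i \<in> ?G" for i j
      unfolding a_def using g0[OF that] b0[OF that] N_pos
      by (intro mult_nonneg_nonneg add_nonneg_nonneg integral_nonneg) auto
    have a1: "(\<Sum>j\<in>?G. a i j) = wt (?w \<mu>) i" if i: "i \<in> ?G" for i
    proof -
      have "(\<Sum>j\<in>?G. \<integral>z. g (fst z) (snd z) i j \<partial>\<pi>) = (\<integral>z. wgt n I h i (fst z) \<partial>\<pi>)"
        using ig[OF i] g1[OF i] by (simp add: Bochner_Integration.integral_sum[symmetric])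
      also have "\<dots> = psi n I h i \<mu>"
        unfolding psi_eq[OF I n h D\<mu>] by (rule coupling_integrable(3)[OF \<pi>(1) wm])
      finally show ?thesis
        unfolding a_def sum_distrib_left[symmetric] sum.distrib wt_zc[OF D\<mu> i] b_def using i by (simp add: sum.delta')
    qed
    have a2: "(\<Sum>i\<in>?G. a i j) = wt (?w \<nu>) j" if j: "j \<in> ?G" for j
    proof -
      have "(\<Sum>i\<in>?G. \<integral>z. g (fst z) (snd z) i j \<partial>\<pi>) = (\<integral>z. wgt n I h j (snd z) \<partial>\<pi>)"
        using ig[OF _ j] g2[OF j] by (simp add: Bochner_Integration.integral_sum[symmetric])
      also have "\<dots> = psi n I h j \<nu>"
        unfolding psi_eq[OF I n h D\<nu>] by (rule coupling_integrable(4)[OF \<pi>(1) wm])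
      finally show ?thesis
        unfolding a_def sum_distrib_left[symmetric] sum.distrib wt_zc[OF D\<nu> j] b_def using j by (simp add: sum.delta)
    qed
    have "wasserstein 1 (nu (?w \<mu>)) (nu (?w \<nu>)) \<le> (\<Sum>i\<in>?G. \<Sum>j\<in>?G. a i j * dist (node n i) (node n j))"
      unfolding nu_def by (rule wasserstein_atomic_coupling_le) (use a0 a1 a2 wt_sum in auto)
    also have "\<dots> = N / (N + 1) * (\<Sum>i\<in>?G. \<Sum>j\<in>?G. (\<integral>z. g (fst z) (snd z) i j \<partial>\<pi>) * dist (node n i) (node n j))"
      unfolding sum_distrib_left by (intro sum.cong refl) (auto simp: a_def)
    also have "\<dots> = N / (N + 1) * (\<integral>z. (\<Sum>i\<in>?G. \<Sum>j\<in>?G. g (fst z) (snd z) i j * dist (node n i) (node n j)) \<partial>\<pi>)"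
      using ig by (simp add: Bochner_Integration.integral_sum)
    also have "\<dots> \<le> 1 * (\<integral>z. ?C * dist (fst z) (snd z) \<partial>\<pi>)"
    proof (rule mult_mono)
      show "(\<integral>z. (\<Sum>i\<in>?G. \<Sum>j\<in>?G. g (fst z) (snd z) i j * dist (node n i) (node n j)) \<partial>\<pi>) \<le> (\<integral>z. ?C * dist (fst z) (snd z) \<partial>\<pi>)"
        using gc ig id by (intro integral_mono Bochner_Integration.integrable_sum integrable_mult_left integrable_mult_right) auto
      show "0 \<le> (\<integral>z. (\<Sum>i\<in>?G. \<Sum>j\<in>?G. g (fst z) (snd z) i j * dist (node n i) (node n j)) \<partial>\<pi>)"
        by (intro Bochner_Integration.integral_nonneg sum_nonneg mult_nonneg_nonneg g0) auto
    qed (use N_pos in auto)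
    also have "\<dots> \<le> ?C * e" using \<pi>(2) C id by (simp add: mult_left_mono)
    finally show ?thesis .
  qed
  then have *: "wasserstein 1 (nu (?w \<mu>)) (nu (?w \<nu>)) \<le> ?C * (wasserstein 1 \<mu> \<nu> + e)" if "0 < e" for e
    using that by simp
  have "((\<lambda>e. ?C * (wasserstein 1 \<mu> \<nu> + e)) \<longlongrightarrow> ?C * (wasserstein 1 \<mu> \<nu> + 0)) (at_right 0)"
    by (intro tendsto_intros)
  then show ?thesis
    using * by (intro tendsto_lowerbound[where F="at_right (0::real)"]) (auto intro!: eventually_mono[OF eventually_at_right_less])
qed

lemma mollify_Lipschitz:
  assumes L: "lipschitz_W1 L U" "0 \<le> L"
  shows "lipschitz_W1 (mollify_const CARD('d) * L) (mollify n I h \<zeta> U)"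
  unfolding lipschitz_W1_def
proof (intro ballI)
  fix \<mu> \<nu> :: "(real^'d) measure" assume m: "\<mu> \<in> Pp 1" "\<nu> \<in> Pp 1"
  let ?w = "\<lambda>\<mu> y. \<lambda>j\<in>J. zc \<mu> j + y j"
  have eq: "mollify n I h \<zeta> U \<mu> - mollify n I h \<zeta> U \<nu> = (\<integral>y. \<zeta> y * (V (?w \<mu> y) - V (?w \<nu> y)) \<partial>M)"
    unfolding mollify_eq(2)[OF Pp_D(1,2)[OF m(1)]] mollify_eq(2)[OF Pp_D(1,2)[OF m(2)]] right_diff_distrib
    by (rule Bochner_Integration.integral_diff[symmetric]) (rule integrable_zeta_V)+
  have "\<bar>(\<integral>y. \<zeta> y * (V (?w \<mu> y) - V (?w \<nu> y)) \<partial>M) - 0\<bar> \<le> L * (mollify_const CARD('d) * wasserstein 1 \<mu> \<nu>)"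
  proof (rule kernel_average)
    show "integrable M (\<lambda>y. \<zeta> y * (V (?w \<mu> y) - V (?w \<nu> y)))"
      unfolding right_diff_distrib by (intro Bochner_Integration.integrable_diff integrable_zeta_V)
    fix y :: "int^'d \<Rightarrow> real" assume "y \<in> Delta n"
    then have y: "y \<in> adm" using Delta_adm by blast
    have S: "?w \<mu> y \<in> Sp" "?w \<nu> y \<in> Sp" using m by (auto intro!: shifted_in_Sp[OF _ _ y] dest: Pp_D(1,2))
    have "\<bar>U (nu (?w \<mu> y)) - U (nu (?w \<nu> y))\<bar> \<le> L * wasserstein 1 (nu (?w \<mu> y)) (nu (?w \<nu> y))"
      using L(1) nu_Pp S unfolding lipschitz_W1_def by blast
    also have "\<dots> \<le> L * (mollify_const CARD('d) * wasserstein 1 \<mu> \<nu>)"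
      by (rule mult_left_mono[OF nu_Lipschitz[OF m y] L(2)])
    finally show "\<bar>V (?w \<mu> y) - V (?w \<nu> y) - 0\<bar> \<le> L * (mollify_const CARD('d) * wasserstein 1 \<mu> \<nu>)"
      using S by (simp add: V_def)
  qed
  then show "\<bar>mollify n I h \<zeta> U \<mu> - mollify n I h \<zeta> U \<nu>\<bar> \<le> mollify_const CARD('d) * L * wasserstein 1 \<mu> \<nu>"
    unfolding eq by (simp add: mult_ac)
qed

end

text \<open>The notion of Lipschitz continuity admits any real constant. Two distinct Dirac measures
  have positive distance, which forces the sign that the estimate of the mollification relies
  on.\<close>

lemma lipschitz_W1_const_nonneg:
  fixes U :: "(real^'d) measure \<Rightarrow> real"
  assumes "lipschitz_W1 L U"
  shows "0 \<le> L"
proof -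
  define \<mu> where "\<mu> x = atomic {()} (\<lambda>_. 1) (\<lambda>_. x)" for x :: "real^'d"
  have P: "\<mu> x \<in> Pp 1" for x unfolding \<mu>_def by (rule atomic_Pp) auto
  let ?e = "(\<chi> l. 1) :: real^'d"
  have i: "(\<integral>y. norm y \<partial>\<mu> x) = norm x" for x
    unfolding \<mu>_def by (subst integral_atomic) auto
  have e0: "?e \<noteq> 0" by (simp add: vec_eq_iff)
  have "\<mu> 0 \<noteq> \<mu> ?e"
  proof
    assume "\<mu> 0 = \<mu> ?e"
    then have "norm (0 :: real^'d) = norm ?e" using i by metis
    then show False using e0 by simp
  qed
  then have "wasserstein 1 (\<mu> 0) (\<mu> ?e) \<noteq> 0" using wasserstein_eq_0_imp_eq[OF P P] by auto
  then have pos: "0 < wasserstein 1 (\<mu> 0) (\<mu> ?e)" using wasserstein_nonneg[of 1 "\<mu> 0" "\<mu> ?e"] by simp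
  have "\<bar>U (\<mu> 0) - U (\<mu> ?e)\<bar> \<le> L * wasserstein 1 (\<mu> 0) (\<mu> ?e)"
    using assms P unfolding lipschitz_W1_def by blast
  then have "0 \<le> L * wasserstein 1 (\<mu> 0) (\<mu> ?e)" by linarith
  then show ?thesis using pos by (simp add: zero_le_mult_iff)
qed

lemma tendsto_0_ennrealI:
  fixes f :: "nat \<Rightarrow> ennreal"
  assumes "\<And>e::real. 0 < e \<Longrightarrow> \<forall>\<^sub>F n in sequentially. f n \<le> ennreal e"
  shows "f \<longlonglongrightarrow> 0"
proof (rule order_tendstoI)
  fix a :: ennreal assume "0 < a"
  then obtain b where b: "0 < b" "b < a" using dense by blast
  then have "b < \<top>" using less_le_trans[of b a \<top>] by simp
  then obtain e where e: "b = ennreal e" "0 < e" using b(1) by (cases b) auto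
  show "\<forall>\<^sub>F n in sequentially. f n < a"
    using assms[OF e(2)] by eventually_elim (use b e in auto)
qed auto

text \<open>Uniform tails make the bound of \<open>mu_n_close\<close> uniform over the compact set.
  The statement stays outside the locale because \<open>n\<close> varies in it.\<close>

lemma mu_n_uniformly_close:
  fixes \<M> :: "(real^'d) measure set" and U :: "(real^'d) measure \<Rightarrow> real"
  assumes \<M>: "compactin (wtop 1) \<M>" and d: "mollifier_data I h \<zeta>" and U: "C0_P 1 U" and \<delta>: "0 < \<delta>"
  shows "\<forall>\<^sub>F n in sequentially. 3 \<le> n \<and> (\<forall>\<mu>\<in>\<M>. \<forall>y\<in>mollifier.adm n (Ngrid TYPE('d) n).
    wasserstein 1 \<mu> (mollifier.nu n (Ngrid TYPE('d) n) (\<lambda>j\<in>grid0 n. mollifier.zc n (I n) (h n) \<mu> j + y j)) < \<delta>)"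
proof -
  have sub: "\<M> \<subseteq> Pp 1" using compactin_subset_topspace[OF \<M>] by simp
  \<comment> \<open>One quarter, since the tail enters with a factor 2 and the other half of
    \<delta> is reserved for the 3d/n term.\<close>
  obtain R where R: "0 \<le> R" "\<And>\<mu>. \<mu> \<in> \<M> \<Longrightarrow> (\<integral>x. tail R x \<partial>\<mu>) < \<delta> / 4"
    using compact_uniform_tail[OF \<M>, of "\<delta> / 4"] \<delta> by auto
  have "\<forall>\<^sub>F n in sequentially. 3 \<le> n \<and> 2 * R \<le> real n \<and> 6 * real CARD('d) / \<delta> < real n"
    using filterlim_at_top[THEN iffD1, OF filterlim_real_sequentially]
      filterlim_at_top_dense[THEN iffD1, OF filterlim_real_sequentially]
    by (intro eventually_conj eventually_ge_at_top) blast+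
  then show ?thesis
  proof eventually_elim
    case (elim n)
    then interpret mollifier n "I n" "h n" "\<zeta> n" U "Ngrid TYPE('d) n"
      using d U by unfold_locales (auto simp: mollifier_data_def)
    have s: "3 * real CARD('d) / real n < \<delta> / 2"
      using elim n \<delta> by (simp add: field_simps)
    have "wasserstein 1 \<mu> (nu (\<lambda>j\<in>J. zc \<mu> j + y j)) < \<delta>" if "\<mu> \<in> \<M>" "y \<in> adm" for \<mu> y
    proof -
      have \<mu>: "\<mu> \<in> Pp 1" using that sub by blast
      have "(\<integral>x. tail (real n / 2) x \<partial>\<mu>) \<le> (\<integral>x. tail R x \<partial>\<mu>)"
        using elim R(1) by (intro integral_mono tail_integrable[OF \<mu>] tail_facts) auto
      then show ?thesis using mu_n_close[OF \<mu> that(2)] R(2)[OF that(1)] s by linarith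
    qed
    then show ?case using n by blast
  qed
qed

lemma mollify_converges:
  fixes \<M> :: "(real^'d) measure set"
  assumes \<M>: "compactin (wtop 1) \<M>" and d: "mollifier_data I h \<zeta>" and U: "C0_P 1 U"
  shows "(\<lambda>n. SUP \<mu>\<in>\<M>. ennreal \<bar>mollify n (I n) (h n) (\<zeta> n) U \<mu> - U \<mu>\<bar>) \<longlonglongrightarrow> 0"
proof (rule tendsto_0_ennrealI)
  fix e :: real assume e: "0 < e"
  have sub: "\<M> \<subseteq> Pp 1" using compactin_subset_topspace[OF \<M>] by simp
  obtain \<delta> where \<delta>: "0 < \<delta>" "\<And>\<mu> \<nu>. \<mu> \<in> \<M> \<Longrightarrow> \<nu> \<in> Pp 1 \<Longrightarrow> wasserstein 1 \<mu> \<nu> < \<delta> \<Longrightarrow> \<bar>U \<nu> - U \<mu>\<bar> < e"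
    using uniformly_continuous_near_compact[OF U \<M> e] by blast
  show "\<forall>\<^sub>F n in sequentially. (SUP \<mu>\<in>\<M>. ennreal \<bar>mollify n (I n) (h n) (\<zeta> n) U \<mu> - U \<mu>\<bar>) \<le> ennreal e"
    using mu_n_uniformly_close[OF \<M> d U \<delta>(1)]
  proof eventually_elim
    case (elim n)
    then interpret mollifier n "I n" "h n" "\<zeta> n" U "Ngrid TYPE('d) n"
      using d U by unfold_locales (auto simp: mollifier_data_def)
    have "\<bar>mollify n (I n) (h n) (\<zeta> n) U \<mu> - U \<mu>\<bar> \<le> e" if \<mu>: "\<mu> \<in> \<M>" for \<mu>
    proof (rule mollify_close)
      show P: "\<mu> \<in> Pp 1" using \<mu> sub by blast
      fix y :: "int^'d \<Rightarrow> real" assume "y \<in> Delta n"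
      then have y: "y \<in> adm" using Delta_adm by blast
      have "nu (\<lambda>j\<in>J. zc \<mu> j + y j) \<in> Pp 1" by (intro nu_Pp shifted_in_Sp y Pp_D(1,2)[OF P])
      then show "\<bar>U (nu (\<lambda>j\<in>J. zc \<mu> j + y j)) - U \<mu>\<bar> \<le> e"
        using \<delta>(2)[OF \<mu>] elim \<mu> y by (meson less_imp_le)
    qed
    then show ?case by (intro SUP_least ennreal_leI)
  qed
qed

section \<open>The Wasserstein derivative at atoms\<close>

text \<open>The mixture of \<mu> with weight \<open>1 - e\<close> and the Dirac measure at
  \<open>x\<close> with weight \<open>e\<close>, written as the law of a Bernoulli choice. The same
  choice couples it with \<mu>, moving a point with probability \<open>e\<close> only.\<close>

definition atom_mix :: "real \<Rightarrow> real^'d \<Rightarrow> (real^'d) measure \<Rightarrow> (real^'d) measure" where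
  "atom_mix e x \<mu> = distr (\<mu> \<Otimes>\<^sub>M measure_pmf (bernoulli_pmf e)) borel (\<lambda>z. if snd z then x else fst z)"

lemma atom_mix:
  fixes \<mu> :: "(real^'d) measure"
  assumes \<mu>: "\<mu> \<in> Pp 2" and e: "0 < e" "e \<le> 1"
  shows "atom_mix e x \<mu> \<in> Pp 2" "0 < measure (atom_mix e x \<mu>) {x}"
    "wasserstein 2 \<mu> (atom_mix e x \<mu>) \<le> sqrt (e * (\<integral>y. (dist y x)\<^sup>2 \<partial>\<mu>))"
proof -
  note D = Pp_D[OF \<mu>]
  let ?b = "measure_pmf (bernoulli_pmf e)"
  let ?P = "\<mu> \<Otimes>\<^sub>M ?b"
  let ?B = "borel \<Otimes>\<^sub>M borel :: ((real^'d) \<times> (real^'d)) measure"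
  interpret m: prob_space \<mu> by fact
  interpret b: prob_space ?b by (rule prob_space_measure_pmf)
  interpret P: pair_prob_space \<mu> ?b ..
  note [measurable_cong] = D(2)
  have snd_b [measurable]: "Measurable.pred ?P snd"
    using measurable_snd[of \<mu> ?b] by simp
  have X [measurable]: "(\<lambda>z. if snd z then x else fst z) \<in> borel_measurable ?P" by measurable
  have int: "(\<integral>\<^sup>+z. F z \<partial>?P) = (\<integral>\<^sup>+y. ennreal e * F (y, True) + ennreal (1 - e) * F (y, False) \<partial>\<mu>)"
    if [measurable]: "F \<in> borel_measurable ?P" for F
    using e by (subst measure_pmf.nn_integral_fst[symmetric]) (auto intro!: nn_integral_cong simp: mult.commute)
  have i2: "integrable \<mu> (\<lambda>y. (dist y x)\<^sup>2)"
  proof (rule Bochner_Integration.integrable_bound)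
    show "integrable \<mu> (\<lambda>y. 2 ^ 2 * ((norm y)\<^sup>2 + (norm x)\<^sup>2))" using D(4) by simp
    have "(dist y x)\<^sup>2 \<le> 2 ^ 2 * ((norm y)\<^sup>2 + (norm x)\<^sup>2)" for y
      using power_mono[OF norm_triangle_ineq4[of y x], of 2] power_sum_le[of "norm y" "norm x" 2]
      unfolding dist_norm by (meson norm_ge_zero order_trans)
    then show "AE y in \<mu>. norm ((dist y x)\<^sup>2) \<le> norm (2 ^ 2 * ((norm y)\<^sup>2 + (norm x)\<^sup>2))"
      by (intro AE_I2) simp
  qed measurable
  have mixP: "prob_space (atom_mix e x \<mu>)"
    unfolding atom_mix_def by (rule P.prob_space_distr[OF X])
  have "integrable (atom_mix e x \<mu>) (\<lambda>y. (norm y)\<^sup>2)"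
  proof (rule integrableI_nonneg)
    have "(\<integral>\<^sup>+y. ennreal ((norm y)\<^sup>2) \<partial>atom_mix e x \<mu>) = (\<integral>\<^sup>+z. ennreal ((norm (if snd z then x else fst z))\<^sup>2) \<partial>?P)"
      unfolding atom_mix_def by (rule nn_integral_distr[OF X]) simp
    also have "\<dots> = (\<integral>\<^sup>+y. ennreal e * ennreal ((norm x)\<^sup>2) + ennreal (1 - e) * ennreal ((norm y)\<^sup>2) \<partial>\<mu>)"
      by (subst int) auto
    also have "\<dots> = (\<integral>\<^sup>+y. ennreal (e * (norm x)\<^sup>2 + (1 - e) * (norm y)\<^sup>2) \<partial>\<mu>)"
      using e by (intro nn_integral_cong) (simp add: ennreal_mult)
    also have "\<dots> = ennreal (\<integral>y. e * (norm x)\<^sup>2 + (1 - e) * (norm y)\<^sup>2 \<partial>\<mu>)"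
      using D(4) e by (intro nn_integral_eq_integral) auto
    finally show "(\<integral>\<^sup>+y. ennreal ((norm y)\<^sup>2) \<partial>atom_mix e x \<mu>) < \<infinity>" by simp
  qed (auto simp: atom_mix_def)
  then show mix: "atom_mix e x \<mu> \<in> Pp 2" using mixP by (simp add: Pp_def atom_mix_def)
  have "ennreal e \<le> emeasure (atom_mix e x \<mu>) {x}"
  proof -
    have "ennreal e = (\<integral>\<^sup>+y. ennreal e \<partial>\<mu>)" by (simp add: m.emeasure_space_1)
    also have "\<dots> \<le> (\<integral>\<^sup>+y. ennreal e * indicator {x} x + ennreal (1 - e) * indicator {x} y \<partial>\<mu>)"
      by (intro nn_integral_mono) simp
    also have "\<dots> = (\<integral>\<^sup>+z. indicator {x} (if snd z then x else fst z) \<partial>?P)" by (subst int) auto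
    also have "\<dots> = (\<integral>\<^sup>+y. indicator {x} y \<partial>atom_mix e x \<mu>)"
      unfolding atom_mix_def by (rule nn_integral_distr[OF X, symmetric]) simp
    finally show ?thesis by (simp add: atom_mix_def)
  qed
  then have "e \<le> measure (atom_mix e x \<mu>) {x}"
    using prob_space.finite_measure[OF mixP] e by (simp add: finite_measure.emeasure_eq_measure)
  then show "0 < measure (atom_mix e x \<mu>) {x}" using e by linarith
  have T [measurable]: "(\<lambda>z. (fst z, if snd z then x else fst z)) \<in> measurable ?P ?B" by measurable
  have "distr (distr ?P ?B (\<lambda>z. (fst z, if snd z then x else fst z))) borel fst = distr ?P \<mu> fst"
    by (subst distr_distr[OF _ T]) (auto simp: comp_def D(2) intro!: distr_cong)
  moreover have "\<dots> = \<mu>" by (rule prob_space.distr_pair_fst[OF prob_space_measure_pmf])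
  moreover have "distr (distr ?P ?B (\<lambda>z. (fst z, if snd z then x else fst z))) borel snd = atom_mix e x \<mu>"
    unfolding atom_mix_def by (subst distr_distr[OF _ T]) (auto simp: comp_def)
  ultimately have cp: "distr ?P ?B (\<lambda>z. (fst z, if snd z then x else fst z)) \<in> couplings \<mu> (atom_mix e x \<mu>)"
    using P.prob_space_distr[OF T] by (simp add: couplings_def)
  let ?c = "\<integral>y. (dist y x)\<^sup>2 \<partial>\<mu>"
  have c0: "0 \<le> ?c" by (rule Bochner_Integration.integral_nonneg) simp
  have "(\<integral>\<^sup>+z. ennreal (dist (fst z) (snd z) ^ 2) \<partial>distr ?P ?B (\<lambda>z. (fst z, if snd z then x else fst z)))
      = (\<integral>\<^sup>+z. ennreal ((dist (fst z) (if snd z then x else fst z))\<^sup>2) \<partial>?P)"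
    by (subst nn_integral_distr[OF T]) auto
  also have "\<dots> = (\<integral>\<^sup>+y. ennreal e * ennreal ((dist y x)\<^sup>2) \<partial>\<mu>)"
    by (subst int) auto
  also have "\<dots> = ennreal e * ennreal ?c"
    using i2 by (simp add: nn_integral_cmult nn_integral_eq_integral)
  also have "\<dots> = ennreal ((sqrt (e * ?c))\<^sup>2)" using e c0 by (simp add: ennreal_mult)
  finally show "wasserstein 2 \<mu> (atom_mix e x \<mu>) \<le> sqrt (e * ?c)"
    using e c0 by (intro wasserstein_le[OF cp]) auto
qed

lemma has_wderivD:
  fixes \<xi> :: "(real^'d) \<times> (real^'d) \<Rightarrow> real^'d"
  assumes "has_wderiv U D" "prob_space M" "\<xi> \<in> L2 M"
  shows "\<eta> \<in> L2 M \<Longrightarrow> integrable M (\<lambda>\<omega>. D (distr M borel \<xi>) (\<xi> \<omega>) \<bullet> \<eta> \<omega>)"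
    "0 < \<epsilon> \<Longrightarrow> \<exists>\<delta>>0. \<forall>\<eta>\<in>L2 M. L2norm M \<eta> \<le> \<delta> \<longrightarrow>
      \<bar>U (distr M borel (\<lambda>\<omega>. \<xi> \<omega> + \<eta> \<omega>)) - U (distr M borel \<xi>)
        - (\<integral>\<omega>. D (distr M borel \<xi>) (\<xi> \<omega>) \<bullet> \<eta> \<omega> \<partial>M)\<bar> \<le> \<epsilon> * L2norm M \<eta>"
  using assms(1)[unfolded has_wderiv_def, THEN spec, THEN mp, OF assms(2), THEN bspec, OF assms(3)]
  by (blast dest: bspec)+

text \<open>Only the atom at \<open>x\<close> is displaced, in the direction of the supposed
  difference \<open>v\<close> of the two derivatives. The linear terms then differ by the mass of
  the atom times \<open>t\<close> times the square of \<open>norm v\<close>, which exceeds the sum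
  of both errors for small displacements.\<close>

lemma wderiv_unique_at_atom:
  fixes D D' :: "(real^'d) measure \<Rightarrow> real^'d \<Rightarrow> real^'d"
  assumes D: "has_wderiv U D" and D': "has_wderiv U D'" and \<mu>: "\<mu> \<in> Pp 2" and a: "0 < measure \<mu> {x}"
  shows "D \<mu> x = D' \<mu> x"
proof (rule ccontr)
  assume ne: "D \<mu> x \<noteq> D' \<mu> x"
  define v where "v = D \<mu> x - D' \<mu> x"
  have v: "0 < norm v" using ne by (simp add: v_def)
  note P = Pp_D[OF \<mu>]
  interpret m: prob_space \<mu> by fact
  note [measurable_cong] = P(2)
  let ?B = "borel \<Otimes>\<^sub>M borel :: ((real^'d) \<times> (real^'d)) measure"
  have T [measurable]: "(\<lambda>y. (y, 0)) \<in> measurable \<mu> ?B" by measurable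
  \<comment> \<open>The expansion quantifies over laws on pairs; the second coordinate is kept at
    0.\<close>
  define M where "M = distr \<mu> ?B (\<lambda>y. (y, 0 :: real^'d))"
  have sM [measurable_cong]: "sets M = sets ?B" by (simp add: M_def)
  have M: "prob_space M" unfolding M_def by (rule m.prob_space_distr[OF T])
  have law: "distr M borel fst = \<mu>"
    unfolding M_def by (subst distr_distr[OF _ T]) (auto simp: comp_def P(2) intro!: distr_id2)
  have fm [measurable]: "fst \<in> borel_measurable M" by measurable
  have "integrable M (\<lambda>z. (norm (fst z))\<^sup>2)"
    unfolding M_def by (subst integrable_distr_eq[OF T]) (measurable, use P(4) in simp)
  then have \<xi>: "fst \<in> L2 M" unfolding L2_def by (intro CollectI conjI fm)
  define \<eta> where "\<eta> t z = (if fst z = x then t *\<^sub>R v else 0)" for t and z :: "(real^'d) \<times> (real^'d)"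
  have "Measurable.pred M (\<lambda>z. fst z \<in> {x})" by measurable
  then have [measurable]: "Measurable.pred M (\<lambda>z. fst z = x)" by simp
  have \<eta>m [measurable]: "\<eta> t \<in> borel_measurable M" for t unfolding \<eta>_def by measurable
  let ?a = "measure \<mu> {x}"
  have \<eta>int: "integrable M (\<lambda>z. F (fst z) \<bullet> \<eta> t z)" "(\<integral>z. F (fst z) \<bullet> \<eta> t z \<partial>M) = ?a * t * (F x \<bullet> v)" for F :: "real^'d \<Rightarrow> real^'d" and t
  proof -
    have e: "(\<lambda>z. F (fst z) \<bullet> \<eta> t z) = (\<lambda>z. indicator {x} (fst z) * (t * (F x \<bullet> v)))"
      by (auto simp: \<eta>_def fun_eq_iff indicator_def)
    have i: "integrable \<mu> (\<lambda>y. indicator {x} y * (t * (F x \<bullet> v)))" by (simp add: m.emeasure_eq_measure)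
    show "integrable M (\<lambda>z. F (fst z) \<bullet> \<eta> t z)"
      unfolding e M_def using i by (subst integrable_distr_eq[OF T]) auto
    show "(\<integral>z. F (fst z) \<bullet> \<eta> t z \<partial>M) = ?a * t * (F x \<bullet> v)"
      unfolding e M_def using i by (subst integral_distr[OF T]) (auto simp: P(3))
  qed
  have \<eta>n: "L2norm M (\<eta> t) = \<bar>t\<bar> * norm v * sqrt ?a" and \<eta>L: "\<eta> t \<in> L2 M" for t
  proof -
    have e: "(\<lambda>z. (norm (\<eta> t z))\<^sup>2) = (\<lambda>z. indicator {x} (fst z) * (\<bar>t\<bar> * norm v)\<^sup>2)"
      by (auto simp: \<eta>_def fun_eq_iff indicator_def)
    have i: "integrable \<mu> (\<lambda>y. indicator {x} y * (\<bar>t\<bar> * norm v)\<^sup>2)" by (simp add: m.emeasure_eq_measure)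
    have "integrable M (\<lambda>z. (norm (\<eta> t z))\<^sup>2)"
      unfolding e M_def using i by (subst integrable_distr_eq[OF T]) auto
    then show "\<eta> t \<in> L2 M" unfolding L2_def by (intro CollectI conjI \<eta>m)
    have "(\<integral>z. (norm (\<eta> t z))\<^sup>2 \<partial>M) = ?a * (\<bar>t\<bar> * norm v)\<^sup>2"
      unfolding e M_def using i by (subst integral_distr[OF T]) (auto simp: P(3))
    then show "L2norm M (\<eta> t) = \<bar>t\<bar> * norm v * sqrt ?a"
      unfolding L2norm_def by (simp add: real_sqrt_mult mult.commute)
  qed
  \<comment> \<open>Chosen so that twice the error is half of the difference of the linear terms;
    the root of the mass comes from the L2 norm of the displacement.\<close>
  define \<epsilon> where "\<epsilon> = sqrt ?a * norm v / 4"
  have \<epsilon>: "0 < \<epsilon>" using a v by (simp add: \<epsilon>_def)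
  have ex: "\<exists>\<delta>>0. \<forall>\<eta>\<in>L2 M. L2norm M \<eta> \<le> \<delta> \<longrightarrow>
           \<bar>U (distr M borel (\<lambda>\<omega>. fst \<omega> + \<eta> \<omega>)) - U \<mu> - (\<integral>\<omega>. E \<mu> (fst \<omega>) \<bullet> \<eta> \<omega> \<partial>M)\<bar> \<le> \<epsilon> * L2norm M \<eta>"
    if "has_wderiv U E" for E :: "(real^'d) measure \<Rightarrow> real^'d \<Rightarrow> real^'d"
    using has_wderivD(2)[OF that M \<xi> \<epsilon>] unfolding law .
  obtain \<delta> where \<delta>: "0 < \<delta>" "\<And>\<eta>. \<eta> \<in> L2 M \<Longrightarrow> L2norm M \<eta> \<le> \<delta> \<Longrightarrow>
           \<bar>U (distr M borel (\<lambda>\<omega>. fst \<omega> + \<eta> \<omega>)) - U \<mu> - (\<integral>\<omega>. D \<mu> (fst \<omega>) \<bullet> \<eta> \<omega> \<partial>M)\<bar> \<le> \<epsilon> * L2norm M \<eta>"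
    using ex[OF D] by blast
  obtain \<delta>' where \<delta>': "0 < \<delta>'" "\<And>\<eta>. \<eta> \<in> L2 M \<Longrightarrow> L2norm M \<eta> \<le> \<delta>' \<Longrightarrow>
           \<bar>U (distr M borel (\<lambda>\<omega>. fst \<omega> + \<eta> \<omega>)) - U \<mu> - (\<integral>\<omega>. D' \<mu> (fst \<omega>) \<bullet> \<eta> \<omega> \<partial>M)\<bar> \<le> \<epsilon> * L2norm M \<eta>"
    using ex[OF D'] by blast
  define t where "t = min \<delta> \<delta>' / (norm v * sqrt ?a)"
  have t: "0 < t" using \<delta> \<delta>' v a by (simp add: t_def)
  have n: "L2norm M (\<eta> t) = min \<delta> \<delta>'" unfolding \<eta>n using t v a \<delta>(1) \<delta>'(1) by (simp add: t_def)
  have "\<bar>(\<integral>\<omega>. D \<mu> (fst \<omega>) \<bullet> \<eta> t \<omega> \<partial>M) - (\<integral>\<omega>. D' \<mu> (fst \<omega>) \<bullet> \<eta> t \<omega> \<partial>M)\<bar> \<le> 2 * (\<epsilon> * L2norm M (\<eta> t))"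
    using \<delta>(2)[OF \<eta>L[of t]] \<delta>'(2)[OF \<eta>L[of t]] n by auto
  then have "\<bar>?a * t * (D \<mu> x \<bullet> v) - ?a * t * (D' \<mu> x \<bullet> v)\<bar> \<le> 2 * (\<epsilon> * L2norm M (\<eta> t))"
    unfolding \<eta>int(2) .
  also have "?a * t * (D \<mu> x \<bullet> v) - ?a * t * (D' \<mu> x \<bullet> v) = ?a * t * (norm v)\<^sup>2"
    by (simp add: v_def power2_norm_eq_inner inner_diff_left inner_diff_right algebra_simps)
  also have "2 * (\<epsilon> * L2norm M (\<eta> t)) = ?a * t * (norm v)\<^sup>2 / 2"
    unfolding \<eta>n \<epsilon>_def using t a by (simp add: power2_eq_square algebra_simps)
  finally have "\<bar>?a * t * (norm v)\<^sup>2\<bar> \<le> ?a * t * (norm v)\<^sup>2 / 2" .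
  moreover have "0 < ?a * t * (norm v)\<^sup>2" using a t v by simp
  ultimately show False by linarith
qed

lemma has_cont_wderiv_slice:
  assumes "has_cont_wderiv U D"
  shows "continuous_map (wtop 2) euclidean (\<lambda>\<mu>. D \<mu> x)" "\<mu> \<in> Pp 2 \<Longrightarrow> continuous_on UNIV (D \<mu>)"
proof -
  have c: "continuous_map (prod_topology (wtop 2) euclidean) euclidean (\<lambda>(\<mu>, x). D \<mu> x)"
    using assms by (simp add: has_cont_wderiv_def)
  have "continuous_map (wtop 2) (prod_topology (wtop 2) euclidean) (\<lambda>\<mu>. (\<mu>, x))"
    by (simp add: continuous_map_pairwise comp_def)
  from continuous_map_compose[OF this c] show "continuous_map (wtop 2) euclidean (\<lambda>\<mu>. D \<mu> x)"
    by (simp add: comp_def)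
  assume "\<mu> \<in> Pp 2"
  then have "continuous_map euclidean (prod_topology (wtop 2) euclidean) (\<lambda>x. (\<mu>, x))"
    by (simp add: continuous_map_pairwise comp_def)
  from continuous_map_compose[OF this c] show "continuous_on UNIV (D \<mu>)"
    by (simp add: comp_def)
qed

text \<open>Mixing in an atom of small mass at \<open>x\<close> gives nearby measures at which both
  derivatives agree at \<open>x\<close>. Continuity in the measure passes the agreement to
  \<mu>.\<close>

lemma has_cont_wderiv_unique:
  fixes D D' :: "(real^'d) measure \<Rightarrow> real^'d \<Rightarrow> real^'d"
  assumes D: "has_cont_wderiv U D" and D': "has_cont_wderiv U D'" and \<mu>: "\<mu> \<in> Pp 2"
  shows "D \<mu> x = D' \<mu> x"
proof (rule ccontr)
  assume "D \<mu> x \<noteq> D' \<mu> x"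
  then have e: "0 < dist (D \<mu> x) (D' \<mu> x) / 2" by simp
  obtain \<delta> where \<delta>: "0 < \<delta>" "\<And>\<nu>. \<nu> \<in> Pp 2 \<Longrightarrow> wasserstein 2 \<mu> \<nu> < \<delta> \<Longrightarrow> dist (D \<mu> x) (D \<nu> x) < dist (D \<mu> x) (D' \<mu> x) / 2"
    using continuous_map_wtop_euclidean[THEN iffD1, OF _ has_cont_wderiv_slice(1)[OF D, of x],
      THEN bspec, OF _ \<mu>, THEN spec, THEN mp, OF _ e] by auto
  obtain \<delta>' where \<delta>': "0 < \<delta>'" "\<And>\<nu>. \<nu> \<in> Pp 2 \<Longrightarrow> wasserstein 2 \<mu> \<nu> < \<delta>' \<Longrightarrow> dist (D' \<mu> x) (D' \<nu> x) < dist (D \<mu> x) (D' \<mu> x) / 2"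
    using continuous_map_wtop_euclidean[THEN iffD1, OF _ has_cont_wderiv_slice(1)[OF D', of x],
      THEN bspec, OF _ \<mu>, THEN spec, THEN mp, OF _ e] by auto
  define c where "c = (\<integral>y. (dist y x)\<^sup>2 \<partial>\<mu>)"
  have c: "0 \<le> c" unfolding c_def by (rule Bochner_Integration.integral_nonneg) simp
  define r where "r = min \<delta> \<delta>'"
  have r: "0 < r" using \<delta>(1) \<delta>'(1) by (simp add: r_def)
  \<comment> \<open>Makes the distance bound, the root of \<open>e * c\<close>, smaller than the
    radius \<open>r\<close>; \<open>c\<close> may be 0, hence \<open>c + 1\<close>.\<close>
  define e where "e = min 1 (r\<^sup>2 / (c + 1) / 2)"
  have e: "0 < e" "e \<le> 1" using r c by (auto simp: e_def)
  have "e * c \<le> (r\<^sup>2 / (c + 1) / 2) * (c + 1)" using c e(1) by (intro mult_mono) (auto simp: e_def)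
  also have "\<dots> = r\<^sup>2 / 2" using c by (simp add: field_simps)
  also have "\<dots> < r\<^sup>2" using r by simp
  finally have "sqrt (e * c) < r" using r by (simp add: real_less_lsqrt)
  then have W: "wasserstein 2 \<mu> (atom_mix e x \<mu>) < r"
    using atom_mix(3)[OF \<mu> e, of x] unfolding c_def by linarith
  have m: "atom_mix e x \<mu> \<in> Pp 2" by (rule atom_mix(1)[OF \<mu> e])
  have "D (atom_mix e x \<mu>) x = D' (atom_mix e x \<mu>) x"
    by (rule wderiv_unique_at_atom[OF _ _ m atom_mix(2)[OF \<mu> e]]) (use D D' in \<open>auto simp: has_cont_wderiv_def\<close>)
  then show False
    using \<delta>(2)[OF m] \<delta>'(2)[OF m] W dist_triangle2[of "D \<mu> x" "D' \<mu> x" "D (atom_mix e x \<mu>) x"] by (simp add: r_def)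
qed

lemma has_cont_wderiv_wderiv:
  assumes "has_cont_wderiv U D"
  shows "has_cont_wderiv U (wderiv U)"
  unfolding wderiv_def by (rule someI[of "has_cont_wderiv U", OF assms])

lemma wderiv_eq:
  assumes "has_cont_wderiv U D" "\<mu> \<in> Pp 2"
  shows "wderiv U \<mu> x = D \<mu> x"
  using has_cont_wderiv_unique[OF has_cont_wderiv_wderiv[OF assms(1)] assms] .

section \<open>The derivative on and near compact sets of measures\<close>

text \<open>A finite subfamily that covers the compact set also covers a uniform neighbourhood of
  it, and thus all but finitely many members of the sequence. The remaining ones take one open set
  each.\<close>

lemma compactin_Un_approximating_sequence:
  fixes \<M> :: "(real^'d) measure set"
  assumes \<M>: "compactin (wtop 1) \<M>" and \<rho>: "\<And>k::nat. \<rho> k \<in> Pp 1" and m: "\<And>k. m k \<in> \<M>"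
    and W: "\<And>k. wasserstein 1 (m k) (\<rho> k) < 1 / (real k + 1)"
  shows "compactin (wtop 1) (\<M> \<union> range \<rho>)"
  unfolding compactin_def
proof (intro conjI allI impI)
  interpret Metric_space "Pp 1 :: (real^'d) measure set" "wasserstein 1" by (rule Metric_space_wasserstein) simp
  have sub: "\<M> \<subseteq> Pp 1" using compactin_subset_topspace[OF \<M>] by simp
  then show "\<M> \<union> range \<rho> \<subseteq> topspace (wtop 1)" using \<rho> by auto
  fix \<U> assume \<U>: "Ball \<U> (openin (wtop 1)) \<and> \<M> \<union> range \<rho> \<subseteq> \<Union>\<U>"
  then obtain \<F> where \<F>: "finite \<F>" "\<F> \<subseteq> \<U>" "\<M> \<subseteq> \<Union>\<F>"
    using compactinD[OF \<M>, of \<U>] by auto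
  have op: "openin (wtop 1) (\<Union>\<F>)" using \<U> \<F>(2) by auto
  have "\<exists>r>0. mball \<mu> r \<subseteq> \<Union>\<F>" if "\<mu> \<in> \<M>" for \<mu>
    using op \<F>(3) that unfolding wtop_def openin_mtopology by blast
  then have "\<forall>\<mu>. \<exists>r. \<mu> \<in> \<M> \<longrightarrow> 0 < r \<and> mball \<mu> r \<subseteq> \<Union>\<F>" by blast
  from choice[OF this] obtain r where r: "\<And>\<mu>. \<mu> \<in> \<M> \<Longrightarrow> 0 < r \<mu>" "\<And>\<mu>. \<mu> \<in> \<M> \<Longrightarrow> mball \<mu> (r \<mu>) \<subseteq> \<Union>\<F>" by blast
  obtain F where F: "finite F" "F \<subseteq> \<M>" "\<And>\<mu>. \<mu> \<in> \<M> \<Longrightarrow> \<exists>\<nu>\<in>F. wasserstein 1 \<nu> \<mu> < r \<nu> / 2"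
    using compactin_wtop_finite_cover[OF _ \<M>, of "\<lambda>\<mu>. r \<mu> / 2"] r(1) by auto
  define s where "s = Min (insert 1 ((\<lambda>\<nu>. r \<nu> / 2) ` F))"
  have s: "0 < s" using F r(1) by (auto simp: s_def)
  obtain k0 where k0: "1 / s < real k0" using reals_Archimedean2 by blast
  have far: "\<rho> k \<in> \<Union>\<F>" if k: "k0 \<le> k" for k
  proof -
    obtain \<nu> where \<nu>: "\<nu> \<in> F" "wasserstein 1 \<nu> (m k) < r \<nu> / 2" using F(3)[OF m] by blast
    have "1 / s < real k + 1" using k0 k by linarith
    then have "1 / (real k + 1) < s" using s by (simp add: field_simps)
    moreover have "s \<le> r \<nu> / 2" unfolding s_def using F(1) \<nu>(1) by (intro Min_le) auto
    moreover have "wasserstein 1 \<nu> (\<rho> k) \<le> wasserstein 1 \<nu> (m k) + wasserstein 1 (m k) (\<rho> k)"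
      using \<nu>(1) F(2) sub m \<rho> by (intro wasserstein_triangle) auto
    ultimately have "wasserstein 1 \<nu> (\<rho> k) < r \<nu>" using \<nu>(2) W[of k] by linarith
    then have "\<rho> k \<in> mball \<nu> (r \<nu>)" using \<nu>(1) F(2) sub \<rho>[of k] unfolding in_mball by blast
    then show ?thesis using r(2) \<nu>(1) F(2) by blast
  qed
  have "\<forall>k. \<exists>T. T \<in> \<U> \<and> \<rho> k \<in> T" using \<U> by blast
  from choice[OF this] obtain T where T: "\<And>k. T k \<in> \<U>" "\<And>k. \<rho> k \<in> T k" by blast
  show "\<exists>\<F>. finite \<F> \<and> \<F> \<subseteq> \<U> \<and> \<M> \<union> range \<rho> \<subseteq> \<Union>\<F>"
  proof (intro exI conjI)
    show "finite (\<F> \<union> T ` {..<k0})" using \<F>(1) by simp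
    show "\<F> \<union> T ` {..<k0} \<subseteq> \<U>" using \<F>(2) T(1) by blast
    show "\<M> \<union> range \<rho> \<subseteq> \<Union>(\<F> \<union> T ` {..<k0})"
    proof
      fix \<nu> assume "\<nu> \<in> \<M> \<union> range \<rho>"
      then consider "\<nu> \<in> \<M>" | k where "\<nu> = \<rho> k" "k0 \<le> k" | k where "\<nu> = \<rho> k" "k < k0"
        by (metis Un_iff imageE not_le)
      then show "\<nu> \<in> \<Union>(\<F> \<union> T ` {..<k0})"
      proof cases
        case 1 then show ?thesis using \<F>(3) by blast
      next
        case 2 then show ?thesis using far by blast
      next
        case 3 then show ?thesis using T(2) by blast
      qed
    qed
  qed
qed

text \<open>Uniform continuity on every compact set gives uniform continuity at a compact set, with the
  second measure outside of it: a violating sequence, added to the compact set, leaves it compact.\<close>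

lemma derivative_near_compact:
  fixes D :: "(real^'d) measure \<Rightarrow> real^'d \<Rightarrow> real^'d"
  assumes H: "\<And>\<M>. compactin (wtop 1) \<M> \<Longrightarrow> unif_cont_W1 (\<M> \<inter> Pp 2) K D"
    and \<M>: "compactin (wtop 1) \<M>" and \<epsilon>: "0 < \<epsilon>"
  obtains \<delta> where "0 < \<delta>" "\<And>\<mu> \<rho> x y. \<mu> \<in> \<M> \<inter> Pp 2 \<Longrightarrow> \<rho> \<in> Pp 2 \<Longrightarrow> x \<in> K \<Longrightarrow> y \<in> K \<Longrightarrow>
    wasserstein 1 \<mu> \<rho> < \<delta> \<Longrightarrow> dist x y < \<delta> \<Longrightarrow> dist (D \<mu> x) (D \<rho> y) < \<epsilon>"
proof (rule ccontr)
  assume no: "\<not> thesis"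
  \<comment> \<open>A violating quadruple of two measures and two points, packed into nested pairs
    so that a single choice produces the sequence.\<close>
  have "\<exists>q. fst q \<in> \<M> \<inter> Pp 2 \<and> fst (snd q) \<in> Pp 2 \<and> fst (snd (snd q)) \<in> K \<and> snd (snd (snd q)) \<in> K \<and>
      wasserstein 1 (fst q) (fst (snd q)) < 1 / (real k + 1) \<and> dist (fst (snd (snd q))) (snd (snd (snd q))) < 1 / (real k + 1) \<and>
      \<not> dist (D (fst q) (fst (snd (snd q)))) (D (fst (snd q)) (snd (snd (snd q)))) < \<epsilon>" for k :: nat
  proof (rule ccontr)
    assume neg: "\<not> ?thesis"
    have "thesis"
    proof (rule that)
      show "0 < 1 / (real k + 1)" by simp
      fix \<mu> \<rho> and x y :: "real^'d" assume "\<mu> \<in> \<M> \<inter> Pp 2" "\<rho> \<in> Pp 2" "x \<in> K" "y \<in> K"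
        "wasserstein 1 \<mu> \<rho> < 1 / (real k + 1)" "dist x y < 1 / (real k + 1)"
      then show "dist (D \<mu> x) (D \<rho> y) < \<epsilon>"
        using neg by (metis fst_conv snd_conv)
    qed
    then show False using no by simp
  qed
  then have "\<forall>k. \<exists>q. fst q \<in> \<M> \<inter> Pp 2 \<and> fst (snd q) \<in> Pp 2 \<and> fst (snd (snd q)) \<in> K \<and> snd (snd (snd q)) \<in> K \<and>
      wasserstein 1 (fst q) (fst (snd q)) < 1 / (real k + 1) \<and> dist (fst (snd (snd q))) (snd (snd (snd q))) < 1 / (real k + 1) \<and>
      \<not> dist (D (fst q) (fst (snd (snd q)))) (D (fst (snd q)) (snd (snd (snd q)))) < \<epsilon>" by blast
  from choice[OF this] obtain q where q: "\<And>k::nat. fst (q k) \<in> \<M> \<inter> Pp 2" "\<And>k. fst (snd (q k)) \<in> Pp 2"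
    "\<And>k. fst (snd (snd (q k))) \<in> K" "\<And>k. snd (snd (snd (q k))) \<in> K"
    "\<And>k. wasserstein 1 (fst (q k)) (fst (snd (q k))) < 1 / (real k + 1)"
    "\<And>k. dist (fst (snd (snd (q k)))) (snd (snd (snd (q k)))) < 1 / (real k + 1)"
    "\<And>k. \<not> dist (D (fst (q k)) (fst (snd (snd (q k))))) (D (fst (snd (q k))) (snd (snd (snd (q k))))) < \<epsilon>" by blast
  define \<rho> where "\<rho> k = fst (snd (q k))" for k
  have "compactin (wtop 1) (\<M> \<union> range \<rho>)"
    by (rule compactin_Un_approximating_sequence[where m="\<lambda>k. fst (q k)"])
      (use \<M> q(1,2,5) Pp_antimono[of _ 2] in \<open>auto simp: \<rho>_def\<close>)
  then obtain \<delta> where \<delta>: "0 < \<delta>" "\<And>\<mu> \<nu> x y. \<mu> \<in> (\<M> \<union> range \<rho>) \<inter> Pp 2 \<Longrightarrow> \<nu> \<in> (\<M> \<union> range \<rho>) \<inter> Pp 2 \<Longrightarrow> x \<in> K \<Longrightarrow> y \<in> K \<Longrightarrow>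
      wasserstein 1 \<mu> \<nu> < \<delta> \<and> dist x y < \<delta> \<Longrightarrow> dist (D \<mu> x) (D \<nu> y) < \<epsilon>"
    using H \<epsilon> unfolding unif_cont_W1_def by meson
  obtain k :: nat where k: "1 / \<delta> < real k" using reals_Archimedean2 by blast
  have "1 / \<delta> < real k + 1" using k by linarith
  then have "1 / (real k + 1) < \<delta>" using \<delta>(1) by (simp add: field_simps)
  then have "wasserstein 1 (fst (q k)) (\<rho> k) < \<delta> \<and> dist (fst (snd (snd (q k)))) (snd (snd (snd (q k)))) < \<delta>"
    using q(5,6)[of k] unfolding \<rho>_def by linarith
  moreover have "fst (q k) \<in> (\<M> \<union> range \<rho>) \<inter> Pp 2" "\<rho> k \<in> (\<M> \<union> range \<rho>) \<inter> Pp 2"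
    using q(1,2)[of k] by (auto simp: \<rho>_def)
  ultimately have "dist (D (fst (q k)) (fst (snd (snd (q k))))) (D (\<rho> k) (snd (snd (snd (q k))))) < \<epsilon>"
    using q(3,4)[of k] by (intro \<delta>(2))
  then show False using q(7)[of k] by (simp add: \<rho>_def)
qed

text \<open>The centres of a finite cover lie in the compact set but perhaps not in
  \<open>Pp 2\<close>, where the derivative is controlled. Each ball that meets \<open>Pp 2\<close>
  therefore gets a representative there, whose derivative is bounded on \<open>K\<close>; other
  members of the ball differ from it by less than 1.\<close>

lemma derivative_bounded_on_compact:
  fixes D :: "(real^'d) measure \<Rightarrow> real^'d \<Rightarrow> real^'d"
  assumes H: "unif_cont_W1 (\<M> \<inter> Pp 2) K D" and c: "\<And>\<mu>. \<mu> \<in> Pp 2 \<Longrightarrow> continuous_on UNIV (D \<mu>)"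
    and \<M>: "compactin (wtop 1) \<M>" and K: "compact K"
  obtains B where "0 \<le> B" "\<And>\<mu> x. \<mu> \<in> \<M> \<inter> Pp 2 \<Longrightarrow> x \<in> K \<Longrightarrow> norm (D \<mu> x) \<le> B"
proof -
  have sub: "\<M> \<subseteq> Pp 1" using compactin_subset_topspace[OF \<M>] by simp
  obtain \<delta> where \<delta>: "0 < \<delta>" "\<And>\<mu> \<nu> x y. \<mu> \<in> \<M> \<inter> Pp 2 \<Longrightarrow> \<nu> \<in> \<M> \<inter> Pp 2 \<Longrightarrow> x \<in> K \<Longrightarrow> y \<in> K \<Longrightarrow>
      wasserstein 1 \<mu> \<nu> < \<delta> \<and> dist x y < \<delta> \<Longrightarrow> dist (D \<mu> x) (D \<nu> y) < 1"
    using H zero_less_one unfolding unif_cont_W1_def by meson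
  obtain F where F: "finite F" "F \<subseteq> \<M>" "\<And>\<mu>. \<mu> \<in> \<M> \<Longrightarrow> \<exists>\<nu>\<in>F. wasserstein 1 \<nu> \<mu> < \<delta> / 2"
    using compactin_wtop_finite_cover[OF _ \<M>, of "\<lambda>_. \<delta> / 2"] \<delta>(1) by auto
  have bd: "\<exists>b. \<forall>x\<in>K. norm (D \<mu> x) \<le> b" if "\<mu> \<in> Pp 2" for \<mu>
  proof -
    have "bounded (D \<mu> ` K)"
      by (intro compact_imp_bounded compact_continuous_image K continuous_on_subset[OF c[OF that]]) simp
    then show ?thesis by (auto simp: bounded_iff)
  qed
  have "\<exists>b. \<forall>\<mu>\<in>\<M> \<inter> Pp 2. wasserstein 1 \<nu> \<mu> < \<delta> / 2 \<longrightarrow> (\<forall>x\<in>K. norm (D \<mu> x) \<le> b)" if \<nu>: "\<nu> \<in> F" for \<nu>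
  proof (cases "\<exists>\<mu>0\<in>\<M> \<inter> Pp 2. wasserstein 1 \<nu> \<mu>0 < \<delta> / 2")
    case True
    then obtain \<mu>0 where \<mu>0: "\<mu>0 \<in> \<M> \<inter> Pp 2" "wasserstein 1 \<nu> \<mu>0 < \<delta> / 2" by blast
    obtain b where b: "\<And>x. x \<in> K \<Longrightarrow> norm (D \<mu>0 x) \<le> b" using bd[of \<mu>0] \<mu>0(1) by blast
    show ?thesis
    proof (intro exI ballI impI)
      fix \<mu> x assume \<mu>: "\<mu> \<in> \<M> \<inter> Pp 2" "wasserstein 1 \<nu> \<mu> < \<delta> / 2" and x: "x \<in> K"
      have "wasserstein 1 \<mu> \<mu>0 \<le> wasserstein 1 \<mu> \<nu> + wasserstein 1 \<nu> \<mu>0"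
        using \<mu>(1) \<mu>0(1) \<nu> F(2) sub by (intro wasserstein_triangle) auto
      then have "wasserstein 1 \<mu> \<mu>0 < \<delta>" using \<mu>(2) \<mu>0(2) wasserstein_commute[of 1 \<mu> \<nu>] by linarith
      then have "dist (D \<mu> x) (D \<mu>0 x) < 1" using \<delta>(1) by (intro \<delta>(2)[OF \<mu>(1) \<mu>0(1) x x]) simp
      then show "norm (D \<mu> x) \<le> b + 1"
        using b[OF x] norm_triangle_sub[of "D \<mu> x" "D \<mu>0 x"] by (simp add: dist_norm)
    qed
  qed blast
  then have "\<forall>\<nu>. \<exists>b. \<nu> \<in> F \<longrightarrow> (\<forall>\<mu>\<in>\<M> \<inter> Pp 2. wasserstein 1 \<nu> \<mu> < \<delta> / 2 \<longrightarrow> (\<forall>x\<in>K. norm (D \<mu> x) \<le> b))" by blast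
  from choice[OF this] obtain b where b: "\<And>\<nu> \<mu> x. \<nu> \<in> F \<Longrightarrow> \<mu> \<in> \<M> \<inter> Pp 2 \<Longrightarrow> wasserstein 1 \<nu> \<mu> < \<delta> / 2 \<Longrightarrow> x \<in> K \<Longrightarrow> norm (D \<mu> x) \<le> b \<nu>" by blast
  show ?thesis
  proof (rule that[of "Max (insert 0 (b ` F))"])
    show "0 \<le> Max (insert 0 (b ` F))" using F(1) by simp
    fix \<mu> x assume \<mu>: "\<mu> \<in> \<M> \<inter> Pp 2" and x: "x \<in> K"
    obtain \<nu> where \<nu>: "\<nu> \<in> F" "wasserstein 1 \<nu> \<mu> < \<delta> / 2" using F(3) \<mu> by blast
    have "b \<nu> \<le> Max (insert 0 (b ` F))" using F(1) \<nu>(1) by (intro Max_ge) auto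
    then show "norm (D \<mu> x) \<le> Max (insert 0 (b ` F))" using b[OF \<nu>(1) \<mu> \<nu>(2) x] by linarith
  qed
qed

text \<open>Moving mass \<open>\<sigma>\<close> from the atom at \<open>f b\<close> along the segment to \<open>p\<close>: the
  Wasserstein derivative is the ordinary derivative along this path.\<close>

lemma mass_transfer:
  fixes D :: "(real^'d) measure \<Rightarrow> real^'d \<Rightarrow> real^'d" and f :: "'i \<Rightarrow> real^'d"
  assumes D: "has_wderiv U D" and A: "finite A" and a: "\<And>i. i \<in> A \<Longrightarrow> 0 \<le> a i" "(\<Sum>i\<in>A. a i) = 1"
    and b: "b \<in> A" and \<sigma>: "0 \<le> \<sigma>" "\<sigma> \<le> a b" and c: "c \<in> A"
  obtains \<theta> \<rho> where "0 < \<theta>" "\<theta> < 1" "\<rho> \<in> Pp 2" "wasserstein 1 (atomic A a f) \<rho> \<le> \<sigma> * dist (f c) (f b)"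
    "U (atomic A (\<lambda>i. a i + (if i = c then \<sigma> else 0) - (if i = b then \<sigma> else 0)) f) - U (atomic A a f)
      = \<sigma> * (D \<rho> (f b + \<theta> *\<^sub>R (f c - f b)) \<bullet> (f c - f b))"
proof -
  define v where "v = f c - f b"
  \<comment> \<open>One additional parcel \<open>None\<close> of mass \<open>\<sigma>\<close>, taken
    out of the atom \<open>b\<close>, travels; the parcels \<open>Some i\<close> stay.\<close>
  define T where "T = insert None (Some ` A)"
  define g where "g t = (case t of None \<Rightarrow> \<sigma> | Some i \<Rightarrow> a i - (if i = b then \<sigma> else 0))" for t
  define X where "X s t = (case t of None \<Rightarrow> f b + s *\<^sub>R v | Some i \<Rightarrow> f i)" for s and t :: "'i option"
  define Y where "Y t = (case t of None \<Rightarrow> v | Some i \<Rightarrow> 0)" for t :: "'i option"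
  have T: "finite T" using A by (simp add: T_def)
  have sumT: "(\<Sum>t\<in>T. F t) = F None + (\<Sum>i\<in>A. F (Some i))" for F :: "'i option \<Rightarrow> real"
    using A by (simp add: T_def sum.reindex)
  have g0: "0 \<le> g t" if "t \<in> T" for t using that a(1) \<sigma> by (auto simp: T_def g_def)
  have g1: "(\<Sum>t\<in>T. g t) = 1"
    unfolding sumT using a(2) A b by (simp add: g_def sum_subtractf sum.delta)
  define \<nu> where "\<nu> s = atomic T g (X s)" for s
  have \<nu>P: "\<nu> s \<in> Pp p" for s p unfolding \<nu>_def using T g0 g1 by (rule atomic_Pp)
  let ?P = "point_measure T (\<lambda>t. ennreal (g t))"
  let ?B = "borel \<Otimes>\<^sub>M borel :: ((real^'d) \<times> (real^'d)) measure"
  define M where "M = distr ?P ?B (\<lambda>t. (X 0 t, Y t))"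
  have Tm: "(\<lambda>t. (X 0 t, Y t)) \<in> measurable ?P ?B" by (auto simp: space_pair_measure)
  have sM [measurable_cong]: "sets M = sets ?B" by (simp add: M_def)
  have pP: "prob_space ?P"
    using T g0 g1 by (intro prob_spaceI) (simp add: emeasure_point_measure_finite space_point_measure sum_ennreal)
  have M: "prob_space M" unfolding M_def by (rule prob_space.prob_space_distr[OF pP Tm])
  have iM: "integrable M F" "(\<integral>z. F z \<partial>M) = (\<Sum>t\<in>T. g t * F (X 0 t, Y t))"
    if F: "F \<in> borel_measurable M" for F :: "(real^'d) \<times> (real^'d) \<Rightarrow> real"
  proof -
    have F': "F \<in> borel_measurable ?B" using F measurable_cong_sets[OF sM refl] by blast
    show "integrable M F"
      unfolding M_def integrable_distr_eq[OF Tm F'] using T by (rule integrable_point_measure_finite)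
    show "(\<integral>z. F z \<partial>M) = (\<Sum>t\<in>T. g t * F (X 0 t, Y t))"
      unfolding M_def integral_distr[OF Tm F'] using T g0
      by (subst lebesgue_integral_point_measure_finite) auto
  qed
  \<comment> \<open>The measure \<open>M\<close> is the joint law of starting point and velocity, so
    an increment in time is a displacement by a multiple of the velocity. This makes the expansion
    applicable at every time \<open>s\<close>.\<close>
  define \<xi> where "\<xi> s z = fst z + s *\<^sub>R snd z" for s and z :: "(real^'d) \<times> (real^'d)"
  have \<xi>m [measurable]: "\<xi> s \<in> borel_measurable M" for s unfolding \<xi>_def by measurable
  have \<xi>X: "\<xi> s (X 0 t, Y t) = X s t" for s t by (cases t) (auto simp: \<xi>_def X_def Y_def)
  have L2I: "F \<in> L2 M" if [measurable]: "F \<in> borel_measurable M" for F :: "(real^'d) \<times> (real^'d) \<Rightarrow> real^'d"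
    unfolding L2_def by (intro CollectI conjI that iM(1)) measurable
  have law: "distr M borel (\<xi> s) = \<nu> s" for s
  proof -
    have "\<xi> s \<in> borel_measurable ?B" unfolding \<xi>_def by measurable
    then show ?thesis
      unfolding M_def \<nu>_def atomic_def by (subst distr_distr[OF _ Tm]) (auto simp: comp_def \<xi>X)
  qed
  define \<Phi> where "\<Phi> s = U (\<nu> s)" for s
  define \<Phi>' where "\<Phi>' s = \<sigma> * (D (\<nu> s) (f b + s *\<^sub>R v) \<bullet> v)" for s
  have sndm: "snd \<in> borel_measurable M" by measurable
  define N where "N = L2norm M snd"
  have N: "0 \<le> N" unfolding N_def by (rule L2_D(6)[OF M L2I[OF sndm]])
  have der: "(\<Phi> has_real_derivative \<Phi>' s) (at s)" for s
    unfolding DERIV_def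
  proof (rule LIM_I)
    fix e :: real assume e: "0 < e"
    define \<epsilon> where "\<epsilon> = e / (2 * (N + 1))"
    have \<epsilon>: "0 < \<epsilon>" using e N by (simp add: \<epsilon>_def)
    obtain \<delta> where \<delta>: "0 < \<delta>" "\<And>\<eta>. \<eta> \<in> L2 M \<Longrightarrow> L2norm M \<eta> \<le> \<delta> \<Longrightarrow>
        \<bar>U (distr M borel (\<lambda>\<omega>. \<xi> s \<omega> + \<eta> \<omega>)) - U (distr M borel (\<xi> s)) - (\<integral>\<omega>. D (distr M borel (\<xi> s)) (\<xi> s \<omega>) \<bullet> \<eta> \<omega> \<partial>M)\<bar> \<le> \<epsilon> * L2norm M \<eta>"
      using has_wderivD(2)[OF D M L2I[OF \<xi>m[of s]] \<epsilon>] by blast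
    show "\<exists>r>0. \<forall>h. h \<noteq> 0 \<and> norm (h - 0) < r \<longrightarrow> norm ((\<Phi> (s + h) - \<Phi> s) / h - \<Phi>' s) < e"
    proof (intro exI[of _ "\<delta> / (N + 1)"] conjI allI impI)
      show "0 < \<delta> / (N + 1)" using \<delta>(1) N by simp
      fix h :: real assume h: "h \<noteq> 0 \<and> norm (h - 0) < \<delta> / (N + 1)"
      define \<eta> where "\<eta> z = h *\<^sub>R snd z" for z :: "(real^'d) \<times> (real^'d)"
      have \<eta>m: "\<eta> \<in> borel_measurable M" unfolding \<eta>_def by measurable
      have \<eta>L: "\<eta> \<in> L2 M" by (rule L2I[OF \<eta>m])
      have \<eta>N: "L2norm M \<eta> = \<bar>h\<bar> * N"
        unfolding L2norm_def N_def \<eta>_def by (simp add: power_mult_distrib real_sqrt_mult)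
      have "\<bar>h\<bar> * (N + 1) < \<delta>" using h N by (simp add: pos_less_divide_eq)
      then have small: "L2norm M \<eta> \<le> \<delta>" unfolding \<eta>N using N by (simp add: distrib_left)
      have sh: "(\<lambda>\<omega>. \<xi> s \<omega> + \<eta> \<omega>) = \<xi> (s + h)"
        by (auto simp: \<xi>_def \<eta>_def fun_eq_iff scaleR_add_left)
      have "(\<lambda>\<omega>. D (distr M borel (\<xi> s)) (\<xi> s \<omega>) \<bullet> \<eta> \<omega>) \<in> borel_measurable M"
        by (rule borel_measurable_integrable[OF has_wderivD(1)[OF D M L2I[OF \<xi>m[of s]] \<eta>L]])
      then have "(\<integral>\<omega>. D (distr M borel (\<xi> s)) (\<xi> s \<omega>) \<bullet> \<eta> \<omega> \<partial>M)
          = (\<Sum>t\<in>T. g t * (D (\<nu> s) (\<xi> s (X 0 t, Y t)) \<bullet> \<eta> (X 0 t, Y t)))"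
        unfolding law by (rule iM(2))
      \<comment> \<open>Only the travelling parcel has a nonzero velocity.\<close>
      also have "\<dots> = h * \<Phi>' s"
        unfolding sumT \<xi>X by (simp add: \<eta>_def Y_def X_def g_def \<Phi>'_def)
      finally have "\<bar>\<Phi> (s + h) - \<Phi> s - h * \<Phi>' s\<bar> \<le> \<epsilon> * (\<bar>h\<bar> * N)"
        using \<delta>(2)[OF \<eta>L small] unfolding sh law \<eta>N \<Phi>_def by simp
      also have "\<dots> \<le> \<bar>h\<bar> * (e / 2)"
      proof -
        have "\<epsilon> * N \<le> \<epsilon> * (N + 1)" using \<epsilon> by (intro mult_left_mono) auto
        also have "\<dots> = e / 2" using N by (simp add: \<epsilon>_def field_simps)
        finally have "\<bar>h\<bar> * (\<epsilon> * N) \<le> \<bar>h\<bar> * (e / 2)" by (intro mult_left_mono) auto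
        then show ?thesis by (simp add: mult_ac)
      qed
      finally have *: "\<bar>\<Phi> (s + h) - \<Phi> s - h * \<Phi>' s\<bar> \<le> \<bar>h\<bar> * (e / 2)" .
      have "(\<Phi> (s + h) - \<Phi> s) / h - \<Phi>' s = (\<Phi> (s + h) - \<Phi> s - h * \<Phi>' s) / h"
        using h by (simp add: diff_divide_distrib)
      then have "\<bar>(\<Phi> (s + h) - \<Phi> s) / h - \<Phi>' s\<bar> = \<bar>\<Phi> (s + h) - \<Phi> s - h * \<Phi>' s\<bar> / \<bar>h\<bar>" by (simp add: abs_divide)
      also have "\<dots> \<le> e / 2" using * h by (simp add: pos_divide_le_eq mult.commute)
      also have "\<dots> < e" using e by simp
      finally show "norm ((\<Phi> (s + h) - \<Phi> s) / h - \<Phi>' s) < e" by simp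
    qed
  qed
  obtain \<theta> where \<theta>: "0 < \<theta>" "\<theta> < 1" "\<Phi> 1 - \<Phi> 0 = (1 - 0) * \<Phi>' \<theta>"
    using MVT2[of 0 1 \<Phi> \<Phi>'] der by auto
  have \<nu>0: "\<nu> 0 = atomic A a f"
    unfolding \<nu>_def
  proof (rule atomic_eqI)
    fix B show "(\<Sum>t\<in>T. g t * indicator B (X 0 t)) = (\<Sum>i\<in>A. a i * indicator B (f i) :: real)"
      unfolding sumT using A b by (simp add: g_def X_def left_diff_distrib sum_subtractf if_distrib[of "\<lambda>r. r * _"] sum.delta cong: if_cong)
  qed (use T g0 A a in auto)
  have \<nu>1: "\<nu> 1 = atomic A (\<lambda>i. a i + (if i = c then \<sigma> else 0) - (if i = b then \<sigma> else 0)) f"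
    unfolding \<nu>_def
  proof (rule atomic_eqI)
    fix B show "(\<Sum>t\<in>T. g t * indicator B (X 1 t))
        = (\<Sum>i\<in>A. (a i + (if i = c then \<sigma> else 0) - (if i = b then \<sigma> else 0)) * indicator B (f i) :: real)"
      unfolding sumT using A b c
      by (simp add: g_def X_def v_def left_diff_distrib distrib_right sum.distrib sum_subtractf if_distrib[of "\<lambda>r. r * _"] sum.delta cong: if_cong)
  next
    fix i assume "i \<in> A" then show "0 \<le> a i + (if i = c then \<sigma> else 0) - (if i = b then \<sigma> else 0)"
      using a(1)[of i] \<sigma> by auto
  qed (use T g0 A in auto)
  have W: "wasserstein 1 (\<nu> 0) (\<nu> \<theta>) \<le> \<sigma> * norm v"
    unfolding \<nu>_def
  proof (rule wasserstein_atomic_le[OF T g0 g1])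
    have "(\<Sum>t\<in>T. g t * dist (X 0 t) (X \<theta> t) ^ 1) = \<sigma> * (\<theta> * norm v)"
      unfolding sumT using \<theta> by (simp add: g_def X_def dist_norm)
    also have "\<dots> \<le> (\<sigma> * norm v) ^ 1"
      using \<theta> \<sigma> mult_right_mono[of \<theta> 1 "norm v"] by (simp add: mult_left_mono)
    finally show "(\<Sum>t\<in>T. g t * dist (X 0 t) (X \<theta> t) ^ 1) \<le> (\<sigma> * norm v) ^ 1" .
  qed (use \<sigma> in auto)
  show ?thesis
  proof (rule that[OF \<theta>(1,2) \<nu>P[of \<theta>]])
    show "wasserstein 1 (atomic A a f) (\<nu> \<theta>) \<le> \<sigma> * dist (f c) (f b)"
      using W unfolding \<nu>0 by (simp add: v_def dist_norm)
    show "U (atomic A (\<lambda>i. a i + (if i = c then \<sigma> else 0) - (if i = b then \<sigma> else 0)) f) - U (atomic A a f)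
      = \<sigma> * (D (\<nu> \<theta>) (f b + \<theta> *\<^sub>R (f c - f b)) \<bullet> (f c - f b))"
      using \<theta>(3) unfolding \<Phi>_def \<Phi>'_def \<nu>0 \<nu>1 v_def by simp
  qed
qed

section \<open>Convergence of the derivative\<close>

lemma le_of_le_add_mult:
  fixes x E C t0 :: real
  assumes "\<And>t. 0 < t \<Longrightarrow> t \<le> t0 \<Longrightarrow> x \<le> E + C * t" "0 \<le> C" "0 < t0"
  shows "x \<le> E"
proof (rule field_le_epsilon)
  fix e :: real assume e: "0 < e"
  define t where "t = min t0 (e / (C + 1))"
  have t: "0 < t" "t \<le> t0" using assms e by (auto simp: t_def)
  have "C * t \<le> (C + 1) * (e / (C + 1))" using assms(2) t(1) by (intro mult_mono) (auto simp: t_def)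
  also have "\<dots> = e" using assms(2) by simp
  finally show "x \<le> E + e" using assms(1)[OF t] by linarith
qed

section \<open>Slopes of the partition functions\<close>

lemma phi1_derivative_family:
  assumes I: "profile n I" "3 \<le> n"
  obtains E where "\<And>j t. (phi1 n I j has_real_derivative E j t) (at t)"
    "\<And>j t. \<bar>E j t\<bar> \<le> real n + 1"
    "\<And>j t. 1 / real n < real n * t - real_of_int j \<Longrightarrow> real n * t - real_of_int j < 1 - 1 / real n \<Longrightarrow> E j t = - real n"
proof -
  have "\<exists>e. (\<forall>t. (phi1 n I j has_real_derivative e t) (at t)) \<and> (\<forall>t. \<bar>e t\<bar> \<le> real n + 1) \<and>
    (\<forall>t. 1 / real n < real n * t - real_of_int j \<longrightarrow> real n * t - real_of_int j < 1 - 1 / real n \<longrightarrow> e t = - real n)" for j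
  proof -
    obtain E where E: "E 0 = phi1 n I j" "\<And>k x. (E k has_real_derivative E (Suc k) x) (at x)"
      "\<And>x. \<bar>E 1 x\<bar> \<le> real n + 1"
      "\<And>x. 1 / real n < real n * x - j \<Longrightarrow> real n * x - j < 1 - 1 / real n \<Longrightarrow> E 1 x = - real n"
      using phi1_derivatives[OF I, of j] by metis
    have "(phi1 n I j has_real_derivative E 1 t) (at t)" for t using E(2)[of 0 t] E(1) by simp
    then show ?thesis using E(3,4) by blast
  qed
  then have "\<forall>j. \<exists>e. (\<forall>t. (phi1 n I j has_real_derivative e t) (at t)) \<and> (\<forall>t. \<bar>e t\<bar> \<le> real n + 1) \<and>
    (\<forall>t. 1 / real n < real n * t - real_of_int j \<longrightarrow> real n * t - real_of_int j < 1 - 1 / real n \<longrightarrow> e t = - real n)" by blast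
  from choice[OF this] show ?thesis using that by blast
qed

text \<open>The function is nonnegative and vanishes at \<open>t\<close>, so \<open>t\<close> is a
  minimum. This argument includes the endpoints of the support.\<close>

lemma phi1_derivative_zero:
  assumes I: "profile n I" "3 \<le> n" and E: "(phi1 n I j has_real_derivative e) (at t)"
    and j: "j \<noteq> \<lfloor>real n * t\<rfloor>" "j \<noteq> \<lfloor>real n * t\<rfloor> + 1"
  shows "e = 0"
proof -
  have "1 \<le> \<bar>real n * t - real_of_int j\<bar>"
  proof (cases "j < \<lfloor>real n * t\<rfloor>")
    case True
    then have "real_of_int j \<le> real_of_int \<lfloor>real n * t\<rfloor> - 1" by linarith
    then show ?thesis using of_int_floor_le[of "real n * t"] by linarith
  next
    case False
    then have "real_of_int \<lfloor>real n * t\<rfloor> + 2 \<le> real_of_int j" using j by linarith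
    then show ?thesis using real_of_int_floor_add_one_gt[of "real n * t"] by linarith
  qed
  then have "phi1 n I j t = 0" using phi1_bounds(3)[OF I, of j t] by auto
  then show ?thesis
    using DERIV_local_min[OF E zero_less_one] phi1_bounds(1)[OF I] by simp
qed

text \<open>The sum of the two functions is at most 1 everywhere and equals 1 at \<open>t\<close>,
  so \<open>t\<close> is a maximum of it. The two neighbours thus have opposite slopes, also when
  \<open>n * t\<close> is an integer.\<close>

lemma phi1_derivative_pair:
  assumes I: "profile n I" "3 \<le> n" and k: "k = \<lfloor>real n * t\<rfloor>"
    and E: "(phi1 n I k has_real_derivative e) (at t)" "(phi1 n I (k + 1) has_real_derivative e') (at t)"
  shows "e + e' = 0"
proof -
  have "((\<lambda>s. phi1 n I k s + phi1 n I (k + 1) s) has_real_derivative e + e') (at t)"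
    using E by (rule DERIV_add)
  moreover have le: "phi1 n I k s + phi1 n I (k + 1) s \<le> 1" for s
  proof -
    let ?B = "{k, k + 1, \<lfloor>real n * s\<rfloor>, \<lfloor>real n * s\<rfloor> + 1}"
    have "phi1 n I k s + phi1 n I (k + 1) s = (\<Sum>i\<in>{k, k + 1}. phi1 n I i s)" by simp
    also have "\<dots> \<le> (\<Sum>i\<in>?B. phi1 n I i s)" using phi1_bounds(1)[OF I] by (intro sum_mono2) auto
    also have "\<dots> = 1" by (rule phi1_sum[OF I]) auto
    finally show ?thesis .
  qed
  moreover have "phi1 n I k t + phi1 n I (k + 1) t = 1"
    using phi1_sum[OF I, of "{k, k + 1}" t] k by simp
  ultimately show ?thesis using DERIV_local_max[OF _ zero_less_one, of _ "e + e'" t] by simp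
qed

lemma axis_shift_component: "(i + axis l 1) $ m = (if m = l then i $ m + 1 else i $ m)" for i :: "int^'d"
  by (simp add: axis_def)

lemma node_shift: "node n (i + axis l 1) - node n i = axis l (1 / real n)"
  by (auto simp: node_def vec_eq_iff axis_def add_divide_distrib)

definition off_prod :: "nat \<Rightarrow> (real \<Rightarrow> real) \<Rightarrow> 'd::finite \<Rightarrow> int^'d \<Rightarrow> real^'d \<Rightarrow> real" where
  "off_prod n I l i x = (\<Prod>m\<in>UNIV - {l}. phi1 n I (i $ m) (x $ m))"

lemma grid_slice_shift_sum:
  fixes F :: "int^'d \<Rightarrow> real"
  assumes k: "- 2 * (int n)\<^sup>2 \<le> k" "k + 1 \<le> 2 * (int n)\<^sup>2"
  shows "(\<Sum>i\<in>{i\<in>grid n. i $ l = k + 1}. F i) = (\<Sum>i\<in>{i\<in>grid n. i $ l = k}. F (i + axis l 1))"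
proof (rule sum.reindex_bij_witness[where j="\<lambda>i. i - axis l 1" and i="\<lambda>i. i + axis l 1"])
  fix i :: "int^'d" assume i: "i \<in> {i\<in>grid n. i $ l = k + 1}"
  have "\<bar>(i - axis l 1) $ m\<bar> \<le> 2 * (int n)\<^sup>2" for m
  proof (cases "m = l")
    case True then show ?thesis using i k by (simp add: axis_def abs_le_iff)
  next
    case False then show ?thesis using i by (simp add: axis_def grid_def)
  qed
  then show "i - axis l 1 \<in> {i\<in>grid n. i $ l = k}" using i by (simp add: grid_def axis_def)
next
  fix i :: "int^'d" assume i: "i \<in> {i\<in>grid n. i $ l = k}"
  have "\<bar>(i + axis l 1) $ m\<bar> \<le> 2 * (int n)\<^sup>2" for m
  proof (cases "m = l")
    case True then show ?thesis using i k by (simp add: axis_def abs_le_iff)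
  next
    case False then show ?thesis using i by (simp add: axis_def grid_def)
  qed
  then show "i + axis l 1 \<in> {i\<in>grid n. i $ l = k + 1}" using i by (simp add: grid_def axis_def)
qed auto

text \<open>The partition of unity in the remaining d - 1 coordinates: the factor in direction
  \<open>l\<close> is replaced by 1 and its index is held at \<open>k\<close>.\<close>

lemma off_prod_slice_sum:
  fixes x :: "real^'d"
  assumes I: "profile n I" "3 \<le> n" and x: "x \<in> cubeQ (real n)"
    and k: "- 2 * (int n)\<^sup>2 \<le> k" "k \<le> 2 * (int n)\<^sup>2"
  shows "(\<Sum>i\<in>{i\<in>grid n. i $ l = k}. off_prod n I l i x) = 1"
proof -
  let ?R = "{- 2 * (int n)\<^sup>2 .. 2 * (int n)\<^sup>2}"
  let ?B = "\<lambda>m. if m = l then {k} else ?R"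
  let ?f = "\<lambda>m j. if m = l then 1 else phi1 n I j (x $ m)"
  have "{i :: int^'d. i \<in> grid n \<and> i $ l = k} = {i. \<forall>m. i $ m \<in> ?B m}"
  proof (intro set_eqI iffI)
    fix i :: "int^'d" assume "i \<in> {i \<in> grid n. i $ l = k}"
    then show "i \<in> {i. \<forall>m. i $ m \<in> ?B m}" unfolding grid_eq by simp
  next
    fix i :: "int^'d" assume i: "i \<in> {i. \<forall>m. i $ m \<in> ?B m}"
    have "i $ l = k" using spec[OF CollectD[OF i], of l] by simp
    moreover have "i $ m \<in> ?R" for m
      using spec[OF CollectD[OF i], of m] k \<open>i $ l = k\<close> by (cases "m = l") auto
    ultimately show "i \<in> {i \<in> grid n. i $ l = k}" unfolding grid_eq by blast
  qed
  moreover have "off_prod n I l i x = (\<Prod>m\<in>UNIV. ?f m (i $ m))" for i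
  proof -
    have "(\<Prod>m\<in>UNIV. ?f m (i $ m)) = ?f l (i $ l) * (\<Prod>m\<in>UNIV - {l}. ?f m (i $ m))"
      by (rule prod.remove) auto
    also have "(\<Prod>m\<in>UNIV - {l}. ?f m (i $ m)) = off_prod n I l i x"
      unfolding off_prod_def by (rule prod.cong) auto
    finally show ?thesis by simp
  qed
  ultimately have "(\<Sum>i\<in>{i\<in>grid n. i $ l = k}. off_prod n I l i x)
      = (\<Sum>i | \<forall>m. i $ m \<in> ?B m. \<Prod>m\<in>UNIV. ?f m (i $ m))" by simp
  also have "\<dots> = (\<Prod>m\<in>UNIV. \<Sum>j\<in>?B m. ?f m j)" by (rule sum_prod_vec) simp
  also have "\<dots> = (\<Prod>m\<in>(UNIV::'d set). 1)"
  proof (rule prod.cong[OF refl])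
    fix m
    have "\<bar>x $ m\<bar> \<le> real n" using x by (simp add: cubeQ_def)
    then have "\<bar>x $ m\<bar> \<le> 3 * real n / 2" by simp
    then show "(\<Sum>j\<in>?B m. ?f m j) = 1"
      using phi1_sum[OF I, of ?R "x $ m"] floor_in_grid_range[OF I(2), of "x $ m"] by auto
  qed
  finally show ?thesis by simp
qed

context mollifier
begin

text \<open>Moving the parameter by \<tau> from the coordinate \<open>b\<close> to the coordinate
  \<open>a\<close> is a transfer of mass \<open>N / (N + 1) * \<tau>\<close> between the two atoms.
  The reserve of \<open>1 / N ^ 3\<close> keeps the donating weight nonnegative.\<close>

lemma V_transfer:
  assumes D: "has_wderiv U D" and \<mu>: "\<mu> \<in> Pp 2" and y: "y \<in> Delta n"
    and a: "a \<in> grid n" and b: "b \<in> grid n" and \<tau>: "0 < \<tau>" "\<tau> \<le> 1 / N ^ 3"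
  obtains \<theta> \<rho> where "0 < \<theta>" "\<theta> < 1" "\<rho> \<in> Pp 2"
    "wasserstein 1 (nu (\<lambda>j\<in>J. zc \<mu> j + y j)) \<rho> \<le> N / (N + 1) * \<tau> * norm (node n a - node n b :: real^'d)"
    "V (\<lambda>j\<in>J. (zc \<mu> j + \<tau> * ((if j = a then 1 else 0) - (if j = b then 1 else 0))) + y j) - V (\<lambda>j\<in>J. zc \<mu> j + y j)
      = N / (N + 1) * \<tau> * (D \<rho> (node n b + \<theta> *\<^sub>R (node n a - node n b)) \<bullet> (node n a - node n b))"
proof -
  note P = Pp_D(1,2)[OF \<mu>]
  define e where "e j = (if j = a then 1 else 0) - (if j = b then 1 else (0::real))" for j
  let ?w = "\<lambda>j\<in>J. zc \<mu> j + y j" and ?w' = "\<lambda>j\<in>J. (zc \<mu> j + \<tau> * e j) + y j"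
  define \<sigma> where "\<sigma> = N / (N + 1) * \<tau>"
  have \<sigma>: "0 \<le> \<sigma>" using \<tau> N_pos by (simp add: \<sigma>_def)
  have S: "?w \<in> Sp" using shifted_in_Sp[OF P] y Delta_adm by blast
  \<comment> \<open>If \<open>a\<close> or \<open>b\<close> is the node 0, the free coordinates no
    longer balance, and the dependent coordinate takes up the difference.\<close>
  have eJ: "(\<Sum>j\<in>J. e j) = - e 0"
  proof -
    have "(\<Sum>j\<in>grid n. e j) = 0"
      unfolding e_def sum_subtractf using a b by (simp add: sum.delta)
    then show ?thesis unfolding sum_grid by simp
  qed
  have f: "full ?w' i = full ?w i + \<tau> * e i" if "i \<in> grid n" for i
  proof (cases "i = 0")
    case True
    have "(\<Sum>j\<in>J. ?w' j) = (\<Sum>j\<in>J. ?w j) + \<tau> * (\<Sum>j\<in>J. e j)"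
      by (simp add: sum.distrib sum_distrib_left)
    then show ?thesis unfolding full_def eJ using True by simp
  next
    case False
    then show ?thesis using that by (simp add: full_def)
  qed
  \<comment> \<open>The uniform share 1/N^2 minus the largest perturbation leaves exactly
    \<open>1 / N ^ 3\<close>.\<close>
  have lo: "\<tau> \<le> full ?w i + 1 / N\<^sup>2" if i: "i \<in> grid n" for i
    using Delta_ycoord(2)[OF y i] psi_nonneg[OF I n h P, of i] \<tau>(2) unfolding full_zc[OF P i] by linarith
  have S': "?w' \<in> Sp"
  proof -
    have "0 \<le> full ?w' i + 1 / N\<^sup>2" if i: "i \<in> grid n" for i
    proof -
      have "- 1 \<le> e i" by (simp add: e_def)
      from mult_left_mono[OF this, of \<tau>] have "- \<tau> \<le> \<tau> * e i" using \<tau>(1) by simp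
      then show ?thesis unfolding f[OF i] using lo[OF i] by linarith
    qed
    then show ?thesis unfolding Sp_def by auto
  qed
  have wt': "wt ?w' i = wt ?w i + (if i = a then \<sigma> else 0) - (if i = b then \<sigma> else 0)" if "i \<in> grid n" for i
  proof -
    have "wt ?w' i = N / (N + 1) * (full ?w i + \<tau> * e i + 1 / N\<^sup>2)"
      using f[OF that] unfolding wt_def by (simp only:)
    also have "\<dots> = wt ?w i + \<sigma> * e i"
      unfolding wt_def \<sigma>_def by (simp only: algebra_simps)
    also have "\<sigma> * e i = (if i = a then \<sigma> else 0) - (if i = b then \<sigma> else 0)" by (simp add: e_def)
    finally show ?thesis by (simp only: diff_conv_add_uminus add.assoc)
  qed
  have nu': "nu ?w' = atomic (grid n) (\<lambda>i. wt ?w i + (if i = a then \<sigma> else 0) - (if i = b then \<sigma> else 0)) (node n)"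
    unfolding nu_def
    by (rule atomic_eqI) (use wt' wt_nonneg[OF S'] in \<open>auto intro!: sum.cong simp: finite_grid\<close>)
  have mb: "\<sigma> \<le> wt ?w b"
    unfolding \<sigma>_def wt_def using lo[OF b] N_pos by (intro mult_left_mono) auto
  obtain \<theta> \<rho> where r: "0 < \<theta>" "\<theta> < 1" "\<rho> \<in> Pp 2"
    "wasserstein 1 (atomic (grid n) (wt ?w) (node n)) \<rho> \<le> \<sigma> * dist (node n a :: real^'d) (node n b)"
    "U (atomic (grid n) (\<lambda>i. wt ?w i + (if i = a then \<sigma> else 0) - (if i = b then \<sigma> else 0)) (node n))
      - U (atomic (grid n) (wt ?w) (node n))
      = \<sigma> * (D \<rho> (node n b + \<theta> *\<^sub>R (node n a - node n b)) \<bullet> (node n a - node n b))"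
    by (rule mass_transfer[OF D finite_grid wt_nonneg[OF S] wt_sum b \<sigma> mb a, of "node n"])
  have w: "atomic (grid n) (wt ?w) (node n) = nu ?w" unfolding nu_def ..
  have V: "V ?w' - V ?w = \<sigma> * (D \<rho> (node n b + \<theta> *\<^sub>R (node n a - node n b)) \<bullet> (node n a - node n b))"
    using r(5) S S' unfolding nu'[symmetric] w V_def by (simp only: if_True)
  show ?thesis
    by (rule that[OF r(1-3) r(4)[unfolded w dist_norm \<sigma>_def] V[unfolded \<sigma>_def e_def]])
qed

text \<open>Here \<open>\<Gamma> i\<close> is the partial derivative of the convolution in the free
  coordinate \<open>i\<close>, and 0 at the dependent node. Hence
  \<open>\<Gamma> a - \<Gamma> b\<close> is the directional derivative along a transfer from
  \<open>b\<close> to \<open>a\<close>; each difference quotient is an average of values of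
  \<open>D\<close> near \<mu> along the segment between the nodes, and \<tau> tends to 0.\<close>

lemma partial_difference:
  assumes D: "has_wderiv U D" and \<mu>: "\<mu> \<in> Pp 2" and a: "a \<in> grid n" and b: "b \<in> grid n"
    and g: "\<And>j. j \<in> J \<Longrightarrow> kern J (1 / N ^ 3) (g j)"
      "\<And>j y. j \<in> J \<Longrightarrow> y \<in> J \<rightarrow>\<^sub>E UNIV \<Longrightarrow> ((\<lambda>t. \<zeta> (y(j := t))) has_real_derivative g j y) (at (y j))"
    and \<delta>: "0 < \<delta>" and close: "\<And>y. y \<in> Delta n \<Longrightarrow> wasserstein 1 \<mu> (nu (\<lambda>j\<in>J. zc \<mu> j + y j)) < \<delta> / 2"
    and near: "\<And>\<rho> x'. \<rho> \<in> Pp 2 \<Longrightarrow> wasserstein 1 \<mu> \<rho> < \<delta> \<Longrightarrow> x' \<in> closed_segment (node n b) (node n a) \<Longrightarrow> norm (D \<rho> x' - q) \<le> \<epsilon>"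
    and \<Gamma>: "\<And>i. \<Gamma> i = (if i = 0 then 0 else - shift_conv J V (g i) (zc \<mu>))"
  shows "\<bar>\<Gamma> a - \<Gamma> b - N / (N + 1) * (q \<bullet> (node n a - node n b))\<bar> \<le> N / (N + 1) * (\<epsilon> * norm (node n a - node n b))"
proof -
  define \<kappa> where "\<kappa> = N / (N + 1)"
  have \<kappa>: "0 < \<kappa>" "\<kappa> \<le> 1" using N_pos by (auto simp: \<kappa>_def)
  define v :: "real^'d" where "v = node n a - node n b"
  define e where "e j = (if j = a then 1 else 0) - (if j = b then 1 else (0::real))" for j
  obtain B where B: "0 \<le> B"
    "\<And>z z'. \<bar>shift_conv J V \<zeta> z' - shift_conv J V \<zeta> z + (\<Sum>j\<in>J. shift_conv J V (g j) z * (z' j - z j))\<bar>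
      \<le> B * (\<Sum>j\<in>J. \<bar>z' j - z j\<bar>)\<^sup>2"
    using shift_conv_expansion[OF finite_J V_integrable kernel_D(1) g] by blast
  define S where "S = (\<Sum>j\<in>J. \<bar>e j\<bar>)"
  \<comment> \<open>The first bound is the reserve of mass at a node. The second keeps the measure
    reached during the transfer within \<delta>/2 of the quantized one.\<close>
  define \<tau>0 where "\<tau>0 = min (1 / N ^ 3) (\<delta> / (2 * (norm v + 1)))"
  have v1: "0 < norm v + 1" by (simp add: add_nonneg_pos)
  have \<tau>0: "0 < \<tau>0" using N_pos \<delta> v1 by (simp add: \<tau>0_def)
  have main: "\<bar>\<Gamma> a - \<Gamma> b - \<kappa> * (q \<bullet> v)\<bar> \<le> \<kappa> * (\<epsilon> * norm v) + B * S\<^sup>2 * \<tau>" if \<tau>: "0 < \<tau>" "\<tau> \<le> \<tau>0" for \<tau>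
  proof -
    let ?z' = "\<lambda>j. zc \<mu> j + \<tau> * e j"
    have \<tau>N: "\<tau> \<le> 1 / N ^ 3" using \<tau>(2) by (simp add: \<tau>0_def)
    have "\<tau> * (norm v + 1) \<le> \<delta> / (2 * (norm v + 1)) * (norm v + 1)"
      using \<tau>(2) v1 by (intro mult_right_mono) (auto simp: \<tau>0_def)
    also have "\<dots> = \<delta> / 2" using v1 by (simp add: field_simps)
    finally have \<tau>v: "\<tau> * norm v \<le> \<delta> / 2" using \<tau>(1) by (simp add: distrib_left)
    have i1: "integrable M (\<lambda>y. \<zeta> y * V (\<lambda>j\<in>J. ?z' j + y j))" and i2: "integrable M (\<lambda>y. \<zeta> y * V (\<lambda>j\<in>J. zc \<mu> j + y j))"
      by (rule integrable_zeta_V)+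
    have "\<bar>(\<integral>y. \<zeta> y * (V (\<lambda>j\<in>J. ?z' j + y j) - V (\<lambda>j\<in>J. zc \<mu> j + y j)) \<partial>M) - \<kappa> * \<tau> * (q \<bullet> v)\<bar> \<le> \<kappa> * \<tau> * (\<epsilon> * norm v)"
    proof (rule kernel_average)
      show "integrable M (\<lambda>y. \<zeta> y * (V (\<lambda>j\<in>J. ?z' j + y j) - V (\<lambda>j\<in>J. zc \<mu> j + y j)))"
        unfolding right_diff_distrib using i1 i2 by (rule Bochner_Integration.integrable_diff)
      fix y :: "int^'d \<Rightarrow> real" assume y: "y \<in> Delta n"
      obtain \<theta> \<rho> where r: "0 < \<theta>" "\<theta> < 1" "\<rho> \<in> Pp 2"
        "wasserstein 1 (nu (\<lambda>j\<in>J. zc \<mu> j + y j)) \<rho> \<le> \<kappa> * \<tau> * norm v"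
        "V (\<lambda>j\<in>J. ?z' j + y j) - V (\<lambda>j\<in>J. zc \<mu> j + y j) = \<kappa> * \<tau> * (D \<rho> (node n b + \<theta> *\<^sub>R v) \<bullet> v)"
        by (rule V_transfer[OF D \<mu> y a b \<tau>(1) \<tau>N, folded \<kappa>_def v_def e_def])
      have "nu (\<lambda>j\<in>J. zc \<mu> j + y j) \<in> Pp 1"
        using y Delta_adm by (intro nu_Pp shifted_in_Sp Pp_D(1,2)[OF \<mu>]) blast
      then have "wasserstein 1 \<mu> \<rho> \<le> wasserstein 1 \<mu> (nu (\<lambda>j\<in>J. zc \<mu> j + y j)) + wasserstein 1 (nu (\<lambda>j\<in>J. zc \<mu> j + y j)) \<rho>"
        using Pp_antimono[OF \<mu>] Pp_antimono[OF r(3)] by (intro wasserstein_triangle) auto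
      moreover have "\<kappa> * \<tau> * norm v \<le> \<tau> * norm v"
        using \<kappa> \<tau>(1) by (intro mult_right_mono) auto
      ultimately have W: "wasserstein 1 \<mu> \<rho> < \<delta>" using close[OF y] r(4) \<tau>v by linarith
      have "node n b + \<theta> *\<^sub>R v \<in> closed_segment (node n b) (node n a)"
        unfolding closed_segment_def v_def using r(1,2)
        by (intro CollectI exI[of _ \<theta>]) (auto simp: algebra_simps)
      then have "norm (D \<rho> (node n b + \<theta> *\<^sub>R v) - q) \<le> \<epsilon>" by (rule near[OF r(3) W])
      then have "\<bar>(D \<rho> (node n b + \<theta> *\<^sub>R v) - q) \<bullet> v\<bar> \<le> \<epsilon> * norm v"
        by (rule order_trans[OF Cauchy_Schwarz_ineq2 mult_right_mono]) simp
      then have "\<kappa> * \<tau> * \<bar>D \<rho> (node n b + \<theta> *\<^sub>R v) \<bullet> v - q \<bullet> v\<bar> \<le> \<kappa> * \<tau> * (\<epsilon> * norm v)"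
        using \<kappa> \<tau>(1) by (intro mult_left_mono) (auto simp: inner_diff_left)
      moreover have "\<bar>\<kappa> * \<tau> * (D \<rho> (node n b + \<theta> *\<^sub>R v) \<bullet> v) - \<kappa> * \<tau> * (q \<bullet> v)\<bar>
          = \<kappa> * \<tau> * \<bar>D \<rho> (node n b + \<theta> *\<^sub>R v) \<bullet> v - q \<bullet> v\<bar>"
        using \<kappa> \<tau>(1) by (simp add: abs_mult flip: right_diff_distrib)
      ultimately show "\<bar>V (\<lambda>j\<in>J. ?z' j + y j) - V (\<lambda>j\<in>J. zc \<mu> j + y j) - \<kappa> * \<tau> * (q \<bullet> v)\<bar> \<le> \<kappa> * \<tau> * (\<epsilon> * norm v)"
        unfolding r(5) by linarith
    qed
    moreover have "(\<integral>y. \<zeta> y * (V (\<lambda>j\<in>J. ?z' j + y j) - V (\<lambda>j\<in>J. zc \<mu> j + y j)) \<partial>M)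
        = shift_conv J V \<zeta> ?z' - shift_conv J V \<zeta> (zc \<mu>)"
      unfolding shift_conv_eq(1)[OF finite_J V_integrable kernel_D(1)] right_diff_distrib
      using i1 i2 by (rule Bochner_Integration.integral_diff)
    ultimately have A: "\<bar>shift_conv J V \<zeta> ?z' - shift_conv J V \<zeta> (zc \<mu>) - \<kappa> * \<tau> * (q \<bullet> v)\<bar> \<le> \<kappa> * \<tau> * (\<epsilon> * norm v)"
      by simp
    have "(\<Sum>j\<in>J. \<bar>?z' j - zc \<mu> j\<bar>) = \<tau> * S"
      unfolding S_def sum_distrib_left using \<tau>(1) by (intro sum.cong) (auto simp: abs_mult)
    moreover have "(\<Sum>j\<in>J. shift_conv J V (g j) (zc \<mu>) * (?z' j - zc \<mu> j)) = - \<tau> * (\<Gamma> a - \<Gamma> b)"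
    proof -
      have "(\<Sum>j\<in>J. shift_conv J V (g j) (zc \<mu>) * (?z' j - zc \<mu> j)) = (\<Sum>j\<in>J. - \<tau> * (\<Gamma> j * e j))"
        by (intro sum.cong) (auto simp: \<Gamma>)
      also have "\<dots> = - \<tau> * (\<Sum>j\<in>J. \<Gamma> j * e j)" by (simp add: sum_distrib_left)
      also have "(\<Sum>j\<in>J. \<Gamma> j * e j) = (\<Sum>j\<in>grid n. \<Gamma> j * e j)" unfolding sum_grid by (simp add: \<Gamma>)
      also have "(\<Sum>j\<in>grid n. \<Gamma> j * e j) = \<Gamma> a - \<Gamma> b"
        unfolding e_def right_diff_distrib sum_subtractf using a b
        by (simp add: if_distrib[of "\<lambda>r. _ * r"] sum.delta cong: if_cong)
      finally show ?thesis .
    qed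
    ultimately have "\<bar>shift_conv J V \<zeta> ?z' - shift_conv J V \<zeta> (zc \<mu>) + - \<tau> * (\<Gamma> a - \<Gamma> b)\<bar> \<le> B * (\<tau> * S)\<^sup>2"
      using B(2)[of ?z' "zc \<mu>"] by simp
    with A have "\<bar>\<tau> * (\<Gamma> a - \<Gamma> b) - \<kappa> * \<tau> * (q \<bullet> v)\<bar> \<le> \<kappa> * \<tau> * (\<epsilon> * norm v) + B * (\<tau> * S)\<^sup>2"
      by linarith
    moreover have "\<bar>\<tau> * (\<Gamma> a - \<Gamma> b) - \<kappa> * \<tau> * (q \<bullet> v)\<bar> = \<tau> * \<bar>\<Gamma> a - \<Gamma> b - \<kappa> * (q \<bullet> v)\<bar>"
    proof -
      have "\<tau> * (\<Gamma> a - \<Gamma> b) - \<kappa> * \<tau> * (q \<bullet> v) = \<tau> * (\<Gamma> a - \<Gamma> b - \<kappa> * (q \<bullet> v))" by (simp add: algebra_simps)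
      then show ?thesis using \<tau>(1) by (simp add: abs_mult)
    qed
    moreover have "\<kappa> * \<tau> * (\<epsilon> * norm v) + B * (\<tau> * S)\<^sup>2 = \<tau> * (\<kappa> * (\<epsilon> * norm v) + B * S\<^sup>2 * \<tau>)"
      by (simp add: power2_eq_square algebra_simps)
    ultimately show ?thesis using \<tau>(1) by simp
  qed
  have "\<bar>\<Gamma> a - \<Gamma> b - \<kappa> * (q \<bullet> v)\<bar> \<le> \<kappa> * (\<epsilon> * norm v)"
    by (rule le_of_le_add_mult[OF main _ \<tau>0]) (use B in auto)
  then show ?thesis by (simp add: \<kappa>_def v_def)
qed

lemma mollify_has_cont_wderiv:
  assumes q': "\<And>i l. test_fun (3 * real n / 2) (q' i l :: real^'d \<Rightarrow> real)"
      "\<And>i l x. ((\<lambda>t. phi n I i (x + t *\<^sub>R axis l 1) * h (x + t *\<^sub>R axis l 1)) has_real_derivative q' i l x) (at 0)"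
    and g: "\<And>j. j \<in> J \<Longrightarrow> kern J (1 / N ^ 3) (g j)"
      "\<And>j y. j \<in> J \<Longrightarrow> y \<in> J \<rightarrow>\<^sub>E UNIV \<Longrightarrow> ((\<lambda>t. \<zeta> (y(j := t))) has_real_derivative g j y) (at (y j))"
  shows "has_cont_wderiv (mollify n I h \<zeta> U) (\<lambda>\<mu> x. \<chi> l. \<Sum>i\<in>J. - 1 * shift_conv J V (g i) (zc \<mu>) * q' i l x)"
  unfolding has_cont_wderiv_def
proof
  have "has_wderiv (\<lambda>\<mu>. 1 * shift_conv J V \<zeta> (\<lambda>i. \<integral>x. phi n I i x * h x \<partial>\<mu>))
     (\<lambda>\<mu> x. \<chi> l. \<Sum>i\<in>J. - 1 * shift_conv J V (g i) (\<lambda>i. \<integral>x. phi n I i x * h x \<partial>\<mu>) * q' i l x)"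
    by (rule has_wderiv_shift_conv[OF finite_J V_integrable test_fun_q q' kernel_D(1) g])
  then show "has_wderiv (mollify n I h \<zeta> U) (\<lambda>\<mu> x. \<chi> l. \<Sum>i\<in>J. - 1 * shift_conv J V (g i) (zc \<mu>) * q' i l x)"
    by (rule has_wderiv_cong) (simp_all add: mollify_eq(1) Pp_D zc_def[abs_def])
  let ?X = "prod_topology (wtop 2 :: (real^'d) measure topology) (euclidean :: (real^'d) topology)"
  have c: "continuous_map ?X euclideanreal (\<lambda>z. \<Sum>i\<in>J. - 1 * shift_conv J V (g i) (zc (fst z)) * q' i l (snd z))" for l
  proof (intro continuous_map_sum finite_J)
    fix i assume i: "i \<in> J"
    have "continuous_map (wtop 2) euclideanreal (\<lambda>\<mu>. shift_conv J V (g i) (zc \<mu>))"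
      using shift_conv_moments_continuous[OF finite_J V_integrable test_fun_q q' g(1)[OF i], of 2]
      by (simp add: zc_def[abs_def])
    from continuous_map_compose[OF continuous_map_fst this]
    have 1: "continuous_map ?X euclideanreal (\<lambda>z. shift_conv J V (g i) (zc (fst z)))" by (simp add: comp_def)
    have "continuous_map euclidean euclideanreal (q' i l)"
      using q'(1)[of i l] Ck_vec_continuous unfolding test_fun_def smooth_vec_def by fastforce
    from continuous_map_compose[OF continuous_map_snd this]
    have 2: "continuous_map ?X euclideanreal (\<lambda>z. q' i l (snd z))" by (simp add: comp_def)
    show "continuous_map ?X euclideanreal (\<lambda>z. - 1 * shift_conv J V (g i) (zc (fst z)) * q' i l (snd z))"
      by (rule continuous_map_real_mult[OF continuous_map_real_mult_left[OF 1] 2])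
  qed
  show "continuous_map ?X euclidean (\<lambda>(\<mu>, x). \<chi> l. \<Sum>i\<in>J. - 1 * shift_conv J V (g i) (zc \<mu>) * q' i l x)"
    unfolding continuous_map_atin
  proof
    fix z assume z: "z \<in> topspace ?X"
    have "((\<lambda>z. \<Sum>i\<in>J. - 1 * shift_conv J V (g i) (zc (fst z)) * q' i l (snd z))
      \<longlongrightarrow> (\<Sum>i\<in>J. - 1 * shift_conv J V (g i) (zc (fst z)) * q' i l (snd z))) (atin ?X z)" for l
      using c[of l, unfolded continuous_map_atin, rule_format, OF z] unfolding limitin_canonical_iff .
    then show "limitin euclidean (\<lambda>(\<mu>, x). \<chi> l. \<Sum>i\<in>J. - 1 * shift_conv J V (g i) (zc \<mu>) * q' i l x)
      ((\<lambda>(\<mu>, x). \<chi> l. \<Sum>i\<in>J. - 1 * shift_conv J V (g i) (zc \<mu>) * q' i l x) z) (atin ?X z)"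
      by (auto simp: case_prod_beta intro!: vec_tendstoI)
  qed
qed

text \<open>The error has two sources in each coordinate. The oscillation of \<open>D\<close> near
  \<open>(\<mu>, x)\<close> contributes \<epsilon> times a slope ratio of at most
  \<open>(n + 1) / n \<le> 2\<close>. The deviation of that ratio, times \<open>N / (N + 1)\<close>,
  from 1 is \<open>1 / (N + 1)\<close> where the profile is affine and at most 3 elsewhere.\<close>

lemma wderiv_mollify_error:
  assumes D: "has_wderiv U D" and \<mu>: "\<mu> \<in> Pp 2" and x: "\<And>m. \<bar>x $ m\<bar> < real n"
    and \<delta>: "0 < \<delta>" and close: "\<And>y. y \<in> Delta n \<Longrightarrow> wasserstein 1 \<mu> (nu (\<lambda>j\<in>J. zc \<mu> j + y j)) < \<delta> / 2"
    and near: "\<And>\<rho> x'. \<rho> \<in> Pp 2 \<Longrightarrow> wasserstein 1 \<mu> \<rho> < \<delta> \<Longrightarrow> dist x x' \<le> real CARD('d) / real n \<Longrightarrow> norm (D \<rho> x' - q) \<le> \<epsilon>"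
    and \<epsilon>: "0 \<le> \<epsilon>"
  shows "norm (wderiv (mollify n I h \<zeta> U) \<mu> x - q) \<le> (\<Sum>l\<in>UNIV. 2 * \<epsilon> +
    (if \<exists>k::int. 1 / real n < real n * x $ l - k \<and> real n * x $ l - k < 1 - 1 / real n then 1 / (N + 1) else 3) * \<bar>q $ l\<bar>)"
proof -
  obtain q' where q': "\<And>i l. test_fun (3 * real n / 2) (q' i l :: real^'d \<Rightarrow> real)"
    "\<And>i l x. ((\<lambda>t. phi n I i (x + t *\<^sub>R axis l 1) * h (x + t *\<^sub>R axis l 1)) has_real_derivative q' i l x) (at 0)"
    using q_partials by blast
  obtain g where g: "\<And>j. j \<in> J \<Longrightarrow> kern J (1 / N ^ 3) (g j)"
    "\<And>j y. j \<in> J \<Longrightarrow> y \<in> J \<rightarrow>\<^sub>E UNIV \<Longrightarrow> ((\<lambda>t. \<zeta> (y(j := t))) has_real_derivative g j y) (at (y j))"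
    using kern_partial[OF kernel_D(1)] by blast
  define \<Gamma> where "\<Gamma> i = (if i = 0 then 0 else - shift_conv J V (g i) (zc \<mu>))" for i
  have W: "wderiv (mollify n I h \<zeta> U) \<mu> x = (\<chi> l. \<Sum>i\<in>J. - 1 * shift_conv J V (g i) (zc \<mu>) * q' i l x)"
    by (rule wderiv_eq[OF mollify_has_cont_wderiv[OF q' g] \<mu>])
  obtain E where E: "\<And>j t. (phi1 n I j has_real_derivative E j t) (at t)" "\<And>j t. \<bar>E j t\<bar> \<le> real n + 1"
    "\<And>j t. 1 / real n < real n * t - real_of_int j \<Longrightarrow> real n * t - real_of_int j < 1 - 1 / real n \<Longrightarrow> E j t = - real n"
    using phi1_derivative_family[OF I n] by blast
  have xQ: "x \<in> cubeQ (real n)" using x by (auto simp: cubeQ_def less_imp_le)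
  have q'eq: "q' i l x = E (i $ l) (x $ l) * off_prod n I l i x" for i l
  proof -
    have e: "phi n I i (x + t *\<^sub>R axis l 1) = phi1 n I (i $ l) (x $ l + t) * off_prod n I l i x" for t
    proof -
      have "phi n I i (x + t *\<^sub>R axis l 1) = phi1 n I (i $ l) ((x + t *\<^sub>R axis l 1) $ l)
          * (\<Prod>m\<in>UNIV - {l}. phi1 n I (i $ m) ((x + t *\<^sub>R axis l 1) $ m))"
        unfolding phi_def by (rule prod.remove) auto
      also have "(\<Prod>m\<in>UNIV - {l}. phi1 n I (i $ m) ((x + t *\<^sub>R axis l 1) $ m)) = off_prod n I l i x"
        unfolding off_prod_def by (rule prod.cong) (auto simp: axis_def)
      finally show ?thesis by (simp add: axis_def)
    qed
    have "((\<lambda>t. phi1 n I (i $ l) (t + x $ l)) has_real_derivative E (i $ l) (x $ l)) (at 0)"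
      using E(1)[of "i $ l" "x $ l"] DERIV_shift[of "phi1 n I (i $ l)" "E (i $ l) (x $ l)" 0 "x $ l"] by simp
    then have d: "((\<lambda>t. phi1 n I (i $ l) (x $ l + t) * off_prod n I l i x) has_real_derivative
        E (i $ l) (x $ l) * off_prod n I l i x) (at 0)"
      by (simp only: add.commute[of "x $ l"]) (rule DERIV_cmult_right)
    \<comment> \<open>The point is interior to the cube where the cutoff equals 1, so near
      \<open>x\<close> only the partition function is differentiated.\<close>
    have o: "open {t. \<bar>x $ l + t\<bar> < real n}" by (intro open_Collect_less continuous_intros)
    have "((\<lambda>t. phi n I i (x + t *\<^sub>R axis l 1) * h (x + t *\<^sub>R axis l 1)) has_real_derivative
        E (i $ l) (x $ l) * off_prod n I l i x) (at 0)"
    proof (rule has_field_derivative_transform_within_open[OF d o])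
      show "0 \<in> {t. \<bar>x $ l + t\<bar> < real n}" using x by simp
      fix t assume t: "t \<in> {t. \<bar>x $ l + t\<bar> < real n}"
      have "\<bar>(x + t *\<^sub>R axis l 1) $ m\<bar> \<le> real n" for m
        using t x[of m] by (cases "m = l") (auto simp: axis_def)
      then have "h (x + t *\<^sub>R axis l 1) = 1" by (intro cutoff_D(4)[OF h]) (simp add: cubeQ_def)
      then show "phi1 n I (i $ l) (x $ l + t) * off_prod n I l i x = phi n I i (x + t *\<^sub>R axis l 1) * h (x + t *\<^sub>R axis l 1)"
        by (simp add: e)
    qed
    then show ?thesis using q'(2) DERIV_unique by blast
  qed
  define \<kappa> where "\<kappa> = N / (N + 1)"
  have \<kappa>: "0 < \<kappa>" "\<kappa> \<le> 1" "1 - \<kappa> = 1 / (N + 1)" using N_pos by (auto simp: \<kappa>_def field_simps)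
  have n0: "0 < real n" using n by simp
  have comp: "\<bar>(wderiv (mollify n I h \<zeta> U) \<mu> x - q) $ l\<bar> \<le> 2 * \<epsilon> +
    (if \<exists>k::int. 1 / real n < real n * x $ l - k \<and> real n * x $ l - k < 1 - 1 / real n then 1 / (N + 1) else 3) * \<bar>q $ l\<bar>" for l
  proof -
    define k where "k = \<lfloor>real n * x $ l\<rfloor>"
    have xl: "\<bar>x $ l\<bar> \<le> 3 * real n / 2" using x[of l] by linarith
    have k: "- 2 * (int n)\<^sup>2 \<le> k" "k + 1 \<le> 2 * (int n)\<^sup>2"
      using floor_in_grid_range[OF n xl] by (auto simp: k_def)
    define \<alpha> where "\<alpha> = E (k + 1) (x $ l)"
    have Ek: "E k (x $ l) = - \<alpha>"
      using phi1_derivative_pair[OF I n k_def E(1) E(1)] by (simp add: \<alpha>_def)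
    have E0: "E j (x $ l) = 0" if "j \<noteq> k" "j \<noteq> k + 1" for j
      using phi1_derivative_zero[OF I n E(1)] that by (simp add: k_def)
    let ?A = "{i\<in>grid n. i $ l = k} :: (int^'d) set" and ?A' = "{i\<in>grid n. i $ l = k + 1} :: (int^'d) set"
    let ?P = "\<lambda>i. off_prod n I l i x"
    have P0: "0 \<le> ?P i" for i unfolding off_prod_def using phi1_bounds(1)[OF I n] by (intro prod_nonneg) auto
    have Pshift: "?P (i + axis l 1) = ?P i" for i
      unfolding off_prod_def by (rule prod.cong) (auto simp: axis_def)
    have P1: "(\<Sum>i\<in>?A. ?P i) = 1" using k by (intro off_prod_slice_sum[OF I n xQ]) auto
    have "wderiv (mollify n I h \<zeta> U) \<mu> x $ l = (\<Sum>i\<in>J. \<Gamma> i * (E (i $ l) (x $ l) * ?P i))"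
      unfolding W vec_lambda_beta q'eq by (intro sum.cong) (auto simp: \<Gamma>_def)
    \<comment> \<open>Since \<open>\<Gamma> 0 = 0\<close>, the node 0 can be included; the sum then
      consists of full slices, which the shift maps onto each other.\<close>
    also have "\<dots> = (\<Sum>i\<in>grid n. \<Gamma> i * (E (i $ l) (x $ l) * ?P i))"
      unfolding sum_grid by (simp add: \<Gamma>_def)
    also have "\<dots> = (\<Sum>i\<in>?A \<union> ?A'. \<Gamma> i * (E (i $ l) (x $ l) * ?P i))"
      by (rule sum.mono_neutral_right) (auto simp: E0)
    also have "\<dots> = (\<Sum>i\<in>?A. \<Gamma> i * (E (i $ l) (x $ l) * ?P i)) + (\<Sum>i\<in>?A'. \<Gamma> i * (E (i $ l) (x $ l) * ?P i))"
      by (rule sum.union_disjoint) auto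
    also have "(\<Sum>i\<in>?A. \<Gamma> i * (E (i $ l) (x $ l) * ?P i)) = (\<Sum>i\<in>?A. - \<alpha> * (?P i * \<Gamma> i))"
      by (intro sum.cong) (auto simp: Ek)
    also have "(\<Sum>i\<in>?A'. \<Gamma> i * (E (i $ l) (x $ l) * ?P i)) = (\<Sum>i\<in>?A'. \<alpha> * (?P i * \<Gamma> i))"
      by (intro sum.cong) (auto simp: \<alpha>_def)
    also have "\<dots> = (\<Sum>i\<in>?A. \<alpha> * (?P i * \<Gamma> (i + axis l 1)))"
      by (subst grid_slice_shift_sum[OF k]) (simp add: Pshift)
    also have "(\<Sum>i\<in>?A. - \<alpha> * (?P i * \<Gamma> i)) + (\<Sum>i\<in>?A. \<alpha> * (?P i * \<Gamma> (i + axis l 1)))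
        = (\<Sum>i\<in>?A. \<alpha> * (?P i * (\<Gamma> (i + axis l 1) - \<Gamma> i)))"
      unfolding sum.distrib[symmetric] by (intro sum.cong) (auto simp: algebra_simps)
    finally have Dl: "wderiv (mollify n I h \<zeta> U) \<mu> x $ l = (\<Sum>i\<in>?A. \<alpha> * (?P i * (\<Gamma> (i + axis l 1) - \<Gamma> i)))" .
    \<comment> \<open>The factor \<open>?P i\<close> singles out nodes within one grid step of
      \<open>x\<close>. For these, both nodes and the segment between them lie in the ball in which
      \<open>D\<close> is within \<epsilon> of \<open>q\<close>.\<close>
    have diff: "?P i * \<bar>\<Gamma> (i + axis l 1) - \<Gamma> i - \<kappa> * (q $ l / real n)\<bar> \<le> ?P i * (\<kappa> * (\<epsilon> / real n))" if i: "i \<in> ?A" for i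
    proof (cases "?P i = 0")
      case False
      have ph: "\<bar>real n * x $ m - i $ m\<bar> \<le> 1" for m
      proof (cases "m = l")
        case True
        have il: "i $ m = \<lfloor>real n * x $ l\<rfloor>" using i True by (simp add: k_def)
        show ?thesis unfolding il unfolding True
          using of_int_floor_le[of "real n * x $ l"] real_of_int_floor_add_one_gt[of "real n * x $ l"]
          by linarith
      next
        case False
        have "phi1 n I (i $ m) (x $ m) \<noteq> 0"
          using \<open>?P i \<noteq> 0\<close> False unfolding off_prod_def by (simp add: prod_zero_iff)
        then show ?thesis using phi1_bounds(3)[OF I n] by (auto intro: less_imp_le)
      qed
      have ph': "\<bar>real n * x $ m - (i + axis l 1) $ m\<bar> \<le> 1" for m
      proof (cases "m = l")
        case True
        have il: "(i + axis l 1) $ m = \<lfloor>real n * x $ l\<rfloor> + 1"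
          unfolding axis_shift_component using i True by (simp add: k_def)
        show ?thesis unfolding il unfolding True
          using of_int_floor_le[of "real n * x $ l"] real_of_int_floor_add_one_gt[of "real n * x $ l"]
          by linarith
      next
        case False
        then show ?thesis using ph[of m] unfolding axis_shift_component by simp
      qed
      have d1: "node n i \<in> cball x (real CARD('d) / real n)"
        using dist_node_le[of n x i 1] ph n by (simp add: dist_commute)
      have d2: "node n (i + axis l 1) \<in> cball x (real CARD('d) / real n)"
        using dist_node_le[of n x "i + axis l 1" 1] ph' n by (simp add: dist_commute)
      have seg: "closed_segment (node n i) (node n (i + axis l 1)) \<subseteq> cball x (real CARD('d) / real n)"
        by (rule closed_segment_subset[OF d1 d2 convex_cball])
      have i': "i + axis l 1 \<in> grid n"
      proof -
        have "\<bar>(i + axis l 1) $ m\<bar> \<le> 2 * (int n)\<^sup>2" for m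
          using i k unfolding axis_shift_component by (cases "m = l") (auto simp: grid_def abs_le_iff)
        then show ?thesis by (simp add: grid_def)
      qed
      have ig: "i \<in> grid n" using i by simp
      have "\<bar>\<Gamma> (i + axis l 1) - \<Gamma> i - N / (N + 1) * (q \<bullet> (node n (i + axis l 1) - node n i))\<bar>
          \<le> N / (N + 1) * (\<epsilon> * norm (node n (i + axis l 1) - node n i :: real^'d))"
      proof (rule partial_difference[OF D \<mu> i' ig g \<delta> close])
        fix \<rho> x' assume r: "\<rho> \<in> Pp 2" "wasserstein 1 \<mu> \<rho> < \<delta>" "x' \<in> closed_segment (node n i) (node n (i + axis l 1))"
        then have "dist x x' \<le> real CARD('d) / real n" using seg by auto
        then show "norm (D \<rho> x' - q) \<le> \<epsilon>" by (rule near[OF r(1,2)])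
      qed (simp_all add: \<Gamma>_def)
      moreover have "norm (axis l (1 / real n) :: real^'d) = 1 / real n"
      proof -
        have "axis l (1 / real n) = (1 / real n) *\<^sub>R (axis l 1 :: real^'d)" by (simp add: vec_eq_iff axis_def)
        then show ?thesis by simp
      qed
      ultimately have "\<bar>\<Gamma> (i + axis l 1) - \<Gamma> i - \<kappa> * (q $ l / real n)\<bar> \<le> \<kappa> * (\<epsilon> / real n)"
        unfolding node_shift \<kappa>_def[symmetric] by (simp add: inner_axis)
      then show ?thesis using P0 by (intro mult_left_mono)
    qed simp
    have "\<bar>wderiv (mollify n I h \<zeta> U) \<mu> x $ l - \<alpha> * (\<kappa> * (q $ l / real n))\<bar>
        = \<bar>\<Sum>i\<in>?A. \<alpha> * (?P i * (\<Gamma> (i + axis l 1) - \<Gamma> i - \<kappa> * (q $ l / real n)))\<bar>"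
    proof -
      have "\<alpha> * (\<kappa> * (q $ l / real n)) = (\<Sum>i\<in>?A. \<alpha> * (?P i * (\<kappa> * (q $ l / real n))))"
        unfolding sum_distrib_left[symmetric] sum_distrib_right[symmetric] P1 by simp
      then show ?thesis unfolding Dl by (simp add: right_diff_distrib sum_subtractf)
    qed
    also have "\<dots> \<le> (\<Sum>i\<in>?A. \<bar>\<alpha>\<bar> * (?P i * \<bar>\<Gamma> (i + axis l 1) - \<Gamma> i - \<kappa> * (q $ l / real n)\<bar>))"
      by (rule order_trans[OF sum_abs]) (simp add: abs_mult P0)
    also have "\<dots> \<le> (\<Sum>i\<in>?A. \<bar>\<alpha>\<bar> * (?P i * (\<kappa> * (\<epsilon> / real n))))"
      by (intro sum_mono mult_left_mono[OF diff abs_ge_zero])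
    also have "\<dots> = \<bar>\<alpha>\<bar> * (\<kappa> * (\<epsilon> / real n))"
      unfolding sum_distrib_left[symmetric] sum_distrib_right[symmetric] P1 by simp
    also have "\<dots> \<le> (real n + 1) * (1 * (\<epsilon> / real n))"
      using E(2)[of "k + 1" "x $ l"] \<kappa> \<epsilon> by (intro mult_mono) (auto simp: \<alpha>_def)
    also have "\<dots> \<le> 2 * \<epsilon>"
    proof -
      have "(real n + 1) / real n \<le> 2" using n by (simp add: divide_simps)
      then have "(real n + 1) / real n * \<epsilon> \<le> 2 * \<epsilon>" using \<epsilon> by (rule mult_right_mono)
      then show ?thesis by simp
    qed
    finally have 1: "\<bar>wderiv (mollify n I h \<zeta> U) \<mu> x $ l - \<alpha> * (\<kappa> * (q $ l / real n))\<bar> \<le> 2 * \<epsilon>" .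
    let ?c = "if \<exists>k::int. 1 / real n < real n * x $ l - k \<and> real n * x $ l - k < 1 - 1 / real n then 1 / (N + 1) else 3"
    \<comment> \<open>Where the profile is affine, \<open>\<alpha> = n\<close> and the defect is
      \<open>1 - \<kappa>\<close>. Elsewhere the slope ratio is at most 2 in absolute value, whence
      3.\<close>
    have cb: "\<bar>\<kappa> * (\<alpha> / real n) - 1\<bar> \<le> ?c"
    proof (cases "\<exists>k::int. 1 / real n < real n * x $ l - k \<and> real n * x $ l - k < 1 - 1 / real n")
      case True
      then obtain k' :: int where k': "1 / real n < real n * x $ l - k'" "real n * x $ l - k' < 1 - 1 / real n" by blast
      have "0 < 1 / real n" using n0 by simp
      then have "0 < real n * x $ l - k'" "real n * x $ l - k' < 1" using k' by linarith+
      then have "k' = k" unfolding k_def by linarith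
      then have "\<alpha> = real n" using E(3) k' Ek by auto
      then have "\<bar>\<kappa> * (\<alpha> / real n) - 1\<bar> = 1 - \<kappa>" using n0 \<kappa> by simp
      then show ?thesis unfolding if_P[OF True] using \<kappa>(3) by simp
    next
      case False
      have "\<bar>\<alpha> / real n\<bar> \<le> (real n + 1) / real n"
        using E(2)[of "k + 1" "x $ l"] n0 by (simp add: \<alpha>_def abs_divide divide_right_mono)
      also have "\<dots> \<le> 2" using n by (simp add: divide_simps)
      finally have "\<kappa> * \<bar>\<alpha> / real n\<bar> \<le> 1 * 2" using \<kappa> by (intro mult_mono) auto
      then have "\<bar>\<kappa> * (\<alpha> / real n)\<bar> \<le> 2" using \<kappa> by (simp add: abs_mult)
      then have "\<bar>\<kappa> * (\<alpha> / real n) - 1\<bar> \<le> 3" by linarith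
      then show ?thesis unfolding if_not_P[OF False] .
    qed
    have "\<bar>\<alpha> * (\<kappa> * (q $ l / real n)) - q $ l\<bar> = \<bar>\<kappa> * (\<alpha> / real n) - 1\<bar> * \<bar>q $ l\<bar>"
      unfolding abs_mult[symmetric] by (simp add: algebra_simps)
    also have "\<dots> \<le> ?c * \<bar>q $ l\<bar>" using cb by (rule mult_right_mono) simp
    finally have "\<bar>\<alpha> * (\<kappa> * (q $ l / real n)) - q $ l\<bar> \<le> ?c * \<bar>q $ l\<bar>" .
    with 1 show ?thesis unfolding vector_minus_component by linarith
  qed
  have "norm (wderiv (mollify n I h \<zeta> U) \<mu> x - q) \<le> (\<Sum>l\<in>UNIV. \<bar>(wderiv (mollify n I h \<zeta> U) \<mu> x - q) $ l\<bar>)"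
    by (rule norm_le_l1_cart)
  also have "\<dots> \<le> (\<Sum>l\<in>UNIV. 2 * \<epsilon> +
    (if \<exists>k::int. 1 / real n < real n * x $ l - k \<and> real n * x $ l - k < 1 - 1 / real n then 1 / (N + 1) else 3) * \<bar>q $ l\<bar>)"
    by (rule sum_mono) (rule comp)
  finally show ?thesis .
qed

end

text \<open>The strips in which a partition function need not have slope \<open>\<plusminus>n\<close> in direction \<open>l\<close>.\<close>

definition transition_set :: "nat \<Rightarrow> nat \<Rightarrow> 'd::finite \<Rightarrow> (real^'d) set" where
  "transition_set R n l = (\<Union>k\<in>{- int (R * n) - 1..int (R * n) + 1}.
     cbox (\<chi> m. if m = l then (real_of_int k - 1 / real n) / real n else - real R)
          (\<chi> m. if m = l then (real_of_int k + 1 / real n) / real n else real R))"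

lemma transition_set_measurable [measurable]: "transition_set R n l \<in> sets borel"
  unfolding transition_set_def by (intro sets.finite_UN) auto

lemma in_transition_set:
  fixes x :: "real^'d"
  assumes n: "0 < n" and x: "x \<in> cubeQ (real R)"
    and no: "\<not> (\<exists>k::int. 1 / real n < real n * x $ l - k \<and> real n * x $ l - k < 1 - 1 / real n)"
  shows "x \<in> transition_set R n l"
proof -
  let ?k = "\<lfloor>real n * x $ l\<rfloor>"
  have n0: "0 < real n" using n by simp
  have xl: "\<bar>x $ m\<bar> \<le> real R" for m using x by (simp add: cubeQ_def)
  have "\<bar>real n * x $ l\<bar> \<le> real n * real R" using xl[of l] n0 by (simp add: abs_mult)
  then have b: "- real (R * n) \<le> real n * x $ l" "real n * x $ l \<le> real (R * n)"
    by (auto simp: abs_le_iff mult.commute)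
  have f: "real_of_int ?k \<le> real n * x $ l" "real n * x $ l < real_of_int ?k + 1"
    by (auto simp: real_of_int_floor_add_one_gt)
  have kb: "- int (R * n) \<le> ?k" "?k \<le> int (R * n)"
    using b by (simp_all add: le_floor_iff floor_le_iff)
  \<comment> \<open>A point outside the affine range is close to the integer below or above it. The
    upper one explains the additional index in the union of strips.\<close>
  have "\<exists>k\<in>{?k, ?k + 1}. \<bar>real n * x $ l - real_of_int k\<bar> \<le> 1 / real n"
  proof -
    have "real n * x $ l - ?k \<le> 1 / real n \<or> 1 - 1 / real n \<le> real n * x $ l - ?k" using no by (meson not_le)
    then show ?thesis
    proof
      assume "real n * x $ l - ?k \<le> 1 / real n"
      then have "\<bar>real n * x $ l - ?k\<bar> \<le> 1 / real n" using f(1) by linarith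
      then show ?thesis by blast
    next
      assume "1 - 1 / real n \<le> real n * x $ l - ?k"
      then have "\<bar>real n * x $ l - real_of_int (?k + 1)\<bar> \<le> 1 / real n" using f(2) unfolding of_int_add of_int_1 by linarith
      then show ?thesis by blast
    qed
  qed
  then obtain k where k: "k \<in> {?k, ?k + 1}" "\<bar>real n * x $ l - real_of_int k\<bar> \<le> 1 / real n" by blast
  have "x \<in> cbox (\<chi> m. if m = l then (real_of_int k - 1 / real n) / real n else - real R)
          (\<chi> m. if m = l then (real_of_int k + 1 / real n) / real n else real R)"
    unfolding mem_box_cart
  proof (intro allI)
    fix m
    have "(real_of_int k - 1 / real n) / real n \<le> x $ l" "x $ l \<le> (real_of_int k + 1 / real n) / real n"
      unfolding pos_divide_le_eq[OF n0] pos_le_divide_eq[OF n0] mult.commute[of "x $ l"] using k(2) by linarith+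
    then show "(\<chi> m. if m = l then (real_of_int k - 1 / real n) / real n else - real R) $ m \<le> x $ m \<and>
        x $ m \<le> (\<chi> m. if m = l then (real_of_int k + 1 / real n) / real n else real R) $ m"
      using xl[of m] by (auto simp: abs_le_iff)
  qed
  moreover have "k \<in> {- int (R * n) - 1..int (R * n) + 1}" using k(1) kb by auto
  ultimately show ?thesis unfolding transition_set_def by blast
qed

text \<open>There are 2Rn + 3 strips of width 2/n^2, since the distance 1/n to an integer is
  measured in the variable \<open>n * x\<close>. Their total measure is therefore of order
  1/n.\<close>

lemma emeasure_transition_set:
  assumes n: "0 < n" and R: "0 < R"
  shows "emeasure lborel (transition_set R n (l :: 'd::finite))
    \<le> ennreal ((2 * real R + 3) * (2 * (2 * real R) ^ (CARD('d) - 1)) / real n)"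
proof -
  let ?a = "\<lambda>k::int. (\<chi> m. if m = l then (real_of_int k - 1 / real n) / real n else - real R) :: real^'d"
  let ?b = "\<lambda>k::int. (\<chi> m. if m = l then (real_of_int k + 1 / real n) / real n else real R) :: real^'d"
  let ?S = "{- int (R * n) - 1..int (R * n) + 1}"
  let ?v = "2 / (real n * real n) * (2 * real R) ^ (CARD('d) - 1)"
  have n0: "0 < real n" using n by simp
  have e: "emeasure lborel (cbox (?a k) (?b k)) = ennreal ?v" for k
  proof -
    have le: "?a k $ m \<le> ?b k $ m" for m using n0 by (auto simp: divide_right_mono)
    then have ne: "cbox (?a k) (?b k) \<noteq> {}" by (auto simp: interval_ne_empty_cart)
    have "measure lborel (cbox (?a k) (?b k)) = (\<Prod>m\<in>UNIV. ?b k $ m - ?a k $ m)"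
      by (rule content_cbox_cart[OF ne])
    also have "\<dots> = (?b k $ l - ?a k $ l) * (\<Prod>m\<in>UNIV - {l}. ?b k $ m - ?a k $ m)"
      by (rule prod.remove) auto
    also have "?b k $ l - ?a k $ l = 2 / (real n * real n)" using n0 by (simp add: field_simps)
    also have "(\<Prod>m\<in>UNIV - {l}. ?b k $ m - ?a k $ m) = (\<Prod>m\<in>UNIV - {l}. 2 * real R)"
      by (rule prod.cong) auto
    also have "\<dots> = (2 * real R) ^ (CARD('d) - 1)" by (simp add: card_Diff_singleton)
    finally show ?thesis
      using emeasure_lborel_cbox_finite[of "?a k" "?b k"] by (simp add: emeasure_eq_ennreal_measure)
  qed
  have "emeasure lborel (transition_set R n l) \<le> (\<Sum>k\<in>?S. emeasure lborel (cbox (?a k) (?b k)))"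
    unfolding transition_set_def by (rule emeasure_subadditive_finite) auto
  also have "\<dots> = ennreal (real (card ?S) * ?v)" 
  proof -
    have "(\<Sum>k\<in>?S. ennreal ?v) = ennreal (\<Sum>k\<in>?S. ?v)" by (rule sum_ennreal) simp
    then show ?thesis unfolding e sum_constant .
  qed
  also have "\<dots> \<le> ennreal ((2 * real R + 3) * (2 * (2 * real R) ^ (CARD('d) - 1)) / real n)"
  proof (rule ennreal_leI)
    have "card {- int m - 1..int m + 1} = 2 * m + 3" for m by simp
    from this[of "R * n"] have "card ?S = 2 * (R * n) + 3" .
    then have "real (card ?S) = 2 * real R * real n + 3" by simp
    also have "\<dots> \<le> (2 * real R + 3) * real n" using n by (simp add: algebra_simps)
    finally have "real (card ?S) * ?v \<le> (2 * real R + 3) * real n * ?v"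
      by (rule mult_right_mono) (use R in auto)
    also have "\<dots> = (2 * real R + 3) * (2 * (2 * real R) ^ (CARD('d) - 1)) / real n" using n0 by simp
    finally show "real (card ?S) * ?v \<le> (2 * real R + 3) * (2 * (2 * real R) ^ (CARD('d) - 1)) / real n" .
  qed
  finally show ?thesis .
qed

lemma emeasure_cubeQ:
  assumes "0 \<le> R"
  shows "emeasure lborel (cubeQ R :: (real^'d) set) = ennreal ((2 * R) ^ CARD('d))"
proof -
  have ne: "cbox (\<chi> l. - R) (\<chi> l. R) \<noteq> ({} :: (real^'d) set)" using assms by (auto simp: interval_ne_empty_cart)
  have "measure lborel (cubeQ R :: (real^'d) set) = (2 * R) ^ CARD('d)"
    unfolding cubeQ_eq_cbox content_cbox_cart[OF ne] by simp
  then show ?thesis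
    using emeasure_lborel_cbox_finite[of "\<chi> l::'d. - R" "\<chi> l. R"]
    unfolding cubeQ_eq_cbox by (simp add: emeasure_eq_ennreal_measure)
qed

text \<open>The pointwise error is uniformly small off the strips and bounded on them, and the
  strips have measure of order 1/n. Integrating over a cube containing \<open>K\<close> gives a
  bound that does not depend on the measure.\<close>

lemma wderiv_mollify_converges:
  fixes \<M> :: "(real^'d) measure set" and U :: "(real^'d) measure \<Rightarrow> real"
  assumes U: "C0_P 1 U" and d: "mollifier_data I h \<zeta>" and C1: "C1_P2 U"
    and H: "\<And>\<M> K. compactin (wtop 1) \<M> \<Longrightarrow> compact K \<Longrightarrow> unif_cont_W1 (\<M> \<inter> Pp 2) K (wderiv U)"
    and \<M>: "compactin (wtop 1) \<M>" and K: "compact K"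
  shows "(\<lambda>n. SUP \<mu>\<in>\<M> \<inter> Pp 2.
    \<integral>\<^sup>+x\<in>K. ennreal (norm (wderiv (mollify n (I n) (h n) (\<zeta> n) U) \<mu> x - wderiv U \<mu> x)) \<partial>lborel) \<longlonglongrightarrow> 0"
proof (rule tendsto_0_ennrealI)
  fix e :: real assume e: "0 < e"
  let ?d = "real CARD('d)"
  let ?D = "wderiv U"
  have D: "has_cont_wderiv U ?D" using C1 has_cont_wderiv_wderiv by (auto simp: C1_P2_def)
  obtain r where r: "\<And>x. x \<in> K \<Longrightarrow> norm x \<le> r" using compact_imp_bounded[OF K] by (auto simp: bounded_iff)
  obtain R :: nat where R: "max r 0 < real R" using reals_Archimedean2 by blast
  have R0: "0 < R" using R by (cases R) auto
  have KR: "K \<subseteq> cubeQ (real R)"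
  proof
    fix x assume "x \<in> K"
    then have "\<bar>x $ l\<bar> \<le> real R" for l using r[of x] R component_le_norm_cart[of x l] by linarith
    then show "x \<in> cubeQ (real R)" by (simp add: cubeQ_def)
  qed
  \<comment> \<open>Enlarged by 1, because the segments between nodes near a point of
    \<open>K\<close> may leave the smaller cube; they stay within d/n, which is eventually less than
    1.\<close>
  let ?K = "cubeQ (real R + 1) :: (real^'d) set"
  obtain B where B: "0 \<le> B" "\<And>\<mu> x. \<mu> \<in> \<M> \<inter> Pp 2 \<Longrightarrow> x \<in> ?K \<Longrightarrow> norm (?D \<mu> x) \<le> B"
    by (rule derivative_bounded_on_compact[OF H[OF \<M> compact_cubeQ] has_cont_wderiv_slice(2)[OF D] \<M> compact_cubeQ]) blast+
  define vol where "vol = (2 * real R) ^ CARD('d)"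
  have vol: "0 \<le> vol" by (simp add: vol_def)
  define tr where "tr = (2 * real R + 3) * (2 * (2 * real R) ^ (CARD('d) - 1))"
  have tr: "0 \<le> tr" by (simp add: tr_def)
  \<comment> \<open>The oscillation contributes \<open>2 * \<epsilon>\<close> in each of the d
    coordinates over the volume \<open>vol\<close>, hence at most \<open>e / 2\<close>.\<close>
  define \<epsilon> where "\<epsilon> = e / (4 * ?d * (vol + 1))"
  have \<epsilon>: "0 < \<epsilon>" using e vol by (simp add: \<epsilon>_def add_nonneg_pos)
  \<comment> \<open>Collects what decays like 1/n: the mass normalization over the whole cube, and
    the slope defect 3 on the strips.\<close>
  define C where "C = ?d * B * vol + 3 * B * ?d * tr"
  obtain \<delta> where \<delta>: "0 < \<delta>" "\<And>\<mu> \<rho> x y. \<mu> \<in> \<M> \<inter> Pp 2 \<Longrightarrow> \<rho> \<in> Pp 2 \<Longrightarrow> x \<in> ?K \<Longrightarrow> y \<in> ?K \<Longrightarrow>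
    wasserstein 1 \<mu> \<rho> < \<delta> \<Longrightarrow> dist x y < \<delta> \<Longrightarrow> dist (?D \<mu> x) (?D \<rho> y) < \<epsilon>"
    using derivative_near_compact[OF H[OF _ compact_cubeQ] \<M> \<epsilon>] by blast
  have \<delta>2: "0 < \<delta> / 2" using \<delta>(1) by simp
  have "\<forall>\<^sub>F n in sequentially. real R < real n \<and> ?d / min \<delta> 1 < real n \<and> C / (e / 2) < real n"
    using filterlim_at_top_dense[THEN iffD1, OF filterlim_real_sequentially]
    by (intro eventually_conj) blast+
  with mu_n_uniformly_close[OF \<M> d U \<delta>2]
  show "\<forall>\<^sub>F n in sequentially. (SUP \<mu>\<in>\<M> \<inter> Pp 2.
    \<integral>\<^sup>+x\<in>K. ennreal (norm (wderiv (mollify n (I n) (h n) (\<zeta> n) U) \<mu> x - ?D \<mu> x)) \<partial>lborel) \<le> ennreal e"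
  proof eventually_elim
    case (elim n)
    then interpret mollifier n "I n" "h n" "\<zeta> n" U "Ngrid TYPE('d) n"
      using d U by unfold_locales (auto simp: mollifier_data_def)
    let ?N = "Ngrid TYPE('d) n"
    have n0: "0 < real n" using n by simp
    have dn: "?d / real n < \<delta>" "?d / real n < 1"
    proof -
      have m0: "0 < min \<delta> 1" using \<delta>(1) by simp
      have "?d / min \<delta> 1 < real n" using elim by blast
      then have "?d / real n < min \<delta> 1"
        unfolding pos_divide_less_eq[OF m0] pos_divide_less_eq[OF n0] by (simp only: mult.commute)
      then show "?d / real n < \<delta>" "?d / real n < 1" by auto
    qed
    have Cn: "C / real n \<le> e / 2" using elim e n0 by (simp add: field_simps)
    have Nn: "real n \<le> ?N + 1"
    proof -
      have "real n \<le> (real n)\<^sup>2" using n by (simp add: power2_eq_square)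
      then show ?thesis using Ngrid_ge[where 'd='d, of n] by linarith
    qed
    have "(\<integral>\<^sup>+x\<in>K. ennreal (norm (wderiv (mollify n (I n) (h n) (\<zeta> n) U) \<mu> x - ?D \<mu> x)) \<partial>lborel) \<le> ennreal e"
      if \<mu>: "\<mu> \<in> \<M> \<inter> Pp 2" for \<mu>
    proof -
      have \<mu>2: "\<mu> \<in> Pp 2" and \<mu>M: "\<mu> \<in> \<M>" using \<mu> by auto
      let ?c1 = "?d * (2 * \<epsilon> + B / real n)"
      have c1: "0 \<le> ?c1" using \<epsilon> B(1) n0 by simp
      have pt: "norm (wderiv (mollify n (I n) (h n) (\<zeta> n) U) \<mu> x - ?D \<mu> x)
          \<le> ?c1 + (\<Sum>l\<in>UNIV. 3 * B * indicator (transition_set R n l) x)" if x: "x \<in> K" for x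
      proof -
        have xR: "\<bar>x $ m\<bar> \<le> real R" for m using x KR by (auto simp: cubeQ_def)
        have xK: "x \<in> ?K" unfolding cubeQ_def using order_trans[OF xR, of "real R + 1"] by simp
        have "norm (wderiv (mollify n (I n) (h n) (\<zeta> n) U) \<mu> x - ?D \<mu> x) \<le> (\<Sum>l\<in>UNIV. 2 * \<epsilon> +
          (if \<exists>k::int. 1 / real n < real n * x $ l - k \<and> real n * x $ l - k < 1 - 1 / real n then 1 / (?N + 1) else 3) * \<bar>?D \<mu> x $ l\<bar>)"
        proof (rule wderiv_mollify_error[OF _ \<mu>2 _ \<delta>(1)])
          show "has_wderiv U ?D" using D by (simp add: has_cont_wderiv_def)
          show "\<bar>x $ m\<bar> < real n" for m using xR[of m] elim by linarith
          show "wasserstein 1 \<mu> (nu (\<lambda>j\<in>J. zc \<mu> j + y j)) < \<delta> / 2" if "y \<in> Delta n" for y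
            using elim \<mu>M that Delta_adm by blast
          fix \<rho> :: "(real^'d) measure" and x' assume \<rho>: "\<rho> \<in> Pp 2" "wasserstein 1 \<mu> \<rho> < \<delta>" "dist x x' \<le> ?d / real n"
          have "\<bar>x' $ m\<bar> \<le> real R + 1" for m
            using component_le_norm_cart[of "x - x'" m] xR[of m] \<rho>(3) dn(2) unfolding dist_norm vector_minus_component by linarith
          then have "x' \<in> ?K" by (simp add: cubeQ_def)
          then have "dist (?D \<mu> x) (?D \<rho> x') < \<epsilon>"
            using \<rho> dn(1) by (intro \<delta>(2)[OF \<mu> \<rho>(1) xK]) auto
          then show "norm (?D \<rho> x' - ?D \<mu> x) \<le> \<epsilon>" by (simp add: dist_norm norm_minus_commute)
        qed (use \<epsilon> in simp)
        also have "\<dots> \<le> (\<Sum>l\<in>(UNIV::'d set). (2 * \<epsilon> + B / real n) + 3 * B * indicator (transition_set R n l) x)"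
        proof (rule sum_mono)
          fix l
          have q: "\<bar>?D \<mu> x $ l\<bar> \<le> B" using B(2)[OF \<mu> xK] component_le_norm_cart[of "?D \<mu> x" l] by linarith
          show "2 * \<epsilon> + (if \<exists>k::int. 1 / real n < real n * x $ l - k \<and> real n * x $ l - k < 1 - 1 / real n then 1 / (?N + 1) else 3) * \<bar>?D \<mu> x $ l\<bar>
              \<le> (2 * \<epsilon> + B / real n) + 3 * B * indicator (transition_set R n l) x"
          proof (cases "\<exists>k::int. 1 / real n < real n * x $ l - k \<and> real n * x $ l - k < 1 - 1 / real n")
            case True
            have "1 / (?N + 1) * \<bar>?D \<mu> x $ l\<bar> \<le> 1 / real n * B"
              using q Nn n0 by (intro mult_mono divide_left_mono) auto
            moreover have "0 \<le> 3 * B * indicator (transition_set R n l) x" using B(1) by (simp add: indicator_def)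
            ultimately show ?thesis unfolding if_P[OF True] by simp
          next
            case False
            then have "x \<in> transition_set R n l" using x KR n by (intro in_transition_set) auto
            moreover have "0 \<le> B / real n" using B(1) by simp
            ultimately show ?thesis unfolding if_not_P[OF False] using q
              by (simp only: indicator_simps(1))
          qed
        qed
        also have "\<dots> = ?c1 + (\<Sum>l\<in>UNIV. 3 * B * indicator (transition_set R n l) x)"
          unfolding sum.distrib[of "\<lambda>_. 2 * \<epsilon> + B / real n"] by simp
        finally show ?thesis .
      qed
      have "(\<integral>\<^sup>+x\<in>K. ennreal (norm (wderiv (mollify n (I n) (h n) (\<zeta> n) U) \<mu> x - ?D \<mu> x)) \<partial>lborel)
          \<le> (\<integral>\<^sup>+x. ennreal ?c1 * indicator (cubeQ (real R)) x + (\<Sum>l\<in>UNIV. ennreal (3 * B) * indicator (transition_set R n l) x) \<partial>(lborel :: (real^'d) measure))"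
      proof (rule nn_integral_mono)
        fix x :: "real^'d"
        show "ennreal (norm (wderiv (mollify n (I n) (h n) (\<zeta> n) U) \<mu> x - ?D \<mu> x)) * indicator K x
            \<le> ennreal ?c1 * indicator (cubeQ (real R)) x + (\<Sum>l\<in>UNIV. ennreal (3 * B) * indicator (transition_set R n l) x)"
        proof (cases "x \<in> K")
          case True
          have "ennreal (norm (wderiv (mollify n (I n) (h n) (\<zeta> n) U) \<mu> x - ?D \<mu> x))
              \<le> ennreal (?c1 + (\<Sum>l\<in>UNIV. 3 * B * indicator (transition_set R n l) x))"
            by (rule ennreal_leI[OF pt[OF True]])
          also have "\<dots> = ennreal ?c1 + ennreal (\<Sum>l\<in>(UNIV::'d set). 3 * B * indicator (transition_set R n l) x)"
            using c1 B(1) by (intro ennreal_plus sum_nonneg) auto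
          also have "ennreal (\<Sum>l\<in>(UNIV::'d set). 3 * B * indicator (transition_set R n l) x)
              = (\<Sum>l\<in>(UNIV::'d set). ennreal (3 * B * indicator (transition_set R n l) x))"
            using B(1) by (intro sum_ennreal[symmetric]) auto
          also have "\<dots> = (\<Sum>l\<in>(UNIV::'d set). ennreal (3 * B) * indicator (transition_set R n l) x)"
            by (intro sum.cong) (auto simp: indicator_def)
          finally show ?thesis using True KR by auto
        qed simp
      qed
      also have "\<dots> = ennreal ?c1 * emeasure lborel (cubeQ (real R) :: (real^'d) set)
          + (\<Sum>l\<in>UNIV. ennreal (3 * B) * emeasure lborel (transition_set R n (l :: 'd)))"
      proof -
        have m: "cubeQ (real R) \<in> sets (borel :: (real^'d) measure)" by (intro borel_closed closed_cubeQ)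
        have "(\<integral>\<^sup>+x. ennreal ?c1 * indicator (cubeQ (real R)) x + (\<Sum>l\<in>UNIV. ennreal (3 * B) * indicator (transition_set R n l) x) \<partial>(lborel :: (real^'d) measure))
          = (\<integral>\<^sup>+x. ennreal ?c1 * indicator (cubeQ (real R)) x \<partial>(lborel :: (real^'d) measure))
            + (\<integral>\<^sup>+x. (\<Sum>l\<in>UNIV. ennreal (3 * B) * indicator (transition_set R n l) x) \<partial>(lborel :: (real^'d) measure))"
          by (intro nn_integral_add borel_measurable_sum borel_measurable_times_ennreal borel_measurable_const
              borel_measurable_indicator) (simp_all add: m transition_set_measurable)
        also have "(\<integral>\<^sup>+x. ennreal ?c1 * indicator (cubeQ (real R)) x \<partial>(lborel :: (real^'d) measure)) = ennreal ?c1 * emeasure lborel (cubeQ (real R) :: (real^'d) set)"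
          by (rule nn_integral_cmult_indicator) (simp add: m)
        also have "(\<integral>\<^sup>+x. (\<Sum>l\<in>UNIV. ennreal (3 * B) * indicator (transition_set R n l) x) \<partial>(lborel :: (real^'d) measure))
          = (\<Sum>l\<in>UNIV. \<integral>\<^sup>+x. ennreal (3 * B) * indicator (transition_set R n l) x \<partial>(lborel :: (real^'d) measure))"
          by (rule nn_integral_sum) measurable
        also have "\<dots> = (\<Sum>l\<in>UNIV. ennreal (3 * B) * emeasure lborel (transition_set R n (l :: 'd)))"
          by (intro sum.cong refl nn_integral_cmult_indicator) simp
        finally show ?thesis .
      qed
      also have "\<dots> \<le> ennreal ?c1 * ennreal vol + (\<Sum>l\<in>(UNIV :: 'd set). ennreal (3 * B) * ennreal (tr / real n))"
      proof (intro add_mono sum_mono mult_left_mono)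
        show "emeasure lborel (cubeQ (real R) :: (real^'d) set) \<le> ennreal vol"
          unfolding vol_def by (subst emeasure_cubeQ) auto
        show "emeasure lborel (transition_set R n l) \<le> ennreal (tr / real n)" for l :: 'd
          unfolding tr_def using n R0 by (intro emeasure_transition_set) auto
      qed auto
      also have "\<dots> = ennreal (?c1 * vol + ?d * (3 * B * (tr / real n)))"
      proof -
        have "(\<Sum>l\<in>(UNIV :: 'd set). ennreal (3 * B) * ennreal (tr / real n)) = (\<Sum>l\<in>(UNIV :: 'd set). ennreal (3 * B * (tr / real n)))"
          using B(1) tr by (intro sum.cong refl ennreal_mult[symmetric]) auto
        also have "\<dots> = ennreal (\<Sum>l\<in>(UNIV :: 'd set). 3 * B * (tr / real n))"
          using B(1) tr by (intro sum_ennreal) auto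
        also have "\<dots> = ennreal (?d * (3 * B * (tr / real n)))" by simp
        finally show ?thesis
          using c1 vol B(1) tr by (simp only:) (simp only: ennreal_mult[symmetric] ennreal_plus[symmetric] mult_nonneg_nonneg
              of_nat_0_le_iff divide_nonneg_nonneg zero_le_numeral)
      qed
      also have "\<dots> \<le> ennreal e"
      proof (rule ennreal_leI)
        have "?d * (2 * \<epsilon>) * vol \<le> ?d * (2 * \<epsilon>) * (vol + 1)" using \<epsilon> by (intro mult_left_mono) auto
        also have "\<dots> = e / 2"
        proof -
          have "?d * (2 * (e / (4 * ?d * v))) * v = e / 2" if "v \<noteq> 0" for v using that by (simp add: field_simps)
          moreover have "vol + 1 \<noteq> 0" using vol by linarith
          ultimately show ?thesis unfolding \<epsilon>_def .
        qed
        finally have "?d * (2 * \<epsilon>) * vol \<le> e / 2" .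
        moreover have "?c1 * vol + ?d * (3 * B * (tr / real n)) = ?d * (2 * \<epsilon>) * vol + C / real n"
          by (simp add: C_def add_divide_distrib algebra_simps)
        ultimately show "?c1 * vol + ?d * (3 * B * (tr / real n)) \<le> e" using Cn by linarith
      qed
      finally show ?thesis .
    qed
    then show ?case by (rule SUP_least)
  qed
qed

theorem theorem3p1:
  shows "\<exists>C::real. \<forall>(U :: (real^'d::finite) measure \<Rightarrow> real) I h \<zeta>.
    C0_P 1 U \<and> mollifier_data I h \<zeta> \<longrightarrow>
      ((\<forall>n\<ge>3. Cinf_P2 (mollify n (I n) (h n) (\<zeta> n) U)
            \<and> C0_P 1 (mollify n (I n) (h n) (\<zeta> n) U)) \<and>
       (\<forall>\<M>. compactin (wtop 1) \<M> \<longrightarrow>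
          (\<lambda>n. SUP \<mu>\<in>\<M>. ennreal \<bar>mollify n (I n) (h n) (\<zeta> n) U \<mu> - U \<mu>\<bar>)
            \<longlonglongrightarrow> 0)) \<and>
      (\<forall>L. lipschitz_W1 L U \<longrightarrow>
          (\<forall>n\<ge>3. lipschitz_W1 (C * L) (mollify n (I n) (h n) (\<zeta> n) U))) \<and>
      (C1_P2 U \<and>
       (\<forall>\<M> K. compactin (wtop 1) \<M> \<and> compact K \<longrightarrow>
          unif_cont_W1 (\<M> \<inter> Pp 2) K (wderiv U)) \<longrightarrow>
       (\<forall>\<M> K. compactin (wtop 1) \<M> \<and> compact K \<longrightarrow>
          (\<lambda>n. SUP \<mu>\<in>\<M> \<inter> Pp 2.
             \<integral>\<^sup>+x\<in>K. ennreal (norm (wderiv (mollify n (I n) (h n) (\<zeta> n) U) \<mu> x - wderiv U \<mu> x))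
               \<partial>lborel) \<longlonglongrightarrow> 0))"
proof (intro exI[of _ "mollify_const CARD('d)"] allI impI)
  fix U :: "(real^'d) measure \<Rightarrow> real" and I and h :: "nat \<Rightarrow> real^'d \<Rightarrow> real"
    and \<zeta> :: "nat \<Rightarrow> (int^'d \<Rightarrow> real) \<Rightarrow> real"
  assume a: "C0_P 1 U \<and> mollifier_data I h \<zeta>"
  then have U: "C0_P 1 U" and d: "mollifier_data I h \<zeta>" by auto
  have loc: "mollifier n (I n) (h n) (\<zeta> n) U (Ngrid TYPE('d) n)" if "3 \<le> n" for n
    using that U d by unfold_locales (auto simp: mollifier_data_def)
  have 1: "Cinf_P2 (mollify n (I n) (h n) (\<zeta> n) U) \<and> C0_P 1 (mollify n (I n) (h n) (\<zeta> n) U)" if "3 \<le> n" for n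
    using mollifier.mollify_smooth[OF loc[OF that]] mollifier.mollify_continuous[OF loc[OF that], of 1] by simp
  have 2: "lipschitz_W1 (mollify_const CARD('d) * L) (mollify n (I n) (h n) (\<zeta> n) U)"
    if "lipschitz_W1 L U" "3 \<le> n" for L n
    by (rule mollifier.mollify_Lipschitz[OF loc[OF that(2)] that(1) lipschitz_W1_const_nonneg[OF that(1)]])
  show "((\<forall>n\<ge>3. Cinf_P2 (mollify n (I n) (h n) (\<zeta> n) U)
            \<and> C0_P 1 (mollify n (I n) (h n) (\<zeta> n) U)) \<and>
       (\<forall>\<M>. compactin (wtop 1) \<M> \<longrightarrow>
          (\<lambda>n. SUP \<mu>\<in>\<M>. ennreal \<bar>mollify n (I n) (h n) (\<zeta> n) U \<mu> - U \<mu>\<bar>)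
            \<longlonglongrightarrow> 0)) \<and>
      (\<forall>L. lipschitz_W1 L U \<longrightarrow>
          (\<forall>n\<ge>3. lipschitz_W1 (mollify_const CARD('d) * L) (mollify n (I n) (h n) (\<zeta> n) U))) \<and>
      (C1_P2 U \<and>
       (\<forall>\<M> K. compactin (wtop 1) \<M> \<and> compact K \<longrightarrow>
          unif_cont_W1 (\<M> \<inter> Pp 2) K (wderiv U)) \<longrightarrow>
       (\<forall>\<M> K. compactin (wtop 1) \<M> \<and> compact K \<longrightarrow>
          (\<lambda>n. SUP \<mu>\<in>\<M> \<inter> Pp 2.
             \<integral>\<^sup>+x\<in>K. ennreal (norm (wderiv (mollify n (I n) (h n) (\<zeta> n) U) \<mu> x - wderiv U \<mu> x))
               \<partial>lborel) \<longlonglongrightarrow> 0))"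
  proof (intro conjI allI impI)
    fix \<M> :: "(real^'d) measure set" and K :: "(real^'d) set"
    assume C1: "C1_P2 U \<and> (\<forall>\<M> K. compactin (wtop 1) \<M> \<and> compact K \<longrightarrow> unif_cont_W1 (\<M> \<inter> Pp 2) K (wderiv U))"
      and MK: "compactin (wtop 1) \<M> \<and> compact K"
    show "(\<lambda>n. SUP \<mu>\<in>\<M> \<inter> Pp 2. \<integral>\<^sup>+x\<in>K. ennreal (norm (wderiv (mollify n (I n) (h n) (\<zeta> n) U) \<mu> x - wderiv U \<mu> x))
               \<partial>lborel) \<longlonglongrightarrow> 0"
      by (rule wderiv_mollify_converges[OF U d]) (use C1 MK in auto)
  qed (use 1 2 mollify_converges[OF _ d U] in auto)
qed

end
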